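(* Fix $n\in\mathbb{N}$. The map $\tilde\iota\colon\mathsf{W}\mathsf{C}_n\to\mathsf{D}\mathsf{C}_n$ is bijective. Consequently $\tilde\varepsilon_n^{-1}\circ\tilde\iota$ is a bijection between the set $\mathsf{W}\mathsf{C}_n$ of $\tilde n$-webs and the monoid $\mathsf{C}_n$, and $\tilde\varrho$ is a bijection between $\mathsf{W}\mathsf{C}_n$ and $\operatorname{IIC}_n$; in particular the elements of $\mathsf{C}_n$, the $\tilde n$-webs, and the elements of $\operatorname{IIC}_n$ are in bijection via these maps.
   Context: $\mathsf{C}_n$ is the monoid with generators $x_1,\dots,x_n$ (indices mod $n$, $x_{n+1}=x_1$) and relations $x_i^2=x_i$; $x_ix_j=x_jx_i$ for $1<i-j<n-1$; $x_ix_{i+1}x_i=x_{i+1}x_ix_{i+1}=x_ix_{i+1}$ for $1\le i\le n$. Let $\mathbb{S}^1=[1,n+1]/(1\sim n+1)$. Diagrams on the cylinder $\mathbb{S}^1\times[0,1]$: maps from $n$ copies of $[0,1]$, each strand projecting vertically bijectively onto $[0,1]$, endpoints at $(k,0),(l,1)$ with $k,l\in\{1,\dots,n\}$, injective except at finitely many interior transverse double points, up to isotopy, composed by stacking ($dd'$ = $d$ on top). $\tilde d_i$ has vertical strands except two strands $(i,0)\to(i+1,1)$, $(i+1,0)\to(i,1)$ crossing once (position $n+1$ meaning $1$). $\tilde n$-diagrams are the elements of the monoid generated by $\tilde d_1,\dots,\tilde d_n$. 2-move: locally, two arcs crossing twice $\leftrightarrow$ two arcs with the same boundary points crossing once. 3-move: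 locally, with lower points $B_1<B_2<B_3$ and upper points $T_1<T_2<T_3$, three pairwise crossing arcs $B_1T_3,B_2T_2,B_3T_1$ $\leftrightarrow$ arcs $B_1T_3,B_2T_1,B_3T_2$ with $B_1T_3$ crossing the other two once and these not crossing. $\mathsf{D}\mathsf{C}_n$ is the monoid of $\tilde n$-diagrams modulo 2- and 3-moves; $\tilde\varepsilon_n\colon\mathsf{C}_n\to\mathsf{D}\mathsf{C}_n$, $x_i\mapsto\tilde d_i$, is a monoid isomorphism. An $\tilde n$-web is an $\tilde n$-diagram without contractible bigons or contractible triangles (bigon: region bounded by arcs of two strands between two crossings; triangle: region bounded by arcs of three strands between their pairwise crossings; contractible: bounding a disk in the cylinder); $\mathsf{W}\mathsf{C}_n$ is the set of $\tilde n$-webs up to isotopy and $\tilde\iota$ sends a web to its class in $\mathsf{D}\mathsf{C}_n$. With $p\colon\mathbb{R}\times[0,1]\to\mathbb{S}^1\times[0,1]$ the covering identifying $(x,y)\sim(x+n,y)$, for a strand starting at $(a,0)$, $a\in\{1,\dots,n\}$, let $b$ be the $x$-coordinate of the upper endpoint of its lift starting at $(a,0)$; the strand is right if $b>a$. $\tilde\varrho(w)=((a_t),(b_t))$, with $(a_t)$ the increasing list of starting positions of right strands and $b_t$ the corresponding lift endpoints. $\operatorname{IIC}_n$ is the set of couples $((a_1,\dots,a_k),(b_1,\dots,b_k))$, $0\le k<n$, of integers with $1\le a_1<\dots<a_k\le n$, $b_1<\dots<b_k<b_1+n$, $a_t<b_t$ for all $t$.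
   Formalization: Stated for n ≥ 3, since C_n and IIC_n are not in bijection for n = 0, 1, 2 (e.g. C_2 has 4 elements, IIC_2 is infinite); in a product dd' the factor d is placed at the bottom, as with d on top the 3-move contradicts x_i x_{i+1} x_i = x_i x_{i+1}. *)

theory Defs
  imports "HOL-Analysis.Analysis" "HOL-Algebra.Group"
begin

section \<open>The monoid \<open>C\<^sub>n\<close>\<close>

definition nxt :: "nat \<Rightarrow> nat \<Rightarrow> nat"
  where "nxt n i = (if i = n then 1 else i + 1)"

inductive C_cong :: "nat \<Rightarrow> nat list \<Rightarrow> nat list \<Rightarrow> bool" for n :: nat where
  idem: "i \<in> {1..n} \<Longrightarrow> C_cong n [i, i] [i]"
| comm: "\<lbrakk>i \<in> {1..n}; j \<in> {1..n}; 1 < int i - int j; int i - int j < int n - 1\<rbrakk>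
          \<Longrightarrow> C_cong n [i, j] [j, i]"
| braid1: "i \<in> {1..n} \<Longrightarrow> C_cong n [i, nxt n i, i] [nxt n i, i, nxt n i]"
| braid2: "i \<in> {1..n} \<Longrightarrow> C_cong n [nxt n i, i, nxt n i] [i, nxt n i]"
| refl: "u \<in> lists {1..n} \<Longrightarrow> C_cong n u u"
| sym: "C_cong n u v \<Longrightarrow> C_cong n v u"
| trans: "\<lbrakk>C_cong n u v; C_cong n v w\<rbrakk> \<Longrightarrow> C_cong n u w"
| ctxt: "\<lbrakk>C_cong n u v; a \<in> lists {1..n}; b \<in> lists {1..n}\<rbrakk> \<Longrightarrow> C_cong n (a @ u @ b) (a @ v @ b)"

definition C_rel :: "nat \<Rightarrow> (nat list \<times> nat list) set"
  where "C_rel n = {(u, v). C_cong n u v}"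

definition C_mon :: "nat \<Rightarrow> nat list set monoid"
  where "C_mon n = \<lparr>carrier = lists {1..n} // C_rel n,
                    mult = (\<lambda>X Y. \<Union>u\<in>X. \<Union>v\<in>Y. C_rel n `` {u @ v}),
                    one = C_rel n `` {[]}\<rparr>"

definition C_gen :: "nat \<Rightarrow> nat \<Rightarrow> nat list set"
  where "C_gen n i = C_rel n `` {[i]}"

section \<open>Diagrams on the cylinder\<close>

text \<open>The circle \<open>[1,n+1]/(1 \<sim> n+1)\<close> is realised as the unit circle of the complex plane, with
  position \<open>x\<close> at \<open>circ_pt n x\<close>; \<open>(x, y) \<mapsto> (circ_pt n x, y)\<close> is the covering map \<open>p\<close>.\<close>

definition circ_pt :: "nat \<Rightarrow> real \<Rightarrow> complex"
  where "circ_pt n x = cis (2 * pi * x / real n)"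

definition cylinder :: "(complex \<times> real) set"
  where "cylinder = sphere 0 1 \<times> {0..1}"

definition cylinder_bd :: "(complex \<times> real) set"
  where "cylinder_bd = sphere 0 1 \<times> {0, 1}"

text \<open>A strand that projects bijectively onto \<open>[0,1]\<close> is parametrised by its height: in a diagram
  \<open>D\<close>, the strand starting at position \<open>k\<close> is \<open>t \<mapsto> (D k t, t)\<close>. Only the values for
  \<open>k \<in> {1..n}\<close> and \<open>t \<in> {0..1}\<close> matter.\<close>

type_synonym diag = "nat \<Rightarrow> real \<Rightarrow> complex"

definition strand_arc :: "diag \<Rightarrow> nat \<Rightarrow> real \<Rightarrow> real \<Rightarrow> (complex \<times> real) set"
  where "strand_arc D k s t = (\<lambda>u. (D k u, u)) ` closed_segment s t"

definition strand :: "diag \<Rightarrow> nat \<Rightarrow> (complex \<times> real) set"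
  where "strand D k = strand_arc D k 0 1"

definition diag_image :: "nat \<Rightarrow> diag \<Rightarrow> (complex \<times> real) set"
  where "diag_image n D = (\<Union>k\<in>{1..n}. strand D k)"

definition double_points :: "nat \<Rightarrow> diag \<Rightarrow> (complex \<times> real) set"
  where "double_points n D =
    {(D j t, t) | j t. j \<in> {1..n} \<and> t \<in> {0..1} \<and> (\<exists>k\<in>{1..n}. k \<noteq> j \<and> D k t = D j t)}"

text \<open>Strands are merely continuous, so transversality is the topological one: the two strands
  exchange sides. For \<open>z\<close>, \<open>w\<close> on the unit circle, \<open>Im (z * cnj w)\<close> is the sine of
  the angle from \<open>w\<close> to \<open>z\<close>.\<close>

definition transverse_at :: "(real \<Rightarrow> complex) \<Rightarrow> (real \<Rightarrow> complex) \<Rightarrow> real \<Rightarrow> bool"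
  where "transverse_at z w t \<longleftrightarrow>
    (\<exists>e>0. \<forall>u\<in>{t - e<..<t}. \<forall>v\<in>{t<..<t + e}. Im (z u * cnj (w u)) * Im (z v * cnj (w v)) < 0)"

definition is_diag :: "nat \<Rightarrow> diag \<Rightarrow> bool"
  where "is_diag n D \<longleftrightarrow>
    (\<forall>k\<in>{1..n}. continuous_on {0..1} (D k) \<and> D k ` {0..1} \<subseteq> sphere 0 1 \<and>
       D k 0 = circ_pt n (real k) \<and> (\<exists>l\<in>{1..n}. D k 1 = circ_pt n (real l))) \<and>
    finite (double_points n D) \<and>
    (\<forall>j\<in>{1..n}. \<forall>k\<in>{1..n}. \<forall>t\<in>{0..1}. j \<noteq> k \<longrightarrow> D j t = D k t \<longrightarrow>
       0 < t \<and> t < 1 \<and> transverse_at (D j) (D k) t \<and> (\<forall>m\<in>{1..n} - {j, k}. D m t \<noteq> D j t))"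

text \<open>Isotopy through diagrams, induced by an isotopy of the cylinder fixing the boundary.\<close>

definition isotopic :: "nat \<Rightarrow> diag \<Rightarrow> diag \<Rightarrow> bool"
  where "isotopic n D D' \<longleftrightarrow>
    (\<exists>H :: real \<Rightarrow> complex \<times> real \<Rightarrow> complex \<times> real.
       continuous_on ({0..1} \<times> cylinder) (\<lambda>(s, q). H s q) \<and>
       (\<forall>s\<in>{0..1}. \<exists>G. homeomorphism cylinder cylinder (H s) G) \<and>
       (\<forall>q\<in>cylinder. H 0 q = q) \<and>
       (\<forall>s\<in>{0..1}. \<forall>q\<in>cylinder_bd. H s q = q) \<and>
       (\<forall>s\<in>{0..1}. \<exists>E. is_diag n E \<and> (\<forall>k\<in>{1..n}. H s ` strand D k = strand E k)) \<and>
       (\<forall>k\<in>{1..n}. H 1 ` strand D k = strand D' k))"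

definition id_diag :: "nat \<Rightarrow> diag"
  where "id_diag n = (\<lambda>k t. circ_pt n (real k))"

definition gen_diag :: "nat \<Rightarrow> nat \<Rightarrow> diag"
  where "gen_diag n i = (\<lambda>k t.
    if k = i then circ_pt n (real k + t)
    else if k = nxt n i then circ_pt n (real k - t)
    else circ_pt n (real k))"

definition top_pos :: "nat \<Rightarrow> diag \<Rightarrow> nat \<Rightarrow> nat"
  where "top_pos n D k = (THE l. l \<in> {1..n} \<and> D k 1 = circ_pt n (real l))"

text \<open>In the product \<open>A B\<close> the factor \<open>A\<close> is the lower one. With the three-move below this is
  the stacking order for which \<open>x\<^sub>i \<mapsto> d\<^sub>i\<close> respects \<open>x\<^sub>i x\<^sub>i\<^sub>+\<^sub>1 x\<^sub>i = x\<^sub>i x\<^sub>i\<^sub>+\<^sub>1\<close>: on the right of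
  that move the arc \<open>B\<^sub>1 T\<^sub>3\<close> first (below) exchanges positions \<open>i\<close>, \<open>i+1\<close> and then (above)
  positions \<open>i+1\<close>, \<open>i+2\<close>. The opposite order turns the map into an anti-isomorphism.\<close>

definition stack :: "nat \<Rightarrow> diag \<Rightarrow> diag \<Rightarrow> diag"
  where "stack n A B = (\<lambda>k t. if t \<le> 1/2 then A k (2 * t) else B (top_pos n A k) (2 * t - 1))"

primrec word_diag :: "nat \<Rightarrow> nat list \<Rightarrow> diag"
  where "word_diag n [] = id_diag n"
  | "word_diag n (i # w) = stack n (gen_diag n i) (word_diag n w)"

definition ndiags :: "nat \<Rightarrow> diag set"
  where "ndiags n = {D. is_diag n D \<and> (\<exists>w\<in>lists {1..n}. isotopic n (word_diag n w) D)}"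

definition isotopy_rel :: "nat \<Rightarrow> (diag \<times> diag) set"
  where "isotopy_rel n = {(D, D'). D \<in> ndiags n \<and> D' \<in> ndiags n \<and> isotopic n D D'}"

section \<open>Local moves and the monoid \<open>DC\<^sub>n\<close>\<close>

text \<open>The disk supporting a move is the image of a rectangle \<open>[x0,x1] \<times> [t0,t1]\<close> under the
  covering map; up to isotopy this is no restriction. \<open>box_arcs\<close> says that inside it the diagram
  consists exactly of the graphs of the functions \<open>gs\<close>, each one a piece of a strand running
  from the lower to the upper side.\<close>

definition is_box :: "nat \<Rightarrow> real \<Rightarrow> real \<Rightarrow> real \<Rightarrow> real \<Rightarrow> bool"
  where "is_box n x0 x1 t0 t1 \<longleftrightarrow> x0 < x1 \<and> x1 < x0 + real n \<and> 0 \<le> t0 \<and> t0 < t1 \<and> t1 \<le> 1"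

definition box_arcs ::
    "nat \<Rightarrow> real \<Rightarrow> real \<Rightarrow> real \<Rightarrow> real \<Rightarrow> diag \<Rightarrow> (real \<Rightarrow> real) list \<Rightarrow> bool"
  where "box_arcs n x0 x1 t0 t1 D gs \<longleftrightarrow>
    (\<exists>ks. distinct ks \<and> set ks \<subseteq> {1..n} \<and> length ks = length gs \<and>
       (\<forall>j<length gs. continuous_on {t0..t1} (gs ! j) \<and>
          (\<forall>t\<in>{t0..t1}. x0 < (gs ! j) t \<and> (gs ! j) t < x1 \<and> D (ks ! j) t = circ_pt n ((gs ! j) t))) \<and>
       (\<forall>k\<in>{1..n} - set ks. \<forall>t\<in>{t0..t1}. D k t \<notin> circ_pt n ` {x0..x1}))"

definition agree_outside ::
    "nat \<Rightarrow> real \<Rightarrow> real \<Rightarrow> real \<Rightarrow> real \<Rightarrow> diag \<Rightarrow> diag \<Rightarrow> bool"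
  where "agree_outside n x0 x1 t0 t1 D D' \<longleftrightarrow>
    diag_image n D - circ_pt n ` {x0..x1} \<times> {t0..t1} =
    diag_image n D' - circ_pt n ` {x0..x1} \<times> {t0..t1}"

definition meets :: "real \<Rightarrow> real \<Rightarrow> (real \<Rightarrow> real) \<Rightarrow> (real \<Rightarrow> real) \<Rightarrow> real set"
  where "meets t0 t1 g h = {t \<in> {t0..t1}. g t = h t}"

definition two_move :: "nat \<Rightarrow> diag \<Rightarrow> diag \<Rightarrow> bool"
  where "two_move n D D' \<longleftrightarrow>
    (\<exists>x0 x1 t0 t1 g1 g2 h1 h2 B1 B2 T1 T2.
       is_box n x0 x1 t0 t1 \<and> agree_outside n x0 x1 t0 t1 D D' \<and>
       box_arcs n x0 x1 t0 t1 D [g1, g2] \<and> box_arcs n x0 x1 t0 t1 D' [h1, h2] \<and>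
       B1 < B2 \<and> T1 < T2 \<and>
       g1 t0 = B1 \<and> g2 t0 = B2 \<and> g1 t1 = T1 \<and> g2 t1 = T2 \<and>
       h1 t0 = B1 \<and> h2 t0 = B2 \<and> h1 t1 = T2 \<and> h2 t1 = T1 \<and>
       card (meets t0 t1 g1 g2) = 2 \<and> card (meets t0 t1 h1 h2) = 1)"

definition three_move :: "nat \<Rightarrow> diag \<Rightarrow> diag \<Rightarrow> bool"
  where "three_move n D D' \<longleftrightarrow>
    (\<exists>x0 x1 t0 t1 g1 g2 g3 h1 h2 h3 B1 B2 B3 T1 T2 T3.
       is_box n x0 x1 t0 t1 \<and> agree_outside n x0 x1 t0 t1 D D' \<and>
       box_arcs n x0 x1 t0 t1 D [g1, g2, g3] \<and> box_arcs n x0 x1 t0 t1 D' [h1, h2, h3] \<and>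
       B1 < B2 \<and> B2 < B3 \<and> T1 < T2 \<and> T2 < T3 \<and>
       g1 t0 = B1 \<and> g2 t0 = B2 \<and> g3 t0 = B3 \<and> g1 t1 = T3 \<and> g2 t1 = T2 \<and> g3 t1 = T1 \<and>
       h1 t0 = B1 \<and> h2 t0 = B2 \<and> h3 t0 = B3 \<and> h1 t1 = T3 \<and> h2 t1 = T1 \<and> h3 t1 = T2 \<and>
       card (meets t0 t1 g1 g2) = 1 \<and> card (meets t0 t1 g1 g3) = 1 \<and> card (meets t0 t1 g2 g3) = 1 \<and>
       card (meets t0 t1 h1 h2) = 1 \<and> card (meets t0 t1 h1 h3) = 1 \<and> meets t0 t1 h2 h3 = {})"

definition move_step :: "nat \<Rightarrow> (diag \<times> diag) set"
  where "move_step n = {(D, D'). D \<in> ndiags n \<and> D' \<in> ndiags n \<and>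
    (isotopic n D D' \<or> two_move n D D' \<or> three_move n D D')}"

definition DC_rel :: "nat \<Rightarrow> (diag \<times> diag) set"
  where "DC_rel n = (move_step n \<union> (move_step n)\<inverse>)\<^sup>+"

definition DC_mon :: "nat \<Rightarrow> diag set monoid"
  where "DC_mon n = \<lparr>carrier = ndiags n // DC_rel n,
                     mult = (\<lambda>X Y. \<Union>A\<in>X. \<Union>B\<in>Y. DC_rel n `` {stack n A B}),
                     one = DC_rel n `` {id_diag n}\<rparr>"

definition DC_gen :: "nat \<Rightarrow> nat \<Rightarrow> diag set"
  where "DC_gen n i = DC_rel n `` {gen_diag n i}"

text \<open>The monoid morphism \<open>x\<^sub>i \<mapsto> d\<^sub>i\<close>, by passing to classes.\<close>

definition eps :: "nat \<Rightarrow> nat list set \<Rightarrow> diag set"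
  where "eps n X = (\<Union>w\<in>X. DC_rel n `` {word_diag n w})"

section \<open>Webs\<close>

definition bounds_disk :: "(complex \<times> real) set \<Rightarrow> bool"
  where "bounds_disk S \<longleftrightarrow>
    (\<exists>h :: complex \<Rightarrow> complex \<times> real. continuous_on (cball 0 1) h \<and> inj_on h (cball 0 1) \<and>
       h ` cball 0 1 \<subseteq> cylinder \<and> h ` sphere 0 1 = S)"

definition has_contractible_bigon :: "nat \<Rightarrow> diag \<Rightarrow> bool"
  where "has_contractible_bigon n D \<longleftrightarrow>
    (\<exists>j\<in>{1..n}. \<exists>k\<in>{1..n}. \<exists>s\<in>{0..1}. \<exists>t\<in>{0..1}.
       j \<noteq> k \<and> s < t \<and> D j s = D k s \<and> D j t = D k t \<and>
       bounds_disk (strand_arc D j s t \<union> strand_arc D k s t))"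

definition has_contractible_triangle :: "nat \<Rightarrow> diag \<Rightarrow> bool"
  where "has_contractible_triangle n D \<longleftrightarrow>
    (\<exists>i\<in>{1..n}. \<exists>j\<in>{1..n}. \<exists>k\<in>{1..n}. \<exists>r\<in>{0..1}. \<exists>s\<in>{0..1}. \<exists>t\<in>{0..1}.
       i \<noteq> j \<and> j \<noteq> k \<and> i \<noteq> k \<and> D i r = D j r \<and> D j s = D k s \<and> D k t = D i t \<and>
       bounds_disk (strand_arc D j r s \<union> strand_arc D k s t \<union> strand_arc D i t r))"

definition nwebs :: "nat \<Rightarrow> diag set"
  where "nwebs n = {D \<in> ndiags n. \<not> has_contractible_bigon n D \<and> \<not> has_contractible_triangle n D}"

definition WC :: "nat \<Rightarrow> diag set set"
  where "WC n = nwebs n // isotopy_rel n"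

definition iota :: "nat \<Rightarrow> diag set \<Rightarrow> diag set"
  where "iota n W = (\<Union>D\<in>W. DC_rel n `` {D})"

section \<open>The map \<open>\<rho>\<close> and the set \<open>IIC\<^sub>n\<close>\<close>

definition lift_end :: "nat \<Rightarrow> diag \<Rightarrow> int \<Rightarrow> int"
  where "lift_end n D a = (THE b. \<exists>g :: real \<Rightarrow> real. continuous_on {0..1} g \<and>
    (\<forall>t\<in>{0..1}. D (nat a) t = circ_pt n (g t)) \<and> g 0 = of_int a \<and> g 1 = of_int b)"

definition rho_diag :: "nat \<Rightarrow> diag \<Rightarrow> int list \<times> int list"
  where "rho_diag n D =
    (let as = filter (\<lambda>a. a < lift_end n D a) [1..int n] in (as, map (lift_end n D) as))"

definition rho :: "nat \<Rightarrow> diag set \<Rightarrow> int list \<times> int list"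
  where "rho n W = the_elem (rho_diag n ` W)"

definition IIC :: "nat \<Rightarrow> (int list \<times> int list) set"
  where "IIC n = {(as, bs). length as = length bs \<and> length as < n \<and>
    sorted_wrt (<) as \<and> set as \<subseteq> {1..int n} \<and>
    sorted_wrt (<) bs \<and> (bs \<noteq> [] \<longrightarrow> last bs < hd bs + int n) \<and>
    (\<forall>t<length as. as ! t < bs ! t)}"

end

theory Submission
  imports Defs
begin

text \<open>
  Call a word alternating if both neighbours of a letter occur between any two of its occurrences.
  The relations of the monoid reduce every word to an alternating one, since a word that is not
  alternating is, up to commutations, one with a factor \<open>x\<^sub>i x\<^sub>i\<close>, \<open>x\<^sub>i x\<^sub>i\<^sub>+\<^sub>1 x\<^sub>i\<close> or \<open>x\<^sub>i\<^sub>+\<^sub>1 x\<^sub>i x\<^sub>i\<^sub>+\<^sub>1\<close>.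
  Letting \<open>x\<^sub>i\<close> push the integers congruent to \<open>i\<close> one step to the right defines an action of the monoid
  on the integers, and an alternating word is determined by this action up to commutations. The
  right ends of the strands that move right carry the same information, which yields the couples of sequences.

  On the side of diagrams, the action is recovered as the right end of the rightmost monotone path that runs
  inside the diagram and may change strands at crossings. Isotopies and both moves preserve it, so words
  with equivalent diagrams are congruent. The diagram of a word that is not alternating has a contractible
  bigon or triangle. In the diagram of an alternating word only a right strand and a left strand
  can cross, so that two lifts cross at most once and three strands never cross pairwise; hence it is a web.
\<close>

section \<open>Alternating words\<close>

text \<open>A move may connect two diagrams neither of which is the diagram of a word, so it cannot
  be translated directly into a relation of the monoid. The burden is shifted instead: every class
  contains the diagram of a word by definition, the relations are realised by explicit isotopies and
  moves, and everything else is separated by an invariant that makes sense for arbitrary diagrams.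
  The ends of the strands are no such invariant, since a 2-move exchanges them; a path that may
  change strands at crossings repairs this and turns the transposition of a generator into the push
  to the right.

  Strands are merely continuous, and an ambient isotopy need not preserve heights. The isotopies
  between diagrams of words are therefore written down explicitly: changes of height, a horizontal
  rescaling around one crossing, a vertical slide of one column.

  The bound \<open>n \<ge> 3\<close> keeps the two neighbours of a letter distinct, lets the three
  arcs of a 3-move fit in a window shorter than the circle, and makes the sine in the definition of
  transversality faithful up to distance 1.\<close>

definition prv :: "nat \<Rightarrow> nat \<Rightarrow> nat"
  where "prv n i = (if i = 1 then n else i - 1)"

text \<open>The shift by one before and after the reduction makes the representatives run over
  \<open>1..n\<close>, as the letters do.\<close>

definition res :: "nat \<Rightarrow> int \<Rightarrow> nat"
  where "res n a = nat ((a - 1) mod int n) + 1"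

lemma res_range: "n \<ge> 1 \<Longrightarrow> res n a \<in> {1..n}"
proof -
  assume "n \<ge> 1"
  then have "(a - 1) mod int n < int n" "(a - 1) mod int n \<ge> 0" by auto
  then show ?thesis unfolding res_def by auto
qed

lemma nxt_range: "i \<in> {1..n} \<Longrightarrow> nxt n i \<in> {1..n}"
  by (auto simp: nxt_def)

lemma prv_range: "i \<in> {1..n} \<Longrightarrow> prv n i \<in> {1..n}"
  by (auto simp: prv_def)

lemma prv_nxt: "i \<in> {1..n} \<Longrightarrow> prv n (nxt n i) = i"
  by (auto simp: prv_def nxt_def)

lemma nxt_prv: "i \<in> {1..n} \<Longrightarrow> nxt n (prv n i) = i"
  by (auto simp: prv_def nxt_def)

lemma nxt_neq: "n \<ge> 2 \<Longrightarrow> i \<in> {1..n} \<Longrightarrow> nxt n i \<noteq> i"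
  by (auto simp: nxt_def)

lemma prv_neq: "n \<ge> 2 \<Longrightarrow> i \<in> {1..n} \<Longrightarrow> prv n i \<noteq> i"
  by (auto simp: prv_def)

lemma nxt_neq_prv: "n \<ge> 3 \<Longrightarrow> i \<in> {1..n} \<Longrightarrow> nxt n i \<noteq> prv n i"
  by (auto simp: nxt_def prv_def split: if_splits)

lemma nxt_inj: "i \<in> {1..n} \<Longrightarrow> j \<in> {1..n} \<Longrightarrow> nxt n i = nxt n j \<longleftrightarrow> i = j"
  by (metis prv_nxt)

lemma res_eq_iff: "n \<ge> 1 \<Longrightarrow> res n a = res n b \<longleftrightarrow> (\<exists>m. a = b + int n * m)"
proof -
  assume n: "n \<ge> 1"
  have "res n a = res n b \<longleftrightarrow> (a - 1) mod int n = (b - 1) mod int n"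
    unfolding res_def using n by (simp add: nat_eq_iff)
  also have "\<dots> \<longleftrightarrow> int n dvd (a - 1) - (b - 1)" by (rule mod_eq_dvd_iff)
  also have "\<dots> \<longleftrightarrow> (\<exists>m. a = b + int n * m)" by (auto simp: dvd_def algebra_simps)
  finally show ?thesis .
qed

lemma res_int: "i \<in> {1..n} \<Longrightarrow> res n (int i) = i"
  by (auto simp: res_def)

lemma res_period: "res n (a + int n * m) = res n a"
  unfolding res_def by (metis add_diff_eq add.commute mod_mult_self2)

lemma res_repr: "n \<ge> 1 \<Longrightarrow> \<exists>m. a = int (res n a) + int n * m"
  using res_eq_iff[of n a "int (res n a)"] res_int[OF res_range[of n a]] by metis

lemma res_Suc: "n \<ge> 1 \<Longrightarrow> res n (a + 1) = nxt n (res n a)"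
proof -
  assume n: "n \<ge> 1"
  define i where "i = res n a"
  have i: "i \<in> {1..n}" using res_range[OF n] i_def by auto
  obtain m where m: "a = int i + int n * m" using res_repr[OF n] i_def by metis
  show ?thesis
  proof (cases "i = n")
    case True
    then have "a + 1 = int 1 + int n * (m + 1)" using m by (simp add: algebra_simps)
    then have "res n (a + 1) = 1" using res_period res_int[of 1 n] n by (metis atLeastAtMost_iff order_refl)
    then show ?thesis using True i_def by (simp add: nxt_def)
  next
    case False
    then have "a + 1 = int (i + 1) + int n * m" using m by simp
    then have "res n (a + 1) = i + 1" using res_period res_int[of "i+1" n] i False
      by (metis add_leD2 atLeastAtMost_iff le_add2 le_neq_implies_less less_eq_Suc_le Suc_eq_plus1)
    then show ?thesis using False i_def by (simp add: nxt_def)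
  qed
qed

lemma res_pred: "n \<ge> 1 \<Longrightarrow> res n (a - 1) = prv n (res n a)"
  using res_Suc[of n "a - 1"] prv_nxt[OF res_range[of n "a-1"]] by simp

text \<open>\<open>step\<close> models a path that takes the right-hand exit at a crossing,
  \<open>swp\<close> a strand that runs straight through it. Words are read from the left, the first
  letter being the lowest crossing.\<close>

definition step :: "nat \<Rightarrow> nat \<Rightarrow> int \<Rightarrow> int"
  where "step n i a = (if res n a = i then a + 1 else a)"

definition swp :: "nat \<Rightarrow> nat \<Rightarrow> int \<Rightarrow> int"
  where "swp n i a = (if res n a = i then a + 1 else if res n a = nxt n i then a - 1 else a)"

primrec act :: "nat \<Rightarrow> nat list \<Rightarrow> int \<Rightarrow> int"
  where "act n [] a = a" | "act n (i # w) a = act n w (step n i a)"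

primrec perm :: "nat \<Rightarrow> nat list \<Rightarrow> int \<Rightarrow> int"
  where "perm n [] a = a" | "perm n (i # w) a = perm n w (swp n i a)"

text \<open>\<open>lead w x y\<close>: the first of the letters \<open>x\<close>, \<open>y\<close> to occur in \<open>w\<close> is \<open>x\<close>.\<close>

primrec lead :: "nat list \<Rightarrow> nat \<Rightarrow> nat \<Rightarrow> bool"
  where "lead [] x y = False" | "lead (z # w) x y = (z = x \<or> z \<noteq> y \<and> lead w x y)"

primrec altern :: "nat \<Rightarrow> nat list \<Rightarrow> bool"
  where "altern n [] = True"
  | "altern n (z # w) = (altern n w \<and> \<not> lead w z (nxt n z) \<and> \<not> lead w z (prv n z))"

text \<open>The letter \<open>res n a\<close> moves the position \<open>a\<close> to the right, its
  predecessor moves it to the left, and whichever occurs first decides the first displacement of the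
  strand. In an alternating word the strand never turns back afterwards.\<close>

definition goes_right :: "nat \<Rightarrow> nat list \<Rightarrow> int \<Rightarrow> bool"
  where "goes_right n w a = lead w (res n a) (prv n (res n a))"

lemma step_mono: "a \<le> b \<Longrightarrow> step n i a \<le> step n i b"
  by (cases "a = b") (auto simp: step_def)

lemma act_mono: "a \<le> b \<Longrightarrow> act n w a \<le> act n w b"
  by (induction w arbitrary: a b) (auto simp: step_mono)

lemma act_ge: "act n w a \<ge> a"
proof (induction w arbitrary: a)
  case (Cons i w)
  have "step n i a \<ge> a" by (auto simp: step_def)
  then show ?case using Cons[of "step n i a"] by auto
qed auto

lemma step_period: "step n i (a + int n * m) = step n i a + int n * m"
  by (simp add: step_def res_period)

lemma act_period: "act n w (a + int n * m) = act n w a + int n * m"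
  by (induction w arbitrary: a) (auto simp: step_period)

lemma swp_period: "swp n i (a + int n * m) = swp n i a + int n * m"
  by (simp add: swp_def res_period)

lemma act_fix: "res n a \<notin> set w \<Longrightarrow> act n w a = a"
  by (induction w arbitrary: a) (auto simp: step_def)

lemma act_gt: "res n a \<in> set w \<Longrightarrow> act n w a > a"
proof (induction w arbitrary: a)
  case (Cons i w)
  show ?case
  proof (cases "res n a = i")
    case True
    then show ?thesis using act_ge[where a = "a+1" and n = n and w = w] by (simp add: step_def)
  next
    case False
    then show ?thesis using Cons by (auto simp: step_def)
  qed
qed auto

lemma perm_fix:
  "n \<ge> 1 \<Longrightarrow> set w \<subseteq> {1..n} \<Longrightarrow> res n a \<notin> set w \<Longrightarrow> prv n (res n a) \<notin> set w \<Longrightarrow> perm n w a = a"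
proof (induction w arbitrary: a)
  case (Cons i w)
  have "res n a \<noteq> nxt n i" using Cons.prems by (auto simp: prv_nxt)
  then show ?case using Cons by (auto simp: swp_def)
qed auto

lemma lead_set: "lead w x y \<Longrightarrow> x \<in> set w"
  by (induction w) auto

lemma lead_total: "x \<in> set w \<or> y \<in> set w \<Longrightarrow> lead w x y \<or> lead w y x"
  by (induction w) auto

lemma lead_antisym: "x \<noteq> y \<Longrightarrow> lead w x y \<Longrightarrow> \<not> lead w y x"
  by (induction w) auto

lemma goes_right_Cons:
  assumes "n \<ge> 2" "i \<in> {1..n}"
  shows "goes_right n (i # w) a \<longleftrightarrow> res n a = i \<or> res n a \<noteq> nxt n i \<and> goes_right n w a"
  using res_range[of n a] assms nxt_neq[of n i] prv_nxt[OF assms(2)] nxt_prv[of "res n a" n]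
  unfolding goes_right_def by auto

lemma altern_Cons_same:
  assumes "altern n (i # w)" "res n a = i"
  shows "\<not> goes_right n w a"
  using assms by (auto simp: goes_right_def)

text \<open>Alternation forbids \<open>i\<close> to lead \<open>nxt n i\<close> in the tail. A
  strand just carried to the class of \<open>nxt n i\<close> thus either continues to the right or
  meets neither of the two letters that could move it.\<close>

lemma altern_Cons_nxt:
  assumes "altern n (i # w)" "res n a = nxt n i" "i \<in> {1..n}"
  shows "goes_right n w a \<or> i \<notin> set w \<and> nxt n i \<notin> set w"
  using assms lead_total[of i w "nxt n i"] prv_nxt[OF assms(3)] by (auto simp: goes_right_def)

text \<open>The first letter shifts \<open>a\<close> by at most one, and alternation controls the
  direction of what remains. The gain is that the right strands are exactly the places where
  \<open>act\<close> is off the diagonal and jumps, so the non-injective \<open>act\<close> still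
  determines them. The value at \<open>a - 1\<close> is carried along because a position whose
  strand goes left is either fixed by \<open>act\<close> or merged with its left neighbour.\<close>

lemma altern_strands:
  assumes "n \<ge> 3" "set w \<subseteq> {1..n}" "altern n w"
  shows "(goes_right n w a \<longrightarrow> a < perm n w a \<and> act n w a = perm n w a \<and> act n w (a - 1) < act n w a) \<and>
    (\<not> goes_right n w a \<longrightarrow> perm n w a \<le> a \<and> (act n w a = a \<or> act n w a = act n w (a - 1)))"
  using assms(2,3)
proof (induction w arbitrary: a)
  case Nil
  then show ?case by (simp add: goes_right_def)
next
  case (Cons i w)
  have n: "n \<ge> 1" "n \<ge> 2" and i: "i \<in> {1..n}" and w: "set w \<subseteq> {1..n}" and alt: "altern n w"
    using Cons.prems assms(1) by auto
  note IH = Cons.IH[OF w alt]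
  note gr = goes_right_Cons[OF n(2) i, of w a]
  have resm: "res n (a - 1) = prv n (res n a)" and resp: "res n (a + 1) = nxt n (res n a)"
    using res_pred[OF n(1), of a] res_Suc[OF n(1), of a] by auto
  consider (1) "res n a = i" | (2) "res n a = nxt n i" "res n a \<noteq> i" | (3) "res n a \<noteq> i" "res n a \<noteq> nxt n i"
    by blast
  then show ?case
  proof cases
    case 1
    have m: "step n i (a - 1) = a - 1" "step n i a = a + 1" "swp n i a = a + 1"
      using 1 resm prv_neq[OF n(2) i] by (auto simp: step_def swp_def)
    from altern_Cons_nxt[OF Cons.prems(2) _ i, of "a+1"] resp 1
    consider "goes_right n w (a + 1)" | "i \<notin> set w" "nxt n i \<notin> set w" by auto
    then show ?thesis
    proof cases
      case 1
      have "act n w (a - 1) \<le> act n w a" by (simp add: act_mono)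
      then show ?thesis using IH[of "a+1"] 1 gr \<open>res n a = i\<close> m by auto
    next
      case 2
      have "act n w (a + 1) = a + 1" "act n w a = a" "perm n w (a+1) = a + 1"
        using act_fix[of n _ w] perm_fix[OF n(1) w, of "a+1"] 2 resp \<open>res n a = i\<close> prv_nxt[OF i] by auto
      moreover have "act n w (a - 1) \<le> act n w a" by (simp add: act_mono)
      ultimately show ?thesis using gr \<open>res n a = i\<close> m by auto
    qed
  next
    case 2
    have a1: "res n (a - 1) = i" using 2 resm prv_nxt[OF i] by simp
    have m: "step n i (a - 1) = a" "step n i a = a" "swp n i a = a - 1"
      using 2 a1 by (auto simp: step_def swp_def)
    have "\<not> goes_right n w (a - 1)" using altern_Cons_same[OF Cons.prems(2) a1] .
    then show ?thesis using IH[of "a-1"] gr 2 m by auto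
  next
    case 3
    have "res n (a - 1) \<noteq> i" using 3 resm nxt_prv[OF res_range[OF n(1), of a]] by auto
    then have m: "step n i (a - 1) = a - 1" "step n i a = a" "swp n i a = a"
      using 3 by (auto simp: step_def swp_def)
    then show ?thesis using IH[of a] gr 3 by auto
  qed
qed

text \<open>Strands that do not go right are recorded as fixed points and their true ends are
  forgotten; the right ends alone determine an alternating word up to commutations.\<close>

definition right_end :: "nat \<Rightarrow> nat list \<Rightarrow> int \<Rightarrow> int"
  where "right_end n w a = (if goes_right n w a then act n w a else a)"

lemma right_end_perm:
  assumes "n \<ge> 3" "set w \<subseteq> {1..n}" "altern n w"
  shows "right_end n w a = max a (perm n w a)"
  using altern_strands[OF assms, of a] by (auto simp: right_end_def)

lemma goes_right_act:
  assumes "n \<ge> 3" "set w \<subseteq> {1..n}" "altern n w"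
  shows "goes_right n w a \<longleftrightarrow> a < act n w a \<and> act n w (a - 1) < act n w a"
  using altern_strands[OF assms, of a] by auto

lemma right_end_gt: "right_end n w a > a \<longleftrightarrow> goes_right n w a"
  using act_gt[of n a w] lead_set[of w "res n a"] by (auto simp: right_end_def goes_right_def)

lemma right_end_ge: "right_end n w a \<ge> a"
  by (simp add: right_end_def act_ge)

lemma goes_right_period: "goes_right n w (a + int n * m) = goes_right n w a"
  by (simp add: goes_right_def res_period)

lemma right_end_period: "right_end n w (a + int n * m) = right_end n w a + int n * m"
  by (simp add: right_end_def goes_right_period act_period)

text \<open>The letter \<open>i\<close> hands the strand at a position of class \<open>i\<close>
  over to the next position, where it keeps its end; the strand that arrives at class
  \<open>i\<close> does not go right in the tail and is recorded as fixed. The formula recovers the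
  function of the tail from that of the word, which makes the first letter cancellable.\<close>

lemma right_end_tail:
  assumes "n \<ge> 3" "set (i # w) \<subseteq> {1..n}" "altern n (i # w)"
  shows "right_end n w a =
    (if res n a = i then a else if res n a = nxt n i then right_end n (i # w) (a - 1)
     else right_end n (i # w) a)"
proof -
  have n: "n \<ge> 1" "n \<ge> 2" and i: "i \<in> {1..n}" using assms by auto
  note gr = goes_right_Cons[OF n(2) i, of w]
  consider (1) "res n a = i" | (2) "res n a = nxt n i" "res n a \<noteq> i" | (3) "res n a \<noteq> i" "res n a \<noteq> nxt n i"
    by blast
  then show ?thesis
  proof cases
    case 1
    then show ?thesis using altern_Cons_same[OF assms(3)] by (simp add: right_end_def)
  next
    case 2
    have a1: "res n (a - 1) = i" using 2 prv_nxt[OF i] res_pred[OF n(1), of a] by simp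
    have "right_end n (i # w) (a - 1) = act n w a" using gr[of "a-1"] a1 by (simp add: right_end_def step_def)
    moreover have "right_end n w a = act n w a"
      using altern_Cons_nxt[OF assms(3) 2(1) i] act_fix[of n a w] 2 by (auto simp: right_end_def)
    ultimately show ?thesis using 2 by simp
  next
    case 3
    then show ?thesis using gr[of a] by (simp add: right_end_def step_def)
  qed
qed

section \<open>Commutation classes\<close>

text \<open>The congruence generated by the commutations alone, with the symmetric side condition
  that the letters are distinct and not cyclically adjacent. It is realised by isotopies, whereas
  the other relations of the monoid need moves.\<close>

inductive comm_cong :: "nat \<Rightarrow> nat list \<Rightarrow> nat list \<Rightarrow> bool" for n :: nat where
  swap: "\<lbrakk>i \<in> {1..n}; j \<in> {1..n}; i \<noteq> j; j \<noteq> nxt n i; i \<noteq> nxt n j; u \<in> lists {1..n}; v \<in> lists {1..n}\<rbrakk>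
    \<Longrightarrow> comm_cong n (u @ [i, j] @ v) (u @ [j, i] @ v)"
| refl: "u \<in> lists {1..n} \<Longrightarrow> comm_cong n u u"
| trans: "\<lbrakk>comm_cong n u v; comm_cong n v w\<rbrakk> \<Longrightarrow> comm_cong n u w"

lemma comm_cong_sym: "comm_cong n u v \<Longrightarrow> comm_cong n v u"
proof (induction rule: comm_cong.induct)
  case (swap i j u v)
  then show ?case by (intro comm_cong.swap) auto
qed (auto intro: comm_cong.intros)

lemma comm_cong_lists: "comm_cong n u v \<Longrightarrow> u \<in> lists {1..n} \<and> v \<in> lists {1..n}"
  by (induction rule: comm_cong.induct) auto

lemma comm_cong_ctxt:
  "comm_cong n u v \<Longrightarrow> a \<in> lists {1..n} \<Longrightarrow> b \<in> lists {1..n} \<Longrightarrow> comm_cong n (a @ u @ b) (a @ v @ b)"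
proof (induction rule: comm_cong.induct)
  case (swap i j u v)
  then have "comm_cong n ((a @ u) @ [i, j] @ (v @ b)) ((a @ u) @ [j, i] @ (v @ b))"
    by (intro comm_cong.swap) auto
  then show ?case by simp
next
  case (refl u)
  then show ?case by (intro comm_cong.refl) auto
next
  case (trans u v w)
  then show ?case using comm_cong.trans by blast
qed

lemma comm_cong_length: "comm_cong n u v \<Longrightarrow> length u = length v"
  by (induction rule: comm_cong.induct) auto

lemma comm_cong_move:
  assumes "z \<in> {1..n}" "p \<in> lists {1..n}" "z \<notin> set p" "nxt n z \<notin> set p" "prv n z \<notin> set p"
  shows "comm_cong n (z # p) (p @ [z])"
  using assms(2-5)
proof (induction p rule: list.induct)
  case Nil
  then show ?case using assms(1) by (auto intro: comm_cong.refl)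
next
  case (Cons x p)
  have "z \<noteq> nxt n x" using Cons.prems prv_nxt[of x n] by auto
  then have "comm_cong n ([] @ [z, x] @ p) ([] @ [x, z] @ p)"
    using Cons.prems assms(1) by (intro comm_cong.swap) auto
  moreover have "comm_cong n ([x] @ (z # p) @ []) ([x] @ (p @ [z]) @ [])"
    using Cons by (intro comm_cong_ctxt) auto
  ultimately show ?case by (auto intro: comm_cong.trans)
qed

lemma lead_swap:
  assumes "{x, y} \<noteq> {i, j}" "i \<noteq> j" "x \<noteq> y"
  shows "lead (u @ [i, j] @ v) x y = lead (u @ [j, i] @ v) x y"
  using assms by (induction u) auto

text \<open>A commutation never exchanges a letter with a cyclic neighbour, so the order in which
  two neighbours occur is constant on a commutation class. Since \<open>altern\<close> and
  \<open>goes_right\<close> are stated through \<open>lead\<close>, they pass to classes as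
  well.\<close>

lemma comm_cong_lead:
  "comm_cong n u v \<Longrightarrow> n \<ge> 2 \<Longrightarrow> x \<in> {1..n} \<Longrightarrow> lead u x (prv n x) = lead v x (prv n x)"
proof (induction rule: comm_cong.induct)
  case (swap i j u v)
  have "{x, prv n x} \<noteq> {i, j}" using swap nxt_prv[of x n] by (auto simp: doubleton_eq_iff)
  then show ?case using lead_swap[of x "prv n x" i j u v] swap prv_neq[of n x] by metis
qed auto

lemma comm_cong_lead':
  "comm_cong n u v \<Longrightarrow> n \<ge> 2 \<Longrightarrow> x \<in> {1..n} \<Longrightarrow> lead u x (nxt n x) = lead v x (nxt n x)"
proof (induction rule: comm_cong.induct)
  case (swap i j u v)
  have "{x, nxt n x} \<noteq> {i, j}" using swap by (auto simp: doubleton_eq_iff)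
  then show ?case using lead_swap[of x "nxt n x" i j u v] swap nxt_neq[of n x] by metis
qed auto

lemma comm_cong_altern: "comm_cong n u v \<Longrightarrow> n \<ge> 2 \<Longrightarrow> altern n u = altern n v"
proof (induction rule: comm_cong.induct)
  case (swap i j u v)
  have ij: "i \<noteq> prv n j" "j \<noteq> prv n i" using swap nxt_prv by metis+
  show ?case using swap(6)
  proof (induction u rule: list.induct)
    case Nil
    then show ?case using swap ij by auto
  next
    case (Cons x u)
    have c: "comm_cong n (u @ [i, j] @ v) (u @ [j, i] @ v)" using swap Cons by (intro comm_cong.swap) auto
    have x: "x \<in> {1..n}" using Cons by auto
    show ?case using comm_cong_lead[OF c \<open>2 \<le> n\<close> x] comm_cong_lead'[OF c \<open>2 \<le> n\<close> x] Cons by auto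
  qed
qed auto

lemma comm_cong_act: "comm_cong n u v \<Longrightarrow> n \<ge> 1 \<Longrightarrow> act n u a = act n v a"
proof (induction rule: comm_cong.induct)
  case (swap i j u v)
  have *: "step n j (step n i b) = step n i (step n j b)" for b
    using swap res_Suc[of n b] by (auto simp: step_def)
  have "act n (u @ [i, j] @ v) b = act n (u @ [j, i] @ v) b" for b
    by (induction u arbitrary: b) (simp_all add: *)
  then show ?case .
qed auto

lemma comm_cong_right_end: "comm_cong n u v \<Longrightarrow> n \<ge> 2 \<Longrightarrow> right_end n u = right_end n v"
  using comm_cong_lead[of n u v] comm_cong_act[of n u v] res_range[of n]
  by (auto simp: right_end_def goes_right_def fun_eq_iff)

lemma altern_append: "altern n (u @ v) \<Longrightarrow> altern n v"
  by (induction u) auto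

lemma lead_split: "lead w x y \<Longrightarrow> \<exists>p q. w = p @ x # q \<and> x \<notin> set p \<and> y \<notin> set p"
proof (induction w)
  case (Cons z w)
  show ?case
  proof (cases "z = x")
    case True
    then show ?thesis by (intro exI[of _ "[]"] exI[of _ w]) auto
  next
    case False
    then obtain p q where "w = p @ x # q" "x \<notin> set p" "y \<notin> set p" using Cons by auto
    then show ?thesis using False Cons.prems by (intro exI[of _ "z # p"] exI[of _ q]) auto
  qed
qed auto

lemma lead_prefix: "y \<notin> set p \<Longrightarrow> lead (p @ x # q) x y"
  by (induction p) auto

text \<open>No neighbour of \<open>i\<close> precedes the first \<open>i\<close>: the lower one
  because \<open>i\<close> leads it, the upper one because it would otherwise lead \<open>i\<close>.
  This occurrence of \<open>i\<close> therefore commutes to the front.\<close>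

lemma altern_bring_front:
  assumes "n \<ge> 3" "w \<in> lists {1..n}" "i \<in> {1..n}" "lead w i (prv n i)" "\<not> lead w (nxt n i) i"
  shows "\<exists>w'. comm_cong n w (i # w')"
proof -
  obtain p q where w: "w = p @ i # q" and p: "i \<notin> set p" "prv n i \<notin> set p" using lead_split[OF assms(4)] by auto
  have nx: "nxt n i \<notin> set p"
  proof
    assume "nxt n i \<in> set p"
    then obtain p1 p2 where p': "p = p1 @ nxt n i # p2" by (meson split_list)
    then have "lead (p1 @ nxt n i # (p2 @ i # q)) (nxt n i) i" using p by (intro lead_prefix) auto
    then show False using assms(5) w p' by simp
  qed
  have "comm_cong n ([] @ (i # p) @ q) ([] @ (p @ [i]) @ q)"
    using assms(2,3) w p nx by (intro comm_cong_ctxt comm_cong_move) auto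
  then show ?thesis using w comm_cong_sym by force
qed

text \<open>Cancellation from the left. The first letter \<open>i\<close> can be seen in
  \<open>right_end\<close>: the position \<open>i\<close> goes right and its successor does not.
  Hence \<open>w'\<close> can be rewritten to start with \<open>i\<close>, and
  \<open>right_end_tail\<close> passes the equality on to the tails.\<close>

lemma altern_unique:
  assumes "n \<ge> 3"
  shows "\<lbrakk>w \<in> lists {1..n}; w' \<in> lists {1..n}; altern n w; altern n w'; right_end n w = right_end n w'\<rbrakk>
    \<Longrightarrow> comm_cong n w w'"
proof (induction w arbitrary: w' rule: list.induct)
  case Nil
  show ?case
  proof (cases w')
    case Nil
    then show ?thesis by (auto intro: comm_cong.refl)
  next
    case (Cons i v)
    then have i: "i \<in> {1..n}" using Nil.prems by auto
    have "goes_right n w' (int i)" using Cons by (simp add: goes_right_def res_int[OF i])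
    then have "right_end n [] (int i) > int i" using Nil.prems(5) right_end_gt by metis
    then show ?thesis by (simp add: right_end_def goes_right_def)
  qed
next
  case (Cons i w)
  have n: "n \<ge> 1" "n \<ge> 2" using assms by auto
  have i: "i \<in> {1..n}" using Cons.prems by auto
  have gr: "goes_right n (i # w) a = goes_right n w' a" for a
    using Cons.prems(5) right_end_gt by metis
  have "goes_right n (i # w) (int i)" by (simp add: goes_right_def res_int[OF i])
  then have l1: "lead w' i (prv n i)" using gr[of "int i"] by (simp add: goes_right_def res_int[OF i])
  have nx: "nxt n i \<in> {1..n}" using nxt_range[OF i] .
  have "\<not> goes_right n (i # w) (int (nxt n i))"
    using nxt_neq[OF n(2) i] by (simp add: goes_right_def res_int[OF nx] prv_nxt[OF i])
  then have l2: "\<not> lead w' (nxt n i) i" using gr[of "int (nxt n i)"] by (simp add: goes_right_def res_int[OF nx] prv_nxt[OF i])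
  obtain v where v: "comm_cong n w' (i # v)" using altern_bring_front[OF assms Cons.prems(2) i l1 l2] by auto
  have vl: "i # v \<in> lists {1..n}" using comm_cong_lists[OF v] by auto
  have va: "altern n (i # v)" using comm_cong_altern[OF v n(2)] Cons.prems by simp
  have "right_end n (i # v) = right_end n (i # w)" using comm_cong_right_end[OF v n(2)] Cons.prems by simp
  moreover have "set (i # v) \<subseteq> {1..n}" "set (i # w) \<subseteq> {1..n}" using vl Cons.prems(1) by auto
  ultimately have "right_end n w a = right_end n v a" for a
    using right_end_tail[OF assms _ va, of a] right_end_tail[OF assms _ Cons.prems(3), of a] by simp
  then have "comm_cong n w v" using Cons va vl by (intro Cons.IH) auto
  then have "comm_cong n ([i] @ w @ []) ([i] @ v @ [])" using i by (intro comm_cong_ctxt) auto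
  then show ?case using comm_cong.trans[OF _ comm_cong_sym[OF v]] by simp
qed

section \<open>Reduction of words to alternating form\<close>

definition bad_factor :: "nat \<Rightarrow> nat list \<Rightarrow> bool"
  where "bad_factor n F \<longleftrightarrow> (\<exists>i\<in>{1..n}. F = [i, i] \<or> F = [i, nxt n i, i] \<or> F = [nxt n i, i, nxt n i])"

text \<open>Before the next occurrence of \<open>z\<close> the neighbour \<open>x\<close> is
  missing. The other neighbour \<open>y\<close> occurs there at most once, since between two
  occurrences of \<open>y\<close> alternation of \<open>w\<close> would force a \<open>z\<close>.
  All remaining letters in between commute with \<open>z\<close>, which leaves \<open>z z\<close> or
  \<open>z y z\<close>.\<close>

lemma not_altern_aux:
  assumes "w \<in> lists {1..n}" "z \<in> {1..n}" "altern n w" "lead w z x"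
    "{x, y} = {nxt n z, prv n z}" "n \<ge> 3"
  shows "\<exists>u F v. u \<in> lists {1..n} \<and> v \<in> lists {1..n} \<and> bad_factor n F \<and> comm_cong n (z # w) (u @ F @ v)"
proof -
  obtain p q where w: "w = p @ z # q" and p: "z \<notin> set p" "x \<notin> set p" using lead_split[OF assms(4)] by auto
  have pl: "p \<in> lists {1..n}" "q \<in> lists {1..n}" using w assms(1) by auto
  have y: "y \<in> {1..n}" using assms(5) nxt_range[OF assms(2)] prv_range[OF assms(2)] by (auto simp: doubleton_eq_iff)
  show ?thesis
  proof (cases "y \<in> set p")
    case False
    then have "nxt n z \<notin> set p" "prv n z \<notin> set p" using p assms(5) by auto
    then have "comm_cong n ([] @ (z # p) @ (z # q)) ([] @ (p @ [z]) @ (z # q))"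
      using p pl assms(2) by (intro comm_cong_ctxt comm_cong_move) auto
    then have "comm_cong n (z # w) (p @ [z, z] @ q)" using w by simp
    moreover have "bad_factor n [z, z]" using assms(2) unfolding bad_factor_def by blast
    ultimately show ?thesis using pl by blast
  next
    case True
    then obtain p1 p2 where p': "p = p1 @ y # p2" "y \<notin> set p1" by (meson split_list_first)
    have p2: "y \<notin> set p2"
    proof
      assume "y \<in> set p2"
      then obtain r s where r: "p2 = r @ y # s" by (meson split_list)
      have "lead (r @ y # (s @ z # q)) y z" using p p' r by (intro lead_prefix) auto
      moreover have "altern n (y # p2 @ z # q)" using assms(3) w p' altern_append[of n p1 "y # p2 @ z # q"] by simp
      moreover have "z = nxt n y \<or> z = prv n y"
      proof -
        from assms(5) have "y = nxt n z \<or> y = prv n z" by blast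
        then show ?thesis using prv_nxt[OF assms(2)] nxt_prv[OF assms(2)] by metis
      qed
      ultimately show False using r by auto
    qed
    have zs: "nxt n z \<notin> set p1" "prv n z \<notin> set p1" "nxt n z \<notin> set p2" "prv n z \<notin> set p2"
      using p p' p2 assms(5) by auto
    \<comment> \<open>The first \<open>z\<close> is pushed right up to \<open>y\<close>; the second
      one is then pulled left up to it.\<close>
    have 1: "comm_cong n ([] @ (z # p1) @ (y # p2 @ z # q)) ([] @ (p1 @ [z]) @ (y # p2 @ z # q))"
      using p p' pl assms(2) zs y by (intro comm_cong_ctxt comm_cong_move) auto
    have 2: "comm_cong n ((p1 @ [z, y]) @ (z # p2) @ q) ((p1 @ [z, y]) @ (p2 @ [z]) @ q)"
      using p p' pl assms(2) zs y by (intro comm_cong_ctxt comm_cong_move) auto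
    have "comm_cong n (z # w) (p1 @ [z, y, z] @ (p2 @ q))"
      using comm_cong.trans[OF 1] comm_cong_sym[OF 2] w p' by simp
    moreover have "bad_factor n [z, y, z]"
    proof -
      from assms(5) have "y = nxt n z \<or> y = prv n z" by blast
      then show ?thesis using assms(2) y nxt_prv[OF assms(2)] unfolding bad_factor_def by metis
    qed
    ultimately show ?thesis using pl p' by (intro exI[of _ p1] exI[of _ "[z, y, z]"] exI[of _ "p2 @ q"]) auto
  qed
qed

lemma not_altern_factor:
  assumes "n \<ge> 3" "w \<in> lists {1..n}" "\<not> altern n w"
  shows "\<exists>u F v. u \<in> lists {1..n} \<and> v \<in> lists {1..n} \<and> bad_factor n F \<and> comm_cong n w (u @ F @ v)"
  using assms(2,3)
proof (induction w rule: list.induct)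
  case (Cons z w)
  have z: "z \<in> {1..n}" and w: "w \<in> lists {1..n}" using Cons.prems by auto
  consider "\<not> altern n w" | "altern n w" "lead w z (nxt n z)" | "altern n w" "lead w z (prv n z)"
    using Cons.prems by auto
  then show ?case
  proof cases
    case 1
    then obtain u F v where *: "u \<in> lists {1..n}" "v \<in> lists {1..n}" "bad_factor n F" "comm_cong n w (u @ F @ v)"
      using Cons.IH w by blast
    have "comm_cong n ([z] @ w @ []) ([z] @ (u @ F @ v) @ [])" using z * by (intro comm_cong_ctxt) auto
    then show ?thesis using * z by (intro exI[of _ "z # u"] exI[of _ F] exI[of _ v]) auto
  next
    case 2
    then show ?thesis using not_altern_aux[OF w z 2, of "prv n z"] assms(1) by auto
  next
    case 3
    then show ?thesis using not_altern_aux[OF w z 3, of "nxt n z"] assms(1) by (auto simp: insert_commute)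
  qed
qed auto

lemma comm_cong_C_cong: "comm_cong n u v \<Longrightarrow> C_cong n u v"
proof (induction rule: comm_cong.induct)
  case (swap i j u v)
  have "C_cong n [i, j] [j, i]"
  proof (cases "i > j")
    case True
    then have "1 < int i - int j" "int i - int j < int n - 1" using swap by (auto simp: nxt_def split: if_splits)
    then show ?thesis using swap by (intro C_cong.comm) auto
  next
    case False
    then have "1 < int j - int i" "int j - int i < int n - 1" using swap by (auto simp: nxt_def split: if_splits)
    then show ?thesis using swap by (intro C_cong.sym[OF C_cong.comm]) auto
  qed
  then show ?case using swap by (intro C_cong.ctxt) auto
qed (auto intro: C_cong.intros)

lemma C_cong_lists: "C_cong n u v \<Longrightarrow> u \<in> lists {1..n} \<and> v \<in> lists {1..n}"
  by (induction rule: C_cong.induct) (auto simp: nxt_def)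

text \<open>Each bad factor is congruent to a strictly shorter word while commutations keep the
  length, so the rewriting terminates.\<close>

lemma C_cong_altern:
  assumes "n \<ge> 3"
  shows "w \<in> lists {1..n} \<Longrightarrow> \<exists>v. altern n v \<and> C_cong n w v"
proof (induction w rule: length_induct)
  case (1 w)
  show ?case
  proof (cases "altern n w")
    case True
    then show ?thesis using C_cong.refl[OF 1(2)] by blast
  next
    case False
    then obtain u F v where *: "u \<in> lists {1..n}" "v \<in> lists {1..n}" "bad_factor n F" "comm_cong n w (u @ F @ v)"
      using not_altern_factor[OF assms _ False] 1 by blast
    obtain G where G: "C_cong n F G" "length G < length F"
    proof -
      from *(3) obtain i where i: "i \<in> {1..n}" and
        "F = [i, i] \<or> F = [i, nxt n i, i] \<or> F = [nxt n i, i, nxt n i]" unfolding bad_factor_def by blast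
      then consider "F = [i, i]" | "F = [i, nxt n i, i]" | "F = [nxt n i, i, nxt n i]" by blast
      then show thesis
      proof cases
        case 1
        then show ?thesis using that[of "[i]"] C_cong.idem[OF i] by auto
      next
        case 2
        then show ?thesis using that[of "[i, nxt n i]"] C_cong.trans[OF C_cong.braid1[OF i] C_cong.braid2[OF i]] by auto
      next
        case 3
        then show ?thesis using that[of "[i, nxt n i]"] C_cong.braid2[OF i] by auto
      qed
    qed
    have c: "C_cong n w (u @ G @ v)"
      using C_cong.trans[OF comm_cong_C_cong[OF *(4)] C_cong.ctxt[OF G(1) *(1,2)]] .
    have "length (u @ G @ v) < length w" using comm_cong_length[OF *(4)] G(2) by simp
    then show ?thesis using 1 C_cong_lists[OF c] C_cong.trans[OF c] by blast
  qed
qed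

section \<open>Periodic displacements and the couples of sequences\<close>

definition periodic_right :: "nat \<Rightarrow> (int \<Rightarrow> int) \<Rightarrow> bool"
  where "periodic_right n r \<longleftrightarrow> (\<forall>a m. r (a + int n * m) = r a + int n * m) \<and> (\<forall>a. a \<le> r a) \<and>
    (\<forall>a b. a < b \<longrightarrow> a < r a \<longrightarrow> b < r b \<longrightarrow> r a < r b) \<and> (\<exists>a. r a = a)"

text \<open>\<open>periodic_right\<close> axiomatises the functions \<open>right_end n w\<close>.
  Strict growth on the moved positions comes from the jumps of \<open>act\<close> at right strands.
  The fixed point is the position after the first letter, which is displaced to the left first; for
  couples it becomes the condition \<open>k < n\<close>.\<close>

lemma periodic_right_right_end:
  assumes "n \<ge> 3" "set w \<subseteq> {1..n}" "altern n w"
  shows "periodic_right n (right_end n w)"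
proof -
  have "right_end n w a < right_end n w b" if "a < b" "a < right_end n w a" "b < right_end n w b" for a b
  proof -
    have g: "goes_right n w a" "goes_right n w b" using that right_end_gt by blast+
    have "act n w a \<le> act n w (b - 1)" using that by (intro act_mono) auto
    also have "\<dots> < act n w b" using altern_strands[OF assms, of b] g by blast
    finally show ?thesis using g by (simp add: right_end_def)
  qed
  moreover have "\<exists>a. right_end n w a = a"
  proof (cases w)
    case Nil
    then show ?thesis by (auto simp: right_end_def goes_right_def)
  next
    case (Cons i v)
    then have i: "i \<in> {1..n}" using assms by auto
    have "\<not> goes_right n w (int (nxt n i))"
      using nxt_neq[of n i] i assms(1) Cons by (simp add: goes_right_def res_int[OF nxt_range[OF i]] prv_nxt[OF i])
    then show ?thesis by (intro exI[of _ "int (nxt n i)"]) (simp add: right_end_def)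
  qed
  ultimately show ?thesis by (auto simp: periodic_right_def right_end_period right_end_ge)
qed

text \<open>Walking to the left from \<open>c\<close>, the value of \<open>act\<close> stays the
  same as long as no right strand is met. Periodicity excludes that this lasts for \<open>n\<close>
  steps.\<close>

lemma act_eq_right:
  assumes "n \<ge> 3" "set w \<subseteq> {1..n}" "altern n w" "act n w c > c"
  shows "\<exists>b\<le>c. goes_right n w b \<and> act n w b = act n w c"
proof (rule ccontr)
  assume H: "\<not> ?thesis"
  have "act n w (c - int k) = act n w c" for k
  proof (induction k)
    case (Suc k)
    have "\<not> goes_right n w (c - int k)" using H Suc by auto
    then have "act n w (c - int k) = act n w (c - int k - 1)"
      using altern_strands[OF assms(1-3), of "c - int k"] Suc assms(4) by auto
    then show ?case using Suc by (simp add: algebra_simps)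
  qed simp
  from this[of n] have "act n w (c + int n * (- 1)) = act n w c" by simp
  then show False unfolding act_period using assms(1) by simp
qed

text \<open>Induction on the total displacement over one period. A letter is split off at a position
  \<open>a\<close> that moves while \<open>a + 1\<close> is fixed. Removing it hands the end of
  \<open>a\<close> over to \<open>a + 1\<close> and makes \<open>a\<close> fixed, which lowers the
  sum by exactly one.\<close>

lemma periodic_right_word:
  assumes "n \<ge> 3"
  shows "periodic_right n r \<Longrightarrow> \<exists>w\<in>lists {1..n}. altern n w \<and> right_end n w = r"
proof (induction "nat (\<Sum>a\<in>{1..int n}. r a - a)" arbitrary: r rule: less_induct)
  case less
  have n: "n \<ge> 1" "n \<ge> 2" using assms by auto
  have per: "r (a + int n * m) = r a + int n * m" and ge: "a \<le> r a"
    and strict: "a < b \<Longrightarrow> a < r a \<Longrightarrow> b < r b \<Longrightarrow> r a < r b" for a b m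
    using less.prems unfolding periodic_right_def by blast+
  obtain c0 where c0: "r c0 = c0" using less.prems unfolding periodic_right_def by blast
  show ?case
  proof (cases "\<forall>a. r a = a")
    case True
    then have "right_end n [] = r" by (auto simp: right_end_def goes_right_def)
    then show ?thesis by (intro bexI[of _ "[]"]) auto
  next
    case False
    then obtain a0 where a0: "r a0 > a0" using ge by (metis order_le_imp_less_or_eq)
    obtain a where a: "r a > a" "r (a + 1) = a + 1"
    proof -
      \<comment> \<open>Shifting the given fixed point by enough periods puts it to the right of
        \<open>a0\<close>; the first fixed point after \<open>a0\<close> then has a moving left
        neighbour.\<close>
      define m where "m = \<bar>a0 - c0\<bar> + 1"
      have "1 * m \<le> int n * m" using n(1) m_def by (intro mult_right_mono) auto
      then have "c0 + int n * m > a0" using m_def by linarith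
      then obtain c1 where c1: "r c1 = c1" "c1 > a0" using per c0 by metis
      have "\<exists>k::nat. r (a0 + int k) = a0 + int k" using c1 by (intro exI[of _ "nat (c1 - a0)"]) auto
      then obtain k :: nat where k: "r (a0 + int k) = a0 + int k" "\<forall>j<k. r (a0 + int j) \<noteq> a0 + int j"
        using exists_least_iff[of "\<lambda>k. r (a0 + int k) = a0 + int k"] by blast
      have "k \<noteq> 0"
      proof
        assume "k = 0"
        then have "r a0 = a0" using k(1) by simp
        then show False using a0 by simp
      qed
      then have "r (a0 + int (k - 1)) \<noteq> a0 + int (k - 1)" "a0 + int (k - 1) + 1 = a0 + int k"
        using k(2)[rule_format, of "k - 1"] by auto
      moreover from this have "r (a0 + int (k - 1)) > a0 + int (k - 1)" using ge by (simp add: order_less_le)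
      ultimately show thesis using that[of "a0 + int (k - 1)"] k by simp
    qed
    define i where "i = res n a"
    define nx where "nx = nxt n i"
    have i: "i \<in> {1..n}" using i_def res_range n by auto
    have nx: "nx \<in> {1..n}" "nx \<noteq> i" using nxt_range[OF i] nxt_neq[OF n(2) i] nx_def by auto
    have rA: "r b > b" if "res n b = i" for b
    proof -
      obtain m where "b = a + int n * m" using \<open>res n b = i\<close> res_eq_iff[OF n(1), of b a] i_def by auto
      then show ?thesis using per a by simp
    qed
    have rB: "r b = b" if "res n b = nx" for b
    proof -
      have "res n (a + 1) = nx" using res_Suc[OF n(1)] i_def nx_def by simp
      then obtain m where "b = a + 1 + int n * m" using \<open>res n b = nx\<close> res_eq_iff[OF n(1), of b "a + 1"] by auto
      then show ?thesis using per a by simp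
    qed
    have pred: "res n (b - 1) = i" if "res n b = nx" for b
      using that res_pred[OF n(1), of b] prv_nxt[OF i] nx_def by simp
    define r1 where "r1 b = (if res n b = i then b else if res n b = nx then r (b - 1) else r b)" for b
    have per1: "r1 (b + int n * m) = r1 b + int n * m" for b m
    proof -
      have "r (b + int n * m - 1) = r (b - 1) + int n * m" using per[of "b - 1" m] by (simp add: diff_add_eq)
      then show ?thesis using per[of b m] by (simp add: r1_def res_period)
    qed
    have ge1: "b \<le> r1 b" for b
      using ge[of b] rA[OF pred, of b] by (auto simp: r1_def)
    have strict1: "r1 b < r1 c" if "b < c" "b < r1 b" "c < r1 c" for b c
    proof -
      have b: "res n b \<noteq> i" and c: "res n c \<noteq> i" using that by (auto simp: r1_def)
      have bc: "b < c - 1" if "res n c = nx"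
        using pred[OF that] b \<open>b < c\<close> by (cases "b = c - 1") auto
      show ?thesis
      proof (cases "res n b = nx"; cases "res n c = nx")
        assume "res n b = nx" "res n c = nx"
        then show ?thesis using strict[of "b - 1" "c - 1"] rA[OF pred] b c that by (simp add: r1_def)
      next
        assume "res n b = nx" "res n c \<noteq> nx"
        then show ?thesis using strict[of "b - 1" c] rA[OF pred, of b] b c that by (simp add: r1_def)
      next
        assume "res n b \<noteq> nx" "res n c = nx"
        then show ?thesis using strict[of b "c - 1"] rA[OF pred, of c] bc b c that by (simp add: r1_def)
      next
        assume "res n b \<noteq> nx" "res n c \<noteq> nx"
        then show ?thesis using strict[of b c] b c that by (simp add: r1_def)
      qed
    qed
    have g1: "periodic_right n r1"
      unfolding periodic_right_def using per1 ge1 strict1 i_def by (auto simp: r1_def intro!: exI[of _ a])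
    have sum: "(\<Sum>b\<in>{1..int n}. r1 b - b) < (\<Sum>b\<in>{1..int n}. r b - b)"
    proof -
      have mem: "int i \<in> {1..int n}" "int nx \<in> {1..int n} - {int i}" using i nx by auto
      have rest: "r1 b - b = r b - b" if "b \<in> {1..int n} - {int i} - {int nx}" for b
      proof -
        have "int (res n b) = b" using that by (simp add: res_def)
        then show ?thesis using that by (auto simp: r1_def)
      qed
      have "res n (int nx - 1) = i" using pred[of "int nx"] res_int[OF nx(1)] by simp
      then obtain m where m: "int nx - 1 = int i + int n * m" using res_eq_iff[OF n(1), of "int nx - 1" "int i"] res_int[OF i] by auto
      have "r1 (int nx) - int nx = r (int nx - 1) - int nx" using nx by (simp add: r1_def res_int[OF nx(1)])
      also have "\<dots> = r (int i) - int i - 1" using m per[of "int i" m] by simp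
      finally have e1: "r1 (int nx) - int nx = r (int i) - int i - 1" .
      have e2: "r (int nx) = int nx" using rB res_int[OF nx(1)] by simp
      have e3: "r1 (int i) = int i" by (simp add: r1_def res_int[OF i])
      have "(\<Sum>b\<in>{1..int n}. r1 b - b) = (r1 (int i) - int i) + ((r1 (int nx) - int nx) + (\<Sum>b\<in>{1..int n} - {int i} - {int nx}. r1 b - b))"
        by (simp only: sum.remove[OF finite_atLeastAtMost_int mem(1)]
            sum.remove[OF finite_Diff[OF finite_atLeastAtMost_int] mem(2)])
      moreover have "(\<Sum>b\<in>{1..int n}. r b - b) = (r (int i) - int i) + ((r (int nx) - int nx) + (\<Sum>b\<in>{1..int n} - {int i} - {int nx}. r b - b))"
        by (simp only: sum.remove[OF finite_atLeastAtMost_int mem(1)]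
            sum.remove[OF finite_Diff[OF finite_atLeastAtMost_int] mem(2)])
      moreover have "(\<Sum>b\<in>{1..int n} - {int i} - {int nx}. r1 b - b) = (\<Sum>b\<in>{1..int n} - {int i} - {int nx}. r b - b)"
        using rest by (intro sum.cong) auto
      ultimately show ?thesis using e1 e2 e3 by simp
    qed
    have "(\<Sum>b\<in>{1..int n}. r1 b - b) \<ge> 0" using ge1 by (intro sum_nonneg) simp
    then have "nat (\<Sum>b\<in>{1..int n}. r1 b - b) < nat (\<Sum>b\<in>{1..int n}. r b - b)" using sum by simp
    then obtain w where w: "w \<in> lists {1..n}" "altern n w" "right_end n w = r1" using less.hyps g1 by blast
    have ws: "set w \<subseteq> {1..n}" using w(1) by auto
    have ngr: "\<not> goes_right n w b" if "res n b = i" for b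
      using that w(3) right_end_gt[of b n w] by (simp add: r1_def)
    have l1: "\<not> lead w i (prv n i)" using ngr[of a] i_def by (simp add: goes_right_def)
    \<comment> \<open>If the strand at \<open>nx\<close> goes right in \<open>w\<close>, then
      \<open>nx\<close> leads \<open>i\<close>. Otherwise \<open>r a = a + 1\<close>, and
      \<open>i\<close> does not occur in \<open>w\<close> at all: an occurrence would require a
      right strand that starts left of \<open>a\<close> and ends beyond \<open>a\<close>, against
      the monotonicity of \<open>r\<close>.\<close>
    have l2: "\<not> lead w i nx"
    proof (cases "goes_right n w (int nx)")
      case True
      then have "lead w nx i" using res_int[OF nx(1)] prv_nxt[OF i] nx_def by (simp add: goes_right_def)
      then show ?thesis using lead_antisym nx(2) by blast
    next
      case False
      have na: "res n (a + 1) = nx" using res_Suc[OF n(1)] i_def nx_def by simp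
      then have "\<not> goes_right n w (a + 1)" using False by (simp add: goes_right_def res_int[OF nx(1)])
      then have "r1 (a + 1) = a + 1" using w(3) by (metis right_end_def)
      then have ra: "r a = a + 1" using na nx(2) by (simp add: r1_def)
      have "i \<notin> set w"
      proof
        assume "i \<in> set w"
        then have "act n w a > a" using act_gt i_def by simp
        then obtain b where b: "b \<le> a" "goes_right n w b" "act n w b = act n w a"
          using act_eq_right[OF assms ws w(2)] by blast
        have "b \<noteq> a" using b ngr i_def by auto
        have rb: "r1 b > a" using b \<open>act n w a > a\<close> w(3) by (metis right_end_def)
        have "res n b \<noteq> i" using b ngr by auto
        show False
        proof (cases "res n b = nx")
          case True
          obtain m where m: "b - 1 = a + int n * m" using pred[OF True] i_def res_eq_iff[OF n(1), of "b - 1" a] by auto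
          have "r1 b = r (b - 1)" using True \<open>res n b \<noteq> i\<close> by (simp add: r1_def)
          also have "\<dots> = b" using m per[of a m] ra by simp
          finally show False using rb b by simp
        next
          case False
          then have "r1 b = r b" using \<open>res n b \<noteq> i\<close> by (simp add: r1_def)
          then show False using strict[of b a] b \<open>b \<noteq> a\<close> rb ra a by auto
        qed
      qed
      then show ?thesis using lead_set by blast
    qed
    have alt: "altern n (i # w)" using w l1 l2 nx_def by simp
    have s: "set (i # w) \<subseteq> {1..n}" using ws i by simp
    have "right_end n (i # w) c = r c" for c
    proof -
      note tl = right_end_tail[OF assms s alt, unfolded w(3)]
      consider "res n c = i" | "res n c = nx" | "res n c \<noteq> i" "res n c \<noteq> nx" by blast
      then show ?thesis
      proof cases
        case 1
        then have "res n (c + 1) = nx" using res_Suc[OF n(1)] nx_def by simp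
        then show ?thesis using tl[of "c + 1"] nx nx_def by (simp add: r1_def)
      next
        case 2
        then have "\<not> goes_right n (i # w) c" using goes_right_Cons[OF n(2) i] nx nx_def by simp
        then show ?thesis using rB[OF 2] by (simp add: right_end_def)
      next
        case 3
        then show ?thesis using tl[of c] nx_def by (simp add: r1_def)
      qed
    qed
    then show ?thesis using w(1) i alt by (intro bexI[of _ "i # w"]) auto
  qed
qed

definition right_lists :: "nat \<Rightarrow> (int \<Rightarrow> int) \<Rightarrow> int list \<times> int list"
  where "right_lists n r = (let as = filter (\<lambda>a. a < r a) [1..int n] in (as, map r as))"

lemma right_lists_IIC:
  assumes "n \<ge> 1" "periodic_right n r"
  shows "right_lists n r \<in> IIC n"
proof -
  define as where "as = filter (\<lambda>a. a < r a) [1..int n]"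
  have per: "r (a + int n * m) = r a + int n * m"
    and strict: "a < b \<Longrightarrow> a < r a \<Longrightarrow> b < r b \<Longrightarrow> r a < r b" for a b m
    using assms(2) unfolding periodic_right_def by blast+
  have as: "sorted_wrt (<) as" "set as = {a \<in> {1..int n}. a < r a}"
    unfolding as_def by (auto intro: sorted_wrt_filter)
  have "sorted_wrt (<) (map r as)"
    unfolding sorted_wrt_map by (rule sorted_wrt_mono_rel[OF _ as(1)]) (use as(2) strict in auto)
  moreover have "last (map r as) < hd (map r as) + int n" if "map r as \<noteq> []"
  proof -
    have ne: "as \<noteq> []" using that by auto
    have l: "last as \<in> set as" and h: "hd as \<in> set as" using ne by auto
    have "last as < hd as + int n" using l h as(2) by auto
    moreover have "r (hd as + int n) = r (hd as) + int n" using per[of "hd as" 1] by simp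
    ultimately have "r (last as) < r (hd as) + int n"
      using strict[of "last as" "hd as + int n"] l h as(2) by auto
    then show ?thesis using ne by (simp add: last_map hd_map)
  qed
  moreover have "length as < n"
  proof -
    obtain c where c: "r c = c" using assms(2) unfolding periodic_right_def by blast
    obtain m where "c = int (res n c) + int n * m" using res_repr[OF assms(1)] by blast
    then have "r (int (res n c)) = int (res n c)" using c per[of "int (res n c)" m] by simp
    then have "int (res n c) \<in> {1..int n} - set as" using as(2) res_range[OF assms(1), of c] by auto
    then have "set as \<subset> {1..int n}" using as(2) by blast
    then have "card (set as) < n" using psubset_card_mono[of "{1..int n}" "set as"] by simp
    moreover have "distinct as" using as(1) strict_sorted_iff by blast
    ultimately show ?thesis by (simp add: distinct_card)
  qed
  moreover have "as ! t < map r as ! t" if "t < length as" for t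
    using nth_mem[OF that] as(2) that by auto
  ultimately show ?thesis using as by (auto simp: right_lists_def IIC_def as_def[symmetric])
qed

lemma right_lists_inj:
  assumes "n \<ge> 1" "periodic_right n r" "periodic_right n r'" "right_lists n r = right_lists n r'"
  shows "r = r'"
proof
  fix a
  obtain m where m: "a = int (res n a) + int n * m" using res_repr[OF assms(1)] by blast
  define c where "c = int (res n a)"
  have c: "c \<in> {1..int n}" using res_range[OF assms(1), of a] c_def by auto
  have ge: "c \<le> r c" "c \<le> r' c" using assms(2,3) unfolding periodic_right_def by blast+
  let ?as = "filter (\<lambda>a. a < r a) [1..int n]"
  have f: "?as = filter (\<lambda>a. a < r' a) [1..int n]" and g: "map r ?as = map r' ?as"
    using assms(4) by (auto simp: right_lists_def Let_def)
  have m1: "c \<in> set ?as \<longleftrightarrow> c < r c" using c by simp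
  have m2: "c \<in> set ?as \<longleftrightarrow> c < r' c" unfolding f using c by simp
  have "r c = r' c"
  proof (cases "c \<in> set ?as")
    case True
    then show ?thesis using g[unfolded map_eq_conv] by (rule bspec[rotated])
  next
    case False
    then show ?thesis using m1 m2 ge by linarith
  qed
  moreover have "r a = r c + int n * m" "r' a = r' c + int n * m"
    using assms(2,3) m c_def unfolding periodic_right_def by metis+
  ultimately show "r a = r' a" by simp
qed

text \<open>The couple is extended by the identity off its first list and then periodically. The
  condition that the last entry of \<open>bs\<close> is below the first plus \<open>n\<close> is
  what keeps the extension strictly increasing from one period to the next.\<close>

lemma right_lists_surj:
  assumes "n \<ge> 1" "p \<in> IIC n"
  shows "\<exists>r. periodic_right n r \<and> right_lists n r = p"
proof -
  obtain as bs where p: "p = (as, bs)" by (cases p)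
  have len: "length as = length bs" "length as < n" and as: "sorted_wrt (<) as" "set as \<subseteq> {1..int n}"
    and bs: "sorted_wrt (<) bs" "bs \<noteq> [] \<Longrightarrow> last bs < hd bs + int n"
    and lt: "\<And>t. t < length as \<Longrightarrow> as ! t < bs ! t"
    using assms(2) p by (auto simp: IIC_def)
  have dist: "distinct as" using as(1) strict_sorted_iff by blast
  define r0 where "r0 a = (case map_of (zip as bs) a of Some b \<Rightarrow> b | None \<Rightarrow> a)" for a
  define r where "r a = r0 (int (res n a)) + (a - int (res n a))" for a
  have r0_nth: "r0 (as ! t) = bs ! t" if "t < length as" for t
    using that len dist by (simp add: r0_def map_of_zip_nth)
  have r0_out: "r0 a = a" if "a \<notin> set as" for a
  proof -
    have "map_of (zip as bs) a = None" using that len by (simp add: map_of_zip_is_None)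
    then show ?thesis by (simp add: r0_def)
  qed
  have r_in: "r a = r0 a" if "a \<in> {1..int n}" for a
  proof -
    have "int (res n a) = a" using that by (simp add: res_def)
    then show ?thesis by (simp add: r_def)
  qed
  have per: "r (a + int n * m) = r a + int n * m" for a m
    by (simp add: r_def res_period)
  have char: "\<exists>t<length as. \<exists>m. a = as ! t + int n * m \<and> r a = bs ! t + int n * m" if "r a \<noteq> a" for a
  proof -
    obtain m where m: "a = int (res n a) + int n * m" using res_repr[OF assms(1)] by blast
    have "r0 (int (res n a)) \<noteq> int (res n a)" using that by (simp add: r_def)
    then obtain t where t: "t < length as" "int (res n a) = as ! t" using r0_out by (metis in_set_conv_nth)
    then show ?thesis using m r0_nth[OF t(1)] by (intro exI[of _ t] conjI exI[of _ m]) (auto simp: r_def)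
  qed
  have ge: "a \<le> r a" for a
    using char[of a] lt by (cases "r a = a") (auto simp: less_imp_le)
  \<comment> \<open>The bound between last and first entry yields the same bound for any two
    entries, since the list is sorted.\<close>
  have wrap: "bs ! t < bs ! u + int n" if "t < length as" "u < length as" for t u
  proof -
    have ne: "bs \<noteq> []" using that len by auto
    have srt: "sorted bs" using bs(1) strict_sorted_iff by blast
    have "bs ! t \<le> last bs" using sorted_nth_mono[OF srt, of t "length bs - 1"] that len ne by (simp add: last_conv_nth)
    moreover have "hd bs \<le> bs ! u" using sorted_nth_mono[OF srt, of 0 u] that len ne by (simp add: hd_conv_nth)
    ultimately show ?thesis using bs(2)[OF ne] by simp
  qed
  have strict: "r a < r b" if "a < b" "a < r a" "b < r b" for a b
  proof -
    obtain t m where t: "t < length as" "a = as ! t + int n * m" "r a = bs ! t + int n * m" using char[of a] \<open>a < r a\<close> by (metis order_less_irrefl)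
    obtain u l where u: "u < length as" "b = as ! u + int n * l" "r b = bs ! u + int n * l" using char[of b] \<open>b < r b\<close> by (metis order_less_irrefl)
    have at: "as ! t \<in> {1..int n}" "as ! u \<in> {1..int n}" using as(2) t u nth_mem by blast+
    have "m \<le> l"
    proof (rule ccontr)
      assume "\<not> m \<le> l"
      then have "int n * (l + 1) \<le> int n * m" by (intro mult_left_mono) auto
      then show False using at t u that by (simp add: algebra_simps)
    qed
    show ?thesis
    proof (cases "m = l")
      case True
      then have "as ! t < as ! u" using t u that by simp
      then have "t < u" using sorted_wrt_nth_less[OF as(1), of u t] t u by (metis linorder_neqE_nat order_less_asym order_less_irrefl)
      then have "bs ! t < bs ! u" using sorted_wrt_nth_less[OF bs(1), of t u] u len by auto
      then show ?thesis using t u True by simp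
    next
      case False
      then have "int n * (m + 1) \<le> int n * l" using \<open>m \<le> l\<close> by (intro mult_left_mono) auto
      then show ?thesis using wrap[OF t(1) u(1)] t u by (simp add: algebra_simps)
    qed
  qed
  have ex: "\<exists>a. r a = a"
  proof -
    have "card (set as) < card {1..int n}" using len card_length[of as] by simp
    then obtain c where "c \<in> {1..int n}" "c \<notin> set as"
      by (metis card_mono finite_set leD subsetI)
    then show ?thesis using r_in r0_out by metis
  qed
  have good: "periodic_right n r" unfolding periodic_right_def using per ge strict ex by blast
  define as' where "as' = filter (\<lambda>a. a < r a) [1..int n]"
  have "set as' = set as"
  proof -
    have "a < r a \<longleftrightarrow> a \<in> set as" if "a \<in> {1..int n}" for a
      using r_in[OF that] r0_out[of a] r0_nth lt by (metis in_set_conv_nth order_less_irrefl)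
    then show ?thesis unfolding as'_def using as(2) by auto
  qed
  moreover have "sorted_wrt (<) as'" unfolding as'_def by (auto intro: sorted_wrt_filter)
  ultimately have "as' = as" using as(1) by (metis strict_sorted_equal)
  moreover have "map r as = bs"
  proof (rule nth_equalityI)
    fix t assume "t < length (map r as)"
    then have t: "t < length as" by simp
    then have "as ! t \<in> {1..int n}" using as(2) nth_mem by blast
    then show "map r as ! t = bs ! t" using r_in r0_nth[OF t] t by simp
  qed (simp add: len)
  ultimately have "right_lists n r = p" using p by (simp add: right_lists_def Let_def as'_def)
  then show ?thesis using good by blast
qed

section \<open>The covering of the circle: lifts and their uniqueness\<close>

lemma circ_pt_eq_iff:
  assumes "n \<ge> 1"
  shows "circ_pt n x = circ_pt n y \<longleftrightarrow> (\<exists>m::int. x = y + real n * of_int m)"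
proof -
  have "circ_pt n x = circ_pt n y \<longleftrightarrow> (\<exists>m::int. 2 * pi * x / real n = 2 * pi * y / real n + 2 * pi * of_int m)"
    unfolding circ_pt_def complex_eq_iff
    using sin_cos_eq_iff[of "2 * pi * x / real n" "2 * pi * y / real n"] by (auto simp: mult.commute mult.left_commute)
  also have "\<dots> \<longleftrightarrow> (\<exists>m::int. x = y + real n * of_int m)"
  proof -
    have "2 * pi * x / real n = 2 * pi * y / real n + 2 * pi * of_int m \<longleftrightarrow> x = y + real n * of_int m" for m :: int
    proof -
      have "2 * pi * x / real n = 2 * pi * y / real n + 2 * pi * of_int m \<longleftrightarrow>
         (2 * pi / real n) * x = (2 * pi / real n) * (y + real n * of_int m)"
        using assms by (simp add: field_simps)
      also have "\<dots> \<longleftrightarrow> x = y + real n * of_int m" using assms by (subst mult_cancel_left) auto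
      finally show ?thesis .
    qed
    then show ?thesis by simp
  qed
  finally show ?thesis .
qed

lemma circ_pt_period: "n \<ge> 1 \<Longrightarrow> circ_pt n (x + real n * of_int m) = circ_pt n x"
  using circ_pt_eq_iff[of n "x + real n * of_int m" x] by auto

lemma circ_pt_norm: "norm (circ_pt n x) = 1"
  by (simp add: circ_pt_def)

lemma circ_pt_sphere: "circ_pt n x \<in> sphere 0 1"
  by (simp add: circ_pt_norm)

lemma continuous_on_circ_pt [continuous_intros]:
  "continuous_on S f \<Longrightarrow> continuous_on S (\<lambda>x. circ_pt n (f x))"
  unfolding circ_pt_def cis_conv_exp divide_inverse by (intro continuous_intros)

lemma circ_pt_int_eq:
  assumes "n \<ge> 1" "i \<in> {1..n}" "j \<in> {1..n}" "circ_pt n (real i) = circ_pt n (real j)"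
  shows "i = j"
proof -
  obtain m :: int where "real i = real j + real n * of_int m" using assms circ_pt_eq_iff by blast
  then have "real_of_int (int i) = of_int (int j + int n * m)" by simp
  then have "int i = int j + int n * m" by (simp only: of_int_eq_iff)
  then have "res n (int i) = res n (int j)" using res_period by metis
  then show ?thesis using res_int assms by metis
qed

lemma circ_pt_res: "n \<ge> 1 \<Longrightarrow> circ_pt n (real (res n a)) = circ_pt n (of_int a)"
proof -
  assume n: "n \<ge> 1"
  obtain m where "a = int (res n a) + int n * m" using res_repr[OF n] by blast
  then have "real_of_int a = real (res n a) + real n * of_int m" by (metis of_int_add of_int_mult of_int_of_nat_eq)
  then show ?thesis using circ_pt_period[OF n] by metis
qed

text \<open>A continuous logarithm of a circle-valued map is purely imaginary; its imaginary part,
  rescaled, is the lift. Besides intervals, the domains that occur are a square for isotopies and a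
  disk for contractible regions.\<close>

lemma circ_lift_contractible:
  fixes f :: "'a::real_normed_vector \<Rightarrow> complex"
  assumes "n \<ge> 1" "contractible S" "continuous_on S f" "f ` S \<subseteq> sphere 0 1"
  shows "\<exists>g::'a \<Rightarrow> real. continuous_on S g \<and> (\<forall>x\<in>S. f x = circ_pt n (g x))"
proof -
  have "f x \<noteq> 0" if "x \<in> S" for x using assms(4) that by (auto simp: image_subset_iff)
  then obtain l where l: "continuous_on S l" "\<And>x. x \<in> S \<Longrightarrow> f x = exp (l x)"
    using continuous_logarithm_on_contractible[OF assms(3,2)] by metis
  define g where "g x = real n * Im (l x) / (2 * pi)" for x
  have "continuous_on S g" unfolding g_def divide_inverse using l(1) by (intro continuous_intros)
  moreover have "f x = circ_pt n (g x)" if "x \<in> S" for x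
  proof -
    have "norm (f x) = 1" using assms(4) that by auto
    then have "Re (l x) = 0" using l(2)[OF that] by (simp add: norm_exp_eq_Re)
    then have "f x = cis (Im (l x))" using l(2)[OF that] by (simp add: exp_eq_polar)
    then show ?thesis using assms(1) by (simp add: circ_pt_def g_def)
  qed
  ultimately show ?thesis by blast
qed

lemma circ_lift_contractible_at:
  fixes f :: "'a::real_normed_vector \<Rightarrow> complex"
  assumes "n \<ge> 1" "contractible S" "continuous_on S f" "f ` S \<subseteq> sphere 0 1" "x0 \<in> S" "f x0 = circ_pt n a"
  shows "\<exists>g::'a \<Rightarrow> real. continuous_on S g \<and> (\<forall>x\<in>S. f x = circ_pt n (g x)) \<and> g x0 = a"
proof -
  obtain g where g: "continuous_on S g" "\<forall>x\<in>S. f x = circ_pt n (g x)"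
    using circ_lift_contractible[OF assms(1-4)] by blast
  then have "circ_pt n a = circ_pt n (g x0)" using assms by metis
  then obtain m :: int where "a = g x0 + real n * of_int m" using circ_pt_eq_iff[OF assms(1)] by blast
  then show ?thesis using g circ_pt_period[OF assms(1)]
    by (intro exI[of _ "\<lambda>x. g x + real n * of_int m"]) (auto intro!: continuous_intros)
qed

text \<open>Two lifts differ by integer multiples of \<open>n\<close>. A continuous function with
  such discrete values is constant on a connected set.\<close>

lemma circ_lift_unique:
  fixes g g' :: "'a::topological_space \<Rightarrow> real"
  assumes "n \<ge> 1" "connected S" "continuous_on S g" "continuous_on S g'"
    "\<And>x. x \<in> S \<Longrightarrow> circ_pt n (g x) = circ_pt n (g' x)" "x0 \<in> S" "g x0 = g' x0" "x \<in> S"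
  shows "g x = g' x"
proof -
  define d where "d x = (g x - g' x) / real n" for x
  have dint: "\<exists>m::int. d x = of_int m" if x: "x \<in> S" for x
  proof -
    obtain m :: int where "g x = g' x + real n * of_int m" using assms(5)[OF x] circ_pt_eq_iff[OF assms(1)] by blast
    then show ?thesis using assms(1) by (intro exI[of _ m]) (simp add: d_def)
  qed
  have "continuous_on S d" unfolding d_def divide_inverse using assms by (intro continuous_intros)
  moreover have "\<exists>e>0. \<forall>y. y \<in> S \<and> d y \<noteq> d x \<longrightarrow> e \<le> norm (d y - d x)" if x: "x \<in> S" for x
  proof (intro exI[of _ 1] conjI allI impI)
    fix y assume y: "y \<in> S \<and> d y \<noteq> d x"
    then obtain k m :: int where "d y = of_int k" "d x = of_int m" using dint x by blast
    moreover from this have "1 \<le> \<bar>k - m\<bar>" using y by auto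
    then have "1 \<le> \<bar>real_of_int k - real_of_int m\<bar>" by linarith
    ultimately show "1 \<le> norm (d y - d x)" by simp
  qed simp
  ultimately have "d constant_on S" using continuous_discrete_range_constant[OF assms(2)] by blast
  then have "d x = d x0" using assms(6,8) unfolding constant_on_def by metis
  then show ?thesis using assms(1,7) by (simp add: d_def)
qed

section \<open>Increasing homeomorphisms of the unit interval\<close>

definition inc_homeo :: "(real \<Rightarrow> real) \<Rightarrow> bool"
  where "inc_homeo f \<longleftrightarrow> continuous_on {0..1} f \<and> strict_mono_on {0..1} f \<and> f 0 = 0 \<and> f 1 = 1"

lemma inc_homeo_less: "inc_homeo f \<Longrightarrow> s \<in> {0..1} \<Longrightarrow> t \<in> {0..1} \<Longrightarrow> f s < f t \<longleftrightarrow> s < t"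
  unfolding inc_homeo_def by (meson strict_mono_on_less)

lemma inc_homeo_eq: "inc_homeo f \<Longrightarrow> s \<in> {0..1} \<Longrightarrow> t \<in> {0..1} \<Longrightarrow> f s = f t \<longleftrightarrow> s = t"
  unfolding inc_homeo_def by (meson strict_mono_on_eq)

lemma inc_homeo_mem: "inc_homeo f \<Longrightarrow> t \<in> {0..1} \<Longrightarrow> f t \<in> {0..1}"
  using inc_homeo_less[of f t 0] inc_homeo_less[of f 1 t] by (auto simp: inc_homeo_def not_less[symmetric])

lemma inc_homeo_surj: "inc_homeo f \<Longrightarrow> u \<in> {0..1} \<Longrightarrow> \<exists>t\<in>{0..1}. f t = u"
  using IVT'[of f 0 u 1] by (auto simp: inc_homeo_def)

lemma inc_homeo_image: "inc_homeo f \<Longrightarrow> f ` {0..1} = {0..1}"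
  using inc_homeo_mem inc_homeo_surj by blast

lemma inc_homeo_inverse:
  assumes "inc_homeo f"
  shows "\<exists>g. inc_homeo g \<and> (\<forall>t\<in>{0..1}. g (f t) = t) \<and> (\<forall>t\<in>{0..1}. f (g t) = t)"
proof -
  have inj: "inj_on f {0..1}" using inc_homeo_eq[OF assms] by (auto intro: inj_onI)
  have "compact {0..1::real}" by simp
  then obtain g where g: "homeomorphism {0..1} {0..1} f g"
    using homeomorphism_compact[OF _ _ inc_homeo_image[OF assms] inj] assms inc_homeo_def by blast
  have gf: "\<forall>t\<in>{0..1}. g (f t) = t" and fg: "\<forall>t\<in>{0..1}. f (g t) = t" and gi: "g ` {0..1} = {0..1}"
    and gc: "continuous_on {0..1} g"
    using g unfolding homeomorphism_def by auto
  have "strict_mono_on {0..1} g"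
  proof (rule strict_mono_onI)
    fix r s :: real assume "r \<in> {0..1}" "s \<in> {0..1}" "r < s"
    moreover from this have "g r \<in> {0..1}" "g s \<in> {0..1}" using gi by blast+
    ultimately show "g r < g s" using inc_homeo_less[OF assms, of "g r" "g s"] fg by auto
  qed
  moreover have "g 0 = 0" "g 1 = 1" using gf assms unfolding inc_homeo_def
    by (metis atLeastAtMost_iff order_refl zero_le_one)+
  ultimately show ?thesis using gf fg gc unfolding inc_homeo_def by blast
qed

lemma inc_homeo_compose: "inc_homeo f \<Longrightarrow> inc_homeo g \<Longrightarrow> inc_homeo (\<lambda>t. f (g t))"
proof -
  assume f: "inc_homeo f" and g: "inc_homeo g"
  have fc: "continuous_on {0..1} f" and gc: "continuous_on {0..1} g" using f g inc_homeo_def by blast+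
  have "continuous_on {0..1} (\<lambda>t. f (g t))"
    using continuous_on_compose2[OF fc gc] inc_homeo_image[OF g] by simp
  moreover have "strict_mono_on {0..1} (\<lambda>t. f (g t))"
  proof (rule strict_mono_onI)
    fix s t :: real assume st: "s \<in> {0..1}" "t \<in> {0..1}" "s < t"
    then have "g s < g t" using inc_homeo_less[OF g st(1,2)] by simp
    then show "f (g s) < f (g t)"
      using inc_homeo_less[OF f inc_homeo_mem[OF g st(1)] inc_homeo_mem[OF g st(2)]] by simp
  qed
  ultimately show ?thesis using f g by (simp add: inc_homeo_def)
qed

text \<open>The straight line from the identity to \<open>f\<close> is the source of all vertical
  isotopies below.\<close>

lemma inc_homeo_convex:
  assumes "inc_homeo f" "s \<in> {0..1}"
  shows "inc_homeo (\<lambda>t. (1 - s) * t + s * f t)"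
proof -
  have "(1 - s) * t + s * f t < (1 - s) * u + s * f u" if "t \<in> {0..1}" "u \<in> {0..1}" "t < u" for t u
  proof (cases "s = 0")
    case False
    have "f t < f u" using inc_homeo_less[OF assms(1)] that by blast
    then have "s * f t < s * f u" using False assms(2) by auto
    moreover have "(1 - s) * t \<le> (1 - s) * u" using that assms(2) by (intro mult_left_mono) auto
    ultimately show ?thesis by simp
  qed (use that in simp)
  then have "strict_mono_on {0..1} (\<lambda>t. (1 - s) * t + s * f t)" by (intro strict_mono_onI) auto
  moreover have "continuous_on {0..1} (\<lambda>t. (1 - s) * t + s * f t)"
    using assms(1) unfolding inc_homeo_def by (intro continuous_intros) auto
  ultimately show ?thesis using assms(1) by (simp add: inc_homeo_def)
qed

text \<open>A continuous injection of an interval is monotone, and the values at the ends select the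
  increasing alternative.\<close>

lemma inc_homeoI:
  assumes "continuous_on {0..1} f" "inj_on f {0..1}" "f 0 = 0" "f 1 = 1" "f ` {0..1} \<subseteq> {0..1}"
  shows "inc_homeo f"
proof -
  have "f s < f t" if st: "s \<in> {0..1}" "t \<in> {0..1}" "s < t" for s t
  proof (cases "s = 0")
    case True
    have "f t \<noteq> f 0" using inj_onD[OF assms(2), of t 0] st by auto
    moreover have "f t \<in> {0..1}" using assms(5) st by blast
    ultimately show ?thesis using assms(3) True by simp
  next
    case False
    have "{0..t} \<subseteq> {0..1}" using st(2) by simp
    then have c: "continuous_on {0..t} f" "inj_on f {0..t}"
      using continuous_on_subset[OF assms(1)] inj_on_subset[OF assms(2)] by blast+
    have "0 < s" using False st(1) by simp
    from continuous_inj_imp_mono[OF this st(3) c]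
    have "f 0 < f s \<and> f s < f t \<or> f t < f s \<and> f s < f 0" .
    moreover have "f s \<ge> 0" using assms(5) st by (simp add: image_subset_iff)
    ultimately show ?thesis using assms(3) by auto
  qed
  then show ?thesis using assms unfolding inc_homeo_def by (auto intro: strict_mono_onI)
qed

text \<open>The minimum over the interval can only be attained at \<open>s\<close>, as every later
  point has a smaller value somewhere. The weak hypothesis suits paths that change strands, for
  which only a comparison with some nearby earlier point is available.\<close>

lemma locally_increasing_imp_less:
  fixes f :: "real \<Rightarrow> real"
  assumes "continuous_on {s..t} f" "s < t"
    "\<And>x. x \<in> {s<..t} \<Longrightarrow> \<exists>y\<in>{s..t}. f y < f x"
  shows "f s < f t"
proof -
  obtain m where m: "m \<in> {s..t}" "\<And>y. y \<in> {s..t} \<Longrightarrow> f m \<le> f y"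
    using continuous_attains_inf[of "{s..t}" f] assms by auto
  have "m = s" using m assms(3)[of m] by (cases "m = s") (auto simp: not_less[symmetric])
  obtain y where y: "y \<in> {s..t}" "f y < f t" using assms(3)[of t] assms(2) by auto
  then show ?thesis using m(2)[of y] \<open>m = s\<close> by simp
qed

section \<open>Isotopies\<close>

lemma compact_cylinder: "compact cylinder"
  unfolding cylinder_def by (intro compact_Times) auto

lemma cylinder_bd_subset: "cylinder_bd \<subseteq> cylinder"
  unfolding cylinder_def cylinder_bd_def by auto

lemma mem_strand: "q \<in> strand D k \<longleftrightarrow> (\<exists>t\<in>{0..1}. q = (D k t, t))"
  unfolding strand_def strand_arc_def by (auto simp: closed_segment_eq_real_ivl)

lemma strand_eq: "strand D k = (\<lambda>t. (D k t, t)) ` {0..1}"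
  by (auto simp: mem_strand)

lemma is_diagD:
  assumes "is_diag n D" "k \<in> {1..n}"
  shows "continuous_on {0..1} (D k)" "D k ` {0..1} \<subseteq> sphere 0 1" "D k 0 = circ_pt n (real k)"
    "\<exists>l\<in>{1..n}. D k 1 = circ_pt n (real l)"
  using assms unfolding is_diag_def by blast+

lemma is_diag_crossD:
  assumes "is_diag n D" "j \<in> {1..n}" "k \<in> {1..n}" "t \<in> {0..1}" "j \<noteq> k" "D j t = D k t"
  shows "0 < t" "t < 1" "transverse_at (D j) (D k) t" "\<And>m. m \<in> {1..n} - {j, k} \<Longrightarrow> D m t \<noteq> D j t"
  using assms unfolding is_diag_def by blast+

lemma strand_subset: "is_diag n D \<Longrightarrow> k \<in> {1..n} \<Longrightarrow> strand D k \<subseteq> cylinder"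
  using is_diagD(2) unfolding strand_eq cylinder_def by fastforce

lemma strand_pt: "is_diag n D \<Longrightarrow> k \<in> {1..n} \<Longrightarrow> t \<in> {0..1} \<Longrightarrow> (D k t, t) \<in> cylinder"
  using strand_subset[of n D k] unfolding strand_eq by blast

text \<open>What an isotopy provides at one fixed time. Statements about end points, heights and
  regions need no more than this.\<close>

definition carries :: "nat \<Rightarrow> diag \<Rightarrow> diag \<Rightarrow> (complex \<times> real \<Rightarrow> complex \<times> real) \<Rightarrow> bool"
  where "carries n D D' h \<longleftrightarrow> continuous_on cylinder h \<and> inj_on h cylinder \<and> h ` cylinder = cylinder \<and>
    (\<forall>q\<in>cylinder_bd. h q = q) \<and> (\<forall>k\<in>{1..n}. h ` strand D k = strand D' k)"

text \<open>The cylinder is compact, so a continuous bijection is a homeomorphism and no inverse has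
  to be exhibited.\<close>

lemma isotopicI:
  fixes H :: "real \<Rightarrow> complex \<times> real \<Rightarrow> complex \<times> real"
  assumes "continuous_on ({0..1} \<times> cylinder) (\<lambda>(s, q). H s q)"
    "\<And>s. s \<in> {0..1} \<Longrightarrow> inj_on (H s) cylinder"
    "\<And>s. s \<in> {0..1} \<Longrightarrow> H s ` cylinder = cylinder"
    "\<And>q. q \<in> cylinder \<Longrightarrow> H 0 q = q"
    "\<And>s q. s \<in> {0..1} \<Longrightarrow> q \<in> cylinder_bd \<Longrightarrow> H s q = q"
    "\<And>s. s \<in> {0..1} \<Longrightarrow> \<exists>E. is_diag n E \<and> (\<forall>k\<in>{1..n}. H s ` strand D k = strand E k)"
    "\<And>k. k \<in> {1..n} \<Longrightarrow> H 1 ` strand D k = strand D' k"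
  shows "isotopic n D D'"
proof -
  have "\<exists>G. homeomorphism cylinder cylinder (H s) G" if s: "s \<in> {0..1}" for s
  proof -
    have "continuous_on cylinder (\<lambda>q. (\<lambda>(s, q). H s q) (s, q))"
      using s by (intro continuous_on_compose2[OF assms(1)] continuous_intros) auto
    then have "continuous_on cylinder (H s)" by simp
    then show ?thesis using homeomorphism_compact[OF compact_cylinder _ assms(3)[OF s] assms(2)[OF s]] by blast
  qed
  then show ?thesis unfolding isotopic_def by (intro exI[of _ H] conjI ballI) (use assms in auto)
qed

definition isotopy_map ::
    "nat \<Rightarrow> diag \<Rightarrow> diag \<Rightarrow> (real \<Rightarrow> complex \<times> real \<Rightarrow> complex \<times> real) \<Rightarrow> bool"
  where "isotopy_map n D D' H \<longleftrightarrow>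
    continuous_on ({0..1} \<times> cylinder) (\<lambda>(s, q). H s q) \<and>
    (\<forall>s\<in>{0..1}. \<exists>G. homeomorphism cylinder cylinder (H s) G) \<and>
    (\<forall>q\<in>cylinder. H 0 q = q) \<and>
    (\<forall>s\<in>{0..1}. \<forall>q\<in>cylinder_bd. H s q = q) \<and>
    (\<forall>s\<in>{0..1}. \<exists>E. is_diag n E \<and> (\<forall>k\<in>{1..n}. H s ` strand D k = strand E k)) \<and>
    (\<forall>k\<in>{1..n}. H 1 ` strand D k = strand D' k)"

lemma isotopicE: "isotopic n D D' \<Longrightarrow> \<exists>H. isotopy_map n D D' H"
  unfolding isotopic_def isotopy_map_def .

lemma isotopy_mapD:
  assumes "isotopy_map n D D' H"
  shows "continuous_on ({0..1} \<times> cylinder) (\<lambda>(s, q). H s q)"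
    "\<And>s. s \<in> {0..1} \<Longrightarrow> inj_on (H s) cylinder"
    "\<And>s. s \<in> {0..1} \<Longrightarrow> H s ` cylinder = cylinder"
    "\<And>q. q \<in> cylinder \<Longrightarrow> H 0 q = q"
    "\<And>s q. s \<in> {0..1} \<Longrightarrow> q \<in> cylinder_bd \<Longrightarrow> H s q = q"
    "\<And>s. s \<in> {0..1} \<Longrightarrow> \<exists>E. is_diag n E \<and> (\<forall>k\<in>{1..n}. H s ` strand D k = strand E k)"
    "\<And>k. k \<in> {1..n} \<Longrightarrow> H 1 ` strand D k = strand D' k"
    "carries n D D' (H 1)"
    "\<And>s E. s \<in> {0..1} \<Longrightarrow> \<forall>k\<in>{1..n}. H s ` strand D k = strand E k \<Longrightarrow> carries n D E (H s)"
proof -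
  have H: "\<And>s. s \<in> {0..1} \<Longrightarrow> \<exists>G. homeomorphism cylinder cylinder (H s) G"
    using assms unfolding isotopy_map_def by blast
  show inj: "inj_on (H s) cylinder" and im: "H s ` cylinder = cylinder" if "s \<in> {0..1}" for s
    using H[OF that] unfolding homeomorphism_def by (auto intro: inj_on_inverseI)
  have c: "continuous_on cylinder (H s)" if "s \<in> {0..1}" for s
    using H[OF that] unfolding homeomorphism_def by auto
  show "continuous_on ({0..1} \<times> cylinder) (\<lambda>(s, q). H s q)"
    "\<And>q. q \<in> cylinder \<Longrightarrow> H 0 q = q"
    "\<And>s. s \<in> {0..1} \<Longrightarrow> \<exists>E. is_diag n E \<and> (\<forall>k\<in>{1..n}. H s ` strand D k = strand E k)"
    and st: "\<And>k. k \<in> {1..n} \<Longrightarrow> H 1 ` strand D k = strand D' k"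
    and bd: "\<And>s q. s \<in> {0..1} \<Longrightarrow> q \<in> cylinder_bd \<Longrightarrow> H s q = q"
    using assms unfolding isotopy_map_def by blast+
  show ca: "carries n D E (H s)" if "s \<in> {0..1}" "\<forall>k\<in>{1..n}. H s ` strand D k = strand E k" for s E
    unfolding carries_def using that inj im c bd by auto
  show "carries n D D' (H 1)" using ca[of 1 D'] st by auto
qed

lemma isotopic_refl:
  assumes "is_diag n D"
  shows "isotopic n D D"
  by (rule isotopicI[where H = "\<lambda>s q. q"]) (use assms in \<open>auto simp: case_prod_unfold intro!: continuous_intros\<close>)

lemma isotopic_trans:
  assumes "isotopic n D D'" "isotopic n D' D''" "is_diag n D"
  shows "isotopic n D D''"
proof -
  obtain H where "isotopy_map n D D' H" using isotopicE[OF assms(1)] by blast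
  note H = isotopy_mapD[OF this]
  obtain K where "isotopy_map n D' D'' K" using isotopicE[OF assms(2)] by blast
  note K = isotopy_mapD[OF this]
  define L where "L s q = (if s \<le> 1/2 then H (2 * s) q else K (2 * s - 1) (H 1 q))" for s q
  have H1: "H 1 q \<in> cylinder" if "q \<in> cylinder" for q using H(3)[of 1] that by auto
  have "continuous_on cylinder (\<lambda>q. (\<lambda>(s, q). H s q) (1, q))"
    by (intro continuous_on_compose2[OF H(1)] continuous_intros) auto
  then have H1c: "continuous_on cylinder (H 1)" by simp
  have "continuous_on ({0..1} \<times> cylinder)
    (\<lambda>p. if fst p \<le> 1/2 then (\<lambda>(s, q). H s q) (2 * fst p, snd p) else (\<lambda>(s, q). K s q) (2 * fst p - 1, H 1 (snd p)))"
  proof (rule continuous_on_cases_le)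
    show "continuous_on {t \<in> {0..1} \<times> cylinder. fst t \<le> 1/2} (\<lambda>p. (\<lambda>(s, q). H s q) (2 * fst p, snd p))"
      by (intro continuous_on_compose2[OF H(1)] continuous_intros) auto
    show "continuous_on {t \<in> {0..1} \<times> cylinder. 1/2 \<le> fst t} (\<lambda>p. (\<lambda>(s, q). K s q) (2 * fst p - 1, H 1 (snd p)))"
      by (intro continuous_on_compose2[OF K(1)] continuous_intros continuous_on_compose2[OF H1c]) (auto simp: H1)
    show "continuous_on ({0..1} \<times> cylinder) fst" by (intro continuous_intros)
    fix p assume p: "p \<in> {0..1} \<times> cylinder" "fst p = (1/2 :: real)"
    have "2 * fst p = 1" "snd p \<in> cylinder" using p by auto
    then show "(\<lambda>(s, q). H s q) (2 * fst p, snd p) = (\<lambda>(s, q). K s q) (2 * fst p - 1, H 1 (snd p))"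
      using K(4)[OF H1, of "snd p"] by auto
  qed
  then have cont: "continuous_on ({0..1} \<times> cylinder) (\<lambda>(s, q). L s q)"
    unfolding L_def case_prod_unfold by (simp cong: if_cong)
  have Llow: "L s = H (2 * s)" if "s \<le> 1/2" for s using that by (auto simp: L_def)
  have Lhigh: "L s = K (2 * s - 1) \<circ> H 1" if "\<not> s \<le> 1/2" for s using that by (auto simp: L_def)
  show ?thesis
  proof (rule isotopicI[OF cont])
    fix s :: real assume s: "s \<in> {0..1}"
    show "inj_on (L s) cylinder"
      by (cases "s \<le> 1/2") (use s H(2) K(2) H(3)[of 1] in \<open>auto simp: Llow Lhigh intro!: comp_inj_on\<close>)
    show "L s ` cylinder = cylinder"
    proof (cases "s \<le> 1/2")
      case False
      then have "L s ` cylinder = K (2 * s - 1) ` (H 1 ` cylinder)" by (simp add: Lhigh image_comp)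
      then show ?thesis using s False H(3)[of 1] K(3)[of "2 * s - 1"] by simp
    qed (use s H(3)[of "2 * s"] in \<open>simp add: Llow\<close>)
    show "\<exists>E. is_diag n E \<and> (\<forall>k\<in>{1..n}. L s ` strand D k = strand E k)"
    proof (cases "s \<le> 1/2")
      case True
      then show ?thesis using H(6)[of "2 * s"] s by (simp add: Llow)
    next
      case False
      obtain E where "is_diag n E" "\<forall>k\<in>{1..n}. K (2 * s - 1) ` strand D' k = strand E k"
        using K(6)[of "2 * s - 1"] s False by auto
      moreover have "L s ` strand D k = K (2 * s - 1) ` (H 1 ` strand D k)" for k
        using False by (simp add: Lhigh image_comp)
      ultimately show ?thesis using H(7) by (intro exI[of _ E] conjI ballI) simp_all
    qed
    fix q assume q: "q \<in> cylinder_bd"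
    then show "L s q = q" using s H(5) K(5) by (auto simp: L_def)
  next
    fix q assume "q \<in> cylinder"
    then show "L 0 q = q" using H(4) by (simp add: L_def)
  next
    fix k assume "k \<in> {1..n}"
    moreover have "L 1 ` strand D k = K 1 ` (H 1 ` strand D k)" by (simp add: Lhigh image_comp)
    ultimately show "L 1 ` strand D k = strand D'' k" using H(7) K(7) by simp
  qed
qed

text \<open>\<open>H\<close> run backwards starts at \<open>H 1\<close> instead of the identity;
  precomposition with the inverse \<open>G\<close> of \<open>H 1\<close> corrects this.\<close>

lemma isotopic_sym:
  assumes "isotopic n D D'" "is_diag n D"
  shows "isotopic n D' D"
proof -
  obtain H where "isotopy_map n D D' H" using isotopicE[OF assms(1)] by blast
  note H = isotopy_mapD[OF this]
  have "continuous_on cylinder (H 1)" using H(8) unfolding carries_def by blast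
  then obtain G where G: "homeomorphism cylinder cylinder (H 1) G"
    using homeomorphism_compact[OF compact_cylinder _ H(3) H(2), of 1] by auto
  have Gc: "continuous_on cylinder G" and Gi: "G ` cylinder = cylinder"
    and GH: "\<And>q. q \<in> cylinder \<Longrightarrow> G (H 1 q) = q" and HG: "\<And>q. q \<in> cylinder \<Longrightarrow> H 1 (G q) = q"
    using G unfolding homeomorphism_def by auto
  have Gm: "G q \<in> cylinder" if "q \<in> cylinder" for q using Gi that by blast
  have Ginj: "inj_on G cylinder" using HG by (rule inj_on_inverseI)
  have Gs: "G ` strand D' k = strand D k" if k: "k \<in> {1..n}" for k
  proof -
    have "G ` strand D' k = (\<lambda>q. G (H 1 q)) ` strand D k" using H(7)[OF k] by (metis image_image)
    also have "\<dots> = strand D k" using GH strand_subset[OF assms(2) k] by force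
    finally show ?thesis .
  qed
  define K where "K s q = H (1 - s) (G q)" for s q
  have "continuous_on ({0..1} \<times> cylinder) (\<lambda>p. (\<lambda>(s, q). H s q) (1 - fst p, G (snd p)))"
    by (intro continuous_on_compose2[OF H(1)] continuous_intros continuous_on_compose2[OF Gc]) (auto simp: Gm)
  then have cont: "continuous_on ({0..1} \<times> cylinder) (\<lambda>(s, q). K s q)"
    unfolding K_def case_prod_unfold by simp
  have Ki: "K s ` A = H (1 - s) ` (G ` A)" for s A by (simp add: K_def image_image)
  show ?thesis
  proof (rule isotopicI[OF cont])
    fix s :: real assume s: "s \<in> {0..1}"
    then have s': "1 - s \<in> {0..1}" by auto
    have "K s = H (1 - s) \<circ> G" by (auto simp: K_def)
    then show "inj_on (K s) cylinder" using H(2)[OF s'] Ginj Gi by (auto intro!: comp_inj_on)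
    show "K s ` cylinder = cylinder" using Gi H(3)[OF s'] by (simp add: Ki)
    show "\<exists>E. is_diag n E \<and> (\<forall>k\<in>{1..n}. K s ` strand D' k = strand E k)"
      using H(6)[OF s'] Gs by (simp add: Ki)
    fix q assume q: "q \<in> cylinder_bd"
    then have "H 1 q = q" using H(5)[of 1 q] by simp
    moreover have "G (H 1 q) = q" using q cylinder_bd_subset by (intro GH) blast
    ultimately have "G q = q" by simp
    then show "K s q = q" using H(5)[OF s' q] by (simp add: K_def)
  next
    fix q assume "q \<in> cylinder"
    then show "K 0 q = q" using HG by (simp add: K_def)
  next
    fix k assume k: "k \<in> {1..n}"
    have "H 0 ` strand D k = strand D k" using H(4) strand_subset[OF assms(2) k] by force
    then show "K 1 ` strand D' k = strand D k" using Gs[OF k] by (simp add: Ki)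
  qed
qed

text \<open>A strand is carried over as a set, so heights may change. As \<open>h\<close> is
  injective, the height of the image is an injective function of the old height; it fixes both ends,
  hence is an increasing homeomorphism.\<close>

lemma carries_reparam:
  assumes "carries n D D' h" "is_diag n D" "k \<in> {1..n}"
  shows "\<exists>f. inc_homeo f \<and> (\<forall>t\<in>{0..1}. h (D k t, t) = (D' k (f t), f t))"
proof -
  have h: "continuous_on cylinder h" "inj_on h cylinder" "\<And>q. q \<in> cylinder_bd \<Longrightarrow> h q = q" "h ` strand D k = strand D' k"
    using assms unfolding carries_def by auto
  define f where "f t = snd (h (D k t, t))" for t
  have pt: "(D k t, t) \<in> cylinder" if "t \<in> {0..1}" for t using strand_pt[OF assms(2,3) that] .
  have hf: "h (D k t, t) = (D' k (f t), f t)" "f t \<in> {0..1}" if t: "t \<in> {0..1}" for t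
  proof -
    have "h (D k t, t) \<in> strand D' k" using h(4) t by (auto simp: strand_eq)
    then show "h (D k t, t) = (D' k (f t), f t)" "f t \<in> {0..1}" by (auto simp: mem_strand f_def)
  qed
  have "continuous_on {0..1} (\<lambda>t. h (D k t, t))"
    using pt is_diagD(1)[OF assms(2,3)] by (intro continuous_on_compose2[OF h(1)] continuous_intros) auto
  then have "continuous_on {0..1} f" unfolding f_def by (intro continuous_intros)
  moreover have "inj_on f {0..1}"
  proof (rule inj_onI)
    fix s t assume st: "s \<in> {0..1}" "t \<in> {0..1}" "f s = f t"
    then have "h (D k s, s) = h (D k t, t)" using hf by simp
    then have "(D k s, s) = (D k t, t)" using inj_onD[OF h(2)] pt st by blast
    then show "s = t" by simp
  qed
  moreover have "f c = c" if "c = 0 \<or> c = 1" for c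
  proof -
    have "(D k c, c) \<in> cylinder_bd" using pt[of c] that by (auto simp: cylinder_bd_def cylinder_def)
    then have "h (D k c, c) = (D k c, c)" by (rule h(3))
    then show ?thesis by (simp add: f_def)
  qed
  ultimately have "inc_homeo f" using hf(2) by (intro inc_homeoI) auto
  then show ?thesis using hf by blast
qed

lemma carries_endpoints:
  assumes "carries n D D' h" "is_diag n D" "k \<in> {1..n}"
  shows "D' k 0 = D k 0" "D' k 1 = D k 1"
proof -
  obtain f where f: "inc_homeo f" "\<forall>t\<in>{0..1}. h (D k t, t) = (D' k (f t), f t)"
    using carries_reparam[OF assms] by blast
  have "D' k c = D k c" if c: "c = 0 \<or> c = 1" for c
  proof -
    have "(D k c, c) \<in> cylinder_bd"
      using strand_pt[OF assms(2,3), of c] c by (auto simp: cylinder_bd_def cylinder_def)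
    then have "h (D k c, c) = (D k c, c)" using assms(1) unfolding carries_def by blast
    moreover have "h (D k c, c) = (D' k (f c), f c)" using f(2) c by auto
    ultimately show ?thesis by (metis prod.inject)
  qed
  then show "D' k 0 = D k 0" "D' k 1 = D k 1" by simp_all
qed

text \<open>A path that runs inside the strands with index in \<open>K\<close>, lifted to the universal cover.\<close>

definition lift_path :: "nat \<Rightarrow> diag \<Rightarrow> nat set \<Rightarrow> (real \<Rightarrow> real) \<Rightarrow> bool"
  where "lift_path n D K g \<longleftrightarrow> continuous_on {0..1} g \<and> (\<forall>t\<in>{0..1}. \<exists>k\<in>K. D k t = circ_pt n (g t))"

text \<open>The isotopy sweeps the path over a square, which lifts to the cover, and the fixed
  boundary keeps the lifted ends in place. The obstacle is that the image has to be a graph over the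
  height again. On a single strand this is \<open>carries_reparam\<close>, but the path may change
  strands, so a local argument is needed. \<open>K\<close> is a single strand for the ends of
  strands and the set of all strands for rightmost paths.\<close>

lemma isotopic_lift_path:
  assumes "n \<ge> 1" "isotopic n D D'" "is_diag n D" "is_diag n D'" "K \<subseteq> {1..n}" "lift_path n D K g"
  shows "\<exists>g'. lift_path n D' K g' \<and> g' 0 = g 0 \<and> g' 1 = g 1"
proof -
  obtain H where "isotopy_map n D D' H" using isotopicE[OF assms(2)] by blast
  note H = isotopy_mapD[OF this]
  have gc: "continuous_on {0..1} g" and gK: "\<And>t. t \<in> {0..1} \<Longrightarrow> \<exists>k\<in>K. D k t = circ_pt n (g t)"
    using assms(6) unfolding lift_path_def by auto
  define q where "q t = (circ_pt n (g t), t)" for t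
  have qc: "q t \<in> cylinder" if "t \<in> {0..1}" for t using that by (auto simp: q_def cylinder_def circ_pt_norm)
  have qcont: "continuous_on {0..1} q" unfolding q_def using gc by (intro continuous_intros)
  define F where "F p = fst (H (fst p) (q (snd p)))" for p
  let ?S = "{0..1::real} \<times> {0..1::real}"
  have "continuous_on ?S (\<lambda>p. (\<lambda>(s, q). H s q) (fst p, q (snd p)))"
    by (intro continuous_on_compose2[OF H(1)] continuous_intros continuous_on_compose2[OF qcont]) (auto simp: qc)
  from continuous_on_fst[OF this] have Fc: "continuous_on ?S F" unfolding F_def by simp
  have Fs: "F ` ?S \<subseteq> sphere 0 1"
  proof
    fix z assume "z \<in> F ` ?S"
    then obtain s t where st: "s \<in> {0..1}" "t \<in> {0..1}" "z = fst (H s (q t))" by (auto simp: F_def)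
    have "H s (q t) \<in> cylinder" using H(3)[OF st(1)] qc[OF st(2)] by blast
    then show "z \<in> sphere 0 1" using st(3) unfolding cylinder_def by (simp add: mem_Times_iff)
  qed
  have Sc: "convex ?S" by (intro convex_Times) auto
  have "F (0, 0) = circ_pt n (g 0)" using H(4)[OF qc[of 0]] by (simp add: F_def q_def)
  then obtain L where L: "continuous_on ?S L" "\<And>p. p \<in> ?S \<Longrightarrow> F p = circ_pt n (L p)" "L (0, 0) = g 0"
    using circ_lift_contractible_at[OF assms(1) convex_imp_contractible[OF Sc] Fc Fs, of "(0,0)" "g 0"] by auto
  have L0: "L (0, t) = g t" if t: "t \<in> {0..1}" for t
  proof (rule circ_lift_unique[OF assms(1), of "{0..1}" "\<lambda>t. L (0, t)" g 0])
    show "continuous_on {0..1} (\<lambda>t. L (0, t))"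
      by (intro continuous_on_compose2[OF L(1)] continuous_intros) auto
    fix x :: real assume x: "x \<in> {0..1}"
    have "circ_pt n (L (0, x)) = F (0, x)" using L(2)[of "(0, x)"] x by auto
    also have "\<dots> = circ_pt n (g x)" using H(4)[OF qc[OF x]] by (simp add: F_def q_def)
    finally show "circ_pt n (L (0, x)) = circ_pt n (g x)" .
  qed (use gc t L(3) in auto)
  have Lconst: "L (s, c) = L (0, c)" if s: "s \<in> {0..1}" and c: "c = 0 \<or> c = 1" for s c
  proof (rule circ_lift_unique[OF assms(1), of "{0..1}" "\<lambda>s. L (s, c)" "\<lambda>_. L (0, c)" 0])
    have cc: "c \<in> {0..1}" using c by auto
    show "continuous_on {0..1} (\<lambda>s. L (s, c))"
      using cc by (intro continuous_on_compose2[OF L(1)] continuous_intros) auto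
    fix x :: real assume x: "x \<in> {0..1}"
    have bd: "q c \<in> cylinder_bd" using c by (auto simp: q_def cylinder_bd_def circ_pt_norm)
    have "F (x, c) = F (0, c)" using H(5)[OF x bd] H(5)[OF _ bd, of 0] by (simp add: F_def)
    then show "circ_pt n (L (x, c)) = circ_pt n (L (0, c))" using L(2)[of "(x, c)"] L(2)[of "(0, c)"] x cc by auto
  qed (use s in auto)
  define h where "h = H 1"
  define T where "T t = snd (h (q t))" for t
  have hc: "carries n D D' h" using H(8) h_def by simp
  have hcont: "continuous_on cylinder h" using hc unfolding carries_def by blast
  obtain f where f: "\<And>k. k \<in> {1..n} \<Longrightarrow> inc_homeo (f k)"
    "\<And>k t. k \<in> {1..n} \<Longrightarrow> t \<in> {0..1} \<Longrightarrow> h (D k t, t) = (D' k (f k t), f k t)"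
    using carries_reparam[OF hc assms(3)] by metis
  have hq: "h (q t) = (D' k (f k t), f k t)" if "t \<in> {0..1}" "k \<in> K" "D k t = circ_pt n (g t)" for t k
    using f(2)[of k t] that assms(5) by (auto simp: q_def)
  have Tf: "T t = f k t" if "t \<in> {0..1}" "k \<in> K" "D k t = circ_pt n (g t)" for t k
    using hq[OF that] by (simp add: T_def)
  have Tc: "continuous_on {0..1} T" unfolding T_def
    by (intro continuous_intros continuous_on_compose2[OF hcont] qcont) (auto simp: qc)
  \<comment> \<open>A strand that misses the path at height \<open>x\<close> misses it on a whole
    neighbourhood of \<open>x\<close>. So a point of the path slightly below lies on a strand that
    also contains its point at \<open>x\<close>, and along this strand the height after the isotopy
    increases.\<close>
  have below: "\<exists>y\<in>{s..x}. T y < T x" if x: "x \<in> {s<..t}" and st: "0 \<le> s" "t \<le> 1" for s t x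
  proof -
    have xI: "x \<in> {0..1}" using x st by auto
    define B where "B = {k \<in> K. D k x \<noteq> circ_pt n (g x)}"
    have finB: "finite B" using assms(5) by (auto simp: B_def intro: finite_subset)
    have "\<forall>k\<in>B. \<exists>d>0. \<forall>y\<in>{0..1}. \<bar>y - x\<bar> < d \<longrightarrow> D k y \<noteq> circ_pt n (g y)"
    proof
      fix k assume k: "k \<in> B"
      have "continuous_on {0..1} (\<lambda>y. D k y - circ_pt n (g y))"
        using k assms(5) is_diagD(1)[OF assms(3), of k] gc by (intro continuous_intros) (auto simp: B_def)
      moreover have "D k x - circ_pt n (g x) \<noteq> 0" using k by (simp add: B_def)
      ultimately obtain d where "d > 0" "\<forall>y\<in>{0..1}. dist x y < d \<longrightarrow> D k y - circ_pt n (g y) \<noteq> 0"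
        using continuous_on_avoid[of "{0..1}" "\<lambda>y. D k y - circ_pt n (g y)" x 0] xI by auto
      then show "\<exists>d>0. \<forall>y\<in>{0..1}. \<bar>y - x\<bar> < d \<longrightarrow> D k y \<noteq> circ_pt n (g y)"
        by (intro exI[of _ d]) (auto simp: dist_real_def abs_minus_commute)
    qed
    then obtain d where d: "\<And>k. k \<in> B \<Longrightarrow> d k > 0"
      "\<And>k y. k \<in> B \<Longrightarrow> y \<in> {0..1} \<Longrightarrow> \<bar>y - x\<bar> < d k \<Longrightarrow> D k y \<noteq> circ_pt n (g y)"
      by metis
    define e where "e = Min (insert (x - s) (d ` B))"
    have e0: "e > 0" using finB d(1) x by (auto simp: e_def)
    have ed: "e \<le> d k" if "k \<in> B" for k using finB that by (auto simp: e_def)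
    have es: "e \<le> x - s" using finB by (auto simp: e_def)
    define y where "y = x - e / 2"
    have y: "y \<in> {s..x}" "y < x" "y \<in> {0..1}" using e0 es x st by (auto simp: y_def)
    obtain k where k: "k \<in> K" "D k y = circ_pt n (g y)" using gK[OF y(3)] by blast
    have "k \<notin> B"
    proof
      assume kB: "k \<in> B"
      have "\<bar>y - x\<bar> < d k" using ed[OF kB] e0 by (simp add: y_def)
      then show False using d(2)[OF kB y(3)] k by blast
    qed
    then have kx: "D k x = circ_pt n (g x)" using k by (simp add: B_def)
    have "f k y < f k x" using inc_homeo_less[OF f(1)] k(1) assms(5) y xI by blast
    then have "T y < T x" using Tf[OF y(3) k] Tf[OF xI k(1) kx] by simp
    then show ?thesis using y(1) by blast
  qed
  have "T s < T t" if st: "s \<in> {0..1}" "t \<in> {0..1}" "s < t" for s t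
  proof (rule locally_increasing_imp_less[where f = T and s = s and t = t])
    show "continuous_on {s..t} T" using Tc st by (auto intro: continuous_on_subset)
    fix x assume x: "x \<in> {s<..t}"
    then show "\<exists>y\<in>{s..t}. T y < T x" using below[OF x] st by fastforce
  qed (use st in simp)
  moreover have "T 0 = 0" "T 1 = 1"
  proof -
    have "q 0 \<in> cylinder_bd" "q 1 \<in> cylinder_bd" by (auto simp: q_def cylinder_bd_def circ_pt_norm)
    then show "T 0 = 0" "T 1 = 1" using H(5)[of 1] by (auto simp: T_def h_def q_def)
  qed
  ultimately have T: "inc_homeo T" unfolding inc_homeo_def using Tc by (auto intro: strict_mono_onI)
  then obtain U where U: "inc_homeo U" "\<forall>t\<in>{0..1}. U (T t) = t" "\<forall>t\<in>{0..1}. T (U t) = t"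
    using inc_homeo_inverse by blast
  \<comment> \<open>Composition with the inverse \<open>U\<close> of the height function
    \<open>T\<close> turns the image of the path into a graph over the height.\<close>
  define g' where "g' u = L (1, U u)" for u
  have Uc: "continuous_on {0..1} U" using U(1) unfolding inc_homeo_def by blast
  have "(\<lambda>u. (1, U u)) ` {0..1} \<subseteq> ?S" using inc_homeo_image[OF U(1)] by auto
  then have "continuous_on {0..1} g'" unfolding g'_def
    by (intro continuous_on_compose2[OF L(1)] continuous_intros Uc)
  moreover have "\<exists>k\<in>K. D' k u = circ_pt n (g' u)" if u: "u \<in> {0..1}" for u
  proof -
    have Uu: "U u \<in> {0..1}" using inc_homeo_mem[OF U(1) u] .
    then obtain k where k: "k \<in> K" "D k (U u) = circ_pt n (g (U u))" using gK by blast
    have "h (q (U u)) = (D' k u, u)" using hq[OF Uu k] Tf[OF Uu k] U(3) u by simp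
    then have "F (1, U u) = D' k u" by (simp add: F_def h_def)
    then show ?thesis using L(2)[of "(1, U u)"] Uu k(1) by (auto simp: g'_def)
  qed
  moreover have "g' 0 = g 0" "g' 1 = g 1"
    using U(1) Lconst[of 1 0] Lconst[of 1 1] L0[of 0] L0[of 1] by (auto simp: g'_def inc_homeo_def)
  ultimately show ?thesis unfolding lift_path_def by blast
qed

section \<open>Stacking\<close>

lemma top_pos_eqI:
  assumes "n \<ge> 1" "l \<in> {1..n}" "A k 1 = circ_pt n (real l)"
  shows "top_pos n A k = l"
  unfolding top_pos_def
proof (rule the_equality)
  show "l \<in> {1..n} \<and> A k 1 = circ_pt n (real l)" using assms(2,3) by (rule conjI)
  fix m assume m: "m \<in> {1..n} \<and> A k 1 = circ_pt n (real m)"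
  then have "circ_pt n (real m) = circ_pt n (real l)" using assms(3) by (metis (no_types))
  then show "m = l" using circ_pt_int_eq[OF assms(1) _ assms(2)] m by blast
qed

lemma top_pos:
  assumes "n \<ge> 1" "is_diag n A" "k \<in> {1..n}"
  shows "top_pos n A k \<in> {1..n}" "A k 1 = circ_pt n (real (top_pos n A k))"
proof -
  obtain l where l: "l \<in> {1..n}" "A k 1 = circ_pt n (real l)" using is_diagD(4)[OF assms(2,3)] by blast
  then have "top_pos n A k = l" by (intro top_pos_eqI[OF assms(1)])
  then show "top_pos n A k \<in> {1..n}" "A k 1 = circ_pt n (real (top_pos n A k))" using l by auto
qed

lemma top_pos_inj:
  assumes "n \<ge> 1" "is_diag n A" "j \<in> {1..n}" "k \<in> {1..n}" "top_pos n A j = top_pos n A k"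
  shows "j = k"
proof (rule ccontr)
  assume "j \<noteq> k"
  moreover have "A j 1 = A k 1"
    using top_pos(2)[OF assms(1,2,3)] top_pos(2)[OF assms(1,2,4)] assms(5) by simp
  ultimately show False using is_diag_crossD(2)[OF assms(2,3,4), of 1] by auto
qed

lemma top_pos_image:
  assumes "n \<ge> 1" "is_diag n A"
  shows "top_pos n A ` {1..n} = {1..n}"
proof (rule endo_inj_surj)
  show "top_pos n A ` {1..n} \<subseteq> {1..n}" using top_pos(1)[OF assms] by blast
  show "inj_on (top_pos n A) {1..n}" using top_pos_inj[OF assms] by (rule inj_onI)
qed simp

lemma stack_low: "t \<le> 1/2 \<Longrightarrow> stack n A B k t = A k (2 * t)"
  by (simp add: stack_def)

text \<open>At \<open>t = 1/2\<close> the definition takes the lower branch; both branches agree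
  there because the upper strand starts where the lower one ends.\<close>

lemma stack_high:
  assumes "n \<ge> 1" "is_diag n A" "is_diag n B" "k \<in> {1..n}" "t \<ge> 1/2"
  shows "stack n A B k t = B (top_pos n A k) (2 * t - 1)"
proof (cases "t = 1/2")
  case True
  then have e: "2 * t = 1" "2 * t - 1 = 0" by auto
  have "stack n A B k t = A k (2 * t)" using True by (intro stack_low) simp
  also have "\<dots> = circ_pt n (real (top_pos n A k))" unfolding e using top_pos(2)[OF assms(1,2,4)] .
  also have "\<dots> = B (top_pos n A k) (2 * t - 1)"
    unfolding e using is_diagD(3)[OF assms(3) top_pos(1)[OF assms(1,2,4)]] by simp
  finally show ?thesis .
next
  case False
  then show ?thesis using assms by (simp add: stack_def)
qed

lemma transverse_at_reparam:
  assumes "transverse_at z w (f t)" "e > 0"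
    "\<And>u. u \<in> {t - e<..<t + e} \<Longrightarrow> Z u = z (f u) \<and> W u = w (f u)"
    "continuous_on {t - e<..<t + e} f"
    "\<And>u v. u \<in> {t - e<..<t + e} \<Longrightarrow> v \<in> {t - e<..<t + e} \<Longrightarrow> u < v \<Longrightarrow> f u < f v"
  shows "transverse_at Z W t"
proof -
  obtain d where d: "d > 0" "\<And>u v. u \<in> {f t - d<..<f t} \<Longrightarrow> v \<in> {f t<..<f t + d} \<Longrightarrow>
      Im (z u * cnj (w u)) * Im (z v * cnj (w v)) < 0"
    using assms(1) unfolding transverse_at_def by blast
  have t: "t \<in> {t - e<..<t + e}" using assms(2) by simp
  obtain c where c: "c > 0" "\<And>u. u \<in> {t - e<..<t + e} \<Longrightarrow> dist u t < c \<Longrightarrow> dist (f u) (f t) < d"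
    using assms(4) t d(1) unfolding continuous_on_iff by metis
  show ?thesis unfolding transverse_at_def
  proof (intro exI[of _ "min c e"] conjI ballI)
    show "min c e > 0" using c assms(2) by simp
    fix u v assume u: "u \<in> {t - min c e<..<t}" and v: "v \<in> {t<..<t + min c e}"
    have u': "u \<in> {t - e<..<t + e}" and v': "v \<in> {t - e<..<t + e}" using u v assms(2) by auto
    have "f u < f t" "f t < f v" using assms(5)[OF u' t] assms(5)[OF t v'] u v by auto
    moreover have "dist (f u) (f t) < d" "dist (f v) (f t) < d"
      using c(2)[OF u'] c(2)[OF v'] u v by (auto simp: dist_real_def)
    ultimately have "f u \<in> {f t - d<..<f t}" "f v \<in> {f t<..<f t + d}" by (auto simp: dist_real_def)
    then show "Im (Z u * cnj (W u)) * Im (Z v * cnj (W v)) < 0"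
      using d(2) assms(3)[OF u'] assms(3)[OF v'] by simp
  qed
qed

lemma is_diagI:
  assumes "\<And>k. k \<in> {1..n} \<Longrightarrow> continuous_on {0..1} (D k)"
    "\<And>k. k \<in> {1..n} \<Longrightarrow> D k ` {0..1} \<subseteq> sphere 0 1"
    "\<And>k. k \<in> {1..n} \<Longrightarrow> D k 0 = circ_pt n (real k)"
    "\<And>k. k \<in> {1..n} \<Longrightarrow> \<exists>l\<in>{1..n}. D k 1 = circ_pt n (real l)"
    "finite (double_points n D)"
    "\<And>j k t. j \<in> {1..n} \<Longrightarrow> k \<in> {1..n} \<Longrightarrow> t \<in> {0..1} \<Longrightarrow> j \<noteq> k \<Longrightarrow> D j t = D k t \<Longrightarrow>
      0 < t \<and> t < 1 \<and> transverse_at (D j) (D k) t \<and> (\<forall>m\<in>{1..n} - {j, k}. D m t \<noteq> D j t)"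
  shows "is_diag n D"
  unfolding is_diag_def using assms by blast

lemma double_pointsI:
  "j \<in> {1..n} \<Longrightarrow> k \<in> {1..n} \<Longrightarrow> t \<in> {0..1} \<Longrightarrow> k \<noteq> j \<Longrightarrow> D k t = D j t \<Longrightarrow> (D j t, t) \<in> double_points n D"
  unfolding double_points_def by blast

lemma double_pointsE:
  assumes "q \<in> double_points n D"
  obtains j k t where "j \<in> {1..n}" "k \<in> {1..n}" "t \<in> {0..1}" "k \<noteq> j" "D k t = D j t" "q = (D j t, t)"
  using assms unfolding double_points_def by blast

lemma is_diag_reparam:
  assumes "is_diag n D" "inc_homeo f"
  shows "is_diag n (\<lambda>k t. D k (f t))"
proof -
  note mem = inc_homeo_mem[OF assms(2)] and less = inc_homeo_less[OF assms(2)]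
  have f: "continuous_on {0..1} f" "f 0 = 0" "f 1 = 1" using assms(2) unfolding inc_homeo_def by auto
  obtain g where g: "\<forall>t\<in>{0..1}. g (f t) = t" using inc_homeo_inverse[OF assms(2)] by blast
  show ?thesis
  proof (rule is_diagI)
    fix k assume k: "k \<in> {1..n}"
    show "continuous_on {0..1} (\<lambda>t. D k (f t))"
      using continuous_on_compose2[OF is_diagD(1)[OF assms(1) k] f(1)] inc_homeo_image[OF assms(2)] by simp
    show "(\<lambda>t. D k (f t)) ` {0..1} \<subseteq> sphere 0 1" using is_diagD(2)[OF assms(1) k] mem by blast
    show "D k (f 0) = circ_pt n (real k)" "\<exists>l\<in>{1..n}. D k (f 1) = circ_pt n (real l)"
      unfolding f(2,3) using is_diagD(3,4)[OF assms(1) k] by blast+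
  next
    have "double_points n (\<lambda>k t. D k (f t)) \<subseteq> (\<lambda>(z, t). (z, g t)) ` double_points n D"
    proof
      fix q assume "q \<in> double_points n (\<lambda>k t. D k (f t))"
      then obtain j k t where q: "j \<in> {1..n}" "k \<in> {1..n}" "t \<in> {0..1}" "k \<noteq> j" "D k (f t) = D j (f t)"
        "q = (D j (f t), t)" by (rule double_pointsE)
      have "(D j (f t), f t) \<in> double_points n D" 
        using q mem[OF q(3)] by (intro double_pointsI[where D = D and t = "f t" and k = k]) simp_all
      moreover have "q = (\<lambda>(z, t). (z, g t)) (D j (f t), f t)" using q g by simp
      ultimately show "q \<in> (\<lambda>(z, t). (z, g t)) ` double_points n D" by blast
    qed
    moreover have "finite (double_points n D)" using assms(1) unfolding is_diag_def by blast
    ultimately show "finite (double_points n (\<lambda>k t. D k (f t)))" by (meson finite_imageI finite_subset)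
  next
    fix j k :: nat and t :: real
    assume H: "j \<in> {1..n}" "k \<in> {1..n}" "t \<in> {0..1}" "j \<noteq> k" "D j (f t) = D k (f t)"
    note c = is_diag_crossD[OF assms(1) H(1,2) mem[OF H(3)] H(4,5)]
    have t: "0 < t" "t < 1" using c(1,2) less[of 0 t] less[of t 1] H(3) f by auto
    define e where "e = min t (1 - t)"
    have sub: "{t - e<..<t + e} \<subseteq> {0..1}" by (auto simp: e_def)
    have "transverse_at (\<lambda>t. D j (f t)) (\<lambda>t. D k (f t)) t"
    proof (rule transverse_at_reparam[where f = f and t = t and e = e, OF c(3)])
      show "e > 0" using t by (simp add: e_def)
      show "continuous_on {t - e<..<t + e} f" using f(1) sub by (rule continuous_on_subset)
      show "f u < f v" if "u \<in> {t - e<..<t + e}" "v \<in> {t - e<..<t + e}" "u < v" for u v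
        using less[of u v] sub that by blast
    qed simp
    then show "0 < t \<and> t < 1 \<and> transverse_at (\<lambda>t. D j (f t)) (\<lambda>t. D k (f t)) t \<and>
      (\<forall>m\<in>{1..n} - {j, k}. D m (f t) \<noteq> D j (f t))" using t c(4) by blast
  qed
qed

lemma is_diag_stack:
  assumes "n \<ge> 1" "is_diag n A" "is_diag n B"
  shows "is_diag n (stack n A B)"
proof (rule is_diagI)
  fix k assume k: "k \<in> {1..n}"
  define l where "l = top_pos n A k"
  have l: "l \<in> {1..n}" "A k 1 = circ_pt n (real l)" using top_pos[OF assms(1,2) k] l_def by auto
  note high = stack_high[OF assms k, folded l_def]
  have "continuous_on {0..1} (\<lambda>t. if t \<le> 1/2 then A k (2 * t) else B l (2 * t - 1))"
  proof (rule continuous_on_cases_le)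
    show "continuous_on {t \<in> {0..1}. t \<le> 1/2} (\<lambda>t. A k (2 * t))"
      by (intro continuous_on_compose2[OF is_diagD(1)[OF assms(2) k]] continuous_intros) auto
    show "continuous_on {t \<in> {0..1}. 1/2 \<le> t} (\<lambda>t. B l (2 * t - 1))"
      by (intro continuous_on_compose2[OF is_diagD(1)[OF assms(3) l(1)]] continuous_intros) auto
    fix t :: real assume "t = 1/2"
    then have e: "2 * t = 1" "2 * t - 1 = 0" by auto
    show "A k (2 * t) = B l (2 * t - 1)" unfolding e using l(2) is_diagD(3)[OF assms(3) l(1)] by simp
  qed (intro continuous_intros)
  then show "continuous_on {0..1} (stack n A B k)" unfolding stack_def l_def .
  show "stack n A B k ` {0..1} \<subseteq> sphere 0 1"
  proof
    fix z assume "z \<in> stack n A B k ` {0..1}"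
    then obtain t where t: "t \<in> {0..1}" "z = stack n A B k t" by blast
    show "z \<in> sphere 0 1"
    proof (cases "t \<le> 1/2")
      case True
      then have "2 * t \<in> {0..1}" using t by auto
      then show ?thesis using is_diagD(2)[OF assms(2) k] t True by (auto simp: stack_low image_subset_iff)
    next
      case False
      then have "2 * t - 1 \<in> {0..1}" using t by auto
      then show ?thesis using is_diagD(2)[OF assms(3) l(1)] t False high[of t] by (auto simp: image_subset_iff)
    qed
  qed
  show "stack n A B k 0 = circ_pt n (real k)" using is_diagD(3)[OF assms(2) k] by (simp add: stack_low)
  show "\<exists>l\<in>{1..n}. stack n A B k 1 = circ_pt n (real l)" using is_diagD(4)[OF assms(3) l(1)] high[of 1] by simp
next
  have "double_points n (stack n A B) \<subseteq>
    (\<lambda>(z, t). (z, t / 2)) ` double_points n A \<union> (\<lambda>(z, t). (z, (t + 1) / 2)) ` double_points n B"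
  proof
    fix q assume "q \<in> double_points n (stack n A B)"
    then obtain j k t where q: "j \<in> {1..n}" "k \<in> {1..n}" "t \<in> {0..1}" "k \<noteq> j"
      "stack n A B k t = stack n A B j t" "q = (stack n A B j t, t)" by (rule double_pointsE)
    show "q \<in> (\<lambda>(z, t). (z, t / 2)) ` double_points n A \<union> (\<lambda>(z, t). (z, (t + 1) / 2)) ` double_points n B"
    proof (cases "t \<le> 1/2")
      case True
      have "(A j (2 * t), 2 * t) \<in> double_points n A"
        using q True by (intro double_pointsI[where k = k]) (auto simp: stack_low)
      moreover have "q = (\<lambda>(z, t). (z, t / 2)) (A j (2 * t), 2 * t)" using q True by (simp add: stack_low)
      ultimately show ?thesis by blast
    next
      case False
      let ?j = "top_pos n A j" and ?k = "top_pos n A k"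
      have s: "stack n A B j t = B ?j (2 * t - 1)" "stack n A B k t = B ?k (2 * t - 1)"
        using stack_high[OF assms] q False by auto
      have "?k \<noteq> ?j" using top_pos_inj[OF assms(1,2)] q by blast
      then have "(B ?j (2 * t - 1), 2 * t - 1) \<in> double_points n B"
        using q False s top_pos(1)[OF assms(1,2)] by (intro double_pointsI[where k = ?k]) auto
      moreover have "q = (\<lambda>(z, t). (z, (t + 1) / 2)) (B ?j (2 * t - 1), 2 * t - 1)" using q s by simp
      ultimately show ?thesis by blast
    qed
  qed
  moreover have "finite (double_points n A)" "finite (double_points n B)"
    using assms unfolding is_diag_def by blast+
  ultimately show "finite (double_points n (stack n A B))" by (meson finite_UnI finite_imageI finite_subset)
next
  fix j k :: nat and t :: real
  let ?S = "stack n A B" and ?j = "top_pos n A j" and ?k = "top_pos n A k"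
  assume H: "j \<in> {1..n}" "k \<in> {1..n}" "t \<in> {0..1}" "j \<noteq> k" "?S j t = ?S k t"
  show "0 < t \<and> t < 1 \<and> transverse_at (?S j) (?S k) t \<and> (\<forall>m\<in>{1..n} - {j, k}. ?S m t \<noteq> ?S j t)"
  proof (cases "t \<le> 1/2")
    case True
    have e: "A j (2 * t) = A k (2 * t)" and t2: "2 * t \<in> {0..1}" using H True by (auto simp: stack_low)
    note c = is_diag_crossD[OF assms(2) H(1,2) t2 H(4) e]
    have "transverse_at (?S j) (?S k) t"
      by (rule transverse_at_reparam[where f = "\<lambda>u. 2 * u" and e = "1/2 - t", OF c(3)])
        (use c in \<open>auto simp: stack_low intro!: continuous_intros\<close>)
    then show ?thesis using c True by (auto simp: stack_low)
  next
    case False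
    have s: "?S m u = B (top_pos n A m) (2 * u - 1)" if "m \<in> {1..n}" "u \<ge> 1/2" for m u
      using stack_high[OF assms that] .
    have e: "B ?j (2 * t - 1) = B ?k (2 * t - 1)" and t2: "2 * t - 1 \<in> {0..1}" using H False s by auto
    have jk: "?j \<in> {1..n}" "?k \<in> {1..n}" "?j \<noteq> ?k"
      using top_pos(1)[OF assms(1,2)] top_pos_inj[OF assms(1,2)] H by blast+
    note c = is_diag_crossD[OF assms(3) jk(1,2) t2 jk(3) e]
    have "transverse_at (?S j) (?S k) t"
      by (rule transverse_at_reparam[where f = "\<lambda>u. 2 * u - 1" and e = "t - 1/2", OF c(3)])
        (use c H s in \<open>auto intro!: continuous_intros\<close>)
    moreover have "?S m t \<noteq> ?S j t" if m: "m \<in> {1..n} - {j, k}" for m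
    proof -
      have "top_pos n A m \<in> {1..n} - {?j, ?k}"
        using m top_pos(1)[OF assms(1,2)] top_pos_inj[OF assms(1,2)] H by blast
      then show ?thesis using c(4) s m H False by auto
    qed
    ultimately show ?thesis using c by auto
  qed
qed

lemma isotopic_cong:
  assumes "isotopic n D D'" "\<And>k t. k \<in> {1..n} \<Longrightarrow> t \<in> {0..1} \<Longrightarrow> D k t = E k t"
    "\<And>k t. k \<in> {1..n} \<Longrightarrow> t \<in> {0..1} \<Longrightarrow> D' k t = E' k t"
  shows "isotopic n E E'"
proof -
  have "strand D k = strand E k" "strand D' k = strand E' k" if "k \<in> {1..n}" for k
    using assms(2,3) that unfolding strand_eq by (auto intro!: image_cong)
  then show ?thesis using assms(1) unfolding isotopic_def by simp
qed

text \<open>All points move vertically, from height \<open>t\<close> to \<open>c s t\<close>. The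
  intermediate diagrams are again reparametrisations of \<open>D\<close>, namely by \<open>f\<close>
  composed with the inverse of \<open>c s\<close>.\<close>

lemma isotopic_reparam:
  assumes "is_diag n D" "inc_homeo f"
  shows "isotopic n (\<lambda>k t. D k (f t)) D"
proof -
  define c where "c s t = (1 - s) * t + s * f t" for s t
  have c: "inc_homeo (c s)" if "s \<in> {0..1}" for s
    using inc_homeo_convex[OF assms(2) that] unfolding c_def .
  define H where "H s q = (fst q, c s (snd q))" for s :: real and q :: "complex \<times> real"
  have fc: "continuous_on {0..1} f" "f 0 = 0" "f 1 = 1" using assms(2) unfolding inc_homeo_def by auto
  have "continuous_on ({0..1} \<times> cylinder) (\<lambda>p. (fst (snd p), (1 - fst p) * snd (snd p) + fst p * f (snd (snd p))))"
    by (intro continuous_intros continuous_on_compose2[OF fc(1)]) (auto simp: cylinder_def)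
  then have cont: "continuous_on ({0..1} \<times> cylinder) (\<lambda>(s, q). H s q)"
    unfolding H_def c_def case_prod_unfold .
  have Hs: "H s ` strand (\<lambda>k t. D k (f t)) k = strand (\<lambda>k u. D k (f (g u))) k"
    if s: "s \<in> {0..1}" and g: "inc_homeo g" "\<forall>t\<in>{0..1}. g (c s t) = t" "\<forall>t\<in>{0..1}. c s (g t) = t" for s k g
  proof -
    have "H s ` strand (\<lambda>k t. D k (f t)) k = (\<lambda>t. (D k (f t), c s t)) ` {0..1}"
      by (simp add: strand_eq image_image H_def)
    also have "\<dots> = (\<lambda>t. (D k (f (g (c s t))), c s t)) ` {0..1}" using g by (intro image_cong) auto
    also have "\<dots> = (\<lambda>u. (D k (f (g u)), u)) ` (c s ` {0..1})" by (simp add: image_image)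
    also have "\<dots> = strand (\<lambda>k u. D k (f (g u))) k" using inc_homeo_image[OF c[OF s]] by (simp add: strand_eq)
    finally show ?thesis .
  qed
  show ?thesis
  proof (rule isotopicI[OF cont])
    fix s :: real assume s: "s \<in> {0..1}"
    show "inj_on (H s) cylinder"
    proof (rule inj_onI)
      fix q r assume qr: "q \<in> cylinder" "r \<in> cylinder" "H s q = H s r"
      then have "snd q \<in> {0..1}" "snd r \<in> {0..1}" "c s (snd q) = c s (snd r)" "fst q = fst r"
        by (auto simp: H_def cylinder_def)
      then show "q = r" using inc_homeo_eq[OF c[OF s], of "snd q" "snd r"] by (simp add: prod_eq_iff)
    qed
    show "H s ` cylinder = cylinder"
    proof (intro equalityI subsetI)
      fix q assume "q \<in> H s ` cylinder"
      then obtain z t where zt: "z \<in> sphere 0 1" "t \<in> {0..1}" "q = (z, c s t)" by (auto simp: H_def cylinder_def)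
      then show "q \<in> cylinder" using inc_homeo_mem[OF c[OF s] zt(2)] by (simp add: cylinder_def)
    next
      fix q assume q: "q \<in> cylinder"
      then obtain t where t: "t \<in> {0..1}" "c s t = snd q"
        using inc_homeo_surj[OF c[OF s], of "snd q"] by (auto simp: cylinder_def)
      then have "q = H s (fst q, t)" "(fst q, t) \<in> cylinder" using q by (auto simp: H_def cylinder_def)
      then show "q \<in> H s ` cylinder" by blast
    qed
    obtain g where g: "inc_homeo g" "\<forall>t\<in>{0..1}. g (c s t) = t" "\<forall>t\<in>{0..1}. c s (g t) = t"
      using inc_homeo_inverse[OF c[OF s]] by blast
    have "is_diag n (\<lambda>k u. D k (f (g u)))"
      using is_diag_reparam[OF assms(1) inc_homeo_compose[OF assms(2) g(1)]] .
    then show "\<exists>E. is_diag n E \<and> (\<forall>k\<in>{1..n}. H s ` strand (\<lambda>k t. D k (f t)) k = strand E k)"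
      using Hs[OF s g] by blast
    fix q assume "q \<in> cylinder_bd"
    then show "H s q = q" using fc by (auto simp: H_def c_def cylinder_bd_def)
  next
    fix q :: "complex \<times> real"
    show "H 0 q = q" by (simp add: H_def c_def)
  next
    fix k
    obtain g where g: "inc_homeo g" "\<forall>t\<in>{0..1}. g (f t) = t" "\<forall>t\<in>{0..1}. f (g t) = t"
      using inc_homeo_inverse[OF assms(2)] by blast
    have "H 1 ` strand (\<lambda>k t. D k (f t)) k = strand (\<lambda>k u. D k (f (g u))) k"
      using g by (intro Hs) (auto simp: c_def)
    also have "\<dots> = strand D k" using g(3) unfolding strand_eq by (intro image_cong) auto
    finally show "H 1 ` strand (\<lambda>k t. D k (f t)) k = strand D k" .
  qed
qed

definition lower_half :: "complex \<times> real \<Rightarrow> complex \<times> real"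
  where "lower_half q = (fst q, snd q / 2)"

definition upper_half :: "complex \<times> real \<Rightarrow> complex \<times> real"
  where "upper_half q = (fst q, (snd q + 1) / 2)"

lemma stack_strand:
  assumes "n \<ge> 1" "is_diag n A" "is_diag n B" "k \<in> {1..n}"
  shows "strand (stack n A B) k = lower_half ` strand A k \<union> upper_half ` strand B (top_pos n A k)"
proof -
  have "strand (stack n A B) k =
    (\<lambda>t. (stack n A B k t, t)) ` ((\<lambda>t. t / 2) ` {0..1}) \<union> (\<lambda>t. (stack n A B k t, t)) ` ((\<lambda>t. (t + 1) / 2) ` {0..1})"
  proof -
    have "{0..1} = (\<lambda>t. t / 2) ` {0..1} \<union> (\<lambda>t. (t + 1) / 2) ` {0..1::real}"
    proof
      show "{0..1} \<subseteq> (\<lambda>t. t / 2) ` {0..1} \<union> (\<lambda>t. (t + 1) / 2) ` {0..1::real}"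
      proof
        fix t :: real assume "t \<in> {0..1}"
        then show "t \<in> (\<lambda>t. t / 2) ` {0..1} \<union> (\<lambda>t. (t + 1) / 2) ` {0..1}"
          using image_eqI[of t "\<lambda>t. t / 2" "2 * t" "{0..1}"] image_eqI[of t "\<lambda>t. (t + 1) / 2" "2 * t - 1" "{0..1}"]
          by (cases "t \<le> 1/2") auto
      qed
    qed auto
    then show ?thesis unfolding strand_eq image_Un[symmetric] by simp
  qed
  moreover have "(\<lambda>t. (stack n A B k t, t)) ` ((\<lambda>t. t / 2) ` {0..1}) = lower_half ` strand A k"
    unfolding strand_eq image_image lower_half_def by (intro image_cong) (auto simp: stack_low)
  moreover have "(\<lambda>t. (stack n A B k t, t)) ` ((\<lambda>t. (t + 1) / 2) ` {0..1}) = upper_half ` strand B (top_pos n A k)"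
    unfolding strand_eq image_image upper_half_def
  proof (rule image_cong)
    fix t :: real assume "t \<in> {0..1}"
    then have "stack n A B k ((t + 1) / 2) = B (top_pos n A k) (2 * ((t + 1) / 2) - 1)"
      by (intro stack_high[OF assms]) simp
    moreover have "2 * ((t + 1) / 2) - 1 = t" by (simp add: field_simps)
    ultimately show "(stack n A B k ((t + 1) / 2), (t + 1) / 2) =
      (fst (B (top_pos n A k) t, t), (snd (B (top_pos n A k) t, t) + 1) / 2)" by simp
  qed simp
  ultimately show ?thesis by simp
qed

lemma cylinder_halves: "cylinder = lower_half ` cylinder \<union> upper_half ` cylinder"
proof
  show "cylinder \<subseteq> lower_half ` cylinder \<union> upper_half ` cylinder"
  proof
    fix q assume q: "q \<in> cylinder"
    show "q \<in> lower_half ` cylinder \<union> upper_half ` cylinder"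
    proof (cases "snd q \<le> 1/2")
      case True
      then have "q = lower_half (fst q, 2 * snd q)" "(fst q, 2 * snd q) \<in> cylinder"
        using q by (auto simp: lower_half_def cylinder_def)
      then show ?thesis by blast
    next
      case False
      then have "q = upper_half (fst q, 2 * snd q - 1)" "(fst q, 2 * snd q - 1) \<in> cylinder"
        using q by (auto simp: upper_half_def cylinder_def)
      then show ?thesis by blast
    qed
  qed
qed (auto simp: lower_half_def upper_half_def cylinder_def)

lemma carries_top_pos:
  assumes "carries n D D' h" "is_diag n D" "k \<in> {1..n}"
  shows "top_pos n D' k = top_pos n D k"
  using carries_endpoints(2)[OF assms] by (simp add: top_pos_def)

text \<open>The two isotopies run simultaneously on the two halves of the cylinder. They fit
  together on the middle circle because both fix the boundary.\<close>

lemma isotopic_stack: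
  assumes "n \<ge> 1" "isotopic n A A'" "isotopic n B B'" "is_diag n A" "is_diag n B" "is_diag n A'" "is_diag n B'"
  shows "isotopic n (stack n A B) (stack n A' B')"
proof -
  obtain H where "isotopy_map n A A' H" using isotopicE[OF assms(2)] by blast
  note H = isotopy_mapD[OF this]
  obtain K where "isotopy_map n B B' K" using isotopicE[OF assms(3)] by blast
  note K = isotopy_mapD[OF this]
  define G where "G s q = (if snd q \<le> 1/2 then lower_half (H s (fst q, 2 * snd q))
    else upper_half (K s (fst q, 2 * snd q - 1)))" for s q
  have "continuous_on ({0..1} \<times> cylinder) (\<lambda>p. if snd (snd p) \<le> 1/2
      then lower_half ((\<lambda>(s, q). H s q) (fst p, (fst (snd p), 2 * snd (snd p))))
      else upper_half ((\<lambda>(s, q). K s q) (fst p, (fst (snd p), 2 * snd (snd p) - 1))))"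
  proof (rule continuous_on_cases_le)
    show "continuous_on {t \<in> {0..1} \<times> cylinder. snd (snd t) \<le> 1/2}
      (\<lambda>p. lower_half ((\<lambda>(s, q). H s q) (fst p, (fst (snd p), 2 * snd (snd p)))))"
      unfolding lower_half_def divide_inverse
      by (intro continuous_intros continuous_on_compose2[OF H(1)]) (auto simp: cylinder_def)
    show "continuous_on {t \<in> {0..1} \<times> cylinder. 1/2 \<le> snd (snd t)}
      (\<lambda>p. upper_half ((\<lambda>(s, q). K s q) (fst p, (fst (snd p), 2 * snd (snd p) - 1))))"
      unfolding upper_half_def divide_inverse
      by (intro continuous_intros continuous_on_compose2[OF K(1)]) (auto simp: cylinder_def)
    show "continuous_on ({0..1} \<times> cylinder) (\<lambda>p. snd (snd p))" by (intro continuous_intros)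
    fix p :: "real \<times> complex \<times> real" assume p: "p \<in> {0..1} \<times> cylinder" "snd (snd p) = 1/2"
    then have bd: "(fst (snd p), 1) \<in> cylinder_bd" "(fst (snd p), 0) \<in> cylinder_bd" "fst p \<in> {0..1}"
      by (auto simp: cylinder_def cylinder_bd_def)
    show "lower_half ((\<lambda>(s, q). H s q) (fst p, (fst (snd p), 2 * snd (snd p)))) =
      upper_half ((\<lambda>(s, q). K s q) (fst p, (fst (snd p), 2 * snd (snd p) - 1)))"
    proof -
      have e: "2 * snd (snd p) = 1" "2 * snd (snd p) - 1 = 0" using p(2) by auto
      have "H (fst p) (fst (snd p), 1) = (fst (snd p), 1)" "K (fst p) (fst (snd p), 0) = (fst (snd p), 0)"
        using H(5) K(5) bd by blast+
      then show ?thesis unfolding e by (simp add: lower_half_def upper_half_def)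
    qed
  qed
  then have cont: "continuous_on ({0..1} \<times> cylinder) (\<lambda>(s, q). G s q)"
    unfolding G_def case_prod_unfold by (simp cong: if_cong)
  have Glo: "G s (lower_half q) = lower_half (H s q)" if "q \<in> cylinder" for s q
    using that by (auto simp: G_def lower_half_def cylinder_def)
  have Ghi: "G s (upper_half q) = upper_half (K s q)" if q: "q \<in> cylinder" and s: "s \<in> {0..1}" for s q
  proof (cases "snd q = 0")
    case True
    then have "(fst q, 1) \<in> cylinder_bd" "q \<in> cylinder_bd" using q by (auto simp: cylinder_def cylinder_bd_def)
    then have "H s (fst q, 1) = (fst q, 1)" "K s q = q" using H(5)[OF s] K(5)[OF s] by blast+
    then show ?thesis using True by (simp add: G_def upper_half_def lower_half_def)
  next
    case False
    have "2 * ((snd q + 1) / 2) - 1 = snd q" by (simp add: field_simps)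
    moreover have "snd q > 0" using False q by (auto simp: cylinder_def)
    ultimately show ?thesis by (simp add: G_def upper_half_def)
  qed
  have Gim: "G s ` (lower_half ` X \<union> upper_half ` Y) = lower_half ` (H s ` X) \<union> upper_half ` (K s ` Y)"
    if "X \<subseteq> cylinder" "Y \<subseteq> cylinder" "s \<in> {0..1}" for s X Y
  proof -
    have "G s ` lower_half ` X = lower_half ` (H s ` X)" unfolding image_image using Glo that by (intro image_cong) auto
    moreover have "G s ` upper_half ` Y = upper_half ` (K s ` Y)" unfolding image_image using Ghi that by (intro image_cong) auto
    ultimately show ?thesis by (simp add: image_Un)
  qed
  have Gst: "G s ` strand (stack n A B) k = strand (stack n E F) k"
    if s: "s \<in> {0..1}" and k: "k \<in> {1..n}" and E: "is_diag n E" "\<forall>k\<in>{1..n}. H s ` strand A k = strand E k"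
      and F: "is_diag n F" "\<forall>k\<in>{1..n}. K s ` strand B k = strand F k" for s k E F
  proof -
    note tp = top_pos(1)[OF assms(1,4) k]
    have "top_pos n E k = top_pos n A k" using carries_top_pos[OF H(9)[OF s E(2)] assms(4) k] .
    then show ?thesis
      using stack_strand[OF assms(1,4,5) k] stack_strand[OF assms(1) E(1) F(1) k] E(2) F(2) k tp
        Gim[OF strand_subset[OF assms(4) k] strand_subset[OF assms(5) tp] s] by simp
  qed
  show ?thesis
  proof (rule isotopicI[OF cont])
    fix s :: real assume s: "s \<in> {0..1}"
    have Gm: "G s ` cylinder = cylinder"
      using Gim[OF subset_refl subset_refl s] cylinder_halves H(3)[OF s] K(3)[OF s] by simp
    show "G s ` cylinder = cylinder" by (rule Gm)
    show "inj_on (G s) cylinder"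
    proof -
      \<comment> \<open>A lower and an upper image can only meet on the middle circle. There the
        boundary condition and injectivity force the upper preimage to height 0, which
        \<open>snd b > 0\<close> excludes.\<close>
      have mixed: False if "a \<in> cylinder" "b \<in> cylinder" "snd b > 0" "lower_half (H s a) = upper_half (K s b)" for a b
      proof -
        have Ha: "H s a \<in> cylinder" and Kb: "K s b \<in> cylinder" using H(3)[OF s] K(3)[OF s] that by blast+
        then have "snd (K s b) = 0" using that(4) by (auto simp: lower_half_def upper_half_def cylinder_def)
        then have bd: "K s b \<in> cylinder_bd" using Kb by (auto simp: cylinder_def cylinder_bd_def)
        then have "K s (K s b) = K s b" using K(5)[OF s] by blast
        then have "K s b = b" using inj_onD[OF K(2)[OF s]] Kb that(2) by blast
        then show False using \<open>snd (K s b) = 0\<close> that(3) by simp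
      qed
      have split: "(\<exists>a\<in>cylinder. q = lower_half a) \<or> (\<exists>b\<in>cylinder. snd b > 0 \<and> q = upper_half b)"
        if q: "q \<in> cylinder" for q
      proof (cases "snd q \<le> 1/2")
        case True
        then have "q = lower_half (fst q, 2 * snd q)" "(fst q, 2 * snd q) \<in> cylinder"
          using q by (auto simp: lower_half_def cylinder_def)
        then show ?thesis by blast
      next
        case False
        then have "q = upper_half (fst q, 2 * snd q - 1)" "(fst q, 2 * snd q - 1) \<in> cylinder"
          using q by (auto simp: upper_half_def cylinder_def)
        then show ?thesis using False by (intro disjI2 bexI[of _ "(fst q, 2 * snd q - 1)"]) auto
      qed
      have ilo: "lower_half a = lower_half b \<Longrightarrow> a = b" and iup: "upper_half a = upper_half b \<Longrightarrow> a = b" for a b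
        by (auto simp: lower_half_def upper_half_def prod_eq_iff)
      show ?thesis
      proof (rule inj_onI)
        fix q r assume qr: "q \<in> cylinder" "r \<in> cylinder" "G s q = G s r"
        from split[OF qr(1)] split[OF qr(2)] show "q = r"
        proof (elim disjE bexE conjE)
          fix a b assume "a \<in> cylinder" "q = lower_half a" "b \<in> cylinder" "r = lower_half b"
          then show ?thesis using qr(3) Glo ilo inj_onD[OF H(2)[OF s]] by metis
        next
          fix a b assume "a \<in> cylinder" "q = lower_half a" "b \<in> cylinder" "snd b > 0" "r = upper_half b"
          then show ?thesis using qr(3) Glo Ghi[OF _ s] mixed by metis
        next
          fix a b assume "a \<in> cylinder" "r = lower_half a" "b \<in> cylinder" "snd b > 0" "q = upper_half b"
          then show ?thesis using qr(3) Glo Ghi[OF _ s] mixed by metis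
        next
          fix a b assume "a \<in> cylinder" "q = upper_half a" "b \<in> cylinder" "r = upper_half b"
          then show ?thesis using qr(3) Ghi[OF _ s] iup inj_onD[OF K(2)[OF s]] by metis
        qed
      qed
    qed
    obtain E F where EF: "is_diag n E" "\<forall>k\<in>{1..n}. H s ` strand A k = strand E k"
      "is_diag n F" "\<forall>k\<in>{1..n}. K s ` strand B k = strand F k" using H(6)[OF s] K(6)[OF s] by blast
    then show "\<exists>E. is_diag n E \<and> (\<forall>k\<in>{1..n}. G s ` strand (stack n A B) k = strand E k)"
      using is_diag_stack[OF assms(1) EF(1,3)] Gst[OF s _ EF] by blast
    fix q assume q: "q \<in> cylinder_bd"
    then consider "snd q = 0" "q \<in> cylinder_bd" | "snd q = 1" "q \<in> cylinder_bd" by (auto simp: cylinder_bd_def)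
    then show "G s q = q"
    proof cases
      case 1
      then have "H s (fst q, 0) = (fst q, 0)" using H(5)[OF s, of q] by (metis prod.collapse)
      then show ?thesis using 1 by (simp add: G_def lower_half_def prod_eq_iff)
    next
      case 2
      then have "K s (fst q, 1) = (fst q, 1)" using K(5)[OF s, of q] by (metis prod.collapse)
      then show ?thesis using 2 by (simp add: G_def upper_half_def prod_eq_iff)
    qed
  next
    fix q assume q: "q \<in> cylinder"
    then have "(fst q, 2 * snd q) \<in> cylinder" if "snd q \<le> 1/2" using that by (auto simp: cylinder_def)
    moreover have "(fst q, 2 * snd q - 1) \<in> cylinder" if "\<not> snd q \<le> 1/2" using q that by (auto simp: cylinder_def)
    ultimately show "G 0 q = q" using H(4) K(4) by (simp add: G_def lower_half_def upper_half_def prod_eq_iff)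
  next
    fix k assume "k \<in> {1..n}"
    then show "G 1 ` strand (stack n A B) k = strand (stack n A' B') k"
      using Gst[of 1 k A' B'] assms H(7) K(7) by simp
  qed
qed

lemma top_pos_stack:
  assumes "n \<ge> 1" "is_diag n A" "is_diag n B" "k \<in> {1..n}"
  shows "top_pos n (stack n A B) k = top_pos n B (top_pos n A k)"
  using stack_high[OF assms, of 1] top_pos[OF assms(1,3) top_pos(1)[OF assms(1,2,4)]]
  by (intro top_pos_eqI[OF assms(1)]) auto

lemma isotopic_stack_assoc:
  assumes "n \<ge> 1" "is_diag n A" "is_diag n B" "is_diag n C"
  shows "isotopic n (stack n A (stack n B C)) (stack n (stack n A B) C)"
proof -
  \<comment> \<open>The linear pieces send \<open>[0,1/2]\<close>, \<open>[1/2,3/4]\<close>,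
    \<open>[3/4,1]\<close> to \<open>[0,1/4]\<close>, \<open>[1/4,1/2]\<close>,
    \<open>[1/2,1]\<close>. Their slopes increase, so the maximum picks the right piece
    everywhere.\<close>
  define f :: "real \<Rightarrow> real" where "f t = max (t / 2) (max (t - 1/4) (2 * t - 1))" for t
  have AB: "is_diag n (stack n A B)" and BC: "is_diag n (stack n B C)" using is_diag_stack assms by blast+
  have "inc_homeo f"
  proof -
    have "continuous_on {0..1} f" unfolding f_def divide_inverse by (intro continuous_intros)
    moreover have "strict_mono_on {0..1} f" by (intro strict_mono_onI) (unfold f_def max_def, auto)
    ultimately show ?thesis by (simp add: inc_homeo_def f_def)
  qed
  from isotopic_reparam[OF is_diag_stack[OF assms(1) AB assms(4)] this]
  show ?thesis
  proof (rule isotopic_cong)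
    fix k :: nat and t :: real assume k: "k \<in> {1..n}" and t: "t \<in> {0..1}"
    let ?a = "top_pos n A k"
    have a: "?a \<in> {1..n}" using top_pos(1)[OF assms(1,2) k] .
    consider "t \<le> 1/2" | "1/2 \<le> t" "t \<le> 3/4" | "3/4 \<le> t" by linarith
    then show "stack n (stack n A B) C k (f t) = stack n A (stack n B C) k t"
    proof cases
      case 1
      then have ft: "f t = t / 2" by (simp add: f_def)
      show ?thesis unfolding ft using 1 t by (simp add: stack_low)
    next
      case 2
      then have ft: "f t = t - 1/4" by (simp add: f_def)
      have "stack n (stack n A B) C k (f t) = stack n A B k (2 * t - 1/2)" using 2 unfolding ft by (simp add: stack_low algebra_simps)
      also have "\<dots> = B ?a (4 * t - 2)" using stack_high[OF assms(1-3) k, of "2 * t - 1/2"] 2 by (simp add: algebra_simps)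
      also have "\<dots> = stack n B C ?a (2 * t - 1)" using 2 by (simp add: stack_low algebra_simps)
      also have "\<dots> = stack n A (stack n B C) k t" using stack_high[OF assms(1,2) BC k] 2 by simp
      finally show ?thesis .
    next
      case 3
      then have ft: "f t = 2 * t - 1" by (simp add: f_def)
      have "stack n (stack n A B) C k (f t) = C (top_pos n (stack n A B) k) (4 * t - 3)"
        using stack_high[OF assms(1) AB assms(4) k, of "f t"] 3 unfolding ft by (simp add: algebra_simps)
      also have "\<dots> = C (top_pos n B ?a) (4 * t - 3)" using top_pos_stack[OF assms(1-3) k] by simp
      also have "\<dots> = stack n B C ?a (2 * t - 1)"
        using stack_high[OF assms(1,3,4) a, of "2 * t - 1"] 3 by (simp add: algebra_simps)
      also have "\<dots> = stack n A (stack n B C) k t" using stack_high[OF assms(1,2) BC k] 3 by simp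
      finally show ?thesis .
    qed
  qed simp
qed

section \<open>Twists\<close>

text \<open>The strands \<open>i\<close> and \<open>i + 1\<close>, for every \<open>i \<in> I\<close>, exchange places symmetrically, the left
  one being displaced by \<open>\<alpha> i\<close>; all other strands are vertical.\<close>

definition twist_offset :: "nat \<Rightarrow> nat set \<Rightarrow> (nat \<Rightarrow> real \<Rightarrow> real) \<Rightarrow> nat \<Rightarrow> real \<Rightarrow> real"
  where "twist_offset n I \<alpha> k t = (if k \<in> I then \<alpha> k t else if prv n k \<in> I then - \<alpha> (prv n k) t else 0)"

definition twist :: "nat \<Rightarrow> nat set \<Rightarrow> (nat \<Rightarrow> real \<Rightarrow> real) \<Rightarrow> diag"
  where "twist n I \<alpha> k t = circ_pt n (real k + twist_offset n I \<alpha> k t)"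

text \<open>A single passage through \<open>1/2\<close>, from below to above, gives a single
  transverse crossing of the two symmetric strands. Flat pieces are allowed because stacking with
  the identity produces them.\<close>

definition cross_fun :: "(real \<Rightarrow> real) \<Rightarrow> bool"
  where "cross_fun f \<longleftrightarrow> continuous_on {0..1} f \<and> f 0 = 0 \<and> f 1 = 1 \<and> (\<forall>t\<in>{0..1}. f t \<in> {0..1}) \<and>
    (\<exists>c. 0 < c \<and> c < 1 \<and> f c = 1/2 \<and> (\<forall>t\<in>{0..1}. (t < c \<longrightarrow> f t < 1/2) \<and> (c < t \<longrightarrow> 1/2 < f t)))"

definition separated :: "nat \<Rightarrow> nat set \<Rightarrow> bool"
  where "separated n I \<longleftrightarrow> I \<subseteq> {1..n} \<and> (\<forall>i\<in>I. nxt n i \<notin> I)"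

lemma circ_pt_shift:
  assumes "n \<ge> 1" "res n a = res n b"
  shows "circ_pt n (of_int a + x) = circ_pt n (of_int b + x)"
proof -
  obtain m where m: "a = b + int n * m" using assms res_eq_iff by blast
  have "of_int a + x = (of_int b + x) + real n * of_int m" by (simp add: m)
  then show ?thesis using circ_pt_period[OF assms(1)] by metis
qed

lemma circ_pt_nxt:
  assumes "n \<ge> 1" "i \<in> {1..n}"
  shows "circ_pt n (real (nxt n i) + x) = circ_pt n (real i + 1 + x)"
  using circ_pt_shift[of n "int (nxt n i)" "int i + 1" x] res_Suc[of n "int i"] assms
    res_int[OF nxt_range[OF assms(2)]] res_int[OF assms(2)] by simp

lemma circ_pt_prv:
  assumes "n \<ge> 1" "i \<in> {1..n}"
  shows "circ_pt n (real (prv n i) + x) = circ_pt n (real i - 1 + x)"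
  using circ_pt_shift[of n "int (prv n i)" "int i - 1" x] res_pred[of n "int i"] assms
    res_int[OF prv_range[OF assms(2)]] res_int[OF assms(2)] by simp

text \<open>Offsets lie in \<open>[-1,1]\<close>, so only lifts starting at distance 1 or 2 can
  meet. Distance 2 would require two adjacent indices in \<open>I\<close>, against
  \<open>separated\<close>; at distance 1 the left index lies in \<open>I\<close>, and the symmetry
  of the exchange forces the meeting point to be the middle.\<close>

lemma twist_collision:
  assumes "n \<ge> 2" "separated n I" "\<And>i. i \<in> I \<Longrightarrow> \<alpha> i t \<in> {0..1}" "j \<in> {1..n}" "k \<in> {1..n}" "j \<noteq> k"
    "twist n I \<alpha> j t = twist n I \<alpha> k t"
  shows "j \<in> I \<and> k = nxt n j \<and> \<alpha> j t = 1/2 \<or> k \<in> I \<and> j = nxt n k \<and> \<alpha> k t = 1/2"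
proof -
  have n: "n \<ge> 1" using assms(1) by simp
  have key: "res n J \<in> I \<and> res n K = nxt n (res n J) \<and> \<alpha> (res n J) t = 1/2"
    if JK: "J < K" and e: "of_int J + twist_offset n I \<alpha> (res n J) t = of_int K + twist_offset n I \<alpha> (res n K) t" for J K
  proof -
    let ?o = "\<lambda>J. twist_offset n I \<alpha> (res n J) t"
    have b: "- 1 \<le> ?o J" "?o J \<le> 1" "res n J \<notin> I \<Longrightarrow> ?o J \<le> 0" "prv n (res n J) \<notin> I \<Longrightarrow> 0 \<le> ?o J" for J
      using assms(3)[of "res n J"] assms(3)[of "prv n (res n J)"] by (auto simp: twist_offset_def)
    have d: "?o J - ?o K = of_int (K - J)" using e by simp
    have "K - J \<le> 2"
    proof -
      have "real_of_int (K - J) \<le> 2" using d b(2)[of J] b(1)[of K] by linarith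
      then show ?thesis by linarith
    qed
    then consider "K = J + 1" | "K = J + 2" using JK by linarith
    then show ?thesis
    proof cases
      case 1
      have rK: "res n K = nxt n (res n J)" using res_Suc[OF n] 1 by simp
      have pK: "prv n (res n K) = res n J" using res_pred[OF n, of K] 1 by simp
      have J: "res n J \<in> I"
      proof (rule ccontr)
        assume "res n J \<notin> I"
        then show False using b(3)[of J] b(4)[of K] pK d 1 by simp
      qed
      then have "res n K \<notin> I" using assms(2) rK unfolding separated_def by simp
      then have "?o K = - \<alpha> (res n J) t" using J pK by (simp add: twist_offset_def)
      moreover have "?o J = \<alpha> (res n J) t" using J by (simp add: twist_offset_def)
      ultimately show ?thesis using d 1 J rK by simp
    next
      case 2
      have "?o J = 1" "?o K = -1" using d 2 b(2)[of J] b(1)[of K] by simp_all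
      then have J: "res n J \<in> I" and K: "prv n (res n K) \<in> I" using b(3)[of J] b(4)[of K] by auto
      have "prv n (res n K) = nxt n (res n J)" using res_pred[OF n, of K] res_Suc[OF n, of J] 2 by (simp add: algebra_simps)
      then show ?thesis using J K assms(2) unfolding separated_def by simp
    qed
  qed
  obtain m :: int where m: "real j + twist_offset n I \<alpha> j t = real k + twist_offset n I \<alpha> k t + real n * of_int m"
    using assms(7) circ_pt_eq_iff[OF n] unfolding twist_def by blast
  define J K where "J = int j" and "K = int k + int n * m"
  have r: "res n J = j" "res n K = k" using res_int assms(4,5) by (auto simp: J_def K_def res_period)
  have e: "of_int J + twist_offset n I \<alpha> (res n J) t = of_int K + twist_offset n I \<alpha> (res n K) t"
    unfolding r using m by (simp add: J_def K_def)
  have "J \<noteq> K" using r assms(6) by auto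
  then show ?thesis using key[of J K] key[of K J] e r by (cases "J < K") auto
qed

lemma Im_circ_pt: "Im (circ_pt n x * cnj (circ_pt n y)) = sin (2 * pi * (x - y) / real n)"
  unfolding circ_pt_def by (simp add: sin_diff right_diff_distrib diff_divide_distrib)

lemma transverse_at_sym: "transverse_at z w t \<Longrightarrow> transverse_at w z t"
proof -
  assume H: "transverse_at z w t"
  have "Im (w u * cnj (z u)) * Im (w v * cnj (z v)) = Im (z u * cnj (w u)) * Im (z v * cnj (w v))" for u v
    by (simp add: algebra_simps)
  then show ?thesis using H unfolding transverse_at_def by (simp only:)
qed

text \<open>The signed distance of two exchanged strands is twice the displacement minus 1, of
  absolute value at most 1. As \<open>2 * pi / n < pi\<close> for \<open>n \<ge> 3\<close>, the sine
  in \<open>transverse_at\<close> has the sign of this distance.\<close>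

lemma is_diag_twist:
  assumes "n \<ge> 3" "separated n I" "\<And>i. i \<in> I \<Longrightarrow> cross_fun (\<alpha> i)"
  shows "is_diag n (twist n I \<alpha>)"
proof (rule is_diagI)
  have n: "n \<ge> 1" "n \<ge> 2" using assms by auto
  have cf: "continuous_on {0..1} (\<alpha> i)" "\<alpha> i 0 = 0" "\<alpha> i 1 = 1" "\<And>t. t \<in> {0..1} \<Longrightarrow> \<alpha> i t \<in> {0..1}" if "i \<in> I" for i
    using assms(3)[OF that] unfolding cross_fun_def by auto
  have "\<forall>i\<in>I. \<exists>c. 0 < c \<and> c < 1 \<and> \<alpha> i c = 1/2 \<and> (\<forall>t\<in>{0..1}. (t < c \<longrightarrow> \<alpha> i t < 1/2) \<and> (c < t \<longrightarrow> 1/2 < \<alpha> i t))"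
    using assms(3) unfolding cross_fun_def by blast
  from bchoice[OF this] obtain c where c0: "\<forall>i\<in>I. 0 < c i \<and> c i < 1 \<and> \<alpha> i (c i) = 1/2 \<and>
    (\<forall>t\<in>{0..1}. (t < c i \<longrightarrow> \<alpha> i t < 1/2) \<and> (c i < t \<longrightarrow> 1/2 < \<alpha> i t))" by blast
  then have c: "\<And>i. i \<in> I \<Longrightarrow> 0 < c i" "\<And>i. i \<in> I \<Longrightarrow> c i < 1"
    "\<And>i t. i \<in> I \<Longrightarrow> t \<in> {0..1} \<Longrightarrow> t < c i \<Longrightarrow> \<alpha> i t < 1/2"
    "\<And>i t. i \<in> I \<Longrightarrow> t \<in> {0..1} \<Longrightarrow> c i < t \<Longrightarrow> 1/2 < \<alpha> i t" by blast+
  have ceq: "t = c i" if "i \<in> I" "t \<in> {0..1}" "\<alpha> i t = 1/2" for i t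
    using c(3)[OF that(1,2)] c(4)[OF that(1,2)] that(3) by (cases "t < c i"; cases "c i < t") auto
  note sep = assms(2)[unfolded separated_def]
  have coll: "j \<in> I \<and> k = nxt n j \<and> t = c j \<or> k \<in> I \<and> j = nxt n k \<and> t = c k"
    if "j \<in> {1..n}" "k \<in> {1..n}" "t \<in> {0..1}" "j \<noteq> k" "twist n I \<alpha> j t = twist n I \<alpha> k t" for j k t
  proof -
    have "\<alpha> i t \<in> {0..1}" if "i \<in> I" for i using cf(4)[OF that \<open>t \<in> {0..1}\<close>] .
    from twist_collision[OF n(2) assms(2) this that(1,2,4,5)] ceq[OF _ that(3)] show ?thesis by blast
  qed
  have tr: "transverse_at (twist n I \<alpha> i) (twist n I \<alpha> (nxt n i)) (c i)" if i: "i \<in> I" for i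
  proof -
    have i': "i \<in> {1..n}" "nxt n i \<notin> I" "prv n (nxt n i) = i" using sep i prv_nxt by auto
    have im: "Im (twist n I \<alpha> i u * cnj (twist n I \<alpha> (nxt n i) u)) = sin (2 * pi * (2 * \<alpha> i u - 1) / real n)" for u
    proof -
      have "twist n I \<alpha> (nxt n i) u = circ_pt n (real i + 1 - \<alpha> i u)"
        using i i' circ_pt_nxt[OF n(1) i'(1), of "- \<alpha> i u"] by (simp add: twist_def twist_offset_def)
      moreover have "twist n I \<alpha> i u = circ_pt n (real i + \<alpha> i u)" using i by (simp add: twist_def twist_offset_def)
      moreover have "(real i + \<alpha> i u) - (real i + 1 - \<alpha> i u) = 2 * \<alpha> i u - 1" by simp
      ultimately show ?thesis by (simp only: Im_circ_pt)
    qed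
    have pos: "sin (2 * pi * x / real n) > 0" if "0 < x" "x \<le> 1" for x
    proof (rule sin_gt_zero)
      show "0 < 2 * pi * x / real n" using that n by simp
      have "2 * pi * x \<le> 2 * pi * 1" using that by (intro mult_left_mono) auto
      also have "\<dots> < pi * real n" using assms(1) by (simp add: mult.commute)
      finally show "2 * pi * x / real n < pi" using n by (simp add: field_simps)
    qed
    have neg: "sin (2 * pi * x / real n) < 0" if "x < 0" "-1 \<le> x" for x
      using pos[of "- x"] that by simp
    show ?thesis unfolding transverse_at_def
    proof (intro exI[of _ "min (c i) (1 - c i)"] conjI ballI)
      show "0 < min (c i) (1 - c i)" using c(1,2)[OF i] by simp
      fix u v assume u: "u \<in> {c i - min (c i) (1 - c i)<..<c i}" and v: "v \<in> {c i<..<c i + min (c i) (1 - c i)}"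
      have uv: "u \<in> {0..1}" "v \<in> {0..1}" "u < c i" "c i < v" using u v c(1,2)[OF i] by auto
      have "sin (2 * pi * (2 * \<alpha> i u - 1) / real n) < 0"
        using c(3)[OF i uv(1,3)] cf(4)[OF i uv(1)] by (intro neg) auto
      moreover have "sin (2 * pi * (2 * \<alpha> i v - 1) / real n) > 0"
        using c(4)[OF i uv(2,4)] cf(4)[OF i uv(2)] by (intro pos) auto
      ultimately show "Im (twist n I \<alpha> i u * cnj (twist n I \<alpha> (nxt n i) u)) *
        Im (twist n I \<alpha> i v * cnj (twist n I \<alpha> (nxt n i) v)) < 0"
        unfolding im by (rule mult_neg_pos)
    qed
  qed
  {
    fix k assume k: "k \<in> {1..n}"
    have "continuous_on {0..1} (twist_offset n I \<alpha> k)"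
      using cf(1)[of k] cf(1)[of "prv n k"]
      by (cases "k \<in> I"; cases "prv n k \<in> I") (auto simp: twist_offset_def[abs_def] intro!: continuous_intros)
    then show "continuous_on {0..1} (twist n I \<alpha> k)" unfolding twist_def by (intro continuous_intros)
    show "twist n I \<alpha> k ` {0..1} \<subseteq> sphere 0 1" using circ_pt_sphere by (auto simp: twist_def)
    show "twist n I \<alpha> k 0 = circ_pt n (real k)"
      using cf(2)[of k] cf(2)[of "prv n k"] by (auto simp: twist_def twist_offset_def)
    show "\<exists>l\<in>{1..n}. twist n I \<alpha> k 1 = circ_pt n (real l)"
    proof -
      consider "k \<in> I" | "k \<notin> I" "prv n k \<in> I" | "k \<notin> I" "prv n k \<notin> I" by blast
      then show ?thesis
      proof cases
        case 1
        then have "twist n I \<alpha> k 1 = circ_pt n (real (nxt n k))"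
          using cf(3)[OF 1] circ_pt_nxt[OF n(1) k, of 0] by (simp add: twist_def twist_offset_def)
        then show ?thesis using nxt_range[OF k] by blast
      next
        case 2
        then have "twist n I \<alpha> k 1 = circ_pt n (real (prv n k))"
          using cf(3)[OF 2(2)] circ_pt_prv[OF n(1) k, of 0] by (simp add: twist_def twist_offset_def)
        then show ?thesis using prv_range[OF k] by blast
      next
        case 3
        then have "twist n I \<alpha> k 1 = circ_pt n (real k)" by (simp add: twist_def twist_offset_def)
        then show ?thesis using k by blast
      qed
    qed
  }
  have "double_points n (twist n I \<alpha>) \<subseteq> (\<lambda>i. (twist n I \<alpha> i (c i), c i)) ` I \<union> (\<lambda>i. (twist n I \<alpha> (nxt n i) (c i), c i)) ` I"
  proof
    fix q assume "q \<in> double_points n (twist n I \<alpha>)"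
    then obtain j k t where q: "j \<in> {1..n}" "k \<in> {1..n}" "t \<in> {0..1}" "k \<noteq> j"
      "twist n I \<alpha> k t = twist n I \<alpha> j t" "q = (twist n I \<alpha> j t, t)" by (rule double_pointsE)
    from coll[OF q(2,1,3,4,5)] show "q \<in> (\<lambda>i. (twist n I \<alpha> i (c i), c i)) ` I \<union> (\<lambda>i. (twist n I \<alpha> (nxt n i) (c i), c i)) ` I"
      using q(6) by blast
  qed
  moreover have "finite I" using sep finite_subset by blast
  ultimately show "finite (double_points n (twist n I \<alpha>))" by (meson finite_UnI finite_imageI finite_subset)
  fix j k :: nat and t :: real
  assume H: "j \<in> {1..n}" "k \<in> {1..n}" "t \<in> {0..1}" "j \<noteq> k" "twist n I \<alpha> j t = twist n I \<alpha> k t"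
  have "transverse_at (twist n I \<alpha> j) (twist n I \<alpha> k) t \<and> 0 < t \<and> t < 1"
    using coll[OF H] tr c(1,2) transverse_at_sym by blast
  moreover have "twist n I \<alpha> m t \<noteq> twist n I \<alpha> j t" if m: "m \<in> {1..n} - {j, k}" for m
  proof
    assume e: "twist n I \<alpha> m t = twist n I \<alpha> j t"
    then have "j \<in> I \<and> m = nxt n j \<or> m \<in> I \<and> j = nxt n m" using coll[of m j t] m H by blast
    moreover have "j \<in> I \<and> k = nxt n j \<or> k \<in> I \<and> j = nxt n k" using coll[OF H] by blast
    ultimately show False using m sep nxt_inj[of m n k] H by auto
  qed
  ultimately show "0 < t \<and> t < 1 \<and> transverse_at (twist n I \<alpha> j) (twist n I \<alpha> k) t \<and>
    (\<forall>m\<in>{1..n} - {j, k}. twist n I \<alpha> m t \<noteq> twist n I \<alpha> j t)" by blast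
qed

lemma separated_single: "n \<ge> 2 \<Longrightarrow> i \<in> {1..n} \<Longrightarrow> separated n {i}"
  using nxt_neq by (simp add: separated_def)

lemma gen_diag_twist: "k \<in> {1..n} \<Longrightarrow> i \<in> {1..n} \<Longrightarrow> gen_diag n i k t = twist n {i} (\<lambda>_ t. t) k t"
  using prv_nxt[of i n] nxt_prv[of k n] by (auto simp: gen_diag_def twist_def twist_offset_def)

lemma id_diag_twist: "id_diag n = twist n {} \<alpha>"
  by (intro ext) (simp add: id_diag_def twist_def twist_offset_def)

lemma is_diag_cong:
  assumes "is_diag n D" "\<And>k t. k \<in> {1..n} \<Longrightarrow> D k t = E k t"
  shows "is_diag n E"
proof -
  have e: "D k = E k" if "k \<in> {1..n}" for k using assms(2)[OF that] by blast
  have "double_points n E \<subseteq> double_points n D"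
  proof
    fix q assume "q \<in> double_points n E"
    then obtain j k t where q: "j \<in> {1..n}" "k \<in> {1..n}" "t \<in> {0..1}" "k \<noteq> j" "E k t = E j t" "q = (E j t, t)"
      by (rule double_pointsE)
    then show "q \<in> double_points n D" using double_pointsI[of j n k t D] e by simp
  qed
  moreover have "finite (double_points n D)" using assms(1) unfolding is_diag_def by blast
  ultimately have fin: "finite (double_points n E)" by (rule finite_subset)
  show ?thesis
  proof (rule is_diagI[OF _ _ _ _ fin])
    fix k assume k: "k \<in> {1..n}"
    show "continuous_on {0..1} (E k)" "E k ` {0..1} \<subseteq> sphere 0 1" "E k 0 = circ_pt n (real k)"
      "\<exists>l\<in>{1..n}. E k 1 = circ_pt n (real l)"
      using is_diagD[OF assms(1) k] unfolding e[OF k] by blast+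
  next
    fix j k :: nat and t :: real
    assume H: "j \<in> {1..n}" "k \<in> {1..n}" "t \<in> {0..1}" "j \<noteq> k" "E j t = E k t"
    then have "D j t = D k t" using e by simp
    note c = is_diag_crossD[OF assms(1) H(1-4) this]
    have "\<forall>m\<in>{1..n} - {j, k}. E m t \<noteq> E j t"
    proof
      fix m assume m: "m \<in> {1..n} - {j, k}"
      then have "D m t \<noteq> D j t" by (rule c(4))
      then show "E m t \<noteq> E j t" using e m H by simp
    qed
    then show "0 < t \<and> t < 1 \<and> transverse_at (E j) (E k) t \<and> (\<forall>m\<in>{1..n} - {j, k}. E m t \<noteq> E j t)"
      using c(1,2,3) e[OF H(1)] e[OF H(2)] by simp
  qed
qed

lemma cross_fun_id: "cross_fun (\<lambda>t. t)"
  unfolding cross_fun_def by (auto intro!: exI[of _ "1/2"] continuous_intros)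

lemma is_diag_gen:
  assumes "n \<ge> 3" "i \<in> {1..n}"
  shows "is_diag n (gen_diag n i)"
proof (rule is_diag_cong)
  have "n \<ge> 2" using assms(1) by simp
  then show "is_diag n (twist n {i} (\<lambda>_ t. t))"
    by (intro is_diag_twist[OF assms(1)] separated_single assms(2) cross_fun_id)
qed (simp only: gen_diag_twist assms(2))

lemma is_diag_id: "n \<ge> 3 \<Longrightarrow> is_diag n (id_diag n)"
  unfolding id_diag_twist[of n "\<lambda>_ t. t"] by (rule is_diag_twist) (auto simp: separated_def)

lemma is_diag_word: "n \<ge> 3 \<Longrightarrow> w \<in> lists {1..n} \<Longrightarrow> is_diag n (word_diag n w)"
  by (induction w rule: list.induct) (auto intro!: is_diag_id is_diag_stack is_diag_gen)

section \<open>Moving strands horizontally\<close>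

text \<open>Odd, supported on \<open>[-1,1]\<close>, and the identity on \<open>[-1/2,1/2]\<close>.\<close>

definition tent :: "real \<Rightarrow> real"
  where "tent y = max 0 (min y (1 - y)) - max 0 (min (- y) (1 + y))"

lemma tent_id: "\<bar>y\<bar> \<le> 1/2 \<Longrightarrow> tent y = y"
  unfolding tent_def by (auto simp: max_def min_def)

lemma tent_zero: "\<bar>y\<bar> \<ge> 1 \<Longrightarrow> tent y = 0"
  unfolding tent_def by (auto simp: max_def min_def)

lemma tent_lipschitz: "\<bar>tent x - tent y\<bar> \<le> \<bar>x - y\<bar>"
  unfolding tent_def by linarith

lemma continuous_on_tent: "continuous_on S tent"
  unfolding tent_def[abs_def] by (intro continuous_intros)

lemma circ_pt_window:
  assumes "n \<ge> 1" "z \<in> sphere 0 1"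
  shows "\<exists>x. \<bar>x - c\<bar> \<le> real n / 2 \<and> z = circ_pt n x"
proof -
  define w where "w = z * cnj (circ_pt n c)"
  have nw: "norm w = 1" using assms(2) by (simp add: w_def norm_mult circ_pt_norm)
  then have "w \<noteq> 0" by auto
  have w: "cis (Arg w) = w" using cis_Arg[OF \<open>w \<noteq> 0\<close>] nw by (simp add: sgn_eq)
  define x where "x = c + real n * Arg w / (2 * pi)"
  have "circ_pt n x = circ_pt n c * w"
  proof -
    have "2 * pi * x / real n = 2 * pi * c / real n + Arg w" using assms(1) by (simp add: x_def field_simps)
    then show ?thesis using w by (simp add: circ_pt_def cis_mult[symmetric])
  qed
  also have "\<dots> = z"
    using complex_norm_square[of "circ_pt n c"] by (simp add: w_def circ_pt_norm mult.commute mult.left_commute)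
  finally have "z = circ_pt n x" by simp
  moreover have "\<bar>x - c\<bar> \<le> real n / 2"
  proof -
    have "\<bar>Arg w\<bar> \<le> pi" using Arg_bounded[of w] by auto
    then have "real n * \<bar>Arg w\<bar> \<le> real n * pi" by (intro mult_left_mono) auto
    then show ?thesis by (simp add: x_def abs_mult field_simps)
  qed
  ultimately show ?thesis by blast
qed

text \<open>Only the two ends of a closed window of length \<open>n\<close> are identified on the
  circle, so a map given in window coordinates has to be checked for consistency there
  alone.\<close>

lemma circ_pt_window_eq:
  assumes "n \<ge> 1" "\<bar>x - c\<bar> \<le> real n / 2" "\<bar>y - c\<bar> \<le> real n / 2" "circ_pt n x = circ_pt n y"
  shows "x = y \<or> \<bar>x - c\<bar> = real n / 2 \<and> \<bar>y - c\<bar> = real n / 2"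
proof -
  obtain m :: int where m: "x = y + real n * of_int m" using assms circ_pt_eq_iff by blast
  consider "m = 0" | "m \<ge> 1" | "m \<le> -1" by linarith
  then show ?thesis
  proof cases
    case 2
    then have "real n * of_int m \<ge> real n * 1" by (intro mult_left_mono) auto
    then have "\<bar>x - c\<bar> = real n / 2" "\<bar>y - c\<bar> = real n / 2" using m assms(2,3) by linarith+
    then show ?thesis by simp
  next
    case 3
    then have "real n * of_int m \<le> real n * (-1)" by (intro mult_left_mono) auto
    then have "\<bar>x - c\<bar> = real n / 2" "\<bar>y - c\<bar> = real n / 2" using m assms(2,3) by linarith+
    then show ?thesis by simp
  qed (use m in simp)
qed

text \<open>The closed window is compact, so its projection onto the circle is a quotient
  map.\<close>

lemma continuous_on_sphere_descend:
  fixes f :: "complex \<Rightarrow> 'a::topological_space"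
  assumes "n \<ge> 1" "continuous_on {c - real n / 2..c + real n / 2} (\<lambda>x. f (circ_pt n x))"
  shows "continuous_on (sphere 0 1) f"
proof -
  let ?I = "{c - real n / 2..c + real n / 2}"
  have im: "circ_pt n ` ?I = sphere 0 1"
  proof (intro equalityI subsetI)
    fix z :: complex assume "z \<in> sphere 0 1"
    then obtain x where "\<bar>x - c\<bar> \<le> real n / 2" "z = circ_pt n x" using circ_pt_window[OF assms(1)] by blast
    moreover from this have "x \<in> ?I" unfolding atLeastAtMost_iff by linarith
    ultimately show "z \<in> circ_pt n ` ?I" by blast
  qed (use circ_pt_sphere in blast)
  have cc: "continuous_on ?I (circ_pt n)" by (rule continuous_on_circ_pt[OF continuous_on_id])
  show ?thesis unfolding continuous_openin_preimage_eq
  proof (intro allI impI)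
    fix U :: "'a set" assume U: "open U"
    have "openin (top_of_set ?I) (?I \<inter> circ_pt n -` (sphere 0 1 \<inter> f -` U))"
    proof -
      have "?I \<inter> circ_pt n -` (sphere 0 1 \<inter> f -` U) = ?I \<inter> (\<lambda>x. f (circ_pt n x)) -` U"
        using circ_pt_sphere by auto
      then show ?thesis using continuous_openin_preimage_gen[OF assms(2) U] by simp
    qed
    then show "openin (top_of_set (sphere 0 1)) (sphere 0 1 \<inter> f -` U)"
      using Abstract_Topology_2.continuous_imp_quotient_map[OF cc im, of "sphere 0 1 \<inter> f -` U"] by auto
  qed
qed


lemma circ_pt_add: "circ_pt n (x + y) = circ_pt n x * circ_pt n y"
  by (simp add: circ_pt_def cis_mult add_divide_distrib distrib_left)

text \<open>At height \<open>t\<close> the cylinder is rescaled around \<open>c\<close>, the middle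
  of the two exchanged positions, by the factor \<open>lam t\<close>, tapered by \<open>tent\<close>
  to the identity at distance 1. As \<open>tent\<close> has Lipschitz constant 1 and
  \<open>lam\<close> lies strictly between 0 and 2, the map stays increasing on each horizontal line
  at every time. This changes the displacement in ways that no change of height can, such as making
  it flat near an end.\<close>

lemma isotopic_twist_horizontal:
  assumes "n \<ge> 3" "i \<in> {1..n}" "continuous_on {0..1} lam" "\<And>t. t \<in> {0..1} \<Longrightarrow> 0 < lam t \<and> lam t < 2"
    "lam 0 = 1" "lam 1 = 1" "\<And>t. t \<in> {0..1} \<Longrightarrow> f t = 1/2 + lam t * (t - 1/2)"
    "\<And>t. t \<in> {0..1} \<Longrightarrow> f t \<in> {0..1}"
  shows "isotopic n (twist n {i} (\<lambda>_ t. t)) (twist n {i} (\<lambda>_. f))"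
proof -
  have n: "n \<ge> 1" "n \<ge> 2" using assms(1) by auto
  define c where "c = real i + 1/2"
  \<comment> \<open>The window coordinate is a choice. Where it is ambiguous, at the two ends of the
    window, \<open>tent\<close> vanishes for both candidates.\<close>
  define S where "S z = tent ((SOME x. \<bar>x - c\<bar> \<le> real n / 2 \<and> z = circ_pt n x) - c)" for z
  have half: "real n / 2 \<ge> 1" using assms(1) by simp
  have S: "S (circ_pt n x) = tent (x - c)" if x: "\<bar>x - c\<bar> \<le> real n / 2" for x
  proof -
    define y where "y = (SOME y. \<bar>y - c\<bar> \<le> real n / 2 \<and> circ_pt n x = circ_pt n y)"
    have "\<exists>y. \<bar>y - c\<bar> \<le> real n / 2 \<and> circ_pt n x = circ_pt n y" using x by blast
    from someI_ex[OF this] have y: "\<bar>y - c\<bar> \<le> real n / 2 \<and> circ_pt n x = circ_pt n y" unfolding y_def .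
    then consider "x = y" | "\<bar>x - c\<bar> = real n / 2" "\<bar>y - c\<bar> = real n / 2"
      using circ_pt_window_eq[OF n(1) x, of y] by blast
    then have "tent (y - c) = tent (x - c)" using half by cases (simp_all add: tent_zero)
    then show ?thesis by (simp add: S_def y_def)
  qed
  have Sc: "continuous_on (sphere 0 1) S"
  proof (rule continuous_on_sphere_descend[OF n(1), of c])
    have "continuous_on {c - real n / 2..c + real n / 2} (\<lambda>x. tent (x - c))"
      by (intro continuous_on_compose2[OF continuous_on_tent[of UNIV]] continuous_intros) auto
    then show "continuous_on {c - real n / 2..c + real n / 2} (\<lambda>x. S (circ_pt n x))"
    proof (rule continuous_on_eq)
      fix x assume "x \<in> {c - real n / 2..c + real n / 2}"
      then have "\<bar>x - c\<bar> \<le> real n / 2" unfolding atLeastAtMost_iff by linarith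
      then show "tent (x - c) = S (circ_pt n x)" using S by simp
    qed
  qed
  define mu where "mu s t = 1 + s * (lam t - 1)" for s t
  have mu: "\<bar>mu s t - 1\<bar> < 1" "0 < mu s t" if "s \<in> {0..1}" "t \<in> {0..1}" for s t
  proof -
    have "\<bar>lam t - 1\<bar> < 1" using assms(4)[OF that(2)] by auto
    then have "s * \<bar>lam t - 1\<bar> < 1" using that(1) by (smt (verit) atLeastAtMost_iff mult_left_le_one_le)
    then show "\<bar>mu s t - 1\<bar> < 1" using that(1) by (simp add: mu_def abs_mult)
    then show "0 < mu s t" by auto
  qed
  define F where "F s t x = x + (mu s t - 1) * tent (x - c)" for s t x
  have Fless: "F s t x < F s t y" if st: "s \<in> {0..1}" "t \<in> {0..1}" and xy: "x < y" for s t x y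
  proof -
    have "\<bar>(mu s t - 1) * (tent (y - c) - tent (x - c))\<bar> \<le> \<bar>mu s t - 1\<bar> * (y - x)"
      using tent_lipschitz[of "y - c" "x - c"] xy unfolding abs_mult by (intro mult_left_mono) auto
    also have "\<dots> < 1 * (y - x)" using mu(1)[OF st] xy by (intro mult_strict_right_mono) auto
    finally show ?thesis unfolding F_def by (simp add: algebra_simps abs_less_iff)
  qed
  have Fend: "F s t x = x" if "\<bar>x - c\<bar> \<ge> 1" for s t x using that by (simp add: F_def tent_zero)
  have Fwin: "\<bar>F s t x - c\<bar> \<le> real n / 2" "\<bar>F s t x - c\<bar> = real n / 2 \<Longrightarrow> \<bar>x - c\<bar> = real n / 2"
    if st: "s \<in> {0..1}" "t \<in> {0..1}" and x: "\<bar>x - c\<bar> \<le> real n / 2" for s t x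
  proof -
    have e: "F s t (c - real n / 2) = c - real n / 2" "F s t (c + real n / 2) = c + real n / 2"
      using half by (intro Fend; simp)+
    consider "x = c - real n / 2" | "x = c + real n / 2" | "c - real n / 2 < x" "x < c + real n / 2"
      using x by linarith
    then have "\<bar>F s t x - c\<bar> \<le> real n / 2 \<and> (\<bar>F s t x - c\<bar> = real n / 2 \<longrightarrow> \<bar>x - c\<bar> = real n / 2)"
    proof cases
      case 3
      have "c - real n / 2 < F s t x" "F s t x < c + real n / 2"
        using Fless[OF st 3(1)] Fless[OF st 3(2)] unfolding e by simp_all
      then show ?thesis by (auto simp: abs_if)
    qed (use e half in auto)
    then show "\<bar>F s t x - c\<bar> \<le> real n / 2" "\<bar>F s t x - c\<bar> = real n / 2 \<Longrightarrow> \<bar>x - c\<bar> = real n / 2" by blast+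
  qed
  define H where "H s q = (fst q * circ_pt n ((mu s (snd q) - 1) * S (fst q)), snd q)" for s :: real and q :: "complex \<times> real"
  have HF: "H s (circ_pt n x, t) = (circ_pt n (F s t x), t)" if "\<bar>x - c\<bar> \<le> real n / 2" for s t x
    by (simp add: H_def F_def S[OF that] circ_pt_add)
  have "continuous_on ({0..1} \<times> cylinder)
    (\<lambda>p. (fst (snd p) * circ_pt n ((1 + fst p * (lam (snd (snd p)) - 1) - 1) * S (fst (snd p))), snd (snd p)))"
    by (intro continuous_intros continuous_on_compose2[OF assms(3)] continuous_on_compose2[OF Sc])
      (auto simp: cylinder_def)
  then have cont: "continuous_on ({0..1} \<times> cylinder) (\<lambda>(s, q). H s q)"
    unfolding H_def mu_def case_prod_unfold .
  define g where "g s t = 1/2 + mu s t * (t - 1/2)" for s t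
  have Hst: "H s (twist n {i} (\<lambda>_ t. t) k t, t) = (twist n {i} (\<lambda>_. g s) k t, t)"
    if k: "k \<in> {1..n}" and t: "t \<in> {0..1}" for s k t
  proof -
    consider "k = i" | "k = nxt n i" "k \<noteq> i" | "k \<noteq> i" "k \<noteq> nxt n i" by blast
    then show ?thesis
    proof cases
      case 1
      have w: "\<bar>(real i + t) - c\<bar> \<le> 1/2" using t by (auto simp: c_def abs_if)
      then have "\<bar>(real i + t) - c\<bar> \<le> real n / 2" using half by linarith
      from HF[OF this, of s t] have "H s (circ_pt n (real i + t), t) = (circ_pt n (F s t (real i + t)), t)" .
      moreover have "F s t (real i + t) = real i + g s t"
        unfolding F_def tent_id[OF w] by (simp add: g_def c_def field_simps)
      ultimately show ?thesis using 1 by (simp add: twist_def twist_offset_def)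
    next
      case 2
      have w: "\<bar>(real i + 1 - t) - c\<bar> \<le> 1/2" using t by (auto simp: c_def abs_if)
      then have "\<bar>(real i + 1 - t) - c\<bar> \<le> real n / 2" using half by linarith
      from HF[OF this, of s t] have "H s (circ_pt n (real i + 1 - t), t) = (circ_pt n (F s t (real i + 1 - t)), t)" .
      moreover have "F s t (real i + 1 - t) = real i + 1 - g s t"
        unfolding F_def tent_id[OF w] by (simp add: g_def c_def field_simps)
      moreover have "twist n {i} (\<lambda>_. h) k t = circ_pt n (real i + 1 - h t)" for h
        using 2 prv_nxt[OF assms(2)] circ_pt_nxt[OF n(1) assms(2), of "- h t"] by (simp add: twist_def twist_offset_def)
      ultimately show ?thesis by simp
    next
      case 3
      obtain x where x: "\<bar>x - c\<bar> \<le> real n / 2" "circ_pt n (real k) = circ_pt n x"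
        using circ_pt_window[OF n(1) circ_pt_sphere] by blast
      then obtain m :: int where m: "x = real k + real n * of_int m" using circ_pt_eq_iff[OF n(1)] by metis
      \<comment> \<open>The remaining strands sit over integers other than \<open>i\<close> and
        \<open>i + 1\<close>, hence outside the support of the rescaling.\<close>
      define J where "J = int k + int n * m"
      have xJ: "x = of_int J" by (simp add: m J_def)
      have rJ: "res n J = k" using res_period res_int[OF k] by (simp add: J_def)
      have "J \<noteq> int i" "J \<noteq> int i + 1"
        using rJ 3 res_int[OF assms(2)] res_Suc[OF n(1), of "int i"] by auto
      then have "J \<le> int i - 1 \<or> J \<ge> int i + 2" by linarith
      then have "\<bar>x - c\<bar> \<ge> 1" unfolding xJ c_def by (auto simp: abs_if)
      then have "H s (circ_pt n (real k), t) = (circ_pt n (real k), t)" using HF[OF x(1)] Fend x(2) by simp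
      moreover have "prv n k \<noteq> i" using 3 nxt_prv[OF k] by auto
      ultimately show ?thesis using 3 by (simp add: twist_def twist_offset_def)
    qed
  qed
  have Hstrand: "H s ` strand (twist n {i} (\<lambda>_ t. t)) k = strand (twist n {i} (\<lambda>_. g s)) k" if "k \<in> {1..n}" for s k
    unfolding strand_eq image_image using Hst[OF that] by (intro image_cong) auto
  have gconv: "g s t = (1 - s) * t + s * f t" if "t \<in> {0..1}" for s t
    unfolding assms(7)[OF that] g_def mu_def by (simp add: algebra_simps)
  have cf: "cross_fun (g s)" if s: "s \<in> {0..1}" for s
    unfolding cross_fun_def
  proof (intro conjI ballI exI[of _ "1/2"])
    show "continuous_on {0..1} (g s)" unfolding g_def mu_def by (intro continuous_intros assms(3))
    show "g s 0 = 0" "g s 1 = 1" "g s (1/2) = 1/2" using assms(5,6) by (auto simp: g_def mu_def)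
    fix t :: real assume t: "t \<in> {0..1}"
    have "0 \<le> f t" "f t \<le> 1" using assms(8)[OF t] by auto
    then have "s * f t \<le> s" "0 \<le> s * f t" "(1 - s) * t \<le> (1 - s)" "0 \<le> (1 - s) * t"
      using s t by (auto simp: mult_left_le)
    then show "g s t \<in> {0..1}" unfolding gconv[OF t] by auto
    show "t < 1/2 \<longrightarrow> g s t < 1/2" "1/2 < t \<longrightarrow> 1/2 < g s t"
      using mu(2)[OF s t] by (auto simp: g_def mult_pos_neg)
  qed auto
  show ?thesis
  proof (rule isotopicI[OF cont])
    fix s :: real assume s: "s \<in> {0..1}"
    have repr: "\<exists>x t. \<bar>x - c\<bar> \<le> real n / 2 \<and> t \<in> {0..1} \<and> q = (circ_pt n x, t)" if "q \<in> cylinder" for q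
    proof -
      have "fst q \<in> sphere 0 1" "snd q \<in> {0..1}" using that by (auto simp: cylinder_def)
      moreover from this obtain x where "\<bar>x - c\<bar> \<le> real n / 2" "fst q = circ_pt n x" using circ_pt_window[OF n(1)] by blast
      ultimately show ?thesis by (metis prod.collapse)
    qed
    show "inj_on (H s) cylinder"
    proof (rule inj_onI)
      fix q r assume "q \<in> cylinder" "r \<in> cylinder" and e: "H s q = H s r"
      then obtain x t y u where q: "\<bar>x - c\<bar> \<le> real n / 2" "t \<in> {0..1}" "q = (circ_pt n x, t)"
        and r: "\<bar>y - c\<bar> \<le> real n / 2" "u \<in> {0..1}" "r = (circ_pt n y, u)" using repr by metis
      have tu: "u = t" and ce: "circ_pt n (F s t x) = circ_pt n (F s t y)"
        using e q(3) r(3) HF[OF q(1)] HF[OF r(1)] by auto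
      from circ_pt_window_eq[OF n(1) Fwin(1)[OF s q(2,1)] Fwin(1)[OF s q(2) r(1)] ce]
      have "circ_pt n x = circ_pt n y"
      proof (elim disjE conjE)
        assume "F s t x = F s t y"
        then have "x = y" using Fless[OF s q(2), of x y] Fless[OF s q(2), of y x] by (cases x y rule: linorder_cases) auto
        then show ?thesis by simp
      next
        assume a: "\<bar>F s t x - c\<bar> = real n / 2" "\<bar>F s t y - c\<bar> = real n / 2"
        have "\<bar>x - c\<bar> = real n / 2" "\<bar>y - c\<bar> = real n / 2"
          using Fwin(2)[OF s q(2,1) a(1)] Fwin(2)[OF s q(2) r(1) a(2)] by auto
        then have "x - c = real n / 2 \<or> x - c = - (real n / 2)" "y - c = real n / 2 \<or> y - c = - (real n / 2)"
          by linarith+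
        then have "x = y \<or> x = y + real n * of_int 1 \<or> y = x + real n * of_int 1" by auto
        then show ?thesis using circ_pt_period[OF n(1)] by metis
      qed
      then show "q = r" using q r tu by simp
    qed
    show "H s ` cylinder = cylinder"
    proof (intro equalityI subsetI)
      fix q assume "q \<in> H s ` cylinder"
      then show "q \<in> cylinder" by (auto simp: H_def cylinder_def norm_mult circ_pt_norm)
    next
      fix q assume "q \<in> cylinder"
      then obtain v t where v: "\<bar>v - c\<bar> \<le> real n / 2" "t \<in> {0..1}" "q = (circ_pt n v, t)" using repr by blast
      have e: "F s t (c - real n / 2) = c - real n / 2" "F s t (c + real n / 2) = c + real n / 2"
        using half by (intro Fend; simp)+
      have cF: "continuous_on {c - real n / 2..c + real n / 2} (F s t)"
        unfolding F_def by (intro continuous_intros continuous_on_compose2[OF continuous_on_tent[of UNIV]]) auto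
      obtain x where "c - real n / 2 \<le> x" "x \<le> c + real n / 2" "F s t x = v"
      proof -
        have "F s t (c - real n / 2) \<le> v" "v \<le> F s t (c + real n / 2)" "c - real n / 2 \<le> c + real n / 2"
          unfolding e using v(1) by linarith+
        then show ?thesis using IVT'[of "F s t" "c - real n / 2" v "c + real n / 2"] cF that by blast
      qed
      then have "\<bar>x - c\<bar> \<le> real n / 2" "F s t x = v" by linarith+
      then have "q = H s (circ_pt n x, t)" "(circ_pt n x, t) \<in> cylinder"
        using HF[of x s t] v(2,3) by (auto simp: cylinder_def circ_pt_norm)
      then show "q \<in> H s ` cylinder" by blast
    qed
    show "\<exists>E. is_diag n E \<and> (\<forall>k\<in>{1..n}. H s ` strand (twist n {i} (\<lambda>_ t. t)) k = strand E k)"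
      using Hstrand is_diag_twist[OF assms(1) separated_single[OF n(2) assms(2)], of "\<lambda>_. g s"] cf[OF s] by blast
    fix q assume "q \<in> cylinder_bd"
    then have "lam (snd q) = 1" using assms(5,6) by (auto simp: cylinder_bd_def)
    then show "H s q = q" by (simp add: H_def mu_def circ_pt_def)
  next
    fix q
    show "H 0 q = q" by (simp add: H_def mu_def circ_pt_def)
  next
    fix k assume k: "k \<in> {1..n}"
    have "twist n {i} (\<lambda>_. g 1) k t = twist n {i} (\<lambda>_. f) k t" if "t \<in> {0..1}" for t
      using gconv[OF that, of 1] by (simp add: twist_def twist_offset_def)
    then have "strand (twist n {i} (\<lambda>_. g 1)) k = strand (twist n {i} (\<lambda>_. f)) k"
      unfolding strand_eq by (intro image_cong) auto
    then show "H 1 ` strand (twist n {i} (\<lambda>_ t. t)) k = strand (twist n {i} (\<lambda>_. f)) k"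
      using Hstrand[OF k, of 1] by simp
  qed
qed

section \<open>Absorbing the identity diagram into a generator\<close>

definition half_first :: "real \<Rightarrow> real" where "half_first t = min 1 (2 * t)"

definition half_last :: "real \<Rightarrow> real" where "half_last t = max 0 (2 * t - 1)"

text \<open>\<open>half_first\<close> is constant on half of the interval while \<open>t\<close> is
  injective, so no change of height relates them. The rescaling makes the exchange end early:
  \<open>f\<close> follows \<open>t\<close> up to 3/4, continues with slope 2 and reaches 1 at 7/8.
  The homeomorphism \<open>rho\<close>, which sends \<open>[0,1/2]\<close> onto
  \<open>[0,7/8]\<close>, then yields \<open>half_first\<close> exactly. \<open>lam\<close> is the
  quotient of \<open>f t - 1/2\<close> by \<open>t - 1/2\<close> and stays between 1 and
  4/3.\<close>

lemma half_first_isotopy: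
  "\<exists>lam rho f. continuous_on {0..1} lam \<and> (\<forall>t\<in>{0..1}. 0 < lam t \<and> lam t < 2) \<and> lam 0 = 1 \<and> lam 1 = 1 \<and>
    (\<forall>t\<in>{0..1}. f t = 1/2 + lam t * (t - 1/2)) \<and> (\<forall>t\<in>{0..1}. f t \<in> {0..1}) \<and>
    inc_homeo rho \<and> (\<forall>t\<in>{0..1}. f (rho t) = half_first t)"
proof -
  define lam :: "real \<Rightarrow> real" where "lam t = (if t \<le> 3/4 then 1 else (min (2 * t - 3/4) 1 - 1/2) / (t - 1/2))" for t
  define f :: "real \<Rightarrow> real" where "f t = (if t \<le> 3/4 then t else min (2 * t - 3/4) 1)" for t
  define rho :: "real \<Rightarrow> real" where "rho t = min (2 * t) (min (3/8 + t) (3/4 + t/4))" for t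
  have "continuous_on {0..1} lam" unfolding lam_def
  proof (rule continuous_on_cases_le)
    show "continuous_on {t \<in> {0..1}. 3/4 \<le> t} (\<lambda>t::real. (min (2 * t - 3/4) 1 - 1/2) / (t - 1/2))"
      by (intro continuous_intros) auto
  qed (auto intro!: continuous_intros)
  moreover have "0 < lam t \<and> lam t < 2" if "t \<in> {0..1}" for t
    using that by (auto simp: lam_def field_simps min_def)
  moreover have "lam 0 = 1" "lam 1 = 1" by (auto simp: lam_def)
  moreover have "f t = 1/2 + lam t * (t - 1/2)" if "t \<in> {0..1}" for t
    using that by (auto simp: lam_def f_def field_simps)
  moreover have "f t \<in> {0..1}" if "t \<in> {0..1}" for t using that by (auto simp: f_def min_def)
  moreover have "inc_homeo rho"
  proof -
    have "continuous_on {0..1} rho" unfolding rho_def divide_inverse by (intro continuous_intros)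
    moreover have "strict_mono_on {0..1} rho" by (intro strict_mono_onI) (unfold rho_def min_def, auto)
    ultimately show ?thesis by (simp add: inc_homeo_def rho_def)
  qed
  moreover have "f (rho t) = half_first t" if "t \<in> {0..1}" for t
    using that unfolding f_def rho_def half_first_def min_def by auto
  ultimately show ?thesis by blast
qed

lemma isotopic_twist_half_first:
  assumes "n \<ge> 3" "i \<in> {1..n}"
  shows "isotopic n (twist n {i} (\<lambda>_ t. t)) (twist n {i} (\<lambda>_. half_first))"
    and "isotopic n (twist n {i} (\<lambda>_ t. t)) (twist n {i} (\<lambda>_. half_last))"
proof -
  obtain lam rho f where lam: "continuous_on {0..1} lam" "\<And>t. t \<in> {0..1} \<Longrightarrow> 0 < lam t \<and> lam t < 2" "lam 0 = 1" "lam 1 = 1"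
    "\<And>t. t \<in> {0..1} \<Longrightarrow> f t = 1/2 + lam t * (t - 1/2)" "\<And>t. t \<in> {0..1} \<Longrightarrow> f t \<in> {0..1}"
    and rho: "inc_homeo rho" "\<And>t. t \<in> {0..1} \<Longrightarrow> f (rho t) = half_first t"
    using half_first_isotopy by metis
  have n2: "n \<ge> 2" using assms by simp
  have dg: "is_diag n (twist n {i} (\<lambda>_ t. t))"
    by (intro is_diag_twist[OF assms(1)] separated_single assms(2) cross_fun_id n2)
  have concl: "isotopic n (twist n {i} (\<lambda>_ t. t)) (twist n {i} (\<lambda>_. h))"
    if l: "continuous_on {0..1} l" "\<And>t. t \<in> {0..1} \<Longrightarrow> 0 < l t \<and> l t < 2" "l 0 = 1" "l 1 = 1"
    "\<And>t. t \<in> {0..1} \<Longrightarrow> e t = 1/2 + l t * (t - 1/2)" "\<And>t. t \<in> {0..1} \<Longrightarrow> e t \<in> {0..1}"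
    and r: "inc_homeo r" "\<And>t. t \<in> {0..1} \<Longrightarrow> e (r t) = h t" for l e r h
  proof -
    have iso: "isotopic n (twist n {i} (\<lambda>_ t. t)) (twist n {i} (\<lambda>_. e))"
      by (rule isotopic_twist_horizontal[OF assms l])
    have "cross_fun e" unfolding cross_fun_def
    proof (intro conjI ballI exI[of _ "1/2"])
      have "continuous_on {0..1} (\<lambda>t. 1/2 + l t * (t - 1/2))" by (intro continuous_intros l(1))
      then show "continuous_on {0..1} e" by (rule continuous_on_eq) (simp add: l(5))
      show "e 0 = 0" "e 1 = 1" "e (1/2) = 1/2" using l(5)[of 0] l(5)[of 1] l(5)[of "1/2"] l(3,4) by simp_all
      fix t :: real assume t: "t \<in> {0..1}"
      show "e t \<in> {0..1}" by (rule l(6)[OF t])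
      show "t < 1/2 \<longrightarrow> e t < 1/2" "1/2 < t \<longrightarrow> 1/2 < e t"
        unfolding l(5)[OF t] using l(2)[OF t] by (auto simp: mult_pos_neg)
    qed auto
    then have de: "is_diag n (twist n {i} (\<lambda>_. e))"
      by (intro is_diag_twist[OF assms(1)] separated_single assms(2) n2)
    have "isotopic n (\<lambda>k t. twist n {i} (\<lambda>_. e) k (r t)) (twist n {i} (\<lambda>_. e))"
      by (rule isotopic_reparam[OF de r(1)])
    then have "isotopic n (twist n {i} (\<lambda>_. h)) (twist n {i} (\<lambda>_. e))"
    proof (rule isotopic_cong)
      fix k :: nat and t :: real assume "t \<in> {0..1}"
      then show "twist n {i} (\<lambda>_. e) k (r t) = twist n {i} (\<lambda>_. h) k t"
        using r(2) by (simp add: twist_def twist_offset_def)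
    qed simp
    moreover have "is_diag n (\<lambda>k t. twist n {i} (\<lambda>_. e) k (r t))" by (rule is_diag_reparam[OF de r(1)])
    ultimately show ?thesis
    proof -
      have "isotopic n (twist n {i} (\<lambda>_. e)) (\<lambda>k t. twist n {i} (\<lambda>_. e) k (r t))"
        by (rule isotopic_sym[OF isotopic_reparam[OF de r(1)] is_diag_reparam[OF de r(1)]])
      then have "isotopic n (twist n {i} (\<lambda>_. e)) (twist n {i} (\<lambda>_. h))"
      proof (rule isotopic_cong)
        fix k :: nat and t :: real assume "t \<in> {0..1}"
        then show "twist n {i} (\<lambda>_. e) k (r t) = twist n {i} (\<lambda>_. h) k t"
          using r(2) by (simp add: twist_def twist_offset_def)
      qed simp
      then show ?thesis using isotopic_trans[OF iso _ dg] by blast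
    qed
  qed
  show "isotopic n (twist n {i} (\<lambda>_ t. t)) (twist n {i} (\<lambda>_. half_first))"
    by (rule concl[OF lam rho])
  \<comment> \<open>Turning the cylinder upside down reduces the second claim to the same data,
    since \<open>half_last t = 1 - half_first (1 - t)\<close>.\<close>
  have flip: "1 - t \<in> {0..1}" if "t \<in> {0..1::real}" for t using that by auto
  show "isotopic n (twist n {i} (\<lambda>_ t. t)) (twist n {i} (\<lambda>_. half_last))"
  proof (rule concl[of "\<lambda>t. lam (1 - t)" "\<lambda>t. 1 - f (1 - t)" "\<lambda>t. 1 - rho (1 - t)"])
    show "continuous_on {0..1} (\<lambda>t. lam (1 - t))"
      by (intro continuous_on_compose2[OF lam(1)] continuous_intros) auto
    show "lam (1 - 0) = 1" "lam (1 - 1) = 1" using lam(3,4) by simp_all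
    show "inc_homeo (\<lambda>t. 1 - rho (1 - t))" unfolding inc_homeo_def
    proof (intro conjI)
      have rc: "continuous_on {0..1} rho" using rho(1) unfolding inc_homeo_def by blast
      have "continuous_on {0..1} (\<lambda>t. rho (1 - t))"
        by (intro continuous_on_compose2[OF rc] continuous_intros) auto
      then show "continuous_on {0..1} (\<lambda>t. 1 - rho (1 - t))" by (intro continuous_intros)
      show "strict_mono_on {0..1} (\<lambda>t. 1 - rho (1 - t))"
      proof (rule strict_mono_onI)
        fix s t :: real assume "s \<in> {0..1}" "t \<in> {0..1}" "s < t"
        then show "1 - rho (1 - s) < 1 - rho (1 - t)"
          using inc_homeo_less[OF rho(1) flip flip, of t s] by simp
      qed
      show "1 - rho (1 - 0) = 0" "1 - rho (1 - 1) = 1" using rho(1) unfolding inc_homeo_def by simp_all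
    qed
    fix t :: real assume t: "t \<in> {0..1}"
    note t' = flip[OF t]
    show "0 < lam (1 - t) \<and> lam (1 - t) < 2" by (rule lam(2)[OF t'])
    show "1 - f (1 - t) = 1/2 + lam (1 - t) * (t - 1/2)" unfolding lam(5)[OF t'] by (simp add: algebra_simps)
    show "1 - f (1 - t) \<in> {0..1}" using lam(6)[OF t'] by simp
    have "1 - (1 - rho (1 - t)) = rho (1 - t)" by simp
    then have "1 - f (1 - (1 - rho (1 - t))) = 1 - half_first (1 - t)" using rho(2)[OF t'] by simp
    also have "\<dots> = half_last t" by (simp add: half_first_def half_last_def min_def max_def)
    finally show "1 - f (1 - (1 - rho (1 - t))) = half_last t" .
  qed
qed

lemma twist_one:
  assumes "n \<ge> 2" "i \<in> {1..n}" "k \<in> {1..n}" "f t = 1"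
  shows "twist n {i} (\<lambda>_. f) k t = circ_pt n (real (if k = i then nxt n i else if k = nxt n i then i else k))"
proof -
  have n: "n \<ge> 1" using assms(1) by simp
  consider "k = i" | "k = nxt n i" "k \<noteq> i" | "k \<noteq> i" "k \<noteq> nxt n i" by blast
  then show ?thesis
  proof cases
    case 1
    then show ?thesis using assms(4) circ_pt_nxt[OF n assms(2), of 0] by (simp add: twist_def twist_offset_def)
  next
    case 2
    then show ?thesis using assms(4) circ_pt_nxt[OF n assms(2), of "-1"] prv_nxt[OF assms(2)]
      by (simp add: twist_def twist_offset_def)
  next
    case 3
    then have "prv n k \<noteq> i" using nxt_prv[OF assms(3)] by auto
    then show ?thesis using 3 by (simp add: twist_def twist_offset_def)
  qed
qed

lemma top_pos_gen:
  assumes "n \<ge> 3" "i \<in> {1..n}" "k \<in> {1..n}"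
  shows "top_pos n (gen_diag n i) k = (if k = i then nxt n i else if k = nxt n i then i else k)"
proof (rule top_pos_eqI)
  show "n \<ge> 1" using assms by simp
  show "(if k = i then nxt n i else if k = nxt n i then i else k) \<in> {1..n}"
    using nxt_range[OF assms(2)] assms(2,3) by presburger
  have "n \<ge> 2" using assms by simp
  then show "gen_diag n i k 1 = circ_pt n (real (if k = i then nxt n i else if k = nxt n i then i else k))"
    using twist_one[OF _ assms(2,3), of "\<lambda>t. t" 1] gen_diag_twist[OF assms(3,2), of 1] by simp
qed

lemma top_pos_id: "n \<ge> 1 \<Longrightarrow> k \<in> {1..n} \<Longrightarrow> top_pos n (id_diag n) k = k"
  by (rule top_pos_eqI) (simp_all add: id_diag_def)

lemma stack_gen_id:
  assumes "n \<ge> 3" "i \<in> {1..n}" "k \<in> {1..n}"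
  shows "stack n (gen_diag n i) (id_diag n) k t = twist n {i} (\<lambda>_. half_first) k t"
proof (cases "t \<le> 1/2")
  case True
  then have "half_first t = 2 * t" by (simp add: half_first_def)
  then show ?thesis using True gen_diag_twist[OF assms(3,2), of "2 * t"]
    by (simp add: stack_def twist_def twist_offset_def)
next
  case False
  then have "half_first t = 1" "n \<ge> 2" using assms(1) by (auto simp: half_first_def)
  then show ?thesis using False top_pos_gen[OF assms] twist_one[OF _ assms(2,3), of half_first t]
    by (simp add: stack_def id_diag_def)
qed

lemma stack_id_gen:
  assumes "n \<ge> 3" "i \<in> {1..n}" "k \<in> {1..n}"
  shows "stack n (id_diag n) (gen_diag n i) k t = twist n {i} (\<lambda>_. half_last) k t"
proof (cases "t \<le> 1/2")
  case True
  then have "half_last t = 0" by (simp add: half_last_def)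
  then show ?thesis using True by (simp add: stack_def id_diag_def twist_def twist_offset_def)
next
  case False
  then have e: "half_last t = 2 * t - 1" by (simp add: half_last_def)
  have "top_pos n (id_diag n) k = k" using top_pos_id assms by simp
  then have "stack n (id_diag n) (gen_diag n i) k t = gen_diag n i k (2 * t - 1)" using False by (simp add: stack_def)
  also have "\<dots> = twist n {i} (\<lambda>_. half_last) k t"
    using gen_diag_twist[OF assms(3,2), of "2 * t - 1"] e by (simp add: twist_def twist_offset_def)
  finally show ?thesis .
qed

text \<open>Stacking with the identity makes the displacement of a generator constant on one half of
  the heights; the result is literally the twist along \<open>half_first\<close> or
  \<open>half_last\<close>.\<close>

lemma isotopic_gen_id:
  assumes "n \<ge> 3" "i \<in> {1..n}"
  shows "isotopic n (gen_diag n i) (stack n (gen_diag n i) (id_diag n))"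
    and "isotopic n (gen_diag n i) (stack n (id_diag n) (gen_diag n i))"
proof -
  show "isotopic n (gen_diag n i) (stack n (gen_diag n i) (id_diag n))"
    by (rule isotopic_cong[OF isotopic_twist_half_first(1)[OF assms]])
      (simp_all only: gen_diag_twist[OF _ assms(2)] stack_gen_id[OF assms])
  show "isotopic n (gen_diag n i) (stack n (id_diag n) (gen_diag n i))"
    by (rule isotopic_cong[OF isotopic_twist_half_first(2)[OF assms]])
      (simp_all only: gen_diag_twist[OF _ assms(2)] stack_id_gen[OF assms])
qed

section \<open>Exchanging distant crossings\<close>

lemma cross_fun_reparam:
  assumes "cross_fun f" "inc_homeo g"
  shows "cross_fun (\<lambda>t. f (g t))"
proof -
  obtain c where c: "0 < c" "c < 1" "f c = 1/2" "\<And>t. t \<in> {0..1} \<Longrightarrow> (t < c \<longrightarrow> f t < 1/2) \<and> (c < t \<longrightarrow> 1/2 < f t)"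
    using assms(1) unfolding cross_fun_def by blast
  have f: "continuous_on {0..1} f" "f 0 = 0" "f 1 = 1" "\<And>t. t \<in> {0..1} \<Longrightarrow> f t \<in> {0..1}"
    using assms(1) unfolding cross_fun_def by blast+
  have g: "continuous_on {0..1} g" "g 0 = 0" "g 1 = 1" using assms(2) unfolding inc_homeo_def by blast+
  obtain d where d: "d \<in> {0..1}" "g d = c" using inc_homeo_surj[OF assms(2), of c] c by auto
  have "d \<noteq> 0" "d \<noteq> 1" using d g c by auto
  show ?thesis unfolding cross_fun_def
  proof (intro conjI ballI exI[of _ d])
    show "continuous_on {0..1} (\<lambda>t. f (g t))"
      using continuous_on_compose2[OF f(1) g(1)] inc_homeo_image[OF assms(2)] by simp
    show "0 < d" "d < 1" "f (g d) = 1/2" "f (g 0) = 0" "f (g 1) = 1"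
      using d c g f \<open>d \<noteq> 0\<close> \<open>d \<noteq> 1\<close> by auto
    fix t :: real assume t: "t \<in> {0..1}"
    have gt: "g t \<in> {0..1}" by (rule inc_homeo_mem[OF assms(2) t])
    show "f (g t) \<in> {0..1}" by (rule f(4)[OF gt])
    show "t < d \<longrightarrow> f (g t) < 1/2" "d < t \<longrightarrow> 1/2 < f (g t)"
      using c(4)[OF gt] inc_homeo_less[OF assms(2) t d(1)] inc_homeo_less[OF assms(2) d(1) t] d(2) by auto
  qed
qed

text \<open>Only the column between the positions \<open>i\<close> and \<open>i + 1\<close> is moved vertically; a bump function on
  the circle makes this an ambient isotopy.\<close>

lemma isotopic_twist_column:
  assumes "n \<ge> 3" "separated n I" "i \<in> I" "\<And>j. j \<in> I \<Longrightarrow> cross_fun (\<alpha> j)" "\<And>j. j \<in> I \<Longrightarrow> cross_fun (\<beta> j)"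
    "inc_homeo f" "\<And>t. t \<in> {0..1} \<Longrightarrow> \<beta> i (f t) = \<alpha> i t" "\<And>j. j \<in> I \<Longrightarrow> j \<noteq> i \<Longrightarrow> \<beta> j = \<alpha> j"
  shows "isotopic n (twist n I \<alpha>) (twist n I \<beta>)"
proof -
  have n: "n \<ge> 1" "n \<ge> 2" using assms(1) by auto
  have I: "I \<subseteq> {1..n}" "\<And>j. j \<in> I \<Longrightarrow> nxt n j \<notin> I" using assms(2) unfolding separated_def by auto
  have finI: "finite I" using I(1) finite_subset by blast
  define arc where "arc j = circ_pt n ` {real j..real j + 1}" for j
  have arc_compact: "compact (arc j)" for j
    unfolding arc_def by (intro compact_continuous_image continuous_on_circ_pt continuous_on_id compact_Icc)
  define S0 where "S0 = (\<Union>j\<in>I - {i}. arc j)"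
  have S0: "compact S0" unfolding S0_def using finI arc_compact by (intro compact_UN) auto
  have disj: "arc i \<inter> S0 = {}"
  proof (rule ccontr)
    assume "arc i \<inter> S0 \<noteq> {}"
    then obtain z where z: "z \<in> arc i" "z \<in> S0" by blast
    then obtain j where j: "j \<in> I" "j \<noteq> i" "z \<in> arc j" unfolding S0_def by blast
    obtain x y where x: "x \<in> {real i..real i + 1}" and y: "y \<in> {real j..real j + 1}"
      and e: "circ_pt n x = circ_pt n y" using z(1) j(3) unfolding arc_def by blast
    obtain m :: int where m: "x = y + real n * of_int m" using e circ_pt_eq_iff[OF n(1)] by blast
    define J where "J = int j + int n * m"
    have rJ: "res n J = j" using res_period res_int j(1) I(1) by (auto simp: J_def)
    have ri: "res n (int i) = i" using res_int assms(3) I(1) by blast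
    have "real_of_int J = real j + real n * of_int m" by (simp add: J_def)
    then have "real_of_int J \<le> real i + 1" "real i \<le> of_int J + 1" using x y m by auto
    then have "J \<le> int i + 1" "int i \<le> J + 1" by linarith+
    then consider "J = int i" | "J = int i + 1" | "int i = J + 1" by linarith
    then show False
    proof cases
      case 1
      then show ?thesis using rJ ri j by simp
    next
      case 2
      then have "j = nxt n i" using rJ ri res_Suc[OF n(1), of "int i"] by simp
      then show ?thesis using I(2)[OF assms(3)] j by simp
    next
      case 3
      then have "i = nxt n j" using rJ ri res_Suc[OF n(1), of J] by simp
      then show ?thesis using I(2)[OF j(1)] assms(3) by simp
    qed
  qed
  \<comment> \<open>The arc swept by the column at \<open>i\<close> and the arcs swept by the other
    columns are disjoint compact sets, as \<open>I\<close> contains no two adjacent indices. A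
    Urysohn function separates them.\<close>
  obtain kap :: "complex \<Rightarrow> real" where kap: "continuous_on UNIV kap" "\<And>z. kap z \<in> closed_segment 1 0"
    "\<And>z. z \<in> arc i \<Longrightarrow> kap z = 1" "\<And>z. z \<in> S0 \<Longrightarrow> kap z = 0"
    using Urysohn[of "arc i" S0 "1::real" 0] compact_imp_closed[OF arc_compact] compact_imp_closed[OF S0] disj by metis
  have kap01: "kap z \<in> {0..1}" for z using kap(2)[of z] by (simp add: closed_segment_eq_real_ivl)
  define c where "c s t = (1 - s) * t + s * f t" for s t
  have c: "inc_homeo (c s)" if "s \<in> {0..1}" for s
    using inc_homeo_convex[OF assms(6) that] unfolding c_def .
  define H where "H s q = (fst q, c (s * kap (fst q)) (snd q))" for s :: real and q :: "complex \<times> real"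
  have sk: "s * kap z \<in> {0..1}" if "s \<in> {0..1}" for s z
    using kap01[of z] that by (auto simp: mult_le_one)
  have fc: "continuous_on {0..1} f" "f 0 = 0" "f 1 = 1" using assms(6) unfolding inc_homeo_def by auto
  have "continuous_on ({0..1} \<times> cylinder) (\<lambda>p. (fst (snd p), (1 - fst p * kap (fst (snd p))) * snd (snd p) +
      (fst p * kap (fst (snd p))) * f (snd (snd p))))"
    by (intro continuous_intros continuous_on_compose2[OF fc(1)] continuous_on_compose2[OF kap(1)]) (auto simp: cylinder_def)
  then have cont: "continuous_on ({0..1} \<times> cylinder) (\<lambda>(s, q). H s q)"
    unfolding H_def c_def case_prod_unfold .
  have cross_val: "\<alpha> j t \<in> {0..1}" if "j \<in> I" "t \<in> {0..1}" for j t
    using assms(4)[OF that(1)] that(2) unfolding cross_fun_def by blast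
  have in_arc: "twist n I \<alpha> k t \<in> arc j" if j: "j \<in> I" "k = j \<or> k = nxt n j" and t: "t \<in> {0..1}" for j k t
  proof -
    have jn: "j \<in> {1..n}" using I j by blast
    show ?thesis using j(2)
    proof
      assume "k = j"
      then show ?thesis using j(1) cross_val[OF j(1) t] unfolding arc_def twist_def twist_offset_def by auto
    next
      assume k: "k = nxt n j"
      then have "twist n I \<alpha> k t = circ_pt n (real j + 1 - \<alpha> j t)"
        using I(2)[OF j(1)] j(1) prv_nxt[OF jn] circ_pt_nxt[OF n(1) jn, of "- \<alpha> j t"]
        by (simp add: twist_def twist_offset_def)
      then show ?thesis using cross_val[OF j(1) t] unfolding arc_def by auto
    qed
  qed
  have Hstrand: "H s ` strand (twist n I \<alpha>) k = strand (twist n I (\<alpha>(i := \<lambda>t. \<alpha> i (g t)))) k"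
    if s: "s \<in> {0..1}" and k: "k \<in> {1..n}"
      and g: "inc_homeo g" "\<And>t. t \<in> {0..1} \<Longrightarrow> g (c s t) = t" for s k g
  proof -
    let ?E = "twist n I (\<alpha>(i := \<lambda>t. \<alpha> i (g t)))"
    have Hs: "H s ` strand (twist n I \<alpha>) k =
      (\<lambda>t. (twist n I \<alpha> k t, c (s * kap (twist n I \<alpha> k t)) t)) ` {0..1}"
      by (simp add: strand_eq image_image H_def)
    consider (col) "k = i \<or> k = nxt n i" | (oth) j where "j \<in> I" "j \<noteq> i" "k = j \<or> k = nxt n j"
      | (vert) "k \<notin> I" "prv n k \<notin> I"
      using nxt_prv[OF k] assms(3) by metis
    then show ?thesis
    proof cases
      case col
      have "H s ` strand (twist n I \<alpha>) k = (\<lambda>t. (?E k (c s t), c s t)) ` {0..1}" unfolding Hs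
      proof (rule image_cong)
        fix t :: real assume t: "t \<in> {0..1}"
        have "kap (twist n I \<alpha> k t) = 1" using kap(3) in_arc[OF assms(3) col t] by blast
        moreover have "?E k (c s t) = twist n I \<alpha> k t"
          using col g(2)[OF t] I(2)[OF assms(3)] assms(3) prv_nxt[of i n] I(1)
          by (auto simp: twist_def twist_offset_def)
        ultimately show "(twist n I \<alpha> k t, c (s * kap (twist n I \<alpha> k t)) t) = (?E k (c s t), c s t)" by simp
      qed simp
      also have "\<dots> = (\<lambda>u. (?E k u, u)) ` (c s ` {0..1})" by (simp add: image_image)
      finally show ?thesis using inc_homeo_image[OF c[OF s]] by (simp add: strand_eq)
    next
      case oth
      have "H s ` strand (twist n I \<alpha>) k = (\<lambda>t. (?E k t, t)) ` {0..1}" unfolding Hs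
      proof (rule image_cong)
        fix t :: real assume t: "t \<in> {0..1}"
        have "twist n I \<alpha> k t \<in> S0" using in_arc[OF oth(1,3) t] oth(1,2) unfolding S0_def by blast
        then have "kap (twist n I \<alpha> k t) = 0" by (rule kap(4))
        moreover have "?E k t = twist n I \<alpha> k t"
        proof -
          have "k \<noteq> i" using oth I(2)[OF oth(1)] assms(3) by blast
          moreover have "k \<in> I \<or> prv n k \<noteq> i" using oth I(1) prv_nxt[of j n] by auto
          ultimately show ?thesis by (auto simp: twist_def twist_offset_def)
        qed
        ultimately show "(twist n I \<alpha> k t, c (s * kap (twist n I \<alpha> k t)) t) = (?E k t, t)" by (simp add: c_def)
      qed simp
      then show ?thesis by (simp add: strand_eq)
    next
      case vert
      \<comment> \<open>A vertical strand slides along itself, whatever value the bump function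
        takes on it.\<close>
      have e: "twist n I \<alpha> k t = circ_pt n (real k)" "?E k t = circ_pt n (real k)" for t
        using vert by (auto simp: twist_def twist_offset_def)
      have "H s ` strand (twist n I \<alpha>) k = (\<lambda>u. (circ_pt n (real k), u)) ` (c (s * kap (circ_pt n (real k))) ` {0..1})"
        unfolding Hs e by (simp add: image_image)
      then show ?thesis using inc_homeo_image[OF c[OF sk[OF s]]] by (simp add: strand_eq e)
    qed
  qed
  show ?thesis
  proof (rule isotopicI[OF cont])
    fix s :: real assume s: "s \<in> {0..1}"
    show "inj_on (H s) cylinder"
    proof (rule inj_onI)
      fix q r assume qr: "q \<in> cylinder" "r \<in> cylinder" "H s q = H s r"
      then have z: "snd q \<in> {0..1}" "snd r \<in> {0..1}" "fst q = fst r" by (auto simp: H_def cylinder_def)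
      then have "c (s * kap (fst q)) (snd q) = c (s * kap (fst q)) (snd r)" using qr(3) by (simp add: H_def)
      then show "q = r" using inc_homeo_eq[OF c[OF sk[OF s]] z(1,2)] z(3) by (simp add: prod_eq_iff)
    qed
    show "H s ` cylinder = cylinder"
    proof (intro equalityI subsetI)
      fix q assume "q \<in> H s ` cylinder"
      then obtain z t where zt: "z \<in> sphere 0 1" "t \<in> {0..1}" "q = (z, c (s * kap z) t)" by (auto simp: H_def cylinder_def)
      then show "q \<in> cylinder" using inc_homeo_mem[OF c[OF sk[OF s]] zt(2)] by (simp add: cylinder_def)
    next
      fix q assume q: "q \<in> cylinder"
      then have "snd q \<in> {0..1}" by (auto simp: cylinder_def)
      then obtain t where t: "t \<in> {0..1}" "c (s * kap (fst q)) t = snd q"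
        using inc_homeo_surj[OF c[OF sk[OF s]]] by blast
      then have "q = H s (fst q, t)" "(fst q, t) \<in> cylinder" using q by (auto simp: H_def cylinder_def)
      then show "q \<in> H s ` cylinder" by blast
    qed
    obtain g where g: "inc_homeo g" "\<forall>t\<in>{0..1}. g (c s t) = t" using inc_homeo_inverse[OF c[OF s]] by blast
    have "is_diag n (twist n I (\<alpha>(i := \<lambda>t. \<alpha> i (g t))))"
      using assms(4) cross_fun_reparam[OF assms(4)[OF assms(3)] g(1)]
      by (intro is_diag_twist[OF assms(1,2)]) simp
    then show "\<exists>E. is_diag n E \<and> (\<forall>k\<in>{1..n}. H s ` strand (twist n I \<alpha>) k = strand E k)"
      using Hstrand[OF s _ g(1)] g(2) by blast
    fix q assume "q \<in> cylinder_bd"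
    then show "H s q = q" using fc by (auto simp: H_def c_def cylinder_bd_def)
  next
    fix q :: "complex \<times> real"
    show "H 0 q = q" by (simp add: H_def c_def)
  next
    fix k assume k: "k \<in> {1..n}"
    obtain g where g: "inc_homeo g" "\<forall>t\<in>{0..1}. g (f t) = t" "\<forall>t\<in>{0..1}. f (g t) = t"
      using inc_homeo_inverse[OF assms(6)] by blast
    have "H 1 ` strand (twist n I \<alpha>) k = strand (twist n I (\<alpha>(i := \<lambda>t. \<alpha> i (g t)))) k"
      using g(2) by (intro Hstrand[OF _ k g(1)]) (simp_all add: c_def)
    also have "\<dots> = strand (twist n I \<beta>) k"
    proof -
      have "(\<alpha>(i := \<lambda>t. \<alpha> i (g t))) j t = \<beta> j t" if "j \<in> I" "t \<in> {0..1}" for j t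
        using assms(7)[OF inc_homeo_mem[OF g(1) that(2)]] assms(8)[OF that(1)] g(3) that(2) by auto
      then have "twist n I (\<alpha>(i := \<lambda>t. \<alpha> i (g t))) k t = twist n I \<beta> k t" if "t \<in> {0..1}" for t
        using that by (simp add: twist_def twist_offset_def)
      then show ?thesis unfolding strand_eq by (intro image_cong) auto
    qed
    finally show "H 1 ` strand (twist n I \<alpha>) k = strand (twist n I \<beta>) k" .
  qed
qed

text \<open>\<open>ramp1\<close> and \<open>ramp2\<close> describe exchanges that take place at
  heights \<open>[1/4,1/2]\<close> and \<open>[1/2,3/4]\<close>. The flat quarters at the two ends
  come from padding with identities. They allow one ramp to be carried to the other by a
  homeomorphism of \<open>[0,1]\<close> fixing the ends; the unpadded \<open>half_first\<close> and
  \<open>half_last\<close> admit none.\<close>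

definition ramp1 :: "real \<Rightarrow> real" where "ramp1 t = max 0 (min 1 (4 * t - 1))"

definition ramp2 :: "real \<Rightarrow> real" where "ramp2 t = max 0 (min 1 (4 * t - 2))"

lemma cross_fun_ramp1: "cross_fun ramp1"
  unfolding cross_fun_def
proof (intro conjI ballI exI[of _ "3/8"])
  show "continuous_on {0..1} ramp1" unfolding ramp1_def by (intro continuous_intros)
qed (unfold ramp1_def max_def min_def, auto)

lemma cross_fun_ramp2: "cross_fun ramp2"
  unfolding cross_fun_def
proof (intro conjI ballI exI[of _ "5/8"])
  show "continuous_on {0..1} ramp2" unfolding ramp2_def by (intro continuous_intros)
qed (unfold ramp2_def max_def min_def, auto)

lemma stack_half_twists:
  assumes "n \<ge> 3" "i \<in> {1..n}" "j \<in> {1..n}" "i \<noteq> j" "j \<noteq> nxt n i" "i \<noteq> nxt n j" "k \<in> {1..n}" "t \<in> {0..1}"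
  shows "stack n (stack n (id_diag n) (gen_diag n i)) (stack n (gen_diag n j) (id_diag n)) k t =
    twist n {i, j} (\<lambda>m. if m = i then ramp1 else ramp2) k t" (is "stack n ?A ?B k t = ?R")
proof -
  have n: "n \<ge> 1" "n \<ge> 2" using assms(1) by auto
  have pk: "prv n k = i \<longleftrightarrow> k = nxt n i" "prv n k = j \<longleftrightarrow> k = nxt n j"
    using prv_nxt nxt_prv assms(2,3,7) by metis+
  have pi: "prv n i \<noteq> j" "prv n (nxt n i) = i" "prv n (nxt n j) = j" "nxt n i \<noteq> i" "nxt n j \<noteq> nxt n i"
    using nxt_prv[OF assms(2)] prv_nxt[OF assms(2)] prv_nxt[OF assms(3)] nxt_neq[OF n(2) assms(2)] assms
      nxt_inj[OF assms(3,2)] by auto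
  have dA: "is_diag n ?A" and dB: "is_diag n ?B"
    using is_diag_stack[OF n(1)] is_diag_gen[OF assms(1)] is_diag_id[OF assms(1)] assms(2,3) by blast+
  show ?thesis
  proof (cases "t \<le> 1/2")
    case True
    have "stack n ?A ?B k t = twist n {i} (\<lambda>_. half_last) k (2 * t)"
      unfolding stack_low[OF True] by (rule stack_id_gen[OF assms(1,2,7)])
    moreover have "half_last (2 * t) = ramp1 t" "ramp2 t = 0"
      using True by (auto simp: half_last_def ramp1_def ramp2_def)
    ultimately show ?thesis using pk assms(4,5) by (auto simp: twist_def twist_offset_def)
  next
    case False
    define l where "l = (if k = i then nxt n i else if k = nxt n i then i else k)"
    have "top_pos n ?A k = l"
      using top_pos_stack[OF n(1) is_diag_id[OF assms(1)] is_diag_gen[OF assms(1,2)] assms(7)]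
        top_pos_id[OF n(1) assms(7)] top_pos_gen[OF assms(1,2,7)] by (simp add: l_def)
    moreover have l: "l \<in> {1..n}" using nxt_range[OF assms(2)] assms(2,7) unfolding l_def by presburger
    ultimately have e: "stack n ?A ?B k t = twist n {j} (\<lambda>_. half_first) l (2 * t - 1)"
      using stack_high[OF n(1) dA dB assms(7), of t] False stack_gen_id[OF assms(1,3)] by simp
    have v: "half_first (2 * t - 1) = ramp2 t" "ramp1 t = 1"
      using False assms(8) by (auto simp: half_first_def ramp1_def ramp2_def)
    consider "k = i" | "k = nxt n i" "k \<noteq> i" | "k \<noteq> i" "k \<noteq> nxt n i" by blast
    then show ?thesis
    proof cases
      case 1
      then show ?thesis unfolding e using v pi assms(4,5) circ_pt_nxt[OF n(1) assms(2), of 0]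
        by (simp add: l_def twist_def twist_offset_def)
    next
      case 2
      then show ?thesis unfolding e using v pi assms(4,5) circ_pt_nxt[OF n(1) assms(2), of "-1"]
        by (auto simp: l_def twist_def twist_offset_def)
    next
      case 3
      then show ?thesis unfolding e using v pk by (auto simp: l_def twist_def twist_offset_def)
    qed
  qed
qed

text \<open>Both products are brought to the twist that performs the two exchanges at the same
  height, and that diagram is symmetric in \<open>i\<close> and \<open>j\<close>.\<close>

lemma isotopic_comm_gens:
  assumes "n \<ge> 3" "i \<in> {1..n}" "j \<in> {1..n}" "i \<noteq> j" "j \<noteq> nxt n i" "i \<noteq> nxt n j"
  shows "isotopic n (stack n (gen_diag n i) (gen_diag n j)) (stack n (gen_diag n j) (gen_diag n i))"
proof -
  have n: "n \<ge> 1" "n \<ge> 2" using assms(1) by auto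
  \<comment> \<open>The intervals \<open>[0,1/4]\<close>, \<open>[1/4,1/2]\<close>,
    \<open>[1/2,1]\<close> go to \<open>[0,1/2]\<close>, \<open>[1/2,3/4]\<close>,
    \<open>[3/4,1]\<close>, so that \<open>ramp2\<close> after \<open>f\<close> is
    \<open>ramp1\<close>. The slopes decrease, hence a minimum.\<close>
  define f :: "real \<Rightarrow> real" where "f t = min (2 * t) (min (t + 1/4) (t/2 + 1/2))" for t
  have f: "inc_homeo f"
  proof -
    have "continuous_on {0..1} f" unfolding f_def divide_inverse by (intro continuous_intros)
    moreover have "strict_mono_on {0..1} f" by (intro strict_mono_onI) (unfold f_def min_def, auto)
    ultimately show ?thesis by (simp add: inc_homeo_def f_def)
  qed
  have rf: "ramp2 (f t) = ramp1 t" if "t \<in> {0..1}" for t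
    using that unfolding f_def ramp1_def ramp2_def min_def max_def by auto
  have step: "isotopic n (stack n (gen_diag n i) (gen_diag n j)) (twist n {i, j} (\<lambda>_. ramp2))"
    if ij: "i \<in> {1..n}" "j \<in> {1..n}" "i \<noteq> j" "j \<noteq> nxt n i" "i \<noteq> nxt n j" for i j
  proof -
    let ?W = "stack n (stack n (id_diag n) (gen_diag n i)) (stack n (gen_diag n j) (id_diag n))"
    note d = is_diag_gen[OF assms(1) ij(1)] is_diag_gen[OF assms(1) ij(2)] is_diag_id[OF assms(1)]
    have "isotopic n (stack n (gen_diag n i) (gen_diag n j)) ?W"
      by (intro isotopic_stack n isotopic_gen_id assms(1) ij d is_diag_stack)
    then have 1: "isotopic n (stack n (gen_diag n i) (gen_diag n j)) (twist n {i, j} (\<lambda>m. if m = i then ramp1 else ramp2))"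
      by (rule isotopic_cong) (simp_all only: stack_half_twists[OF assms(1) ij])
    have sep: "separated n {i, j}" using ij nxt_neq[OF n(2)] by (auto simp: separated_def)
    have 2: "isotopic n (twist n {i, j} (\<lambda>m. if m = i then ramp1 else ramp2)) (twist n {i, j} (\<lambda>_. ramp2))"
      by (rule isotopic_twist_column[OF assms(1) sep, of i _ _ f])
        (use cross_fun_ramp1 cross_fun_ramp2 f rf in auto)
    show ?thesis by (rule isotopic_trans[OF 1 2 is_diag_stack[OF n(1) d(1,2)]])
  qed
  have d: "is_diag n (stack n (gen_diag n j) (gen_diag n i))" "is_diag n (stack n (gen_diag n i) (gen_diag n j))"
    using is_diag_stack[OF n(1)] is_diag_gen[OF assms(1)] assms(2,3) by blast+
  have "isotopic n (stack n (gen_diag n j) (gen_diag n i)) (twist n {i, j} (\<lambda>_. ramp2))"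
    using step[of j i] assms by (simp add: insert_commute)
  then have "isotopic n (twist n {i, j} (\<lambda>_. ramp2)) (stack n (gen_diag n j) (gen_diag n i))"
    by (rule isotopic_sym[OF _ d(1)])
  then show ?thesis using isotopic_trans[OF step[OF assms(2-6)] _ d(2)] by blast
qed

section \<open>Diagrams of words\<close>

text \<open>For the empty word the two diagrams coincide pointwise. Otherwise the identity is moved
  by associativity next to the first generator, which absorbs it.\<close>

lemma isotopic_id_word:
  assumes "n \<ge> 3" "v \<in> lists {1..n}"
  shows "isotopic n (stack n (id_diag n) (word_diag n v)) (word_diag n v)"
proof (cases v)
  case Nil
  have "isotopic n (id_diag n) (id_diag n)" by (rule isotopic_refl[OF is_diag_id[OF assms(1)]])
  then show ?thesis unfolding Nil
    by (rule isotopic_cong) (simp_all add: stack_def id_diag_def top_pos_id[unfolded id_diag_def])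
next
  case (Cons i w)
  have n: "n \<ge> 1" using assms by simp
  have i: "i \<in> {1..n}" and w: "w \<in> lists {1..n}" using Cons assms(2) by auto
  note d = is_diag_id[OF assms(1)] is_diag_gen[OF assms(1) i] is_diag_word[OF assms(1) w]
  have ds: "is_diag n (stack n (id_diag n) (gen_diag n i))" by (rule is_diag_stack[OF n d(1,2)])
  have 1: "isotopic n (stack n (id_diag n) (word_diag n v)) (stack n (stack n (id_diag n) (gen_diag n i)) (word_diag n w))"
    using isotopic_stack_assoc[OF n d] Cons by simp
  have "isotopic n (stack n (id_diag n) (gen_diag n i)) (gen_diag n i)"
    by (rule isotopic_sym[OF isotopic_gen_id(2)[OF assms(1) i] d(2)])
  then have 2: "isotopic n (stack n (stack n (id_diag n) (gen_diag n i)) (word_diag n w)) (word_diag n v)"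
    using isotopic_stack[OF n _ isotopic_refl[OF d(3)] ds d(3) d(2) d(3)] Cons by simp
  show ?thesis
    by (rule isotopic_trans[OF 1 2 is_diag_stack[OF n d(1) is_diag_word[OF assms]]])
qed

lemma isotopic_word_append:
  assumes "n \<ge> 3" "v \<in> lists {1..n}"
  shows "u \<in> lists {1..n} \<Longrightarrow> isotopic n (stack n (word_diag n u) (word_diag n v)) (word_diag n (u @ v))"
proof (induction u rule: list.induct)
  case Nil
  then show ?case using isotopic_id_word[OF assms] by simp
next
  case (Cons i u)
  have n: "n \<ge> 1" using assms by simp
  have i: "i \<in> {1..n}" and u: "u \<in> lists {1..n}" using Cons.prems by auto
  have uv: "u @ v \<in> lists {1..n}" using u assms(2) by simp
  note d = is_diag_gen[OF assms(1) i] is_diag_word[OF assms(1) u] is_diag_word[OF assms]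
  note duv = is_diag_word[OF assms(1) uv]
  have 0: "isotopic n (stack n (gen_diag n i) (stack n (word_diag n u) (word_diag n v)))
     (stack n (stack n (gen_diag n i) (word_diag n u)) (word_diag n v))"
    by (rule isotopic_stack_assoc[OF n d])
  have ds: "is_diag n (stack n (gen_diag n i) (stack n (word_diag n u) (word_diag n v)))"
    "is_diag n (stack n (word_diag n u) (word_diag n v))"
    "is_diag n (stack n (stack n (gen_diag n i) (word_diag n u)) (word_diag n v))"
    by (intro is_diag_stack n d)+
  have 2: "isotopic n (stack n (gen_diag n i) (stack n (word_diag n u) (word_diag n v))) (stack n (gen_diag n i) (word_diag n (u @ v)))"
    by (rule isotopic_stack[OF n isotopic_refl[OF d(1)] Cons.IH[OF u] d(1) ds(2) d(1) duv])
  show ?case using isotopic_trans[OF isotopic_sym[OF 0 ds(1)] 2 ds(3)] by simp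
qed

lemma isotopic_word_cong:
  assumes "n \<ge> 3" "u \<in> lists {1..n}" "v \<in> lists {1..n}" "isotopic n (word_diag n u) (word_diag n v)"
    "a \<in> lists {1..n}" "b \<in> lists {1..n}"
  shows "isotopic n (word_diag n (a @ u @ b)) (word_diag n (a @ v @ b))"
proof -
  have n: "n \<ge> 1" using assms(1) by simp
  have key: "isotopic n (word_diag n (a @ b)) (word_diag n (c @ d))"
    if "a \<in> lists {1..n}" "b \<in> lists {1..n}" "c \<in> lists {1..n}" "d \<in> lists {1..n}"
      "isotopic n (word_diag n a) (word_diag n c)" "isotopic n (word_diag n b) (word_diag n d)" for a b c d
  proof -
    note D = is_diag_word[OF assms(1)]
    have ab: "a @ b \<in> lists {1..n}" using that by simp
    note S = is_diag_stack[OF n D[OF that(1)] D[OF that(2)]]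
    have 1: "isotopic n (word_diag n (a @ b)) (stack n (word_diag n a) (word_diag n b))"
      by (rule isotopic_sym[OF isotopic_word_append[OF assms(1) that(2,1)] S])
    have 2: "isotopic n (stack n (word_diag n a) (word_diag n b)) (stack n (word_diag n c) (word_diag n d))"
      by (rule isotopic_stack[OF n that(5,6) D[OF that(1)] D[OF that(2)] D[OF that(3)] D[OF that(4)]])
    have 3: "isotopic n (stack n (word_diag n c) (word_diag n d)) (word_diag n (c @ d))"
      by (rule isotopic_word_append[OF assms(1) that(4,3)])
    show ?thesis by (rule isotopic_trans[OF 1 isotopic_trans[OF 2 3 S] D[OF ab]])
  qed
  have r: "isotopic n (word_diag n x) (word_diag n x)" if "x \<in> lists {1..n}" for x
    by (rule isotopic_refl[OF is_diag_word[OF assms(1) that]])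
  have "isotopic n (word_diag n (u @ b)) (word_diag n (v @ b))"
    by (rule key[OF assms(2,6,3,6,4) r[OF assms(6)]])
  then show ?thesis using assms by (intro key r) simp_all
qed

text \<open>The diagram of a two-letter word is a nested stack ending in the identity, so the
  commutation of generators is applied between two associativity isotopies and then put in
  context.\<close>

lemma comm_cong_isotopic:
  assumes "n \<ge> 3"
  shows "comm_cong n u v \<Longrightarrow> isotopic n (word_diag n u) (word_diag n v)"
proof (induction rule: comm_cong.induct)
  case (swap i j u v)
  have n: "n \<ge> 1" using assms by simp
  note g = is_diag_gen[OF assms swap(1)] is_diag_gen[OF assms swap(2)] and e = is_diag_id[OF assms]
  have w: "word_diag n [i, j] = stack n (gen_diag n i) (stack n (gen_diag n j) (id_diag n))"
    "word_diag n [j, i] = stack n (gen_diag n j) (stack n (gen_diag n i) (id_diag n))" by simp_all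
  have 1: "isotopic n (word_diag n [i, j]) (stack n (stack n (gen_diag n i) (gen_diag n j)) (id_diag n))"
    unfolding w by (rule isotopic_stack_assoc[OF n g(1,2) e])
  have 2: "isotopic n (stack n (stack n (gen_diag n i) (gen_diag n j)) (id_diag n)) (stack n (stack n (gen_diag n j) (gen_diag n i)) (id_diag n))"
    by (intro isotopic_stack n isotopic_comm_gens[OF assms swap(1-5)] isotopic_refl is_diag_stack g e)
  have 3: "isotopic n (stack n (stack n (gen_diag n j) (gen_diag n i)) (id_diag n)) (word_diag n [j, i])"
    unfolding w by (rule isotopic_sym[OF isotopic_stack_assoc[OF n g(2,1) e]]) (intro is_diag_stack n g e)
  have d: "is_diag n (word_diag n [i, j])" "is_diag n (stack n (stack n (gen_diag n i) (gen_diag n j)) (id_diag n))"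
    unfolding w by (intro is_diag_stack n g e)+
  have "isotopic n (word_diag n [i, j]) (word_diag n [j, i])"
    by (rule isotopic_trans[OF 1 isotopic_trans[OF 2 3 d(2)] d(1)])
  then show ?case using swap by (intro isotopic_word_cong[OF assms]) simp_all
next
  case (refl u)
  then show ?case by (intro isotopic_refl is_diag_word assms)
next
  case (trans u v w)
  then show ?case using isotopic_trans is_diag_word[OF assms] comm_cong_lists by blast
qed

text \<open>An explicit lift of the strand starting over \<open>a\<close>. Each letter takes half of
  the remaining height: the first three letters occupy \<open>[0,1/2]\<close>,
  \<open>[1/2,3/4]\<close>, \<open>[3/4,7/8]\<close>, and the strands they exchange cross at the
  midpoints \<open>1/4\<close>, \<open>5/8\<close>, \<open>13/16\<close>. These constants recur in
  the moves and in the contractible regions.\<close>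

primrec word_lift :: "nat \<Rightarrow> nat list \<Rightarrow> int \<Rightarrow> real \<Rightarrow> real"
  where "word_lift n [] a t = of_int a"
  | "word_lift n (i # w) a t =
      (if t \<le> 1/2 then of_int a + 2 * t * of_int (swp n i a - a) else word_lift n w (swp n i a) (2 * t - 1))"

lemma word_lift_0: "word_lift n w a 0 = of_int a"
  by (induction w) auto

lemma word_lift_1: "word_lift n w a 1 = of_int (perm n w a)"
  by (induction w arbitrary: a) auto

lemma continuous_on_word_lift: "continuous_on {0..1} (word_lift n w a)"
proof (induction w arbitrary: a)
  case Nil
  have "word_lift n [] a = (\<lambda>t. of_int a)" by auto
  then show ?case by simp
next
  case (Cons i w)
  have "continuous_on {0..1} (\<lambda>t. if t \<le> 1/2 then of_int a + 2 * t * of_int (swp n i a - a)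
    else word_lift n w (swp n i a) (2 * t - 1))"
  proof (rule continuous_on_cases_le)
    show "continuous_on {t \<in> {0..1}. 1/2 \<le> t} (\<lambda>t. word_lift n w (swp n i a) (2 * t - 1))"
      by (intro continuous_on_compose2[OF Cons.IH] continuous_intros) auto
    fix t :: real assume t: "t = 1/2"
    show "of_int a + 2 * t * of_int (swp n i a - a) = word_lift n w (swp n i a) (2 * t - 1)"
      unfolding t using word_lift_0[of n w "swp n i a"] by simp
  qed (intro continuous_intros)+
  then show ?case by (simp only: word_lift.simps[abs_def])
qed

lemma top_pos_gen_res:
  assumes "n \<ge> 3" "i \<in> {1..n}"
  shows "top_pos n (gen_diag n i) (res n a) = res n (swp n i a)"
proof -
  have n: "n \<ge> 1" using assms by simp
  show ?thesis using top_pos_gen[OF assms res_range[OF n]] res_Suc[OF n, of a] res_pred[OF n, of a] prv_nxt[OF assms(2)]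
    by (auto simp: swp_def)
qed

lemma word_diag_lift:
  assumes "n \<ge> 3"
  shows "w \<in> lists {1..n} \<Longrightarrow> t \<in> {0..1} \<Longrightarrow> word_diag n w (res n a) t = circ_pt n (word_lift n w a t)"
proof (induction w arbitrary: a t rule: list.induct)
  case Nil
  then show ?case using circ_pt_res[of n a] assms by (simp add: id_diag_def)
next
  case (Cons i w)
  have n: "n \<ge> 1" using assms by simp
  have i: "i \<in> {1..n}" and w: "w \<in> lists {1..n}" using Cons.prems by auto
  note r = res_range[OF n, of a]
  show ?case
  proof (cases "t \<le> 1/2")
    case True
    have "word_diag n (i # w) (res n a) t = twist n {i} (\<lambda>_ t. t) (res n a) (2 * t)"
      using True gen_diag_twist[OF r i] by (simp add: stack_low)
    also have "\<dots> = circ_pt n (of_int (int (res n a)) + 2 * t * of_int (swp n i a - a))"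
      using prv_nxt[OF i] nxt_prv[OF r] by (auto simp: twist_def twist_offset_def swp_def)
    also have "\<dots> = circ_pt n (of_int a + 2 * t * of_int (swp n i a - a))"
      by (rule circ_pt_shift[OF n]) (rule res_int[OF r])
    finally show ?thesis using True by simp
  next
    case False
    have "word_diag n (i # w) (res n a) t = word_diag n w (res n (swp n i a)) (2 * t - 1)"
      using False stack_high[OF n is_diag_gen[OF assms i] is_diag_word[OF assms w] r, of t] top_pos_gen_res[OF assms i] by simp
    also have "\<dots> = circ_pt n (word_lift n w (swp n i a) (2 * t - 1))" using Cons.IH[OF w] Cons.prems(2) False by simp
    finally show ?thesis using False by simp
  qed
qed

section \<open>The rightmost path through a diagram\<close>

text \<open>\<open>dominates\<close> compares the right ends of the monotone paths that run inside two diagrams and may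
  change strands at crossings. Unlike the strands themselves, the rightmost such path is not affected by
  the moves.\<close>

definition dominates :: "nat \<Rightarrow> diag \<Rightarrow> diag \<Rightarrow> bool"
  where "dominates n D' D \<longleftrightarrow> (\<forall>g. lift_path n D {1..n} g \<longrightarrow>
    (\<exists>g'. lift_path n D' {1..n} g' \<and> g' 0 = g 0 \<and> g 1 \<le> g' 1))"

text \<open>The maximum is stated as a value that is attained and bounds all others. Uniqueness and
  the transfer along mutual domination are then immediate.\<close>

definition top_end :: "nat \<Rightarrow> diag \<Rightarrow> int \<Rightarrow> int \<Rightarrow> bool"
  where "top_end n D a b \<longleftrightarrow> (\<exists>g. lift_path n D {1..n} g \<and> g 0 = of_int a \<and> g 1 = of_int b) \<and>
    (\<forall>g. lift_path n D {1..n} g \<longrightarrow> g 0 = of_int a \<longrightarrow> g 1 \<le> of_int b)"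

lemma top_end_unique: "top_end n D a b \<Longrightarrow> top_end n D a c \<Longrightarrow> b = c"
  unfolding top_end_def by (metis of_int_le_iff order_antisym)

lemma top_end_dominates:
  assumes "dominates n D' D" "dominates n D D'" "top_end n D a b"
  shows "top_end n D' a b"
proof -
  have up: "g 1 \<le> of_int b" if g: "lift_path n D' {1..n} g" "g 0 = of_int a" for g
  proof -
    obtain h where h: "lift_path n D {1..n} h" "h 0 = g 0" "g 1 \<le> h 1"
      using assms(2) g(1) unfolding dominates_def by blast
    have "h 1 \<le> of_int b" using assms(3) h(1,2) g(2) unfolding top_end_def by simp
    then show ?thesis using h(3) by simp
  qed
  obtain g where "lift_path n D {1..n} g" "g 0 = of_int a" "g 1 = of_int b"
    using assms(3) unfolding top_end_def by blast
  then obtain h where h: "lift_path n D' {1..n} h" "h 0 = of_int a" "of_int b \<le> h 1"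
    using assms(1) unfolding dominates_def by metis
  then have "h 1 = of_int b" using up by force
  then show ?thesis using h up unfolding top_end_def by blast
qed

lemma isotopic_dominates:
  assumes "n \<ge> 1" "isotopic n D D'" "is_diag n D" "is_diag n D'"
  shows "dominates n D' D" "dominates n D D'"
  using isotopic_lift_path[OF assms(1,2,3,4) subset_refl]
    isotopic_lift_path[OF assms(1) isotopic_sym[OF assms(2,3)] assms(4,3) subset_refl]
  unfolding dominates_def by (metis order_refl)+

lemma strand_lift:
  assumes "n \<ge> 1" "is_diag n D" "k \<in> {1..n}" "s \<in> {0..1}" "D k s = circ_pt n a"
  shows "\<exists>g. continuous_on {0..1} g \<and> (\<forall>t\<in>{0..1}. D k t = circ_pt n (g t)) \<and> g s = a"
  using circ_lift_contractible_at[OF assms(1) convex_imp_contractible[OF convex_real_interval(5)]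
      is_diagD(1,2)[OF assms(2,3)] assms(4,5)] .

text \<open>At each height the maximum agrees with one of the two paths and so lies in the diagram;
  it changes strands only where they meet.\<close>

lemma lift_path_max:
  assumes "lift_path n D K g" "lift_path n D K h"
  shows "lift_path n D K (\<lambda>t. max (g t) (h t))"
  unfolding lift_path_def
proof (intro conjI ballI)
  show "continuous_on {0..1} (\<lambda>t. max (g t) (h t))"
    using assms unfolding lift_path_def by (intro continuous_intros) auto
  fix t :: real assume "t \<in> {0..1}"
  then show "\<exists>k\<in>K. D k t = circ_pt n (max (g t) (h t))" using assms unfolding lift_path_def max_def by simp
qed

lemma mem_diag_image: "(z, t) \<in> diag_image n D \<longleftrightarrow> t \<in> {0..1} \<and> (\<exists>k\<in>{1..n}. D k t = z)"
  unfolding diag_image_def by (auto simp: mem_strand)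

text \<open>A path that avoids the box is copied. One that enters it stays inside from bottom to
  top, and there it is replaced: it follows the arc of \<open>D'\<close> with the same lower end up
  to a meeting point with \<open>hs ! M\<close>, and then that arc, whose upper end is to the right
  of all upper ends of \<open>gs\<close>. Above the box either the old path or the continuation of
  the new strand may end further right, so their maximum is taken.\<close>

lemma dominates_box:
  assumes n: "n \<ge> 1" and D': "is_diag n D'" and box: "is_box n x0 x1 t0 t1"
    and out: "agree_outside n x0 x1 t0 t1 D D'"
    and arcs: "box_arcs n x0 x1 t0 t1 D gs" "box_arcs n x0 x1 t0 t1 D' hs" "length gs = length hs"
    and M: "M < length hs" "\<And>j. j < length hs \<Longrightarrow> (gs ! j) t1 \<le> (hs ! M) t1"
    and bot: "\<And>j. j < length hs \<Longrightarrow> (gs ! j) t0 = (hs ! j) t0"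
    and meet: "\<And>j. j < length hs \<Longrightarrow> j \<noteq> M \<Longrightarrow> meets t0 t1 (hs ! j) (hs ! M) \<noteq> {}"
  shows "dominates n D' D"
  unfolding dominates_def
proof (intro allI impI)
  fix g assume g: "lift_path n D {1..n} g"
  have t01: "0 \<le> t0" "t0 < t1" "t1 \<le> 1" and xs: "x0 < x1" using box unfolding is_box_def by auto
  have sub: "{t0..t1} \<subseteq> {0..1}" using t01 by auto
  have gc: "continuous_on {0..1} g" and gk: "\<And>t. t \<in> {0..1} \<Longrightarrow> \<exists>k\<in>{1..n}. D k t = circ_pt n (g t)"
    using g unfolding lift_path_def by auto
  obtain ks where ks: "set ks \<subseteq> {1..n}" "length ks = length gs"
    "\<And>j t. j < length gs \<Longrightarrow> t \<in> {t0..t1} \<Longrightarrow> x0 < (gs ! j) t \<and> (gs ! j) t < x1 \<and> D (ks ! j) t = circ_pt n ((gs ! j) t)"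
    "\<And>k t. k \<in> {1..n} - set ks \<Longrightarrow> t \<in> {t0..t1} \<Longrightarrow> D k t \<notin> circ_pt n ` {x0..x1}"
    using arcs(1) unfolding box_arcs_def by blast
  obtain ls where ls: "set ls \<subseteq> {1..n}" "length ls = length hs"
    "\<And>j. j < length hs \<Longrightarrow> continuous_on {t0..t1} (hs ! j)"
    "\<And>j t. j < length hs \<Longrightarrow> t \<in> {t0..t1} \<Longrightarrow> D' (ls ! j) t = circ_pt n ((hs ! j) t)"
    using arcs(2) unfolding box_arcs_def by blast
  have transfer: "\<exists>k\<in>{1..n}. D' k t = circ_pt n x"
    if "\<exists>k\<in>{1..n}. D k t = circ_pt n x" "t \<in> {0..1}" "t \<notin> {t0..t1} \<or> circ_pt n x \<notin> circ_pt n ` {x0..x1}" for t x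
  proof -
    have "(circ_pt n x, t) \<in> diag_image n D" using that(1,2) unfolding mem_diag_image by blast
    moreover have "(circ_pt n x, t) \<notin> circ_pt n ` {x0..x1} \<times> {t0..t1}" using that(3) by auto
    ultimately have "(circ_pt n x, t) \<in> diag_image n D'" using out unfolding agree_outside_def by blast
    then show ?thesis unfolding mem_diag_image by blast
  qed
  have hit: "\<exists>j<length gs. \<exists>m::int. g t = (gs ! j) t + real n * of_int m"
    if tt: "t \<in> {t0..t1}" "circ_pt n (g t) \<in> circ_pt n ` {x0..x1}" for t
  proof -
    obtain k where k: "k \<in> {1..n}" "D k t = circ_pt n (g t)" using gk tt(1) sub by blast
    then have "k \<in> set ks" using ks(4)[of k t] tt by auto
    then obtain j where j: "j < length gs" "ks ! j = k" using ks(2) by (metis in_set_conv_nth)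
    then have "circ_pt n (g t) = circ_pt n ((gs ! j) t)" using ks(3)[OF j(1) tt(1)] k by simp
    then show ?thesis using circ_pt_eq_iff[OF n] j(1) by blast
  qed
  show "\<exists>g'. lift_path n D' {1..n} g' \<and> g' 0 = g 0 \<and> g 1 \<le> g' 1"
  proof (cases "\<exists>t\<in>{t0..t1}. circ_pt n (g t) \<in> circ_pt n ` {x0..x1}")
    case False
    then have "lift_path n D' {1..n} g"
      unfolding lift_path_def using gc transfer[OF gk] by blast
    then show ?thesis by blast
  next
    case True
    then obtain s where s: "s \<in> {t0..t1}" "circ_pt n (g s) \<in> circ_pt n ` {x0..x1}" by blast
    obtain j0 m where m: "j0 < length gs" "g s = (gs ! j0) s + real n * of_int m" using hit[OF s] by blast
    \<comment> \<open>The diagram \<open>D\<close> has no point on the side walls of the box,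
      because every arc in the box lies strictly between them. A translate by a period cannot help,
      the box being narrower than \<open>n\<close>.\<close>
    have nohit: "g t \<noteq> y + real n * of_int l" if ty: "t \<in> {t0..t1}" "y = x0 \<or> y = x1" for t y l
    proof
      assume a: "g t = y + real n * of_int l"
      then have "circ_pt n (g t) = circ_pt n y" using circ_pt_period[OF n] by simp
      then have c: "circ_pt n (g t) \<in> circ_pt n ` {x0..x1}" using ty(2) xs by auto
      obtain j l' where j: "j < length gs" "g t = (gs ! j) t + real n * of_int l'" using hit[OF ty(1) c] by blast
      have b: "x0 < (gs ! j) t" "(gs ! j) t < x1" using ks(3)[OF j(1) ty(1)] by auto
      have eq: "y - (gs ! j) t = real n * of_int (l' - l)" using a j(2) by (simp add: algebra_simps)
      have "\<bar>y - (gs ! j) t\<bar> < real n" "y - (gs ! j) t \<noteq> 0" using b ty(2) box unfolding is_box_def by auto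
      then have "real n * \<bar>of_int (l' - l)\<bar> < real n * 1" "l' - l \<noteq> 0" unfolding eq by (auto simp: abs_mult)
      then have "\<bar>real_of_int (l' - l)\<bar> < 1" using n by (simp only: mult_less_cancel_left)
      then show False using \<open>l' - l \<noteq> 0\<close> by linarith
    qed
    have inbox: "x0 + real n * of_int m < g t \<and> g t < x1 + real n * of_int m" if t: "t \<in> {t0..t1}" for t
    proof -
      have gs_s: "x0 + real n * of_int m < g s" "g s < x1 + real n * of_int m" using ks(3)[OF m(1) s(1)] m(2) by auto
      have conn: "connected (g ` {t0..t1})"
        by (intro connected_continuous_image continuous_on_subset[OF gc sub] connected_Icc)
      have no: "y + real n * of_int m \<notin> g ` {t0..t1}" if "y = x0 \<or> y = x1" for y
      proof
        assume "y + real n * of_int m \<in> g ` {t0..t1}"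
        then obtain t' where "t' \<in> {t0..t1}" "g t' = y + real n * of_int m" by (metis imageE)
        then show False using nohit[of t' y m] that by blast
      qed
      have mem: "g s \<in> g ` {t0..t1}" "g t \<in> g ` {t0..t1}" using s t by auto
      show ?thesis
      proof (intro conjI; rule ccontr)
        assume "\<not> x0 + real n * of_int m < g t"
        then have "x0 + real n * of_int m \<in> g ` {t0..t1}" using connectedD_interval[OF conn mem(2,1)] gs_s by simp
        then show False using no[of x0] by simp
      next
        assume "\<not> g t < x1 + real n * of_int m"
        then have "x1 + real n * of_int m \<in> g ` {t0..t1}" using connectedD_interval[OF conn mem(1,2)] gs_s by simp
        then show False using no[of x1] by simp
      qed
    qed
    \<comment> \<open>As the box is narrower than \<open>n\<close>, its lifts are disjoint and the
      path stays in the translate with index \<open>m\<close>.\<close>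
    have hitm: "\<exists>j<length gs. g t = (gs ! j) t + real n * of_int m" if t: "t \<in> {t0..t1}" for t
    proof -
      have "g t = (g t - real n * of_int m) + real n * of_int m" by simp
      then have "circ_pt n (g t) = circ_pt n (g t - real n * of_int m)" using circ_pt_period[OF n] by metis
      moreover have "g t - real n * of_int m \<in> {x0..x1}" using inbox[OF t] by auto
      ultimately obtain j l where j: "j < length gs" "g t = (gs ! j) t + real n * of_int l" using hit[OF t] by blast
      have b: "x0 < (gs ! j) t" "(gs ! j) t < x1" using ks(3)[OF j(1) t] by auto
      have "\<bar>real n * of_int (l - m)\<bar> < real n" using inbox[OF t] b j(2) box unfolding is_box_def
        by (auto simp: algebra_simps abs_less_iff)
      then have "real n * \<bar>of_int (l - m)\<bar> < real n * 1" by (simp add: abs_mult)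
      then have "\<bar>real_of_int (l - m)\<bar> < 1" using n by (simp only: mult_less_cancel_left)
      then have "l = m" by linarith
      then show ?thesis using j by blast
    qed
    have t0m: "t0 \<in> {t0..t1}" "t1 \<in> {t0..t1}" using t01 by auto
    obtain j where j: "j < length hs" "g t0 = (hs ! j) t0 + real n * of_int m"
      using hitm[OF t0m(1)] bot arcs(3) by auto
    obtain j' where j': "j' < length hs" "g t1 = (gs ! j') t1 + real n * of_int m"
      using hitm[OF t0m(2)] arcs(3) by auto
    \<comment> \<open>At the top of the box the old path is not to the right of the new one, so the
      maximum starts on \<open>u\<close> and the pieces fit continuously.\<close>
    have le1: "g t1 \<le> (hs ! M) t1 + real n * of_int m" using M(2)[OF j'(1)] j'(2) by simp
    obtain c where c: "c \<in> {t0..t1}" "(hs ! j) c = (hs ! M) c"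
    proof (cases "j = M")
      case False
      then show ?thesis using meet[OF j(1) False] that unfolding meets_def by blast
    qed (use that t0m in blast)
    have M01: "ls ! M \<in> {1..n}" "ls ! j \<in> {1..n}" using ls(1,2) M(1) j(1) by (auto simp: subset_iff)
    have "D' (ls ! M) t1 = circ_pt n ((hs ! M) t1 + real n * of_int m)"
      using ls(4)[OF M(1) t0m(2)] circ_pt_period[OF n] by simp
    then obtain u where u: "continuous_on {0..1} u" "\<forall>t\<in>{0..1}. D' (ls ! M) t = circ_pt n (u t)"
      "u t1 = (hs ! M) t1 + real n * of_int m"
      using strand_lift[OF n D' M01(1), of t1] t01 by auto
    define g' where "g' t = (if t \<le> t0 then g t else if t \<le> c then (hs ! j) t + real n * of_int m
      else if t \<le> t1 then (hs ! M) t + real n * of_int m else max (g t) (u t))" for t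
    have cj: "continuous_on {t0..t1} (hs ! j)" "continuous_on {t0..t1} (hs ! M)" using ls(3) j(1) M(1) by blast+
    have g4: "continuous_on {0..1} (\<lambda>t. max (g t) (u t))" using gc u(1) by (intro continuous_intros)
    have c3: "continuous_on {c..1} (\<lambda>t. if t \<le> t1 then (hs ! M) t + real n * of_int m else max (g t) (u t))"
    proof (rule continuous_on_cases_le)
      show "continuous_on {t \<in> {c..1}. t \<le> t1} (\<lambda>t. (hs ! M) t + real n * of_int m)"
        by (rule continuous_on_add[OF continuous_on_subset[OF cj(2)] continuous_on_const]) (use c in auto)
      show "continuous_on {t \<in> {c..1}. t1 \<le> t} (\<lambda>t. max (g t) (u t))"
        by (rule continuous_on_subset[OF g4]) (use c t01 in auto)
      fix t assume "t = t1"
      then show "(hs ! M) t + real n * of_int m = max (g t) (u t)" using u(3) le1 by simp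
    qed (rule continuous_on_id)
    have c2: "continuous_on {t0..1} (\<lambda>t. if t \<le> c then (hs ! j) t + real n * of_int m
      else if t \<le> t1 then (hs ! M) t + real n * of_int m else max (g t) (u t))"
    proof (rule continuous_on_cases_le)
      show "continuous_on {t \<in> {t0..1}. t \<le> c} (\<lambda>t. (hs ! j) t + real n * of_int m)"
        by (rule continuous_on_add[OF continuous_on_subset[OF cj(1)] continuous_on_const]) (use c in auto)
      show "continuous_on {t \<in> {t0..1}. c \<le> t} (\<lambda>t. if t \<le> t1 then (hs ! M) t + real n * of_int m else max (g t) (u t))"
        by (rule continuous_on_subset[OF c3]) auto
      fix t assume "t = c"
      then show "(hs ! j) t + real n * of_int m =
        (if t \<le> t1 then (hs ! M) t + real n * of_int m else max (g t) (u t))" using c by simp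
    qed (rule continuous_on_id)
    have "continuous_on {0..1} g'" unfolding g'_def
    proof (rule continuous_on_cases_le)
      show "continuous_on {t \<in> {0..1}. t \<le> t0} g" by (rule continuous_on_subset[OF gc]) auto
      show "continuous_on {t \<in> {0..1}. t0 \<le> t} (\<lambda>t. if t \<le> c then (hs ! j) t + real n * of_int m
        else if t \<le> t1 then (hs ! M) t + real n * of_int m else max (g t) (u t))"
        by (rule continuous_on_subset[OF c2]) auto
      fix t assume "t = t0"
      then show "g t = (if t \<le> c then (hs ! j) t + real n * of_int m
        else if t \<le> t1 then (hs ! M) t + real n * of_int m else max (g t) (u t))" using c j(2) by simp
    qed (rule continuous_on_id)
    moreover have "\<exists>k\<in>{1..n}. D' k t = circ_pt n (g' t)" if t: "t \<in> {0..1}" for t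
    proof -
      consider "t < t0" | "t = t0" | "t0 < t" "t \<le> c" | "c < t" "t0 < t" "t \<le> t1" | "t1 < t" by linarith
      then show ?thesis
      proof cases
        case 1
        then show ?thesis using transfer[OF gk[OF t] t] by (simp add: g'_def)
      next
        case 2
        then have "D' (ls ! j) t = circ_pt n (g' t)"
          using ls(4)[OF j(1) t0m(1)] j(2) circ_pt_period[OF n] by (simp add: g'_def)
        then show ?thesis using M01 by blast
      next
        case 3
        then have "D' (ls ! j) t = circ_pt n (g' t)"
          using ls(4)[OF j(1), of t] c circ_pt_period[OF n] by (simp add: g'_def)
        then show ?thesis using M01 by blast
      next
        case 4
        then have "D' (ls ! M) t = circ_pt n (g' t)"
          using ls(4)[OF M(1), of t] circ_pt_period[OF n] by (simp add: g'_def)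
        then show ?thesis using M01 by blast
      next
        case 5
        then have e: "g' t = max (g t) (u t)" using c t01 by (simp add: g'_def)
        have "\<exists>k\<in>{1..n}. D' k t = circ_pt n (g t)" using transfer[OF gk[OF t] t] 5 by simp
        moreover have "\<exists>k\<in>{1..n}. D' k t = circ_pt n (u t)" using u(2) t M01(1) by blast
        ultimately show ?thesis unfolding e max_def by simp
      qed
    qed
    moreover have "g' 0 = g 0" using t01 by (simp add: g'_def)
    moreover have "g 1 \<le> g' 1"
    proof (cases "t1 = 1")
      case True
      show ?thesis
      proof (cases "c = 1")
        case c1: True
        then show ?thesis using True le1 c t01 by (simp add: g'_def)
      next
        case False
        then show ?thesis using True le1 c t01 by (simp add: g'_def)
      qed
    next
      case False
      then show ?thesis using c t01 by (simp add: g'_def)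
    qed
    ultimately show ?thesis unfolding lift_path_def by blast
  qed
qed

lemma meets_nonempty:
  assumes "card (meets t0 t1 g h) = Suc m"
  shows "meets t0 t1 g h \<noteq> {}" "meets t0 t1 h g \<noteq> {}"
proof -
  have "meets t0 t1 h g = meets t0 t1 g h" unfolding meets_def by auto
  moreover show "meets t0 t1 g h \<noteq> {}" using assms by (metis card.empty nat.distinct(1))
  ultimately show "meets t0 t1 h g \<noteq> {}" by simp
qed

text \<open>The arc ending at \<open>T2\<close> plays the role of \<open>M\<close>: this is
  \<open>h1\<close> after the move and \<open>g2\<close> before it. In both pictures the other arc
  meets it.\<close>

lemma two_move_dominates:
  assumes "n \<ge> 1" "is_diag n D" "is_diag n D'" "two_move n D D'"
  shows "dominates n D' D" "dominates n D D'"
proof -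
  obtain x0 x1 t0 t1 g1 g2 h1 h2 B1 B2 T1 T2 where
    box: "is_box n x0 x1 t0 t1" "agree_outside n x0 x1 t0 t1 D D'"
    "box_arcs n x0 x1 t0 t1 D [g1, g2]" "box_arcs n x0 x1 t0 t1 D' [h1, h2]"
    and e: "B1 < B2" "T1 < T2"
       "g1 t0 = B1" "g2 t0 = B2" "g1 t1 = T1" "g2 t1 = T2"
       "h1 t0 = B1" "h2 t0 = B2" "h1 t1 = T2" "h2 t1 = T1"
       "card (meets t0 t1 g1 g2) = 2" "card (meets t0 t1 h1 h2) = 1"
    using assms(4) unfolding two_move_def by blast
  have m: "meets t0 t1 g1 g2 \<noteq> {}" "meets t0 t1 h2 h1 \<noteq> {}"
    using meets_nonempty[of t0 t1 g1 g2 1] meets_nonempty[of t0 t1 h1 h2 0] e(11,12) by simp_all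
  have out': "agree_outside n x0 x1 t0 t1 D' D" using box(2) by (simp add: agree_outside_def)
  show "dominates n D' D"
    by (rule dominates_box[OF assms(1,3) box, of 0]) (use e m in \<open>auto simp: less_Suc_eq\<close>)
  show "dominates n D D'"
    by (rule dominates_box[OF assms(1,2) box(1) out' box(4,3), of 1]) (use e m in \<open>auto simp: less_Suc_eq\<close>)
qed

text \<open>The arc from \<open>B1\<close> to \<open>T3\<close> meets the other two arcs in both
  pictures, so every path can be led over to the rightmost upper end.\<close>

lemma three_move_dominates:
  assumes "n \<ge> 1" "is_diag n D" "is_diag n D'" "three_move n D D'"
  shows "dominates n D' D" "dominates n D D'"
proof -
  obtain x0 x1 t0 t1 g1 g2 g3 h1 h2 h3 B1 B2 B3 T1 T2 T3 where
    box: "is_box n x0 x1 t0 t1" "agree_outside n x0 x1 t0 t1 D D'"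
    "box_arcs n x0 x1 t0 t1 D [g1, g2, g3]" "box_arcs n x0 x1 t0 t1 D' [h1, h2, h3]"
    and e: "B1 < B2" "B2 < B3" "T1 < T2" "T2 < T3"
       "g1 t0 = B1" "g2 t0 = B2" "g3 t0 = B3" "g1 t1 = T3" "g2 t1 = T2" "g3 t1 = T1"
       "h1 t0 = B1" "h2 t0 = B2" "h3 t0 = B3" "h1 t1 = T3" "h2 t1 = T1" "h3 t1 = T2"
    and c: "card (meets t0 t1 g1 g2) = 1" "card (meets t0 t1 g1 g3) = 1"
       "card (meets t0 t1 h1 h2) = 1" "card (meets t0 t1 h1 h3) = 1"
    using assms(4) unfolding three_move_def by blast
  have m: "meets t0 t1 g2 g1 \<noteq> {}" "meets t0 t1 g3 g1 \<noteq> {}" "meets t0 t1 h2 h1 \<noteq> {}" "meets t0 t1 h3 h1 \<noteq> {}"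
    using meets_nonempty(2)[of t0 t1 _ _ 0] c by simp_all
  have out': "agree_outside n x0 x1 t0 t1 D' D" using box(2) by (simp add: agree_outside_def)
  show "dominates n D' D"
    by (rule dominates_box[OF assms(1,3) box, of 0]) (use e m in \<open>auto simp: less_Suc_eq\<close>)
  show "dominates n D D'"
    by (rule dominates_box[OF assms(1,2) box(1) out' box(4,3), of 0]) (use e m in \<open>auto simp: less_Suc_eq\<close>)
qed

section \<open>Rightmost ends for diagrams of words\<close>

lemma lift_path_barrier:
  assumes "lift_path n D K g" "\<And>k t. k \<in> K \<Longrightarrow> t \<in> {0..1} \<Longrightarrow> D k t \<noteq> circ_pt n y" "g 0 < y"
  shows "g 1 < y"
proof (rule ccontr)
  assume "\<not> g 1 < y"
  then obtain t where "0 \<le> t" "t \<le> 1" "g t = y"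
    using IVT'[of g 0 y 1] assms(1,3) unfolding lift_path_def by auto
  then show False using assms(1,2) unfolding lift_path_def by force
qed

lemma lift_path_end_int:
  assumes "n \<ge> 1" "is_diag n D" "lift_path n D {1..n} g"
  shows "\<exists>b::int. g 1 = of_int b"
proof -
  obtain k where k: "k \<in> {1..n}" "D k 1 = circ_pt n (g 1)" using assms(3) unfolding lift_path_def by force
  then obtain l where "circ_pt n (g 1) = circ_pt n (real l)" using is_diagD(4)[OF assms(2)] by metis
  then obtain m :: int where "g 1 = real l + real n * of_int m" using circ_pt_eq_iff[OF assms(1)] by blast
  then have "g 1 = of_int (int l + int n * m)" by simp
  then show ?thesis by blast
qed

lemma gen_diag_res:
  assumes "n \<ge> 3" "i \<in> {1..n}"
  shows "gen_diag n i (res n a) t = circ_pt n (of_int a + t * of_int (swp n i a - a))"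
proof -
  have n: "n \<ge> 1" using assms by simp
  note r = res_range[OF n, of a]
  have "gen_diag n i (res n a) t = circ_pt n (of_int (int (res n a)) + t * of_int (swp n i a - a))"
    unfolding gen_diag_twist[OF r assms(2)]
    using prv_nxt[OF assms(2)] nxt_prv[OF r] by (auto simp: twist_def twist_offset_def swp_def)
  also have "\<dots> = circ_pt n (of_int a + t * of_int (swp n i a - a))"
    by (rule circ_pt_shift[OF n]) (rule res_int[OF r])
  finally show ?thesis .
qed

text \<open>Strands of a generator are vertical over integers, except for the exchanged pair, which
  sweeps only the column right of a position of class \<open>i\<close>. A vertical line at a
  half-integer of any other class is therefore a wall; since paths end at integers, such a wall at
  \<open>b + 1/2\<close> bounds the end by \<open>b\<close>.\<close>

lemma gen_diag_barrier:
  assumes "n \<ge> 3" "i \<in> {1..n}" "res n b \<noteq> i" "k \<in> {1..n}" "t \<in> {0..1}"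
  shows "gen_diag n i k t \<noteq> circ_pt n (of_int b + 1/2)"
proof
  assume e: "gen_diag n i k t = circ_pt n (of_int b + 1/2)"
  have n: "n \<ge> 1" using assms by simp
  have "gen_diag n i k t = circ_pt n (of_int (int k) + t * of_int (swp n i (int k) - int k))"
    using gen_diag_res[OF assms(1,2), of "int k"] res_int[OF assms(4)] by simp
  then obtain m :: int where m: "of_int b + 1/2 = of_int (int k) + t * of_int (swp n i (int k) - int k) + real n * of_int m"
    using e circ_pt_eq_iff[OF n] by metis
  define J where "J = int k + int n * m"
  have sJ: "swp n i J - J = swp n i (int k) - int k" unfolding J_def swp_period by simp
  have eq: "of_int b + 1/2 = of_int J + t * of_int (swp n i J - J)" unfolding sJ using m by (simp add: J_def)
  consider "res n J = i" | "res n J = nxt n i" "res n J \<noteq> i" | "res n J \<noteq> i" "res n J \<noteq> nxt n i" by blast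
  then show False
  proof cases
    case 1
    then have "real_of_int b + 1/2 = of_int J + t" using eq by (simp add: swp_def)
    then have "real_of_int b - of_int J < 1" "real_of_int b - of_int J > -1" using assms(5) by auto
    then have "b = J" by linarith
    then show False using 1 assms(3) by simp
  next
    case 2
    then have "real_of_int b + 1/2 = of_int J - t" using eq by (simp add: swp_def)
    then have "real_of_int b - of_int J < 0" "real_of_int b - of_int J > -2" using assms(5) by auto
    then have "b = J - 1" by linarith
    then show False using 2 assms(2,3) res_pred[OF n, of J] prv_nxt[OF assms(2)] by simp
  next
    case 3
    then have "real_of_int b + 1/2 = of_int J" using eq by (simp add: swp_def)
    then have "real_of_int (2 * b + 1) = of_int (2 * J)" by simp
    then have "2 * b + 1 = 2 * J" by (simp only: of_int_eq_iff)
    then show False by presburger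
  qed
qed

lemma top_endI:
  assumes "n \<ge> 1" "is_diag n D" "lift_path n D {1..n} g" "g 0 = of_int a" "g 1 = of_int b"
    "\<And>k t. k \<in> {1..n} \<Longrightarrow> t \<in> {0..1} \<Longrightarrow> D k t \<noteq> circ_pt n (of_int b + 1/2)" "a \<le> b"
  shows "top_end n D a b"
proof -
  have "h 1 \<le> of_int b" if h: "lift_path n D {1..n} h" "h 0 = of_int a" for h
  proof -
    have "h 0 < of_int b + 1/2" using h(2) assms(7) by simp
    from lift_path_barrier[OF h(1) assms(6) this] have "h 1 < of_int b + 1/2" .
    moreover obtain c :: int where "h 1 = of_int c" using lift_path_end_int[OF assms(1,2) h(1)] by blast
    ultimately show ?thesis by simp
  qed
  then show ?thesis unfolding top_end_def using assms by blast
qed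

lemma lift_path_gen:
  assumes "n \<ge> 3" "i \<in> {1..n}"
  shows "lift_path n (gen_diag n i) {1..n} (\<lambda>t. of_int a + t * of_int (swp n i a - a))"
  unfolding lift_path_def
proof (intro conjI ballI)
  show "continuous_on {0..1} (\<lambda>t::real. of_int a + t * of_int (swp n i a - a))" by (intro continuous_intros)
  fix t :: real
  show "\<exists>k\<in>{1..n}. gen_diag n i k t = circ_pt n (of_int a + t * of_int (swp n i a - a))"
    using gen_diag_res[OF assms, of a t] res_range[of n a] assms(1) by (intro bexI[of _ "res n a"]) auto
qed

lemma top_end_gen:
  assumes "n \<ge> 3" "i \<in> {1..n}"
  shows "top_end n (gen_diag n i) a (step n i a)"
proof -
  have n: "n \<ge> 1" "n \<ge> 2" using assms by auto
  note d = is_diag_gen[OF assms]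
  have nb: "res n (step n i a) \<noteq> i"
    using nxt_neq[OF n(2) assms(2)] res_Suc[OF n(1), of a] by (auto simp: step_def)
  have ge: "a \<le> step n i a" by (simp add: step_def)
  note I = top_endI[OF n(1) d _ _ _ gen_diag_barrier[OF assms nb] ge]
  show ?thesis
  proof (cases "res n a = nxt n i \<and> res n a \<noteq> i")
    case True
    \<comment> \<open>Here the strand from \<open>a\<close> goes left. The rightmost path leaves it
      at the crossing for the strand from \<open>a - 1\<close> and returns to \<open>a\<close>; this
      path is the maximum of the two lifts.\<close>
    then have r: "res n (a - 1) = i" using res_pred[OF n(1), of a] prv_nxt[OF assms(2)] by simp
    have "swp n i a = a - 1" "swp n i (a - 1) = a" "step n i a = a" using True r by (auto simp: swp_def step_def)
    then show ?thesis
      using lift_path_max[OF lift_path_gen[OF assms, of a] lift_path_gen[OF assms, of "a - 1"]]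
      by (intro I[where g = "\<lambda>t. max (of_int a - t) (of_int a - 1 + t)"]) auto
  next
    case False
    then have "swp n i a = step n i a" by (auto simp: swp_def step_def)
    then show ?thesis using lift_path_gen[OF assms, of a]
      by (intro I[where g = "\<lambda>t. of_int a + t * of_int (swp n i a - a)"]) auto
  qed
qed

lemma top_end_id:
  assumes "n \<ge> 3"
  shows "top_end n (id_diag n) a a"
proof (rule top_endI[of _ _ "\<lambda>t. of_int a"])
  have n: "n \<ge> 1" using assms by auto
  show "n \<ge> 1" "is_diag n (id_diag n)" using n is_diag_id[OF assms] by auto
  show "lift_path n (id_diag n) {1..n} (\<lambda>t. of_int a)" unfolding lift_path_def
    using circ_pt_res[OF n, of a] res_range[OF n, of a] by (auto simp: id_diag_def intro!: bexI[of _ "res n a"])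
  fix k t
  show "id_diag n k t \<noteq> circ_pt n (of_int a + 1/2)"
  proof
    assume "id_diag n k t = circ_pt n (of_int a + 1/2)"
    then obtain m :: int where "of_int a + 1/2 = real k + real n * of_int m"
      unfolding id_diag_def using circ_pt_eq_iff[OF n] by metis
    then have "real_of_int (2 * a + 1) = of_int (2 * (int k + int n * m))" by simp
    then have "2 * a + 1 = 2 * (int k + int n * m)" by (simp only: of_int_eq_iff)
    then show False by presburger
  qed
qed auto

lemma lift_path_stack:
  assumes "n \<ge> 1" "is_diag n A" "is_diag n B"
  shows "lift_path n A {1..n} g \<Longrightarrow> lift_path n B {1..n} h \<Longrightarrow> g 1 = h 0 \<Longrightarrow>
      lift_path n (stack n A B) {1..n} (\<lambda>t. if t \<le> 1/2 then g (2 * t) else h (2 * t - 1))"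
    and "lift_path n (stack n A B) {1..n} f \<Longrightarrow> lift_path n A {1..n} (\<lambda>t. f (t / 2))"
    and "lift_path n (stack n A B) {1..n} f \<Longrightarrow> lift_path n B {1..n} (\<lambda>t. f ((t + 1) / 2))"
proof -
  assume g: "lift_path n A {1..n} g" and h: "lift_path n B {1..n} h" and e: "g 1 = h 0"
  have gc: "continuous_on {0..1} g" and hc: "continuous_on {0..1} h" using g h unfolding lift_path_def by blast+
  show "lift_path n (stack n A B) {1..n} (\<lambda>t. if t \<le> 1/2 then g (2 * t) else h (2 * t - 1))"
    unfolding lift_path_def
  proof (intro conjI ballI)
    show "continuous_on {0..1} (\<lambda>t. if t \<le> 1/2 then g (2 * t) else h (2 * t - 1))"
    proof (rule continuous_on_cases_le)
      show "continuous_on {t \<in> {0..1}. t \<le> 1/2} (\<lambda>t. g (2 * t))"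
        by (intro continuous_on_compose2[OF gc] continuous_intros) auto
      show "continuous_on {t \<in> {0..1}. 1/2 \<le> t} (\<lambda>t. h (2 * t - 1))"
        by (intro continuous_on_compose2[OF hc] continuous_intros) auto
      fix t :: real assume t: "t = 1/2"
      show "g (2 * t) = h (2 * t - 1)" unfolding t using e by simp
    qed (rule continuous_on_id)
    fix t :: real assume t: "t \<in> {0..1}"
    show "\<exists>k\<in>{1..n}. stack n A B k t = circ_pt n (if t \<le> 1/2 then g (2 * t) else h (2 * t - 1))"
    proof (cases "t \<le> 1/2")
      case True
      then have "2 * t \<in> {0..1}" using t by auto
      then show ?thesis using True g unfolding lift_path_def by (simp add: stack_low)
    next
      case False
      then have "2 * t - 1 \<in> {0..1}" using t by auto
      then obtain l where l: "l \<in> {1..n}" "B l (2 * t - 1) = circ_pt n (h (2 * t - 1))"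
        using h unfolding lift_path_def by blast
      have "l \<in> top_pos n A ` {1..n}" using l(1) top_pos_image[OF assms(1,2)] by simp
      then obtain k where k: "k \<in> {1..n}" "l = top_pos n A k" by (rule imageE)
      have "stack n A B k t = circ_pt n (h (2 * t - 1))"
        using l(2) k(2) False stack_high[OF assms k(1), of t] by simp
      then show ?thesis using k(1) False by (intro bexI[of _ k]) simp_all
    qed
  qed
next
  assume f: "lift_path n (stack n A B) {1..n} f"
  have fc: "continuous_on {0..1} f" and fk: "\<And>t. t \<in> {0..1} \<Longrightarrow> \<exists>k\<in>{1..n}. stack n A B k t = circ_pt n (f t)"
    using f unfolding lift_path_def by blast+
  show "lift_path n A {1..n} (\<lambda>t. f (t / 2))" unfolding lift_path_def
  proof (intro conjI ballI)
    show "continuous_on {0..1} (\<lambda>t. f (t / 2))"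
      by (intro continuous_on_compose2[OF fc] continuous_intros) auto
    fix t :: real assume t: "t \<in> {0..1}"
    then obtain k where "k \<in> {1..n}" "stack n A B k (t / 2) = circ_pt n (f (t / 2))" using fk[of "t / 2"] by auto
    moreover have "stack n A B k (t / 2) = A k t" using t stack_low[of "t / 2" n A B k] by simp
    ultimately show "\<exists>k\<in>{1..n}. A k t = circ_pt n (f (t / 2))" by metis
  qed
  show "lift_path n B {1..n} (\<lambda>t. f ((t + 1) / 2))" unfolding lift_path_def
  proof (intro conjI ballI)
    show "continuous_on {0..1} (\<lambda>t. f ((t + 1) / 2))"
      by (intro continuous_on_compose2[OF fc] continuous_intros) auto
    fix t :: real assume t: "t \<in> {0..1}"
    then obtain k where k: "k \<in> {1..n}" "stack n A B k ((t + 1) / 2) = circ_pt n (f ((t + 1) / 2))"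
      using fk[of "(t + 1) / 2"] by auto
    have "2 * ((t + 1) / 2) - 1 = t" by (simp add: field_simps)
    moreover have "stack n A B k ((t + 1) / 2) = B (top_pos n A k) (2 * ((t + 1) / 2) - 1)"
      using t by (intro stack_high[OF assms k(1)]) simp
    ultimately have "B (top_pos n A k) t = circ_pt n (f ((t + 1) / 2))" using k(2) by (simp only:)
    then show "\<exists>k\<in>{1..n}. B k t = circ_pt n (f ((t + 1) / 2))" using top_pos(1)[OF assms(1,2) k(1)] by blast
  qed
qed

lemma top_end_stack:
  assumes "n \<ge> 1" "is_diag n A" "is_diag n B" "top_end n A a b" "top_end n B b c"
  shows "top_end n (stack n A B) a c"
proof -
  obtain g h where g: "lift_path n A {1..n} g" "g 0 = of_int a" "g 1 = of_int b"
    and h: "lift_path n B {1..n} h" "h 0 = of_int b" "h 1 = of_int c"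
    using assms(4,5) unfolding top_end_def by blast
  let ?f = "\<lambda>t. if t \<le> 1/2 then g (2 * t) else h (2 * t - 1)"
  have "lift_path n (stack n A B) {1..n} ?f" using lift_path_stack(1)[OF assms(1-3) g(1) h(1)] g h by simp
  moreover have "?f 0 = of_int a" "?f 1 = of_int c" using g h by simp_all
  moreover have "f 1 \<le> of_int c" if f: "lift_path n (stack n A B) {1..n} f" "f 0 = of_int a" for f
  proof -
    have fA: "lift_path n A {1..n} (\<lambda>t. f (t / 2))" and fB: "lift_path n B {1..n} (\<lambda>t. f ((t + 1) / 2))"
      using lift_path_stack(2,3)[OF assms(1-3) f(1)] .
    have "\<forall>g. lift_path n A {1..n} g \<longrightarrow> g 0 = of_int a \<longrightarrow> g 1 \<le> of_int b"
      using assms(4) unfolding top_end_def by blast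
    from this[rule_format, OF fA] have "f (1/2) \<le> of_int b" using f(2) by simp
    \<comment> \<open>The upper half of \<open>f\<close> may start to the left of \<open>b\<close>.
      Its maximum with \<open>h\<close> starts at \<open>b\<close>, so the bound for
      \<open>B\<close> applies to it and hence to \<open>f\<close>.\<close>
    moreover have m: "lift_path n B {1..n} (\<lambda>t. max (f ((t + 1) / 2)) (h t))" by (rule lift_path_max[OF fB h(1)])
    moreover have up: "\<forall>g. lift_path n B {1..n} g \<longrightarrow> g 0 = of_int b \<longrightarrow> g 1 \<le> of_int c"
      using assms(5) unfolding top_end_def by blast
    ultimately have "max (f ((1 + 1) / 2)) (h 1) \<le> of_int c" using up[rule_format, OF m] h(2) by simp
    then show ?thesis by simp
  qed
  ultimately show ?thesis unfolding top_end_def by blast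
qed

lemma top_end_word:
  assumes "n \<ge> 3"
  shows "w \<in> lists {1..n} \<Longrightarrow> top_end n (word_diag n w) a (act n w a)"
proof (induction w arbitrary: a rule: list.induct)
  case Nil
  then show ?case using top_end_id[OF assms] by simp
next
  case (Cons i w)
  have n: "n \<ge> 1" using assms by simp
  have i: "i \<in> {1..n}" and w: "w \<in> lists {1..n}" using Cons.prems by auto
  show ?case
    using top_end_stack[OF n is_diag_gen[OF assms i] is_diag_word[OF assms w] top_end_gen[OF assms i] Cons.IH[OF w]] by simp
qed

section \<open>Lift ends\<close>

lemma lift_end_isotopic:
  assumes "n \<ge> 1" "isotopic n D D'" "is_diag n D" "is_diag n D'" "a \<in> {1..int n}"
  shows "lift_end n D a = lift_end n D' a"
proof -
  have k: "{nat a} \<subseteq> {1..n}" using assms(5) by auto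
  have "(\<exists>g. continuous_on {0..1} g \<and> (\<forall>t\<in>{0..1}. D (nat a) t = circ_pt n (g t)) \<and> g 0 = of_int a \<and> g 1 = of_int b) \<longleftrightarrow>
    (\<exists>g. continuous_on {0..1} g \<and> (\<forall>t\<in>{0..1}. D' (nat a) t = circ_pt n (g t)) \<and> g 0 = of_int a \<and> g 1 = of_int b)" for b :: int
  proof -
    have *: "(\<exists>g. continuous_on {0..1} g \<and> (\<forall>t\<in>{0..1}. E (nat a) t = circ_pt n (g t)) \<and> g 0 = of_int a \<and> g 1 = of_int b) \<longleftrightarrow>
      (\<exists>g. lift_path n E {nat a} g \<and> g 0 = of_int a \<and> g 1 = of_int b)" for E
      unfolding lift_path_def by simp
    show ?thesis unfolding *
      using isotopic_lift_path[OF assms(1,2,3,4) k]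
        isotopic_lift_path[OF assms(1) isotopic_sym[OF assms(2,3)] assms(4,3) k] by metis
  qed
  then show ?thesis unfolding lift_end_def by simp
qed

lemma lift_end_word:
  assumes "n \<ge> 3" "w \<in> lists {1..n}" "a \<in> {1..int n}"
  shows "lift_end n (word_diag n w) a = perm n w a"
  unfolding lift_end_def
proof (rule the_equality)
  have n: "n \<ge> 1" using assms by simp
  have "int (res n a) = a" using assms(3) by (simp add: res_def)
  then have r: "nat a = res n a" by (metis nat_int)
  have L: "\<forall>t\<in>{0..1}. word_diag n w (nat a) t = circ_pt n (word_lift n w a t)"
    unfolding r using word_diag_lift[OF assms(1,2)] by blast
  then show "\<exists>g. continuous_on {0..1} g \<and> (\<forall>t\<in>{0..1}. word_diag n w (nat a) t = circ_pt n (g t)) \<and>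
      g 0 = real_of_int a \<and> g 1 = real_of_int (perm n w a)"
    using continuous_on_word_lift word_lift_0 word_lift_1 by blast
  fix b :: int
  assume "\<exists>g. continuous_on {0..1} g \<and> (\<forall>t\<in>{0..1}. word_diag n w (nat a) t = circ_pt n (g t)) \<and>
      g 0 = real_of_int a \<and> g 1 = real_of_int b"
  then obtain g where g: "continuous_on {0..1} g" "\<forall>t\<in>{0..1}. word_diag n w (nat a) t = circ_pt n (g t)"
    "g 0 = real_of_int a" "g 1 = real_of_int b" by blast
  have "g 1 = word_lift n w a 1"
  proof (rule circ_lift_unique[OF n, of "{0..1}" g "word_lift n w a" 0])
    show "circ_pt n (g t) = circ_pt n (word_lift n w a t)" if "t \<in> {0..1}" for t
      using g(2) L that by metis
  qed (use g(1,3) continuous_on_word_lift word_lift_0 in auto)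
  then show "b = perm n w a" using g(4) word_lift_1[of n w a] by simp
qed

section \<open>Moves between diagrams of words\<close>

lemma res_window: "n \<ge> 1 \<Longrightarrow> res n a = res n b \<Longrightarrow> \<bar>a - b\<bar> < int n \<Longrightarrow> a = b"
proof -
  assume n: "n \<ge> 1" and e: "res n a = res n b" and l: "\<bar>a - b\<bar> < int n"
  obtain m where m: "a = b + int n * m" using res_eq_iff[OF n] e by blast
  then have "int n * \<bar>m\<bar> < int n * 1" using l by (simp add: abs_mult)
  then have "\<bar>m\<bar> < 1" using n by (simp only: mult_less_cancel_left)
  then show "a = b" using m by simp
qed

lemma swp_window:
  assumes "n \<ge> 2" "i = res n b" "b \<in> {a0..<a0 + m}" "m < int n" "a \<in> {a0..a0 + m}"
  shows "swp n i a \<in> {a0..a0 + m}"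
proof -
  have n: "n \<ge> 1" using assms by simp
  have "a = b" if "res n a = i" using res_window[OF n, of a b] assms that by auto
  moreover have "a = b + 1" if "res n a = nxt n i"
    using res_window[OF n, of a "b + 1"] res_Suc[OF n, of b] assms that by auto
  ultimately show ?thesis using assms(3,5) by (auto simp: swp_def)
qed

text \<open>Letters over \<open>{a0..<a0 + m}\<close> permute the positions
  \<open>a0..a0 + m\<close> among themselves, so their lifts never leave the window. A box of full
  height around the window can thus serve for a move.\<close>

lemma word_lift_window:
  assumes "n \<ge> 2" "m < int n"
  shows "set w \<subseteq> res n ` {a0..<a0 + m} \<Longrightarrow> a \<in> {a0..a0 + m} \<Longrightarrow> t \<in> {0..1} \<Longrightarrow>
    word_lift n w a t \<in> {of_int a0..of_int (a0 + m)}"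
proof (induction w arbitrary: a t)
  case Nil
  have "real_of_int a0 \<le> of_int a" "real_of_int a \<le> of_int (a0 + m)"
    using Nil.prems(2) by (simp_all only: of_int_le_iff atLeastAtMost_iff)
  then show ?case by simp
next
  case (Cons i w)
  obtain b where b: "b \<in> {a0..<a0 + m}" "i = res n b" using Cons.prems(1) by auto
  have s: "swp n i a \<in> {a0..a0 + m}" by (rule swp_window[OF assms(1) b(2,1) assms(2) Cons.prems(2)])
  show ?case
  proof (cases "t \<le> 1/2")
    case True
    have x: "real_of_int a0 \<le> of_int a" "real_of_int a \<le> of_int (a0 + m)"
      "real_of_int a0 \<le> of_int (swp n i a)" "real_of_int (swp n i a) \<le> of_int (a0 + m)"
      using Cons.prems(2) s by (simp_all only: of_int_le_iff atLeastAtMost_iff)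
    have "swp n i a - a = 0 \<or> swp n i a - a = 1 \<or> swp n i a - a = -1" by (auto simp: swp_def)
    then show ?thesis
    proof (elim disjE)
      assume "swp n i a - a = 0"
      then show ?thesis using x True by simp
    next
      assume d: "swp n i a - a = 1"
      then have "real_of_int (swp n i a) = of_int a + 1" by linarith
      then show ?thesis using x True Cons.prems(3) d by simp
    next
      assume d: "swp n i a - a = -1"
      then have "real_of_int (swp n i a) = of_int a - 1" by linarith
      then show ?thesis using x True Cons.prems(3) d by simp
    qed
  next
    case False
    then show ?thesis using Cons.IH[OF _ s, of "2 * t - 1"] Cons.prems by simp
  qed
qed

lemma word_lift_fixed:
  assumes "n \<ge> 1"
  shows "w \<in> lists {1..n} \<Longrightarrow> res n a \<notin> set w \<Longrightarrow> prv n (res n a) \<notin> set w \<Longrightarrow> word_lift n w a t = of_int a"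
proof (induction w arbitrary: t rule: list.induct)
  case (Cons i w)
  then have "res n a \<noteq> nxt n i" using prv_nxt[of i n] by auto
  then have "swp n i a = a" using Cons.prems by (auto simp: swp_def)
  then show ?case using Cons by auto
qed simp

lemma word_diag_fixed:
  assumes "n \<ge> 3" "w \<in> lists {1..n}" "k \<in> {1..n}" "k \<notin> set w" "prv n k \<notin> set w" "t \<in> {0..1}"
  shows "word_diag n w k t = circ_pt n (real k)"
proof -
  have r: "res n (int k) = k" by (rule res_int[OF assms(3)])
  have "word_diag n w (res n (int k)) t = circ_pt n (word_lift n w (int k) t)"
    by (rule word_diag_lift[OF assms(1,2,6)])
  moreover have "word_lift n w (int k) t = of_int (int k)"
    by (rule word_lift_fixed) (use assms r in simp_all)
  ultimately show ?thesis by (simp add: r)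
qed

text \<open>Strands starting outside the window are vertical over integers. The margin of
  \<open>1/4\<close> keeps the box clear of the nearest of them while its own arcs remain strictly
  inside.\<close>

lemma word_outside_window:
  assumes "n \<ge> 3" "0 \<le> m" "m < int n" "w \<in> lists {1..n}" "set w \<subseteq> res n ` {a0..<a0 + m}" "k \<in> {1..n}"
    "k \<notin> res n ` {a0..a0 + m}" "t \<in> {0..1}"
  shows "word_diag n w k t = circ_pt n (real k)"
    and "circ_pt n (real k) \<notin> circ_pt n ` {of_int a0 - 1/4..of_int (a0 + m) + 1/4}"
proof -
  have n: "n \<ge> 1" using assms by simp
  have "k \<notin> set w" using assms(5,7) by auto
  moreover have "prv n k \<notin> set w"
  proof
    assume "prv n k \<in> set w"
    then obtain b where b: "b \<in> {a0..<a0 + m}" "prv n k = res n b" using assms(5) by auto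
    then have "k = res n (b + 1)" using nxt_prv[OF assms(6)] res_Suc[OF n, of b] by simp
    then show False using assms(7) b(1) by auto
  qed
  ultimately show "word_diag n w k t = circ_pt n (real k)" using word_diag_fixed assms by blast
  show "circ_pt n (real k) \<notin> circ_pt n ` {of_int a0 - 1/4..of_int (a0 + m) + 1/4}"
  proof
    assume "circ_pt n (real k) \<in> circ_pt n ` {of_int a0 - 1/4..of_int (a0 + m) + 1/4}"
    then obtain y where y: "y \<in> {of_int a0 - 1/4..of_int (a0 + m) + 1/4}" "circ_pt n y = circ_pt n (real k)" by auto
    then obtain l :: int where "y = real k + real n * of_int l" using circ_pt_eq_iff[OF n] by blast
    define J where "J = int k + int n * l"
    have "y = of_int J" using \<open>y = real k + real n * of_int l\<close> by (simp add: J_def)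
    then have "real_of_int a0 - 1/4 \<le> of_int J" "real_of_int J \<le> of_int (a0 + m) + 1/4" using y(1) by simp_all
    then have "a0 \<le> J" "J \<le> a0 + m" by linarith+
    moreover have "res n J = k" unfolding J_def using res_period res_int[OF assms(6)] by simp
    ultimately show False using assms(7) by (metis atLeastAtMost_iff imageI)
  qed
qed

lemma box_arcs_word:
  assumes "n \<ge> 3" "0 \<le> m" "m < int n" "w \<in> lists {1..n}" "set w \<subseteq> res n ` {a0..<a0 + m}"
    "set as = {a0..a0 + m}" "distinct as"
  shows "box_arcs n (of_int a0 - 1/4) (of_int (a0 + m) + 1/4) 0 1 (word_diag n w) (map (word_lift n w) as)"
  unfolding box_arcs_def
proof (intro exI[of _ "map (res n) as"] conjI allI impI ballI)
  have n: "n \<ge> 1" "n \<ge> 2" using assms by auto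
  have "inj_on (res n) {a0..a0 + m}"
    using assms(3) by (intro inj_onI res_window[OF n(1)]) auto
  then show "distinct (map (res n) as)" using assms(6,7) by (simp add: distinct_map)
  show "set (map (res n) as) \<subseteq> {1..n}" using res_range[OF n(1)] by auto
  show "length (map (res n) as) = length (map (word_lift n w) as)" by simp
  fix j assume "j < length (map (word_lift n w) as)"
  then have j: "j < length as" by simp
  then have a: "as ! j \<in> {a0..a0 + m}" using assms(6) nth_mem by blast
  show "continuous_on {0..1} (map (word_lift n w) as ! j)" using j continuous_on_word_lift by simp
  fix t :: real assume t: "t \<in> {0..1}"
  have "word_lift n w (as ! j) t \<in> {of_int a0..of_int (a0 + m)}"
    by (rule word_lift_window[OF n(2) assms(3,5) a t])
  then show "of_int a0 - 1/4 < (map (word_lift n w) as ! j) t" "(map (word_lift n w) as ! j) t < of_int (a0 + m) + 1/4"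
    using j by auto
  show "word_diag n w (map (res n) as ! j) t = circ_pt n ((map (word_lift n w) as ! j) t)"
    using word_diag_lift[OF assms(1,4) t] j by simp
next
  fix k and t :: real assume k: "k \<in> {1..n} - set (map (res n) as)" and t: "t \<in> {0..1}"
  then have "k \<in> {1..n}" "k \<notin> res n ` {a0..a0 + m}" using assms(6) by auto
  from word_outside_window[OF assms(1-5) this t]
  show "word_diag n w k t \<notin> circ_pt n ` {of_int a0 - 1/4..of_int (a0 + m) + 1/4}" by simp
qed

lemma agree_outsideI:
  assumes "\<And>z t. \<not> (z \<in> circ_pt n ` {x0..x1} \<and> t \<in> {t0..t1}) \<Longrightarrow> (z, t) \<in> diag_image n D \<longleftrightarrow> (z, t) \<in> diag_image n D'"
  shows "agree_outside n x0 x1 t0 t1 D D'"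
  unfolding agree_outside_def
proof (rule Set.set_eqI)
  fix q :: "complex \<times> real"
  obtain z t where q: "q = (z, t)" by (cases q)
  show "q \<in> diag_image n D - circ_pt n ` {x0..x1} \<times> {t0..t1} \<longleftrightarrow>
    q \<in> diag_image n D' - circ_pt n ` {x0..x1} \<times> {t0..t1}"
    using assms[of z t] unfolding q Diff_iff mem_Times_iff fst_conv snd_conv by blast
qed

lemma agree_outsideD:
  assumes "agree_outside n x0 x1 t0 t1 D D'" "\<not> (z \<in> circ_pt n ` {x0..x1} \<and> t \<in> {t0..t1})"
  shows "(z, t) \<in> diag_image n D \<longleftrightarrow> (z, t) \<in> diag_image n D'"
  using assms unfolding agree_outside_def by blast

lemma agree_outside_word:
  assumes "n \<ge> 3" "0 \<le> m" "m < int n" "w \<in> lists {1..n}" "set w \<subseteq> res n ` {a0..<a0 + m}"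
    "w' \<in> lists {1..n}" "set w' \<subseteq> res n ` {a0..<a0 + m}"
  shows "agree_outside n (of_int a0 - 1/4) (of_int (a0 + m) + 1/4) 0 1 (word_diag n w) (word_diag n w')"
proof (rule agree_outsideI)
  have key: "(z, t) \<in> diag_image n (word_diag n v')"
    if v: "v \<in> lists {1..n}" "set v \<subseteq> res n ` {a0..<a0 + m}" "v' \<in> lists {1..n}" "set v' \<subseteq> res n ` {a0..<a0 + m}"
      and o: "\<not> (z \<in> circ_pt n ` {of_int a0 - 1/4..of_int (a0 + m) + 1/4} \<and> t \<in> {0..1})"
      and z: "(z, t) \<in> diag_image n (word_diag n v)" for v v' z t
  proof -
    have n: "n \<ge> 2" using assms by simp
    obtain k where k: "k \<in> {1..n}" "word_diag n v k t = z" and t: "t \<in> {0..1}" using z unfolding mem_diag_image by blast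
    have "k \<notin> res n ` {a0..a0 + m}"
    proof
      assume "k \<in> res n ` {a0..a0 + m}"
      then obtain a where a: "a \<in> {a0..a0 + m}" "k = res n a" by blast
      have "word_lift n v a t \<in> {of_int a0..of_int (a0 + m)}" by (rule word_lift_window[OF n assms(3) v(2) a(1) t])
      then have "word_lift n v a t \<in> {of_int a0 - 1/4..of_int (a0 + m) + 1/4}" by auto
      moreover have "z = circ_pt n (word_lift n v a t)" using word_diag_lift[OF assms(1) v(1) t, of a] k a by simp
      ultimately show False using o t by blast
    qed
    then have "word_diag n v' k t = word_diag n v k t"
      using word_outside_window(1)[OF assms(1-3) v(1,2) k(1) _ t] word_outside_window(1)[OF assms(1-3) v(3,4) k(1) _ t] by simp
    then show ?thesis unfolding mem_diag_image using k t by auto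
  qed
  fix z t assume "\<not> (z \<in> circ_pt n ` {of_int a0 - 1/4..of_int (a0 + m) + 1/4} \<and> t \<in> {0..1::real})"
  then show "(z, t) \<in> diag_image n (word_diag n w) \<longleftrightarrow> (z, t) \<in> diag_image n (word_diag n w')"
    using key[OF assms(4-7)] key[OF assms(6,7,4,5)] by blast
qed

lemma two_moveI:
  assumes "is_box n x0 x1 t0 t1" "agree_outside n x0 x1 t0 t1 D D'"
    "box_arcs n x0 x1 t0 t1 D [g1, g2]" "box_arcs n x0 x1 t0 t1 D' [h1, h2]"
    "g1 t0 < g2 t0" "g1 t1 < g2 t1" "h1 t0 = g1 t0" "h2 t0 = g2 t0" "h1 t1 = g2 t1" "h2 t1 = g1 t1"
    "card (meets t0 t1 g1 g2) = 2" "card (meets t0 t1 h1 h2) = 1"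
  shows "two_move n D D'"
  unfolding two_move_def using assms by metis

lemma three_moveI:
  assumes "is_box n x0 x1 t0 t1" "agree_outside n x0 x1 t0 t1 D D'"
    "box_arcs n x0 x1 t0 t1 D [g1, g2, g3]" "box_arcs n x0 x1 t0 t1 D' [h1, h2, h3]"
    "g1 t0 < g2 t0" "g2 t0 < g3 t0" "g3 t1 < g2 t1" "g2 t1 < g1 t1"
    "h1 t0 = g1 t0" "h2 t0 = g2 t0" "h3 t0 = g3 t0" "h1 t1 = g1 t1" "h2 t1 = g3 t1" "h3 t1 = g2 t1"
    "card (meets t0 t1 g1 g2) = 1" "card (meets t0 t1 g1 g3) = 1" "card (meets t0 t1 g2 g3) = 1"
    "card (meets t0 t1 h1 h2) = 1" "card (meets t0 t1 h1 h3) = 1" "meets t0 t1 h2 h3 = {}"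
  shows "three_move n D D'"
  unfolding three_move_def
  by (rule exI[of _ x0], rule exI[of _ x1], rule exI[of _ t0], rule exI[of _ t1], rule exI[of _ g1], rule exI[of _ g2], rule exI[of _ g3], rule exI[of _ h1], rule exI[of _ h2], rule exI[of _ h3], rule exI[of _ "g1 t0"], rule exI[of _ "g2 t0"], rule exI[of _ "g3 t0"], rule exI[of _ "g3 t1"], rule exI[of _ "g2 t1"], rule exI[of _ "g1 t1"], intro conjI) (rule assms HOL.refl)+

lemma card_meets:
  assumes "\<And>t. t \<in> {t0..t1} \<Longrightarrow> g t = h t \<longleftrightarrow> t \<in> S" "S \<subseteq> {t0..t1}"
  shows "card (meets t0 t1 g h) = card S"
proof -
  have "meets t0 t1 g h = S" unfolding meets_def using assms by blast
  then show ?thesis by simp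
qed

lemma two_move_word:
  assumes "n \<ge> 3" "i \<in> {1..n}"
  shows "two_move n (word_diag n [i, i]) (word_diag n [i])"
proof -
  have n: "n \<ge> 1" "n \<ge> 2" "1 < int n" using assms by auto
  define a where "a = int i"
  have r: "res n a = i" "res n (a + 1) = nxt n i" using res_int[OF assms(2)] res_Suc[OF n(1), of a] by (auto simp: a_def)
  have ne: "nxt n i \<noteq> i" by (rule nxt_neq[OF n(2) assms(2)])
  have s: "swp n i a = a + 1" "swp n i (a + 1) = a" using r ne by (auto simp: swp_def)
  have win: "{a..<a + 1} = {a}" "set [a, a + 1] = {a..a + 1}" "distinct [a, a + 1]" by auto
  have sub: "set [i, i] \<subseteq> res n ` {a..<a + 1}" "set [i] \<subseteq> res n ` {a..<a + 1}" unfolding win using r by auto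
  have l: "[i, i] \<in> lists {1..n}" "[i] \<in> lists {1..n}" using assms(2) by auto
  show ?thesis
  proof (rule two_moveI)
    show "is_box n (of_int a - 1/4) (of_int (a + 1) + 1/4) 0 1" using assms(1) by (simp add: is_box_def)
    show "agree_outside n (of_int a - 1/4) (of_int (a + 1) + 1/4) 0 1 (word_diag n [i, i]) (word_diag n [i])"
      by (rule agree_outside_word[OF assms(1) _ n(3) l(1) sub(1) l(2) sub(2)]) simp
    show "box_arcs n (of_int a - 1/4) (of_int (a + 1) + 1/4) 0 1 (word_diag n [i, i]) [word_lift n [i, i] a, word_lift n [i, i] (a + 1)]"
      using box_arcs_word[OF assms(1) _ n(3) l(1) sub(1) win(2,3)] by simp
    show "box_arcs n (of_int a - 1/4) (of_int (a + 1) + 1/4) 0 1 (word_diag n [i]) [word_lift n [i] a, word_lift n [i] (a + 1)]"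
      using box_arcs_word[OF assms(1) _ n(3) l(2) sub(2) win(2,3)] by simp
    have "card (meets 0 1 (word_lift n [i, i] a) (word_lift n [i, i] (a + 1))) = card {1/4, 5/8 :: real}"
      by (rule card_meets) (auto simp: s split: if_splits)
    then show "card (meets 0 1 (word_lift n [i, i] a) (word_lift n [i, i] (a + 1))) = 2" by simp
    have "card (meets 0 1 (word_lift n [i] a) (word_lift n [i] (a + 1))) = card {1/4 :: real}"
      by (rule card_meets) (auto simp: s split: if_splits)
    then show "card (meets 0 1 (word_lift n [i] a) (word_lift n [i] (a + 1))) = 1" by simp
  qed (auto simp: s)
qed

text \<open>Both triple words reverse the three positions, each pair crossing once, at the midpoints
  of the three height intervals in a different order. In the two-letter word the strand from
  \<open>a\<close> crosses the two others, which do not meet each other; this is the right-hand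
  picture of the move.\<close>

lemma three_move_word:
  assumes "n \<ge> 3" "i \<in> {1..n}" "w = [i, nxt n i, i] \<or> w = [nxt n i, i, nxt n i]"
  shows "three_move n (word_diag n w) (word_diag n [i, nxt n i])"
proof -
  have n: "n \<ge> 1" "n \<ge> 2" "2 < int n" using assms by auto
  define a where "a = int i"
  let ?j = "nxt n i"
  have j: "?j \<in> {1..n}" by (rule nxt_range[OF assms(2)])
  have "res n (a + 1 + 1) = nxt n (res n (a + 1))" by (rule res_Suc[OF n(1)])
  then have r: "res n a = i" "res n (a + 1) = ?j" "res n (a + 2) = nxt n ?j"
    using res_int[OF assms(2)] res_Suc[OF n(1), of a] by (auto simp: a_def add.assoc)
  have ne: "?j \<noteq> i" "nxt n ?j \<noteq> ?j" "nxt n ?j \<noteq> i"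
    using nxt_neq[OF n(2) assms(2)] nxt_neq[OF n(2) j] nxt_neq_prv[OF assms(1,2)] prv_nxt[OF j] by metis+
  have s: "swp n i a = a + 1" "swp n i (a + 1) = a" "swp n i (a + 2) = a + 2"
    "swp n ?j a = a" "swp n ?j (a + 1) = a + 2" "swp n ?j (a + 2) = a + 1"
    using r ne ne[symmetric] by (auto simp: swp_def)
  have win: "{a..<a + 2} = {a, a + 1}" "set [a, a + 1, a + 2] = {a..a + 2}" "distinct [a, a + 1, a + 2]" by auto
  have ij: "set [i, ?j] \<subseteq> res n ` {a..<a + 2}" unfolding win using r by auto
  have sub: "set w \<subseteq> res n ` {a..<a + 2}" using assms(3) ij by auto
  have l: "w \<in> lists {1..n}" "[i, ?j] \<in> lists {1..n}" using assms(2,3) j by auto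
  show ?thesis
  proof (rule three_moveI)
    show "is_box n (of_int a - 1/4) (of_int (a + 2) + 1/4) 0 1" using assms(1) by (simp add: is_box_def)
    show "agree_outside n (of_int a - 1/4) (of_int (a + 2) + 1/4) 0 1 (word_diag n w) (word_diag n [i, ?j])"
      by (rule agree_outside_word[OF assms(1) _ n(3) l(1) sub l(2) ij]) simp
    show "box_arcs n (of_int a - 1/4) (of_int (a + 2) + 1/4) 0 1 (word_diag n w) [word_lift n w a, word_lift n w (a + 1), word_lift n w (a + 2)]"
      using box_arcs_word[OF assms(1) _ n(3) l(1) sub win(2,3)] by simp
    show "box_arcs n (of_int a - 1/4) (of_int (a + 2) + 1/4) 0 1 (word_diag n [i, ?j])
      [word_lift n [i, ?j] a, word_lift n [i, ?j] (a + 1), word_lift n [i, ?j] (a + 2)]"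
      using box_arcs_word[OF assms(1) _ n(3) l(2) ij win(2,3)] by simp
    have c: "card (meets 0 1 (word_lift n w a) (word_lift n w (a + 1))) = 1 \<and>
       card (meets 0 1 (word_lift n w a) (word_lift n w (a + 2))) = 1 \<and>
       card (meets 0 1 (word_lift n w (a + 1)) (word_lift n w (a + 2))) = 1"
      using assms(3)
    proof
      assume w: "w = [i, ?j, i]"
      have "card (meets 0 1 (word_lift n w a) (word_lift n w (a + 1))) = card {1/4 :: real}" unfolding w
        by (rule card_meets) (auto simp: s split: if_splits)
      moreover have "card (meets 0 1 (word_lift n w a) (word_lift n w (a + 2))) = card {5/8 :: real}" unfolding w
        by (rule card_meets) (auto simp: s split: if_splits)
      moreover have "card (meets 0 1 (word_lift n w (a + 1)) (word_lift n w (a + 2))) = card {13/16 :: real}" unfolding w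
        by (rule card_meets) (auto simp: s split: if_splits)
      ultimately show ?thesis by simp
    next
      assume w: "w = [?j, i, ?j]"
      have "card (meets 0 1 (word_lift n w a) (word_lift n w (a + 1))) = card {13/16 :: real}" unfolding w
        by (rule card_meets) (auto simp: s split: if_splits)
      moreover have "card (meets 0 1 (word_lift n w a) (word_lift n w (a + 2))) = card {5/8 :: real}" unfolding w
        by (rule card_meets) (auto simp: s split: if_splits)
      moreover have "card (meets 0 1 (word_lift n w (a + 1)) (word_lift n w (a + 2))) = card {1/4 :: real}" unfolding w
        by (rule card_meets) (auto simp: s split: if_splits)
      ultimately show ?thesis by simp
    qed
    then show "card (meets 0 1 (word_lift n w a) (word_lift n w (a + 1))) = 1"
      "card (meets 0 1 (word_lift n w a) (word_lift n w (a + 2))) = 1"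
      "card (meets 0 1 (word_lift n w (a + 1)) (word_lift n w (a + 2))) = 1" by blast+
    have "card (meets 0 1 (word_lift n [i, ?j] a) (word_lift n [i, ?j] (a + 1))) = card {1/4 :: real}"
      by (rule card_meets) (auto simp: s split: if_splits)
    then show "card (meets 0 1 (word_lift n [i, ?j] a) (word_lift n [i, ?j] (a + 1))) = 1" by simp
    have "card (meets 0 1 (word_lift n [i, ?j] a) (word_lift n [i, ?j] (a + 2))) = card {5/8 :: real}"
      by (rule card_meets) (auto simp: s split: if_splits)
    then show "card (meets 0 1 (word_lift n [i, ?j] a) (word_lift n [i, ?j] (a + 2))) = 1" by simp
    show "meets 0 1 (word_lift n [i, ?j] (a + 1)) (word_lift n [i, ?j] (a + 2)) = {}"
      by (auto simp: meets_def s split: if_splits)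
  qed (use assms(3) in \<open>auto simp: s word_lift_0 word_lift_1\<close>)
qed

section \<open>Moves inside one factor of a stack\<close>

lemma mem_image_stack:
  assumes "n \<ge> 1" "is_diag n A" "is_diag n B"
  shows "t \<le> 1/2 \<Longrightarrow> (z, t) \<in> diag_image n (stack n A B) \<longleftrightarrow> (z, 2 * t) \<in> diag_image n A"
    and "1/2 \<le> t \<Longrightarrow> (z, t) \<in> diag_image n (stack n A B) \<longleftrightarrow> (z, 2 * t - 1) \<in> diag_image n B"
proof -
  assume t: "t \<le> 1/2"
  then have "t \<in> {0..1} \<longleftrightarrow> 2 * t \<in> {0..1}" by auto
  then show "(z, t) \<in> diag_image n (stack n A B) \<longleftrightarrow> (z, 2 * t) \<in> diag_image n A"
    unfolding mem_diag_image stack_low[OF t] by simp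
next
  assume t: "1/2 \<le> t"
  then have "t \<in> {0..1} \<longleftrightarrow> 2 * t - 1 \<in> {0..1}" by auto
  moreover have "(\<exists>k\<in>{1..n}. stack n A B k t = z) \<longleftrightarrow> (\<exists>l\<in>top_pos n A ` {1..n}. B l (2 * t - 1) = z)"
    using stack_high[OF assms _ t] by simp
  ultimately show "(z, t) \<in> diag_image n (stack n A B) \<longleftrightarrow> (z, 2 * t - 1) \<in> diag_image n B"
    unfolding mem_diag_image top_pos_image[OF assms(1,2)] by simp
qed

text \<open>The box is rescaled to the upper half. A strand of the stack is labelled by its starting
  point in \<open>A\<close>, so the labels of the arcs are pulled back along
  \<open>top_pos n A\<close>.\<close>

lemma box_upper:
  assumes "n \<ge> 1" "is_diag n A" "is_diag n P" "is_diag n P'" "is_box n x0 x1 t0 t1"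
  shows "is_box n x0 x1 ((t0 + 1) / 2) ((t1 + 1) / 2)"
    and "agree_outside n x0 x1 t0 t1 P P' \<Longrightarrow>
      agree_outside n x0 x1 ((t0 + 1) / 2) ((t1 + 1) / 2) (stack n A P) (stack n A P')"
    and "box_arcs n x0 x1 t0 t1 P gs \<Longrightarrow>
      box_arcs n x0 x1 ((t0 + 1) / 2) ((t1 + 1) / 2) (stack n A P) (map (\<lambda>g t. g (2 * t - 1)) gs)"
proof -
  have b: "0 \<le> t0" "t0 < t1" "t1 \<le> 1" using assms(5) unfolding is_box_def by auto
  show "is_box n x0 x1 ((t0 + 1) / 2) ((t1 + 1) / 2)" using assms(5) unfolding is_box_def by auto
  have T: "t \<in> {(t0 + 1) / 2..(t1 + 1) / 2} \<longleftrightarrow> 2 * t - 1 \<in> {t0..t1}" for t by auto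
  show "agree_outside n x0 x1 ((t0 + 1) / 2) ((t1 + 1) / 2) (stack n A P) (stack n A P')"
    if a: "agree_outside n x0 x1 t0 t1 P P'"
  proof (rule agree_outsideI)
    fix z t assume o: "\<not> (z \<in> circ_pt n ` {x0..x1} \<and> t \<in> {(t0 + 1) / 2..(t1 + 1) / 2})"
    show "(z, t) \<in> diag_image n (stack n A P) \<longleftrightarrow> (z, t) \<in> diag_image n (stack n A P')"
    proof (cases "t \<le> 1/2")
      case True
      then show ?thesis using mem_image_stack(1)[OF assms(1,2,3) True] mem_image_stack(1)[OF assms(1,2,4) True] by simp
    next
      case False
      then have t: "1/2 \<le> t" by simp
      show ?thesis unfolding mem_image_stack(2)[OF assms(1,2,3) t] mem_image_stack(2)[OF assms(1,2,4) t]
        by (rule agree_outsideD[OF a]) (use o T in blast)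
    qed
  qed
  show "box_arcs n x0 x1 ((t0 + 1) / 2) ((t1 + 1) / 2) (stack n A P) (map (\<lambda>g t. g (2 * t - 1)) gs)"
    if a: "box_arcs n x0 x1 t0 t1 P gs"
  proof -
    obtain ks where ks: "distinct ks" "set ks \<subseteq> {1..n}" "length ks = length gs"
      "\<And>j. j < length gs \<Longrightarrow> continuous_on {t0..t1} (gs ! j)"
      "\<And>j t. j < length gs \<Longrightarrow> t \<in> {t0..t1} \<Longrightarrow> x0 < (gs ! j) t \<and> (gs ! j) t < x1 \<and> P (ks ! j) t = circ_pt n ((gs ! j) t)"
      "\<And>k t. k \<in> {1..n} - set ks \<Longrightarrow> t \<in> {t0..t1} \<Longrightarrow> P k t \<notin> circ_pt n ` {x0..x1}"
      using a unfolding box_arcs_def by blast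
    define q where "q = inv_into {1..n} (top_pos n A)"
    have im: "top_pos n A ` {1..n} = {1..n}" by (rule top_pos_image[OF assms(1,2)])
    have q: "q k \<in> {1..n}" "top_pos n A (q k) = k" if "k \<in> {1..n}" for k
      using inv_into_into[of k "top_pos n A" "{1..n}"] f_inv_into_f[of k "top_pos n A" "{1..n}"] that im
      unfolding q_def by auto
    have st: "stack n A P k t = P (top_pos n A k) (2 * t - 1)" if "k \<in> {1..n}" "2 * t - 1 \<in> {t0..t1}" for k t
      using that b by (intro stack_high[OF assms(1,2,3)]) auto
    show ?thesis unfolding box_arcs_def
    proof (intro exI[of _ "map q ks"] conjI allI impI ballI)
      have "inj_on q (set ks)" using q(2) ks(2) by (metis inj_onI subsetD)
      then show "distinct (map q ks)" using ks(1) by (simp add: distinct_map)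
      show "set (map q ks) \<subseteq> {1..n}" using q(1) ks(2) by auto
      show "length (map q ks) = length (map (\<lambda>g t. g (2 * t - 1)) gs)" using ks(3) by simp
      fix j assume "j < length (map (\<lambda>g t::real. g (2 * t - 1)::real) gs)"
      then have j: "j < length gs" by simp
      have kj: "ks ! j \<in> {1..n}" using ks(2,3) j by (metis nth_mem subsetD)
      have "continuous_on {(t0 + 1) / 2..(t1 + 1) / 2} (\<lambda>t. (gs ! j) (2 * t - 1))"
        by (intro continuous_on_compose2[OF ks(4)[OF j]] continuous_intros) auto
      then show "continuous_on {(t0 + 1) / 2..(t1 + 1) / 2} (map (\<lambda>g t. g (2 * t - 1)) gs ! j)" using j by simp
      fix t assume "t \<in> {(t0 + 1) / 2..(t1 + 1) / 2}"
      then have t: "2 * t - 1 \<in> {t0..t1}" unfolding T .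
      show "x0 < (map (\<lambda>g t. g (2 * t - 1)) gs ! j) t" "(map (\<lambda>g t. g (2 * t - 1)) gs ! j) t < x1"
        using ks(5)[OF j t] j by simp_all
      show "stack n A P (map q ks ! j) t = circ_pt n ((map (\<lambda>g t. g (2 * t - 1)) gs ! j) t)"
        using st[OF q(1)[OF kj] t] q(2)[OF kj] ks(5)[OF j t] j ks(3) by simp
    next
      fix k t assume k: "k \<in> {1..n} - set (map q ks)" and "t \<in> {(t0 + 1) / 2..(t1 + 1) / 2}"
      then have t: "2 * t - 1 \<in> {t0..t1}" using T by blast
      have k1: "k \<in> {1..n}" using k by blast
      have "top_pos n A k \<notin> set ks"
      proof
        assume m: "top_pos n A k \<in> set ks"
        then have m': "top_pos n A k \<in> {1..n}" using ks(2) by blast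
        have "q (top_pos n A k) = k" by (rule top_pos_inj[OF assms(1,2) q(1)[OF m'] k1 q(2)[OF m']])
        then have "k \<in> q ` set ks" using m by (metis imageI)
        then show False using k by simp
      qed
      then have "top_pos n A k \<in> {1..n} - set ks" using top_pos(1)[OF assms(1,2) k1] by simp
      then show "stack n A P k t \<notin> circ_pt n ` {x0..x1}" using ks(6)[OF _ t] st[OF k1 t] by simp
    qed
  qed
qed

lemma box_lower:
  assumes "n \<ge> 1" "is_diag n B" "is_diag n P" "is_diag n P'" "is_box n x0 x1 t0 t1"
  shows "is_box n x0 x1 (t0 / 2) (t1 / 2)"
    and "agree_outside n x0 x1 t0 t1 P P' \<Longrightarrow>
      agree_outside n x0 x1 (t0 / 2) (t1 / 2) (stack n P B) (stack n P' B)"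
    and "box_arcs n x0 x1 t0 t1 P gs \<Longrightarrow>
      box_arcs n x0 x1 (t0 / 2) (t1 / 2) (stack n P B) (map (\<lambda>g t. g (2 * t)) gs)"
proof -
  have b: "0 \<le> t0" "t0 < t1" "t1 \<le> 1" using assms(5) unfolding is_box_def by auto
  show "is_box n x0 x1 (t0 / 2) (t1 / 2)" using assms(5) unfolding is_box_def by auto
  have T: "t \<in> {t0 / 2..t1 / 2} \<longleftrightarrow> 2 * t \<in> {t0..t1}" for t by auto
  show "agree_outside n x0 x1 (t0 / 2) (t1 / 2) (stack n P B) (stack n P' B)"
    if a: "agree_outside n x0 x1 t0 t1 P P'"
  proof (rule agree_outsideI)
    fix z t assume o: "\<not> (z \<in> circ_pt n ` {x0..x1} \<and> t \<in> {t0 / 2..t1 / 2})"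
    show "(z, t) \<in> diag_image n (stack n P B) \<longleftrightarrow> (z, t) \<in> diag_image n (stack n P' B)"
    proof (cases "1/2 \<le> t")
      case True
      then show ?thesis using mem_image_stack(2)[OF assms(1,3,2) True] mem_image_stack(2)[OF assms(1,4,2) True] by simp
    next
      case False
      then have t: "t \<le> 1/2" by simp
      show ?thesis unfolding mem_image_stack(1)[OF assms(1,3,2) t] mem_image_stack(1)[OF assms(1,4,2) t]
        by (rule agree_outsideD[OF a]) (use o T in blast)
    qed
  qed
  show "box_arcs n x0 x1 (t0 / 2) (t1 / 2) (stack n P B) (map (\<lambda>g t. g (2 * t)) gs)"
    if a: "box_arcs n x0 x1 t0 t1 P gs"
  proof -
    obtain ks where ks: "distinct ks" "set ks \<subseteq> {1..n}" "length ks = length gs"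
      "\<And>j. j < length gs \<Longrightarrow> continuous_on {t0..t1} (gs ! j)"
      "\<And>j t. j < length gs \<Longrightarrow> t \<in> {t0..t1} \<Longrightarrow> x0 < (gs ! j) t \<and> (gs ! j) t < x1 \<and> P (ks ! j) t = circ_pt n ((gs ! j) t)"
      "\<And>k t. k \<in> {1..n} - set ks \<Longrightarrow> t \<in> {t0..t1} \<Longrightarrow> P k t \<notin> circ_pt n ` {x0..x1}"
      using a unfolding box_arcs_def by blast
    have st: "stack n P B k t = P k (2 * t)" if "2 * t \<in> {t0..t1}" for k t
      using that b by (intro stack_low) auto
    show ?thesis unfolding box_arcs_def
    proof (intro exI[of _ ks] conjI allI impI ballI)
      show "distinct ks" "set ks \<subseteq> {1..n}" by (rule ks)+
      show "length ks = length (map (\<lambda>g t. g (2 * t)) gs)" using ks(3) by simp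
      fix j assume "j < length (map (\<lambda>g t::real. g (2 * t)::real) gs)"
      then have j: "j < length gs" by simp
      have "continuous_on {t0 / 2..t1 / 2} (\<lambda>t. (gs ! j) (2 * t))"
        by (intro continuous_on_compose2[OF ks(4)[OF j]] continuous_intros) auto
      then show "continuous_on {t0 / 2..t1 / 2} (map (\<lambda>g t. g (2 * t)) gs ! j)" using j by simp
      fix t assume "t \<in> {t0 / 2..t1 / 2}"
      then have t: "2 * t \<in> {t0..t1}" unfolding T .
      show "x0 < (map (\<lambda>g t. g (2 * t)) gs ! j) t" "(map (\<lambda>g t. g (2 * t)) gs ! j) t < x1"
        using ks(5)[OF j t] j by simp_all
      show "stack n P B (ks ! j) t = circ_pt n ((map (\<lambda>g t. g (2 * t)) gs ! j) t)"
        using st[OF t] ks(5)[OF j t] j by simp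
    next
      fix k t assume k: "k \<in> {1..n} - set ks" and "t \<in> {t0 / 2..t1 / 2}"
      then have t: "2 * t \<in> {t0..t1}" using T by blast
      then show "stack n P B k t \<notin> circ_pt n ` {x0..x1}" using ks(6)[OF k t] st[OF t] by simp
    qed
  qed
qed

lemma meets_reparam:
  "meets ((t0 + 1) / 2) ((t1 + 1) / 2) (\<lambda>t. g (2 * t - 1)) (\<lambda>t. h (2 * t - 1)) = (\<lambda>t. (t + 1) / 2) ` meets t0 t1 g h"
  "meets (t0 / 2) (t1 / 2) (\<lambda>t. g (2 * t)) (\<lambda>t. h (2 * t)) = (\<lambda>t. t / 2) ` meets t0 t1 g h"
proof -
  show "meets ((t0 + 1) / 2) ((t1 + 1) / 2) (\<lambda>t. g (2 * t - 1)) (\<lambda>t. h (2 * t - 1)) = (\<lambda>t. (t + 1) / 2) ` meets t0 t1 g h"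
  proof (intro equalityI subsetI)
    fix t assume "t \<in> meets ((t0 + 1) / 2) ((t1 + 1) / 2) (\<lambda>t. g (2 * t - 1)) (\<lambda>t. h (2 * t - 1))"
    then have "2 * t - 1 \<in> meets t0 t1 g h" by (auto simp: meets_def)
    moreover have "t = ((2 * t - 1) + 1) / 2" by simp
    ultimately show "t \<in> (\<lambda>t. (t + 1) / 2) ` meets t0 t1 g h" by blast
  next
    fix t assume "t \<in> (\<lambda>t. (t + 1) / 2) ` meets t0 t1 g h"
    then obtain u where u: "u \<in> meets t0 t1 g h" "t = (u + 1) / 2" by blast
    then have "2 * t - 1 = u" by (simp add: field_simps)
    then have "g (2 * t - 1) = h (2 * t - 1)" using u(1) by (simp only: meets_def mem_Collect_eq)
    moreover have "t \<in> {(t0 + 1) / 2..(t1 + 1) / 2}" using u by (auto simp: meets_def)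
    ultimately show "t \<in> meets ((t0 + 1) / 2) ((t1 + 1) / 2) (\<lambda>t. g (2 * t - 1)) (\<lambda>t. h (2 * t - 1))"
      unfolding meets_def by blast
  qed
  show "meets (t0 / 2) (t1 / 2) (\<lambda>t. g (2 * t)) (\<lambda>t. h (2 * t)) = (\<lambda>t. t / 2) ` meets t0 t1 g h"
  proof (intro equalityI subsetI)
    fix t assume "t \<in> meets (t0 / 2) (t1 / 2) (\<lambda>t. g (2 * t)) (\<lambda>t. h (2 * t))"
    then have "2 * t \<in> meets t0 t1 g h" by (auto simp: meets_def)
    moreover have "t = (2 * t) / 2" by simp
    ultimately show "t \<in> (\<lambda>t. t / 2) ` meets t0 t1 g h" by blast
  qed (auto simp: meets_def)
qed

lemma card_meets_reparam:
  "card (meets ((t0 + 1) / 2) ((t1 + 1) / 2) (\<lambda>t. g (2 * t - 1)) (\<lambda>t. h (2 * t - 1))) = card (meets t0 t1 g h)"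
  "card (meets (t0 / 2) (t1 / 2) (\<lambda>t. g (2 * t)) (\<lambda>t. h (2 * t))) = card (meets t0 t1 g h)"
  unfolding meets_reparam by (auto intro!: card_image inj_onI)

lemma two_move_stack:
  assumes "n \<ge> 1" "is_diag n A" "is_diag n P" "is_diag n P'" "two_move n P P'"
  shows "two_move n (stack n A P) (stack n A P')" "two_move n (stack n P A) (stack n P' A)"
proof -
  obtain x0 x1 t0 t1 g1 g2 h1 h2 B1 B2 T1 T2 where
    box: "is_box n x0 x1 t0 t1" "agree_outside n x0 x1 t0 t1 P P'"
    "box_arcs n x0 x1 t0 t1 P [g1, g2]" "box_arcs n x0 x1 t0 t1 P' [h1, h2]"
    and e: "B1 < B2" "T1 < T2"
       "g1 t0 = B1" "g2 t0 = B2" "g1 t1 = T1" "g2 t1 = T2"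
       "h1 t0 = B1" "h2 t0 = B2" "h1 t1 = T2" "h2 t1 = T1"
       "card (meets t0 t1 g1 g2) = 2" "card (meets t0 t1 h1 h2) = 1"
    using assms(5) unfolding two_move_def by blast
  have t: "2 * ((t0 + 1) / 2) - 1 = t0" "2 * ((t1 + 1) / 2) - 1 = t1" "2 * (t0 / 2) = t0" "2 * (t1 / 2) = t1"
    by (simp_all add: field_simps)
  note up = box_upper[OF assms(1,2,3,4) box(1)] box_upper(3)[OF assms(1,2,4,3) box(1)]
  note lo = box_lower[OF assms(1,2,3,4) box(1)] box_lower(3)[OF assms(1,2,4,3) box(1)]
  show "two_move n (stack n A P) (stack n A P')"
    by (rule two_moveI[OF up(1) up(2)[OF box(2)] up(3)[OF box(3), simplified] up(4)[OF box(4), simplified]])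
      (unfold t card_meets_reparam, use e in simp_all)
  show "two_move n (stack n P A) (stack n P' A)"
    by (rule two_moveI[OF lo(1) lo(2)[OF box(2)] lo(3)[OF box(3), simplified] lo(4)[OF box(4), simplified]])
      (unfold t card_meets_reparam, use e in simp_all)
qed

lemma three_move_stack:
  assumes "n \<ge> 1" "is_diag n A" "is_diag n P" "is_diag n P'" "three_move n P P'"
  shows "three_move n (stack n A P) (stack n A P')" "three_move n (stack n P A) (stack n P' A)"
proof -
  obtain x0 x1 t0 t1 g1 g2 g3 h1 h2 h3 B1 B2 B3 T1 T2 T3 where
    box: "is_box n x0 x1 t0 t1" "agree_outside n x0 x1 t0 t1 P P'"
    "box_arcs n x0 x1 t0 t1 P [g1, g2, g3]" "box_arcs n x0 x1 t0 t1 P' [h1, h2, h3]"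
    and e: "B1 < B2" "B2 < B3" "T1 < T2" "T2 < T3"
       "g1 t0 = B1" "g2 t0 = B2" "g3 t0 = B3" "g1 t1 = T3" "g2 t1 = T2" "g3 t1 = T1"
       "h1 t0 = B1" "h2 t0 = B2" "h3 t0 = B3" "h1 t1 = T3" "h2 t1 = T1" "h3 t1 = T2"
       "card (meets t0 t1 g1 g2) = 1" "card (meets t0 t1 g1 g3) = 1" "card (meets t0 t1 g2 g3) = 1"
       "card (meets t0 t1 h1 h2) = 1" "card (meets t0 t1 h1 h3) = 1" "meets t0 t1 h2 h3 = {}"
    using assms(5) unfolding three_move_def by blast
  have t: "2 * ((t0 + 1) / 2) - 1 = t0" "2 * ((t1 + 1) / 2) - 1 = t1" "2 * (t0 / 2) = t0" "2 * (t1 / 2) = t1"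
    by (simp_all add: field_simps)
  note up = box_upper[OF assms(1,2,3,4) box(1)] box_upper(3)[OF assms(1,2,4,3) box(1)]
  note lo = box_lower[OF assms(1,2,3,4) box(1)] box_lower(3)[OF assms(1,2,4,3) box(1)]
  show "three_move n (stack n A P) (stack n A P')"
    by (rule three_moveI[OF up(1) up(2)[OF box(2)] up(3)[OF box(3), simplified] up(4)[OF box(4), simplified]])
      (unfold t card_meets_reparam, use e meets_reparam(1)[of t0 t1 h2 h3] in simp_all)
  show "three_move n (stack n P A) (stack n P' A)"
    by (rule three_moveI[OF lo(1) lo(2)[OF box(2)] lo(3)[OF box(3), simplified] lo(4)[OF box(4), simplified]])
      (unfold t card_meets_reparam, use e meets_reparam(2)[of t0 t1 h2 h3] in simp_all)
qed

section \<open>The equivalence relation generated by the moves\<close>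

lemma ndiagsD: "D \<in> ndiags n \<Longrightarrow> is_diag n D"
  by (simp add: ndiags_def)

lemma word_ndiags: "n \<ge> 3 \<Longrightarrow> w \<in> lists {1..n} \<Longrightarrow> word_diag n w \<in> ndiags n"
  unfolding ndiags_def using is_diag_word isotopic_refl by blast

lemma ndiags_isotopic:
  assumes "n \<ge> 3" "w \<in> lists {1..n}" "isotopic n (word_diag n w) D" "is_diag n D"
  shows "D \<in> ndiags n"
  unfolding ndiags_def using assms by blast

lemma DC_rel_refl: "D \<in> ndiags n \<Longrightarrow> (D, D) \<in> DC_rel n"
  unfolding DC_rel_def move_step_def using isotopic_refl[OF ndiagsD] by blast

lemma DC_rel_sym: "(D, E) \<in> DC_rel n \<Longrightarrow> (E, D) \<in> DC_rel n"
  unfolding DC_rel_def by (rule symD[OF sym_trancl[OF sym_Un_converse]])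

lemma DC_rel_trans: "(D, E) \<in> DC_rel n \<Longrightarrow> (E, F) \<in> DC_rel n \<Longrightarrow> (D, F) \<in> DC_rel n"
  unfolding DC_rel_def by (rule trancl_trans)

lemma DC_rel_step:
  assumes "D \<in> ndiags n" "E \<in> ndiags n" "isotopic n D E \<or> two_move n D E \<or> three_move n D E"
  shows "(D, E) \<in> DC_rel n"
  unfolding DC_rel_def move_step_def using assms by blast

lemma DC_rel_ndiags: "(D, E) \<in> DC_rel n \<Longrightarrow> D \<in> ndiags n \<and> E \<in> ndiags n"
  unfolding DC_rel_def
proof (induction rule: trancl_induct)
  case (base y)
  then show ?case by (auto simp: move_step_def)
next
  case (step y z)
  then show ?case by (auto simp: move_step_def)
qed

lemma equiv_DC_rel: "equiv (ndiags n) (DC_rel n)"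
proof (rule equivI)
  show "DC_rel n \<subseteq> ndiags n \<times> ndiags n" using DC_rel_ndiags by auto
  show "refl_on (ndiags n) (DC_rel n)" using DC_rel_refl by (intro refl_onI) auto
  show "sym (DC_rel n)" using DC_rel_sym by (intro symI)
  show "trans (DC_rel n)" using DC_rel_trans by (intro transI)
qed

text \<open>The relation also contains the converses of the moves, which is why domination is
  established in both directions for each step.\<close>

lemma DC_rel_top_end:
  assumes "n \<ge> 1"
  shows "(D, E) \<in> DC_rel n \<Longrightarrow> top_end n D a b \<Longrightarrow> top_end n E a b"
  unfolding DC_rel_def
proof (induction rule: trancl_induct)
  have key: "dominates n F E \<and> dominates n E F" if "(E, F) \<in> move_step n \<union> (move_step n)\<inverse>" for E F
  proof -
    have *: "dominates n F E \<and> dominates n E F" if "(E, F) \<in> move_step n" for E F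
    proof -
      have d: "is_diag n E" "is_diag n F" using that ndiagsD unfolding move_step_def by auto
      from that consider "isotopic n E F" | "two_move n E F" | "three_move n E F" unfolding move_step_def by blast
      then show ?thesis
      proof cases
        case 1
        then show ?thesis using isotopic_dominates[OF assms _ d] by blast
      next
        case 2
        then show ?thesis using two_move_dominates[OF assms d] by blast
      next
        case 3
        then show ?thesis using three_move_dominates[OF assms d] by blast
      qed
    qed
    show ?thesis using that *[of E F] *[of F E] by blast
  qed
  {
    case (base E)
    show ?case by (rule top_end_dominates[OF _ _ base(2)]) (use key[OF base(1)] in blast)+
  next
    case (step E F)
    have "top_end n E a b" using step by blast
    then show ?case using top_end_dominates key[OF step(2)] by blast
  }
qed

lemma DC_rel_isotopic_words:
  assumes "n \<ge> 3" "u \<in> lists {1..n}" "v \<in> lists {1..n}" "isotopic n (word_diag n u) (word_diag n v)"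
  shows "(word_diag n u, word_diag n v) \<in> DC_rel n"
  using DC_rel_step[OF word_ndiags[OF assms(1,2)] word_ndiags[OF assms(1,3)]] assms(4) by blast

text \<open>The move takes place in the nested stack \<open>S p\<close>, where the factor
  \<open>p\<close> is a rescaled copy of its diagram. In the diagram of the concatenated word the
  letters sit at other heights, so isotopies lead from one to the other before and after.\<close>

lemma DC_rel_word_ctxt:
  assumes "n \<ge> 3" "p \<in> lists {1..n}" "q \<in> lists {1..n}" "u \<in> lists {1..n}" "v \<in> lists {1..n}"
    "two_move n (word_diag n p) (word_diag n q) \<or> three_move n (word_diag n p) (word_diag n q)"
  shows "(word_diag n (u @ p @ v), word_diag n (u @ q @ v)) \<in> DC_rel n"
proof -
  have n: "n \<ge> 1" using assms(1) by simp
  note D = is_diag_word[OF assms(1)]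
  define S where "S p = stack n (word_diag n u) (stack n (word_diag n p) (word_diag n v))" for p
  have S: "is_diag n (S x)" "isotopic n (S x) (word_diag n (u @ x @ v))" if x: "x \<in> lists {1..n}" for x
  proof -
    have xv: "x @ v \<in> lists {1..n}" using x assms(5) by simp
    note d = is_diag_stack[OF n D[OF x] D[OF assms(5)]]
    show dS: "is_diag n (S x)" unfolding S_def by (rule is_diag_stack[OF n D[OF assms(4)] d])
    have "isotopic n (S x) (stack n (word_diag n u) (word_diag n (x @ v)))" unfolding S_def
      by (rule isotopic_stack[OF n isotopic_refl[OF D[OF assms(4)]] isotopic_word_append[OF assms(1,5) x]
            D[OF assms(4)] d D[OF assms(4)] D[OF xv]])
    moreover have "isotopic n (stack n (word_diag n u) (word_diag n (x @ v))) (word_diag n (u @ x @ v))"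
      by (rule isotopic_word_append[OF assms(1) xv assms(4)])
    ultimately show "isotopic n (S x) (word_diag n (u @ x @ v))" using isotopic_trans dS by blast
  qed
  have w: "u @ x @ v \<in> lists {1..n}" if "x \<in> lists {1..n}" for x using that assms by simp
  have nd: "S x \<in> ndiags n" if x: "x \<in> lists {1..n}" for x
    by (rule ndiags_isotopic[OF assms(1) w[OF x] isotopic_sym[OF S(2)[OF x] S(1)[OF x]] S(1)[OF x]])
  have rel: "(S x, word_diag n (u @ x @ v)) \<in> DC_rel n" if x: "x \<in> lists {1..n}" for x
    using DC_rel_step[OF nd[OF x] word_ndiags[OF assms(1) w[OF x]]] S(2)[OF x] by blast
  have "two_move n (S p) (S q) \<or> three_move n (S p) (S q)"
  proof -
    note d = is_diag_stack[OF n D[OF assms(2)] D[OF assms(5)]] is_diag_stack[OF n D[OF assms(3)] D[OF assms(5)]]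
    show ?thesis using assms(6)
    proof
      assume "two_move n (word_diag n p) (word_diag n q)"
      then have "two_move n (stack n (word_diag n p) (word_diag n v)) (stack n (word_diag n q) (word_diag n v))"
        by (rule two_move_stack(2)[OF n D[OF assms(5)] D[OF assms(2)] D[OF assms(3)]])
      then have "two_move n (S p) (S q)" unfolding S_def by (rule two_move_stack(1)[OF n D[OF assms(4)] d])
      then show ?thesis by blast
    next
      assume "three_move n (word_diag n p) (word_diag n q)"
      then have "three_move n (stack n (word_diag n p) (word_diag n v)) (stack n (word_diag n q) (word_diag n v))"
        by (rule three_move_stack(2)[OF n D[OF assms(5)] D[OF assms(2)] D[OF assms(3)]])
      then have "three_move n (S p) (S q)" unfolding S_def by (rule three_move_stack(1)[OF n D[OF assms(4)] d])
      then show ?thesis by blast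
    qed
  qed
  then have "(S p, S q) \<in> DC_rel n" using DC_rel_step[OF nd[OF assms(2)] nd[OF assms(3)]] by blast
  from DC_rel_trans[OF DC_rel_sym[OF rel[OF assms(2)]] DC_rel_trans[OF this rel[OF assms(3)]]] show ?thesis .
qed

text \<open>The contexts \<open>a\<close> and \<open>b\<close> are part of the induction, which
  makes closure under contexts immediate. The symmetric braid relation is a 3-move followed by a
  3-move backwards, both through the word \<open>[i, nxt n i]\<close>.\<close>

lemma C_cong_DC_rel:
  assumes "n \<ge> 3"
  shows "C_cong n u v \<Longrightarrow> a \<in> lists {1..n} \<Longrightarrow> b \<in> lists {1..n} \<Longrightarrow>
    (word_diag n (a @ u @ b), word_diag n (a @ v @ b)) \<in> DC_rel n"
proof (induction arbitrary: a b rule: C_cong.induct)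
  case (idem i)
  have l: "[i, i] \<in> lists {1..n}" "[i] \<in> lists {1..n}" using idem(1) by auto
  show ?case by (rule DC_rel_word_ctxt[OF assms l idem(2,3) disjI1[OF two_move_word[OF assms idem(1)]]])
next
  case (comm i j)
  have "i \<noteq> j" "j \<noteq> nxt n i" "i \<noteq> nxt n j" using comm(1-4) by (auto simp: nxt_def split: if_splits)
  then have "comm_cong n (a @ [i, j] @ b) (a @ [j, i] @ b)" using comm by (intro comm_cong.swap)
  then show ?case using DC_rel_isotopic_words[OF assms] comm_cong_isotopic[OF assms] comm_cong_lists by blast
next
  case (braid1 i)
  have j: "nxt n i \<in> {1..n}" by (rule nxt_range[OF braid1(1)])
  have key: "(word_diag n (a @ w @ b), word_diag n (a @ [i, nxt n i] @ b)) \<in> DC_rel n"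
    if w: "w = [i, nxt n i, i] \<or> w = [nxt n i, i, nxt n i]" for w
  proof -
    have l: "w \<in> lists {1..n}" "[i, nxt n i] \<in> lists {1..n}" using w braid1(1) j by auto
    show ?thesis by (rule DC_rel_word_ctxt[OF assms l braid1(2,3) disjI2[OF three_move_word[OF assms braid1(1) w]]])
  qed
  show ?case by (rule DC_rel_trans[OF key[OF disjI1] DC_rel_sym[OF key[OF disjI2]]]) simp_all
next
  case (braid2 i)
  have j: "nxt n i \<in> {1..n}" by (rule nxt_range[OF braid2(1)])
  have l: "[nxt n i, i, nxt n i] \<in> lists {1..n}" "[i, nxt n i] \<in> lists {1..n}" using braid2(1) j by auto
  show ?case
    by (rule DC_rel_word_ctxt[OF assms l braid2(2,3) disjI2[OF three_move_word[OF assms braid2(1) disjI2[OF HOL.refl]]]])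
next
  case (refl u)
  then show ?case by (intro DC_rel_refl word_ndiags assms) simp
next
  case (sym u v)
  show ?case by (rule DC_rel_sym[OF sym.IH[OF sym.prems]])
next
  case (trans u v w)
  show ?case by (rule DC_rel_trans[OF trans.IH(1)[OF trans.prems] trans.IH(2)[OF trans.prems]])
next
  case (ctxt u v c d)
  then have "a @ c \<in> lists {1..n}" "d @ b \<in> lists {1..n}" by auto
  from ctxt.IH[OF this] show ?case by simp
qed

text \<open>The rightmost ends compute \<open>act\<close>; its jumps off the diagonal give the
  directions of the strands, and both together give \<open>right_end\<close>, which determines an
  alternating word up to commutations.\<close>

lemma DC_rel_altern:
  assumes "n \<ge> 3" "x \<in> lists {1..n}" "y \<in> lists {1..n}" "altern n x" "altern n y"
    "(word_diag n x, word_diag n y) \<in> DC_rel n"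
  shows "comm_cong n x y"
proof -
  have n: "n \<ge> 1" using assms(1) by simp
  have act: "act n x a = act n y a" for a
    using top_end_unique[OF DC_rel_top_end[OF n assms(6) top_end_word[OF assms(1,2)]] top_end_word[OF assms(1,3)]] .
  have s: "set x \<subseteq> {1..n}" "set y \<subseteq> {1..n}" using assms(2,3) by auto
  have "goes_right n x a = goes_right n y a" for a
    using goes_right_act[OF assms(1) s(1) assms(4)] goes_right_act[OF assms(1) s(2) assms(5)] act by simp
  then have "right_end n x = right_end n y" using act by (auto simp: right_end_def fun_eq_iff)
  then show ?thesis using altern_unique[OF assms(1-5)] by blast
qed

text \<open>From diagrams to words, both words are replaced by congruent alternating ones, to which
  the invariant applies.\<close>

lemma DC_rel_words_iff:
  assumes "n \<ge> 3" "u \<in> lists {1..n}" "v \<in> lists {1..n}"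
  shows "(word_diag n u, word_diag n v) \<in> DC_rel n \<longleftrightarrow> C_cong n u v"
proof
  assume "C_cong n u v"
  from C_cong_DC_rel[OF assms(1) this, of "[]" "[]"] show "(word_diag n u, word_diag n v) \<in> DC_rel n" by simp
next
  assume r: "(word_diag n u, word_diag n v) \<in> DC_rel n"
  obtain x where x: "altern n x" "C_cong n u x" using C_cong_altern[OF assms(1,2)] by blast
  obtain y where y: "altern n y" "C_cong n v y" using C_cong_altern[OF assms(1,3)] by blast
  have xl: "x \<in> lists {1..n}" "y \<in> lists {1..n}" using C_cong_lists x(2) y(2) by blast+
  have "(word_diag n u, word_diag n x) \<in> DC_rel n" "(word_diag n v, word_diag n y) \<in> DC_rel n"
    using C_cong_DC_rel[OF assms(1) x(2), of "[]" "[]"] C_cong_DC_rel[OF assms(1) y(2), of "[]" "[]"] by simp_all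
  then have "(word_diag n x, word_diag n y) \<in> DC_rel n"
    using DC_rel_trans[OF DC_rel_sym DC_rel_trans[OF r]] by blast
  then have "C_cong n x y" using DC_rel_altern[OF assms(1) xl x(1) y(1)] comm_cong_C_cong by blast
  then show "C_cong n u v" by (rule C_cong.trans[OF x(2) C_cong.trans[OF _ C_cong.sym[OF y(2)]]])
qed

section \<open>Contractible bigons and triangles\<close>

definition has_bad_region :: "nat \<Rightarrow> diag \<Rightarrow> bool"
  where "has_bad_region n D \<longleftrightarrow> has_contractible_bigon n D \<or> has_contractible_triangle n D"

lemma bounds_disk_image:
  assumes "bounds_disk S" "continuous_on cylinder h" "inj_on h cylinder" "h ` cylinder \<subseteq> cylinder"
  shows "bounds_disk (h ` S)"
proof -
  obtain d :: "complex \<Rightarrow> complex \<times> real" where d: "continuous_on (cball 0 1) d" "inj_on d (cball 0 1)"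
    "d ` cball 0 1 \<subseteq> cylinder" "d ` sphere 0 1 = S" using assms(1) unfolding bounds_disk_def by blast
  show ?thesis unfolding bounds_disk_def
  proof (intro exI[of _ "h \<circ> d"] conjI)
    show "continuous_on (cball 0 1) (h \<circ> d)"
      using d(1) continuous_on_subset[OF assms(2) d(3)] by (rule continuous_on_compose)
    show "inj_on (h \<circ> d) (cball 0 1)" using d(2) inj_on_subset[OF assms(3) d(3)] by (rule comp_inj_on)
    show "(h \<circ> d) ` cball 0 1 \<subseteq> cylinder" unfolding image_comp[symmetric] using d(3) assms(4) by blast
    show "(h \<circ> d) ` sphere 0 1 = h ` S" unfolding image_comp[symmetric] d(4) ..
  qed
qed

lemma strand_arc_le: "s \<le> t \<Longrightarrow> strand_arc D k s t = (\<lambda>u. (D k u, u)) ` {s..t}"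
  by (simp add: strand_arc_def closed_segment_eq_real_ivl)

lemma strand_arc_commute: "strand_arc D k s t = strand_arc D k t s"
  by (simp add: strand_arc_def closed_segment_commute)

text \<open>The transport of regions is stated for a map that acts on heights through \<open>f k\<close> on the strand
  \<open>k\<close>, sending it to the strand \<open>p k\<close>; both isotopies and stacking are of this form.\<close>

lemma has_bad_region_transport:
  assumes "has_bad_region n D" "continuous_on cylinder h" "inj_on h cylinder" "h ` cylinder \<subseteq> cylinder"
    and p: "inj_on p {1..n}" "p ` {1..n} \<subseteq> {1..n}"
    and f: "\<And>k t. k \<in> {1..n} \<Longrightarrow> t \<in> {0..1} \<Longrightarrow> h (D k t, t) = (D' (p k) (f k t), f k t)"
    and fm: "\<And>k t. k \<in> {1..n} \<Longrightarrow> t \<in> {0..1} \<Longrightarrow> f k t \<in> {0..1}"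
    and fless: "\<And>k s t. k \<in> {1..n} \<Longrightarrow> s \<in> {0..1} \<Longrightarrow> t \<in> {0..1} \<Longrightarrow> s < t \<Longrightarrow> f k s < f k t"
    and fc: "\<And>k. k \<in> {1..n} \<Longrightarrow> continuous_on {0..1} (f k)"
  shows "has_bad_region n D'"
proof -
  have arc: "h ` strand_arc D k s t = strand_arc D' (p k) (f k s) (f k t)"
    if k: "k \<in> {1..n}" and st: "s \<in> {0..1}" "t \<in> {0..1}" for k s t
  proof -
    have main: "h ` strand_arc D k s t = strand_arc D' (p k) (f k s) (f k t)"
      if st: "s \<in> {0..1}" "t \<in> {0..1}" and le: "s \<le> t" for s t
    proof -
      have fle: "f k u \<le> f k v" if "u \<in> {0..1}" "v \<in> {0..1}" "u \<le> v" for u v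
        using fless[OF k that(1,2)] that(3) by (cases "u = v") auto
      have "f k ` {s..t} = {f k s..f k t}"
      proof (intro equalityI subsetI)
        fix x assume "x \<in> f k ` {s..t}"
        then obtain u where u: "u \<in> {s..t}" "x = f k u" by blast
        then have "u \<in> {0..1}" using st by auto
        then show "x \<in> {f k s..f k t}" using fle[of s u] fle[of u t] u st by simp
      next
        fix x assume "x \<in> {f k s..f k t}"
        moreover have "continuous_on {s..t} (f k)" by (rule continuous_on_subset[OF fc[OF k]]) (use st in auto)
        ultimately obtain u where "s \<le> u" "u \<le> t" "f k u = x" using IVT'[of "f k" s x t] le by auto
        then show "x \<in> f k ` {s..t}" by auto
      qed
      then have "strand_arc D' (p k) (f k s) (f k t) = (\<lambda>u. (D' (p k) u, u)) ` (f k ` {s..t})"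
        using strand_arc_le[OF fle[OF st le], of D' "p k"] by simp
      then have "strand_arc D' (p k) (f k s) (f k t) = (\<lambda>u. (D' (p k) (f k u), f k u)) ` {s..t}"
        by (simp only: image_image)
      also have "\<dots> = (\<lambda>u. h (D k u, u)) ` {s..t}" using f[OF k] st by (intro image_cong) auto
      finally show ?thesis unfolding strand_arc_le[OF le] by (simp add: image_image)
    qed
    show ?thesis
    proof (cases "s \<le> t")
      case True
      then show ?thesis using main[OF st] by blast
    next
      case False
      then show ?thesis using main[OF st(2,1)] strand_arc_commute by (metis linear)
    qed
  qed
  \<comment> \<open>The height functions of two strands may differ, but at a crossing they agree,
    because \<open>h\<close> has a single value there.\<close>
  have cross: "f j t = f k t \<and> D' (p j) (f j t) = D' (p k) (f j t)"
    if "j \<in> {1..n}" "k \<in> {1..n}" "t \<in> {0..1}" "D j t = D k t" for j k t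
  proof -
    have "(D' (p j) (f j t), f j t) = (D' (p k) (f k t), f k t)"
      using f[OF that(1,3)] f[OF that(2,3)] that(4) by metis
    then show ?thesis unfolding prod.inject by (metis (no_types))
  qed
  have pr: "p k \<in> {1..n}" if "k \<in> {1..n}" for k using p(2) that by blast
  have pn: "p j \<noteq> p k" if "j \<in> {1..n}" "k \<in> {1..n}" "j \<noteq> k" for j k using inj_onD[OF p(1)] that by blast
  from assms(1) consider "has_contractible_bigon n D" | "has_contractible_triangle n D"
    unfolding has_bad_region_def by blast
  then show ?thesis
  proof cases
    case 1
    then obtain j k s t where b: "j \<in> {1..n}" "k \<in> {1..n}" "s \<in> {0..1}" "t \<in> {0..1}" "j \<noteq> k" "s < t"
      "D j s = D k s" "D j t = D k t" "bounds_disk (strand_arc D j s t \<union> strand_arc D k s t)"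
      unfolding has_contractible_bigon_def by blast
    note c = cross[OF b(1,2,3,7)] cross[OF b(1,2,4,8)]
    have "bounds_disk (strand_arc D' (p j) (f j s) (f j t) \<union> strand_arc D' (p k) (f j s) (f j t))"
      using bounds_disk_image[OF b(9) assms(2-4)] arc[OF b(1,3,4)] arc[OF b(2,3,4)] c by (simp add: image_Un)
    then have "has_contractible_bigon n D'" unfolding has_contractible_bigon_def
      using pr[OF b(1)] pr[OF b(2)] pn[OF b(1,2,5)] fm[OF b(1,3)] fm[OF b(1,4)] fless[OF b(1,3,4,6)] c by metis
    then show ?thesis unfolding has_bad_region_def by blast
  next
    case 2
    then obtain i j k r s t where b: "i \<in> {1..n}" "j \<in> {1..n}" "k \<in> {1..n}" "r \<in> {0..1}" "s \<in> {0..1}" "t \<in> {0..1}"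
      "i \<noteq> j" "j \<noteq> k" "i \<noteq> k" "D i r = D j r" "D j s = D k s" "D k t = D i t"
      "bounds_disk (strand_arc D j r s \<union> strand_arc D k s t \<union> strand_arc D i t r)"
      unfolding has_contractible_triangle_def by blast
    note c = cross[OF b(1,2,4,10)] cross[OF b(2,3,5,11)] cross[OF b(3,1,6,12)]
    have "bounds_disk (strand_arc D' (p j) (f i r) (f j s) \<union> strand_arc D' (p k) (f j s) (f k t) \<union>
        strand_arc D' (p i) (f k t) (f i r))"
      using bounds_disk_image[OF b(13) assms(2-4)] arc[OF b(2,4,5)] arc[OF b(3,5,6)] arc[OF b(1,6,4)] c
      by (simp add: image_Un)
    moreover have "D' (p i) (f i r) = D' (p j) (f i r)" "D' (p j) (f j s) = D' (p k) (f j s)"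
      "D' (p k) (f k t) = D' (p i) (f k t)" using c by blast+
    ultimately have "has_contractible_triangle n D'" unfolding has_contractible_triangle_def
      using pr[OF b(1)] pr[OF b(2)] pr[OF b(3)] pn[OF b(1,2,7)] pn[OF b(2,3,8)] pn[OF b(1,3,9)]
        fm[OF b(1,4)] fm[OF b(2,5)] fm[OF b(3,6)] by blast
    then show ?thesis unfolding has_bad_region_def by blast
  qed
qed

lemma has_bad_region_isotopic:
  assumes "isotopic n D D'" "is_diag n D" "has_bad_region n D"
  shows "has_bad_region n D'"
proof -
  obtain H where "isotopy_map n D D' H" using isotopicE[OF assms(1)] by blast
  note H = isotopy_mapD[OF this]
  define h where "h = H 1"
  have h: "carries n D D' h" using H(8) h_def by simp
  have "\<forall>k\<in>{1..n}. \<exists>f. inc_homeo f \<and> (\<forall>t\<in>{0..1}. h (D k t, t) = (D' k (f t), f t))"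
    using carries_reparam[OF h assms(2)] by blast
  from bchoice[OF this] obtain f where f: "\<forall>k\<in>{1..n}. inc_homeo (f k) \<and> (\<forall>t\<in>{0..1}. h (D k t, t) = (D' k (f k t), f k t))"
    by blast
  have hh: "continuous_on cylinder h" "inj_on h cylinder" "h ` cylinder \<subseteq> cylinder"
    using h unfolding carries_def by auto
  show ?thesis
  proof (rule has_bad_region_transport[OF assms(3) hh, of "\<lambda>k. k"])
    fix k assume k: "k \<in> {1..n}"
    have fk: "inc_homeo (f k)" using f k by blast
    show "continuous_on {0..1} (f k)" using fk unfolding inc_homeo_def by blast
    show "h (D k t, t) = (D' k (f k t), f k t)" "f k t \<in> {0..1}" if "t \<in> {0..1}" for t
      using f k that inc_homeo_mem[OF fk that] by blast+
    show "f k s < f k t" if "s \<in> {0..1}" "t \<in> {0..1}" "s < t" for s t using inc_homeo_less[OF fk that(1,2)] that(3) by blast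
  qed auto
qed

text \<open>A strand of the upper factor continues the strand of \<open>A\<close> that ends at its
  start, and the stack labels it by the latter; hence the inverse of \<open>top_pos n A\<close> as
  relabelling.\<close>

lemma has_bad_region_stack:
  assumes "n \<ge> 1" "is_diag n A" "is_diag n B"
  shows "has_bad_region n A \<Longrightarrow> has_bad_region n (stack n A B)" "has_bad_region n B \<Longrightarrow> has_bad_region n (stack n A B)"
proof -
  have c: "continuous_on cylinder lower_half" "continuous_on cylinder upper_half"
    unfolding lower_half_def upper_half_def divide_inverse by (intro continuous_intros)+
  have i: "inj_on lower_half cylinder" "inj_on upper_half cylinder"
    by (auto simp: inj_on_def lower_half_def upper_half_def)
  have m: "lower_half ` cylinder \<subseteq> cylinder" "upper_half ` cylinder \<subseteq> cylinder" using cylinder_halves by blast+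
  show "has_bad_region n (stack n A B)" if b: "has_bad_region n A"
  proof (rule has_bad_region_transport[OF b c(1) i(1) m(1), of "\<lambda>k. k" _ "\<lambda>k t. t / 2"])
    fix k :: nat and t :: real assume "t \<in> {0..1}"
    then show "lower_half (A k t, t) = (stack n A B k (t / 2), t / 2)" by (simp add: lower_half_def stack_low)
  qed (auto intro!: continuous_intros)
  show "has_bad_region n (stack n A B)" if b: "has_bad_region n B"
  proof (rule has_bad_region_transport[OF b c(2) i(2) m(2), of "inv_into {1..n} (top_pos n A)" _ "\<lambda>k t. (t + 1) / 2"])
    have im: "top_pos n A ` {1..n} = {1..n}" by (rule top_pos_image[OF assms(1,2)])
    show "inj_on (inv_into {1..n} (top_pos n A)) {1..n}" using im inj_on_inv_into by (metis order_refl)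
    show "inv_into {1..n} (top_pos n A) ` {1..n} \<subseteq> {1..n}" using im inv_into_into by (metis image_subsetI)
    fix k :: nat and t :: real assume k: "k \<in> {1..n}" and t: "t \<in> {0..1}"
    let ?q = "inv_into {1..n} (top_pos n A) k"
    have kk: "k \<in> top_pos n A ` {1..n}" using k im by simp
    have q: "?q \<in> {1..n}" "top_pos n A ?q = k" using inv_into_into[OF kk] f_inv_into_f[OF kk] by auto
    have "stack n A B ?q ((t + 1) / 2) = B k (2 * ((t + 1) / 2) - 1)"
      using stack_high[OF assms q(1), of "(t + 1) / 2"] q(2) t by simp
    moreover have "2 * ((t + 1) / 2) - 1 = t" by (simp add: field_simps)
    ultimately show "upper_half (B k t, t) = (stack n A B ?q ((t + 1) / 2), (t + 1) / 2)"
      by (simp only: upper_half_def fst_conv snd_conv)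
  qed (auto intro!: continuous_intros)
qed

text \<open>The unit disk is mapped chord by chord: \<open>Im z\<close> determines the height, and
  \<open>x z\<close>, the position of \<open>z\<close> relative to its horizontal chord,
  interpolates between \<open>l\<close> and \<open>r\<close>. A width below \<open>n\<close> makes
  the projection to the cylinder injective on each horizontal slice.\<close>

lemma bounds_disk_graphs:
  assumes "n \<ge> 1" "0 \<le> s" "s < t" "t \<le> 1" "continuous_on {s..t} l" "continuous_on {s..t} r"
    "l s = r s" "l t = r t" "\<And>u. u \<in> {s<..<t} \<Longrightarrow> l u < r u" "\<And>u. u \<in> {s..t} \<Longrightarrow> r u - l u < real n"
  shows "bounds_disk ((\<lambda>u. (circ_pt n (l u), u)) ` {s..t} \<union> (\<lambda>u. (circ_pt n (r u), u)) ` {s..t})"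
proof -
  define U where "U y = s + (t - s) * (y + 1) / 2" for y
  define m where "m u = (l u + r u) / 2" for u
  define w where "w u = (r u - l u) / 2" for u
  define x where "x z = Re z / sqrt (1 - (Im z)\<^sup>2)" for z
  define d where "d z = (circ_pt n (m (U (Im z)) + w (U (Im z)) * x z), U (Im z))" for z
  have ub: "U y \<in> {s..t}" if "\<bar>y\<bar> \<le> 1" for y
  proof -
    have "(t - s) * (y + 1) \<le> (t - s) * 2" by (rule mult_left_mono) (use that assms(3) in linarith)+
    moreover have "0 \<le> (t - s) * (y + 1)" by (rule mult_nonneg_nonneg) (use that assms(3) in linarith)+
    ultimately show ?thesis by (simp add: U_def field_simps)
  qed
  have us: "U y \<in> {s<..<t}" if "\<bar>y\<bar> < 1" for y
  proof -
    have "(t - s) * (y + 1) < (t - s) * 2" by (rule mult_strict_left_mono) (use that assms(3) in linarith)+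
    moreover have "0 < (t - s) * (y + 1)" by (rule mult_pos_pos) (use that assms(3) in linarith)+
    ultimately show ?thesis by (simp add: U_def field_simps)
  qed
  have ue: "U y = s \<or> U y = t" if "\<bar>y\<bar> = 1" for y
  proof -
    have "y = 1 \<or> y = -1" using that by linarith
    then show ?thesis by (auto simp: U_def field_simps)
  qed
  have uinj: "y = y'" if "U y = U y'" for y y' using that assms(3) by (simp add: U_def)
  have w0: "0 \<le> w u" if "u \<in> {s..t}" for u
  proof -
    have "u = s \<or> u = t \<or> u \<in> {s<..<t}" using that by auto
    then show ?thesis using assms(7,8) assms(9)[of u] by (auto simp: w_def less_imp_le)
  qed
  have im: "\<bar>Im z\<bar> \<le> 1" "\<bar>Re z\<bar> \<le> sqrt (1 - (Im z)\<^sup>2)" if "z \<in> cball 0 1" for z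
  proof -
    have "(Re z)\<^sup>2 + (Im z)\<^sup>2 \<le> 1" using that by (simp add: cmod_def)
    then show "\<bar>Re z\<bar> \<le> sqrt (1 - (Im z)\<^sup>2)" by (intro real_le_rsqrt) simp
    show "\<bar>Im z\<bar> \<le> 1" using that abs_Im_le_cmod[of z] by simp
  qed
  have xb: "\<bar>x z\<bar> \<le> 1" if "z \<in> cball 0 1" for z
  proof (cases "sqrt (1 - (Im z)\<^sup>2) = 0")
    case True
    then show ?thesis by (simp add: x_def)
  next
    case False
    then have "sqrt (1 - (Im z)\<^sup>2) > 0" using im(2)[OF that] by linarith
    then show ?thesis using im(2)[OF that] by (simp add: x_def abs_divide)
  qed
  have Uc: "continuous_on A (\<lambda>z. U (Im z))" for A unfolding U_def divide_inverse by (intro continuous_intros)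
  have mc: "continuous_on {s..t} m" "continuous_on {s..t} w"
    unfolding m_def w_def divide_inverse by (intro continuous_intros assms(5,6))+
  have Um: "(\<lambda>z. U (Im z)) ` cball 0 1 \<subseteq> {s..t}" using ub im(1) by blast
  have mU: "continuous_on (cball 0 1) (\<lambda>z. m (U (Im z)))" and wU: "continuous_on (cball 0 1) (\<lambda>z. w (U (Im z)))"
    by (rule continuous_on_compose2[OF mc(1) Uc Um], rule continuous_on_compose2[OF mc(2) Uc Um])
  \<comment> \<open>At the poles the chord shrinks to a point and \<open>x\<close> has no limit;
    division by zero gives it the value 0 there. The product is continuous nevertheless, since the
    width \<open>w\<close> tends to 0 while \<open>x\<close> is bounded by 1.\<close>
  have wx: "continuous_on (cball 0 1) (\<lambda>z. w (U (Im z)) * x z)"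
    unfolding continuous_on_eq_continuous_within
  proof
    fix z0 :: complex assume z0: "z0 \<in> cball 0 1"
    have wz: "((\<lambda>z. w (U (Im z))) \<longlongrightarrow> w (U (Im z0))) (at z0 within cball 0 1)"
      using wU z0 unfolding continuous_on_def by blast
    show "continuous (at z0 within cball 0 1) (\<lambda>z. w (U (Im z)) * x z)"
    proof (cases "\<bar>Im z0\<bar> = 1")
      case True
      have w00: "w (U (Im z0)) = 0" using ue[OF True] assms(7,8) by (auto simp: w_def)
      have "((\<lambda>z. w (U (Im z)) * x z) \<longlongrightarrow> 0) (at z0 within cball 0 1)"
      proof (rule Lim_null_comparison)
        show "\<forall>\<^sub>F z in at z0 within cball 0 1. norm (w (U (Im z)) * x z) \<le> w (U (Im z))"
          unfolding eventually_at_filter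
        proof (intro always_eventually allI impI)
          fix z :: complex assume z: "z \<in> cball 0 1"
          have "\<bar>w (U (Im z))\<bar> * \<bar>x z\<bar> \<le> w (U (Im z)) * 1"
            using w0[OF ub[OF im(1)[OF z]]] xb[OF z] by (intro mult_mono) auto
          then show "norm (w (U (Im z)) * x z) \<le> w (U (Im z))" by (simp add: abs_mult)
        qed
        show "((\<lambda>z. w (U (Im z))) \<longlongrightarrow> 0) (at z0 within cball 0 1)" using wz w00 by simp
      qed
      then show ?thesis unfolding continuous_within using w00 by simp
    next
      case False
      then have "(Im z0)\<^sup>2 < 1" using im(1)[OF z0] by (simp add: abs_square_less_1)
      then have "sqrt (1 - (Im z0)\<^sup>2) \<noteq> 0" by simp
      then have "(x \<longlongrightarrow> x z0) (at z0 within cball 0 1)" unfolding x_def[abs_def] by (intro tendsto_intros)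
      then show ?thesis unfolding continuous_within using wz by (intro tendsto_mult)
    qed
  qed
  have X: "m (U (Im z)) + w (U (Im z)) * x z \<in> {l (U (Im z))..r (U (Im z))}" if z: "z \<in> cball 0 1" for z
  proof -
    let ?u = "U (Im z)"
    have "\<bar>w ?u * x z\<bar> \<le> w ?u * 1" unfolding abs_mult
      using w0[OF ub[OF im(1)[OF z]]] xb[OF z] by (intro mult_mono) auto
    then have "- w ?u \<le> w ?u * x z" "w ?u * x z \<le> w ?u" by (auto simp: abs_le_iff)
    moreover have "m ?u - w ?u = l ?u" "m ?u + w ?u = r ?u" by (auto simp: m_def w_def field_simps)
    ultimately show ?thesis by auto
  qed
  have inj: "inj_on d (cball 0 1)"
  proof (rule inj_onI)
    fix z z' assume z: "z \<in> cball 0 1" and z': "z' \<in> cball 0 1" and e: "d z = d z'"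
    then have i: "Im z = Im z'" using uinj by (auto simp: d_def)
    let ?u = "U (Im z)"
    have uI: "?u \<in> {s..t}" by (rule ub[OF im(1)[OF z]])
    have "circ_pt n (m ?u + w ?u * x z) = circ_pt n (m ?u + w ?u * x z')" using e i by (simp add: d_def)
    then obtain q :: int where q: "m ?u + w ?u * x z = m ?u + w ?u * x z' + real n * of_int q"
      using circ_pt_eq_iff[OF assms(1)] by blast
    have "l ?u \<le> m ?u + w ?u * x z" "m ?u + w ?u * x z \<le> r ?u" "l ?u \<le> m ?u + w ?u * x z'" "m ?u + w ?u * x z' \<le> r ?u"
      using X[OF z] X[OF z', folded i] by simp_all
    then have "\<bar>real n * of_int q\<bar> < real n" using q assms(10)[OF uI] by linarith
    then have "real n * \<bar>of_int q\<bar> < real n * 1" by (simp add: abs_mult)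
    then have "\<bar>real_of_int q\<bar> < 1" using assms(1) by (simp only: mult_less_cancel_left)
    then have "q = 0" by linarith
    then have wx: "w ?u * x z = w ?u * x z'" using q by simp
    have "Re z = Re z'"
    proof (cases "\<bar>Im z\<bar> = 1")
      case True
      then have "sqrt (1 - (Im z)\<^sup>2) = 0" by (simp add: power2_eq_1_iff abs_if split: if_splits)
      then show ?thesis using im(2)[OF z] im(2)[OF z'] i by simp
    next
      case False
      then have a: "\<bar>Im z\<bar> < 1" using im(1)[OF z] by simp
      have "w ?u > 0" using assms(9)[OF us[OF a]] by (simp add: w_def)
      then have "x z = x z'" using wx by simp
      moreover have "sqrt (1 - (Im z)\<^sup>2) \<noteq> 0" using a by (simp add: abs_square_less_1 less_imp_neq[symmetric])
      ultimately show ?thesis using i by (simp add: x_def)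
    qed
    then show "z = z'" using i by (simp add: complex_eq_iff)
  qed
  have sph: "d ` sphere 0 1 = (\<lambda>u. (circ_pt n (l u), u)) ` {s..t} \<union> (\<lambda>u. (circ_pt n (r u), u)) ` {s..t}"
  proof -
    have val: "d z = (circ_pt n (if Re z \<le> 0 then l (U (Im z)) else r (U (Im z))), U (Im z))" if z: "norm z = 1" for z
    proof -
      have sq: "(Re z)\<^sup>2 = 1 - (Im z)\<^sup>2" using z by (simp add: cmod_def)
      then have sr: "sqrt (1 - (Im z)\<^sup>2) = \<bar>Re z\<bar>" by (metis real_sqrt_abs)
      let ?u = "U (Im z)"
      have lr: "m ?u - w ?u = l ?u" "m ?u + w ?u = r ?u" by (auto simp: m_def w_def field_simps)
      consider "Re z = 0" | "Re z < 0" | "Re z > 0" by linarith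
      then show ?thesis
      proof cases
        case 1
        then have "(Im z)\<^sup>2 = 1" using sq by simp
        then have "\<bar>Im z\<bar> = 1" by (auto simp: power2_eq_1_iff)
        then have "l ?u = r ?u" using ue[of "Im z"] assms(7,8) by auto
        then show ?thesis using 1 by (simp add: d_def x_def m_def)
      next
        case 2
        then have "x z = -1" unfolding x_def sr by (simp add: divide_eq_minus_1_iff)
        then show ?thesis using 2 lr by (simp add: d_def)
      next
        case 3
        then have "x z = 1" unfolding x_def sr by simp
        then show ?thesis using 3 lr by (simp add: d_def)
      qed
    qed
    show ?thesis
    proof (intro equalityI subsetI)
      fix p assume "p \<in> d ` sphere 0 1"
      then obtain z where z: "norm z = 1" "p = d z" by auto
      then have "U (Im z) \<in> {s..t}" using im(1)[of z] by (intro ub) simp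
      then show "p \<in> (\<lambda>u. (circ_pt n (l u), u)) ` {s..t} \<union> (\<lambda>u. (circ_pt n (r u), u)) ` {s..t}"
        using val[OF z(1)] z(2) by (cases "Re z \<le> 0") auto
    next
      fix p assume "p \<in> (\<lambda>u. (circ_pt n (l u), u)) ` {s..t} \<union> (\<lambda>u. (circ_pt n (r u), u)) ` {s..t}"
      then obtain u where u: "u \<in> {s..t}" "p = (circ_pt n (l u), u) \<or> p = (circ_pt n (r u), u)" by blast
      define y where "y = 2 * ((u - s) / (t - s)) - 1"
      have Uy: "U y = u" using assms(3) by (simp add: U_def y_def field_simps)
      have "0 \<le> (u - s) / (t - s)" "(u - s) / (t - s) \<le> 1" using u(1) assms(3) by auto
      then have y1: "\<bar>y\<bar> \<le> 1" unfolding y_def by linarith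
      then have y2: "y\<^sup>2 \<le> 1" by (simp add: abs_square_le_1)
      define zl where "zl = Complex (- sqrt (1 - y\<^sup>2)) y"
      define zr where "zr = Complex (sqrt (1 - y\<^sup>2)) y"
      have nz: "norm zl = 1" "norm zr = 1" using y2 by (simp_all add: zl_def zr_def cmod_def)
      have dl: "d zl = (circ_pt n (l u), u)" using val[OF nz(1)] y2 Uy by (simp add: zl_def)
      have dr: "d zr = (circ_pt n (r u), u)"
      proof (cases "sqrt (1 - y\<^sup>2) = 0")
        case True
        then have "\<bar>y\<bar> = 1" by (auto simp: power2_eq_1_iff)
        then have "l u = r u" using ue[of y] Uy assms(7,8) by auto
        then show ?thesis using val[OF nz(2)] True Uy by (simp add: zr_def)
      next
        case False
        then have "sqrt (1 - y\<^sup>2) > 0" using y2 by simp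
        then show ?thesis using val[OF nz(2)] Uy by (simp add: zr_def)
      qed
      show "p \<in> d ` sphere 0 1" using u(2)
      proof
        assume "p = (circ_pt n (l u), u)"
        then show ?thesis using dl nz(1) by (intro image_eqI[of _ _ zl]) auto
      next
        assume "p = (circ_pt n (r u), u)"
        then show ?thesis using dr nz(2) by (intro image_eqI[of _ _ zr]) auto
      qed
    qed
  qed
  show ?thesis unfolding bounds_disk_def
  proof (intro exI[of _ d] conjI)
    show "continuous_on (cball 0 1) d" unfolding d_def by (intro continuous_intros mU wx Uc)
    show "inj_on d (cball 0 1)" by (rule inj)
    show "d ` cball 0 1 \<subseteq> cylinder"
    proof
      fix p assume "p \<in> d ` cball 0 1"
      then obtain z where z: "z \<in> cball 0 1" "p = d z" by blast
      have "U (Im z) \<in> {0..1}" using ub[OF im(1)[OF z(1)]] assms(2,4) by auto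
      then show "p \<in> cylinder" using z(2) by (simp add: d_def cylinder_def circ_pt_norm)
    qed
    show "d ` sphere 0 1 = (\<lambda>u. (circ_pt n (l u), u)) ` {s..t} \<union> (\<lambda>u. (circ_pt n (r u), u)) ` {s..t}" by (rule sph)
  qed
qed

lemma strand_arc_word:
  assumes "n \<ge> 3" "w \<in> lists {1..n}" "0 \<le> s" "s \<le> t" "t \<le> 1"
  shows "strand_arc (word_diag n w) (res n a) s t = (\<lambda>u. (circ_pt n (word_lift n w a u), u)) ` {s..t}"
  unfolding strand_arc_le[OF assms(4)] using word_diag_lift[OF assms(1,2)] assms by (intro image_cong) auto

text \<open>The two letters of \<open>[i, i]\<close> produce a bigon between the heights
  \<open>1/4\<close> and \<open>5/8\<close>. For the other factors the triangle is the region
  between the strand from \<open>a + 1\<close> and the broken line formed by the two other strands,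
  joined at their crossing at height \<open>5/8\<close>.\<close>

lemma bad_factor_region:
  assumes "n \<ge> 3" "bad_factor n F"
  shows "has_bad_region n (word_diag n F)"
proof -
  have n: "n \<ge> 1" "n \<ge> 2" and nr: "real n \<ge> 3" using assms by auto
  obtain i where i: "i \<in> {1..n}" and F: "F = [i, i] \<or> F = [i, nxt n i, i] \<or> F = [nxt n i, i, nxt n i]"
    using assms(2) unfolding bad_factor_def by blast
  define a where "a = int i"
  let ?j = "nxt n i"
  have j: "?j \<in> {1..n}" by (rule nxt_range[OF i])
  have "res n (a + 1 + 1) = nxt n (res n (a + 1))" by (rule res_Suc[OF n(1)])
  then have r: "res n a = i" "res n (a + 1) = ?j" "res n (a + 2) = nxt n ?j"
    using res_int[OF i] res_Suc[OF n(1), of a] by (auto simp: a_def add.assoc)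
  have ne: "?j \<noteq> i" "nxt n ?j \<noteq> ?j" "nxt n ?j \<noteq> i"
    using nxt_neq[OF n(2) i] nxt_neq[OF n(2) j] nxt_neq_prv[OF assms(1) i] prv_nxt[OF j] by metis+
  have s: "swp n i a = a + 1" "swp n i (a + 1) = a" "swp n i (a + 2) = a + 2"
    "swp n ?j a = a" "swp n ?j (a + 1) = a + 2" "swp n ?j (a + 2) = a + 1"
    using r ne ne[symmetric] by (auto simp: swp_def)
  have Fl: "F \<in> lists {1..n}" using F i j by auto
  have rr: "res n b \<in> {1..n}" for b by (rule res_range[OF n(1)])
  define L where "L = word_lift n F"
  have cont: "continuous_on {s..t} (L b)" if "0 \<le> s" "t \<le> 1" for s t b
    unfolding L_def by (rule continuous_on_subset[OF continuous_on_word_lift]) (use that in auto)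
  have arc: "strand_arc (word_diag n F) (res n b) s t = (\<lambda>u. (circ_pt n (L b u), u)) ` {s..t}"
    if "0 \<le> s" "s \<le> t" "t \<le> 1" for b s t unfolding L_def by (rule strand_arc_word[OF assms(1) Fl that])
  have meet: "word_diag n F (res n b) t = word_diag n F (res n c) t" if "L b t = L c t" "t \<in> {0..1}" for b c t
    using word_diag_lift[OF assms(1) Fl that(2)] that(1) by (simp add: L_def)
  have tri: "has_contractible_triangle n (word_diag n F)"
    if "res n b \<noteq> res n c" "res n c \<noteq> res n d" "res n b \<noteq> res n d"
      "L b (1/4) = L c (1/4)" "L c (5/8) = L d (5/8)" "L d (13/16) = L b (13/16)"
      "bounds_disk ((\<lambda>u. (circ_pt n (L c u), u)) ` {1/4..5/8} \<union> (\<lambda>u. (circ_pt n (L d u), u)) ` {5/8..13/16} \<union>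
        (\<lambda>u. (circ_pt n (L b u), u)) ` {1/4..13/16})" for b c d
  proof -
    have a: "strand_arc (word_diag n F) (res n c) (1/4) (5/8) = (\<lambda>u. (circ_pt n (L c u), u)) ` {1/4..5/8}"
      "strand_arc (word_diag n F) (res n d) (5/8) (13/16) = (\<lambda>u. (circ_pt n (L d u), u)) ` {5/8..13/16}"
      "strand_arc (word_diag n F) (res n b) (1/4) (13/16) = (\<lambda>u. (circ_pt n (L b u), u)) ` {1/4..13/16}"
      by (rule arc; simp)+
    have "bounds_disk (strand_arc (word_diag n F) (res n c) (1/4) (5/8) \<union> strand_arc (word_diag n F) (res n d) (5/8) (13/16) \<union>
      strand_arc (word_diag n F) (res n b) (13/16) (1/4))"
      unfolding strand_arc_commute[of "word_diag n F" "res n b" "13/16" "1/4"] a by (rule that(7))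
    moreover have "word_diag n F (res n b) (1/4) = word_diag n F (res n c) (1/4)" by (rule meet[OF that(4)]) simp
    moreover have "word_diag n F (res n c) (5/8) = word_diag n F (res n d) (5/8)" by (rule meet[OF that(5)]) simp
    moreover have "word_diag n F (res n d) (13/16) = word_diag n F (res n b) (13/16)" by (rule meet[OF that(6)]) simp
    moreover have "1/4 \<in> {0..1::real}" "5/8 \<in> {0..1::real}" "13/16 \<in> {0..1::real}" by simp_all
    ultimately show ?thesis unfolding has_contractible_triangle_def
      using rr[of b] rr[of c] rr[of d] that(1-3) by blast
  qed
  have split: "(\<lambda>u. (circ_pt n (if u \<le> 5/8 then f u else g u), u)) ` {1/4..13/16} =
    (\<lambda>u. (circ_pt n (f u), u)) ` {1/4..5/8} \<union> (\<lambda>u. (circ_pt n (g u), u)) ` {5/8..13/16}"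
    if "f (5/8) = g (5/8)" for f g :: "real \<Rightarrow> real"
  proof -
    have "{1/4..13/16} = {1/4..5/8} \<union> {5/8..13/16::real}" by auto
    moreover have "(\<lambda>u. (circ_pt n (if u \<le> 5/8 then f u else g u), u)) ` {1/4..5/8} = (\<lambda>u. (circ_pt n (f u), u)) ` {1/4..5/8}"
      by (intro image_cong) auto
    moreover have "(\<lambda>u. (circ_pt n (if u \<le> 5/8 then f u else g u), u)) ` {5/8..13/16} = (\<lambda>u. (circ_pt n (g u), u)) ` {5/8..13/16}"
    proof (rule image_cong)
      fix u :: real assume u: "u \<in> {5/8..13/16}"
      have "(if u \<le> 5/8 then f u else g u) = g u"
      proof (cases "u \<le> 5/8")
        case True
        then have "u = 5/8" using u by (intro antisym) auto
        then have "f u = g u" using that by (simp only:)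
        then show ?thesis by simp
      qed simp
      then show "(circ_pt n (if u \<le> 5/8 then f u else g u), u) = (circ_pt n (g u), u)" by (simp only:)
    qed simp
    ultimately show ?thesis by (simp only: image_Un)
  qed
  have pc: "continuous_on {1/4..13/16} (\<lambda>u. if u \<le> 5/8 then L b u else L c u)" if "L b (5/8) = L c (5/8)" for b c
  proof (rule continuous_on_cases_le)
    show "continuous_on {t \<in> {1/4..13/16}. t \<le> 5/8} (L b)" by (rule continuous_on_subset[OF cont[of 0 1]]) auto
    show "continuous_on {t \<in> {1/4..13/16}. 5/8 \<le> t} (L c)" by (rule continuous_on_subset[OF cont[of 0 1]]) auto
    show "continuous_on {1/4..13/16} (\<lambda>u::real. u)" by (rule continuous_on_id)
    fix u :: real assume "u = 5/8"
    then show "L b u = L c u" using that by (simp only:)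
  qed
  from F consider (A) "F = [i, i]" | (B) "F = [i, ?j, i]" | (C) "F = [?j, i, ?j]" by blast
  then show ?thesis
  proof cases
    case A
    have disk: "bounds_disk ((\<lambda>u. (circ_pt n (L (a + 1) u), u)) ` {1/4..5/8} \<union> (\<lambda>u. (circ_pt n (L a u), u)) ` {1/4..5/8})"
    proof (rule bounds_disk_graphs[OF n(1)])
      show "L (a + 1) u < L a u" if "u \<in> {1/4<..<5/8}" for u
        using that unfolding L_def A by (auto simp: s split: if_splits)
      show "L a u - L (a + 1) u < real n" if "u \<in> {1/4..5/8}" for u
        using that nr unfolding L_def A by (auto simp: s split: if_splits)
      show "L (a + 1) (1/4) = L a (1/4)" "L (a + 1) (5/8) = L a (5/8)" unfolding L_def A by (auto simp: s)
    qed (auto intro!: cont)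
    have "L (a + 1) (1/4) = L a (1/4)" "L (a + 1) (5/8) = L a (5/8)" unfolding L_def A by (auto simp: s)
    note e = this
    have q: "1/4 \<in> {0..1::real}" "5/8 \<in> {0..1::real}" "(1/4::real) < 5/8" by simp_all
    have arcs: "strand_arc (word_diag n F) (res n b) (1/4) (5/8) = (\<lambda>u. (circ_pt n (L b u), u)) ` {1/4..5/8}" for b
      by (rule arc) simp_all
    have "res n (a + 1) \<noteq> res n a" using r ne(1) by simp
    then have "has_contractible_bigon n (word_diag n F)" unfolding has_contractible_bigon_def
      using meet[OF e(1) q(1)] meet[OF e(2) q(2)] disk[folded arcs] q rr[of "a + 1"] rr[of a] by blast
    then show ?thesis unfolding has_bad_region_def by blast
  next
    case B
    have e: "L (a + 1) (1/4) = L a (1/4)" "L a (5/8) = L (a + 2) (5/8)" "L (a + 2) (13/16) = L (a + 1) (13/16)"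
      unfolding L_def B by (auto simp: s)
    have "bounds_disk ((\<lambda>u. (circ_pt n (L (a + 1) u), u)) ` {1/4..13/16} \<union>
      (\<lambda>u. (circ_pt n (if u \<le> 5/8 then L a u else L (a + 2) u), u)) ` {1/4..13/16})"
    proof (rule bounds_disk_graphs[OF n(1)])
      show "L (a + 1) u < (if u \<le> 5/8 then L a u else L (a + 2) u)" if "u \<in> {1/4<..<13/16}" for u
        using that unfolding L_def B by (auto simp: s split: if_splits)
      show "(if u \<le> 5/8 then L a u else L (a + 2) u) - L (a + 1) u < real n" if "u \<in> {1/4..13/16}" for u
        using that nr unfolding L_def B by (auto simp: s split: if_splits)
      show "continuous_on {1/4..13/16} (\<lambda>u. if u \<le> 5/8 then L a u else L (a + 2) u)" by (rule pc[OF e(2)])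
      show "continuous_on {1/4..13/16} (L (a + 1))" by (rule cont) simp_all
    qed (use e in simp_all)
    then have "bounds_disk ((\<lambda>u. (circ_pt n (L a u), u)) ` {1/4..5/8} \<union> (\<lambda>u. (circ_pt n (L (a + 2) u), u)) ` {5/8..13/16} \<union>
        (\<lambda>u. (circ_pt n (L (a + 1) u), u)) ` {1/4..13/16})"
      unfolding split[of "L a" "L (a + 2)", OF e(2)] Un_commute[of "(\<lambda>u. (circ_pt n (L (a + 1) u), u)) ` {1/4..13/16}"] .
    from tri[OF _ _ _ e this] show ?thesis unfolding has_bad_region_def using r ne by metis
  next
    case C
    have e: "L (a + 1) (1/4) = L (a + 2) (1/4)" "L (a + 2) (5/8) = L a (5/8)" "L a (13/16) = L (a + 1) (13/16)"
      unfolding L_def C by (auto simp: s)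
    have "bounds_disk ((\<lambda>u. (circ_pt n (if u \<le> 5/8 then L (a + 2) u else L a u), u)) ` {1/4..13/16} \<union>
      (\<lambda>u. (circ_pt n (L (a + 1) u), u)) ` {1/4..13/16})"
    proof (rule bounds_disk_graphs[OF n(1)])
      show "(if u \<le> 5/8 then L (a + 2) u else L a u) < L (a + 1) u" if "u \<in> {1/4<..<13/16}" for u
        using that unfolding L_def C by (auto simp: s split: if_splits)
      show "L (a + 1) u - (if u \<le> 5/8 then L (a + 2) u else L a u) < real n" if "u \<in> {1/4..13/16}" for u
        using that nr unfolding L_def C by (auto simp: s split: if_splits)
      show "continuous_on {1/4..13/16} (\<lambda>u. if u \<le> 5/8 then L (a + 2) u else L a u)" by (rule pc[OF e(2)])
      show "continuous_on {1/4..13/16} (L (a + 1))" by (rule cont) simp_all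
    qed (use e in simp_all)
    from tri[OF _ _ _ e this[unfolded split[of "L (a + 2)" "L a", OF e(2)]]] show ?thesis unfolding has_bad_region_def using r ne by metis
  qed
qed

lemma not_altern_bad_region:
  assumes "n \<ge> 3" "w \<in> lists {1..n}" "\<not> altern n w"
  shows "has_bad_region n (word_diag n w)"
proof -
  have n: "n \<ge> 1" using assms(1) by simp
  note D = is_diag_word[OF assms(1)]
  obtain u F v where f: "u \<in> lists {1..n}" "v \<in> lists {1..n}" "bad_factor n F" "comm_cong n w (u @ F @ v)"
    using not_altern_factor[OF assms] by blast
  have F: "F \<in> lists {1..n}" and l: "u @ F @ v \<in> lists {1..n}" using comm_cong_lists[OF f(4)] by auto
  then have Fv: "F @ v \<in> lists {1..n}" by auto
  have "has_bad_region n (stack n (word_diag n F) (word_diag n v))"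
    by (rule has_bad_region_stack(1)[OF n D[OF F] D[OF f(2)] bad_factor_region[OF assms(1) f(3)]])
  then have "has_bad_region n (word_diag n (F @ v))"
    by (rule has_bad_region_isotopic[OF isotopic_word_append[OF assms(1) f(2) F] is_diag_stack[OF n D[OF F] D[OF f(2)]]])
  then have "has_bad_region n (stack n (word_diag n u) (word_diag n (F @ v)))"
    by (rule has_bad_region_stack(2)[OF n D[OF f(1)] D[OF Fv]])
  then have "has_bad_region n (word_diag n (u @ F @ v))"
    by (rule has_bad_region_isotopic[OF isotopic_word_append[OF assms(1) Fv f(1)] is_diag_stack[OF n D[OF f(1)] D[OF Fv]]])
  then show ?thesis
    by (rule has_bad_region_isotopic[OF isotopic_sym[OF comm_cong_isotopic[OF assms(1) f(4)] D[OF assms(2)]] D[OF l]])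
qed

section \<open>Alternating words give webs\<close>

lemma word_lift_period: "word_lift n w (a + int n * m) t = word_lift n w a t + real n * of_int m"
  by (induction w arbitrary: a t) (auto simp: swp_period)

text \<open>An integer position that no letter of the word moves is a wall: a generator that carried
  a neighbouring position onto it would have to move the wall as well.\<close>

lemma word_lift_avoid:
  assumes "n \<ge> 1"
  shows "w \<in> lists {1..n} \<Longrightarrow> res n c \<notin> set w \<Longrightarrow> prv n (res n c) \<notin> set w \<Longrightarrow> t \<in> {0..1} \<Longrightarrow>
    (b < c \<longrightarrow> word_lift n w b t < of_int c) \<and> (c < b \<longrightarrow> of_int c < word_lift n w b t)"
proof (induction w arbitrary: b t rule: list.induct)
  case (Cons i w)
  have i: "i \<in> {1..n}" using Cons.prems by auto
  have IH: "(b < c \<longrightarrow> word_lift n w b t < of_int c) \<and> (c < b \<longrightarrow> of_int c < word_lift n w b t)"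
    if "t \<in> {0..1}" for b t using Cons.IH[of t b] Cons.prems that by auto
  have lt: "swp n i b < c" if "b < c"
  proof (rule ccontr)
    assume "\<not> swp n i b < c"
    then have "b = c - 1" "res n b = i" using that by (auto simp: swp_def split: if_splits)
    then show False using Cons.prems res_pred[OF assms, of c] by auto
  qed
  have gt: "c < swp n i b" if "c < b"
  proof (rule ccontr)
    assume "\<not> c < swp n i b"
    then have "b = c + 1" "res n b = nxt n i" using that by (auto simp: swp_def split: if_splits)
    then have "nxt n (res n c) = nxt n i" using res_Suc[OF assms, of c] by simp
    then show False using Cons.prems nxt_inj[OF res_range[OF assms] i] by auto
  qed
  show ?case
  proof (cases "t \<le> 1/2")
    case True
    have d: "swp n i b - b = 0 \<or> swp n i b - b = 1 \<or> swp n i b - b = -1" by (auto simp: swp_def)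
    have "of_int b + 2 * t * of_int (swp n i b - b) < of_int c" if b: "b < c"
    proof -
      have "real_of_int b \<le> of_int c - 1" "real_of_int (swp n i b) \<le> of_int c - 1" using b lt[OF b] by linarith+
      then show ?thesis using d True Cons.prems(4) by (elim disjE) auto
    qed
    moreover have "of_int c < of_int b + 2 * t * of_int (swp n i b - b)" if b: "c < b"
    proof -
      have "real_of_int b \<ge> of_int c + 1" "real_of_int (swp n i b) \<ge> of_int c + 1" using b gt[OF b] by linarith+
      then show ?thesis using d True Cons.prems(4) by (elim disjE) auto
    qed
    ultimately show ?thesis using True by simp
  next
    case False
    then have "2 * t - 1 \<in> {0..1}" using Cons.prems(4) by auto
    from IH[OF this, of "swp n i b"] show ?thesis using lt gt False by auto
  qed
qed simp

lemma res_swp_inj: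
  assumes "n \<ge> 2" "i \<in> {1..n}" "res n (swp n i a) = res n (swp n i b)"
  shows "res n a = res n b"
proof -
  have n: "n \<ge> 1" using assms by simp
  have *: "res n (swp n i a) = (if res n a = i then nxt n i else if res n a = nxt n i then i else res n a)" for a
    using res_Suc[OF n, of a] res_pred[OF n, of a] prv_nxt[OF assms(2)] by (auto simp: swp_def)
  show ?thesis using assms(3) nxt_neq[OF assms(1,2)] unfolding * by (auto split: if_splits)
qed

text \<open>Lifts that meet while the first letter acts are the two strands it exchanges, one
  starting to the right and one to the left. If they meet later, the directions are inherited by the
  tail and induction applies. The only exception would be a strand that has made its last step and
  stays vertical, but by \<open>word_lift_avoid\<close> no other lift meets such a strand.\<close>

lemma altern_crossing:
  assumes "n \<ge> 3"
  shows "w \<in> lists {1..n} \<Longrightarrow> altern n w \<Longrightarrow> res n a \<noteq> res n b \<Longrightarrow> t \<in> {0..1} \<Longrightarrow>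
    word_lift n w a t = word_lift n w b t \<Longrightarrow> goes_right n w a \<noteq> goes_right n w b"
proof (induction w arbitrary: a b t rule: list.induct)
  case Nil
  then show ?case by auto
next
  case (Cons i w)
  have n: "n \<ge> 1" "n \<ge> 2" using assms by auto
  have i: "i \<in> {1..n}" and w: "w \<in> lists {1..n}" and alt: "altern n w" using Cons.prems by auto
  note gr = goes_right_Cons[OF n(2) i, of w]
  show ?case
  proof (cases "t \<le> 1/2")
    case True
    have key: "res n a = i \<and> res n b = nxt n i"
      if ab: "a < b" and e: "of_int a + 2 * t * of_int (swp n i a - a) = of_int b + 2 * t * of_int (swp n i b - b)" for a b
    proof -
      define da where "da = swp n i a - a"
      define db where "db = swp n i b - b"
      have d: "da = 0 \<or> da = 1 \<or> da = -1" "db = 0 \<or> db = 1 \<or> db = -1" by (auto simp: swp_def da_def db_def)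
      have eq: "of_int (b - a) = 2 * t * of_int (da - db)" using e by (simp add: da_def db_def algebra_simps)
      have pos: "da - db \<ge> 1"
      proof (rule ccontr)
        assume "\<not> da - db \<ge> 1"
        then have "2 * t * of_int (da - db) \<le> 0" using Cons.prems(4) by (intro mult_nonneg_nonpos) auto
        then show False using eq ab by simp
      qed
      then consider "da = 1" "db = -1" | "da - db = 1" using d by linarith
      then show ?thesis
      proof cases
        case 1
        then show ?thesis by (auto simp: da_def db_def swp_def split: if_splits)
      next
        case 2
        then have "real_of_int (b - a) \<le> 1" using eq True by simp
        then have ba: "b = a + 1" using ab by linarith
        have "res n b = nxt n (res n a)" unfolding ba by (rule res_Suc[OF n(1)])
        moreover have "da = 1 \<or> db = -1" using 2 d by auto
        then have "res n a = i \<or> res n b = nxt n i" by (auto simp: da_def db_def swp_def split: if_splits)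
        ultimately show ?thesis using nxt_inj[OF res_range[OF n(1)] i, of a] by auto
      qed
    qed
    have e: "of_int a + 2 * t * of_int (swp n i a - a) = of_int b + 2 * t * of_int (swp n i b - b)"
      using Cons.prems(5) True by simp
    have "a \<noteq> b" using Cons.prems(3) by auto
    then have "res n a = i \<and> res n b = nxt n i \<or> res n b = i \<and> res n a = nxt n i"
      using key[of a b] key[of b a] e by (cases "a < b") auto
    then show ?thesis using gr[of a] gr[of b] nxt_neq[OF n(2) i] by auto
  next
    case False
    let ?a = "swp n i a" and ?b = "swp n i b"
    have t: "2 * t - 1 \<in> {0..1}" using False Cons.prems(4) by auto
    have e: "word_lift n w ?a (2 * t - 1) = word_lift n w ?b (2 * t - 1)" using Cons.prems(5) False by simp
    have ne: "res n ?a \<noteq> res n ?b" using res_swp_inj[OF n(2) i] Cons.prems(3) by blast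
    have IH: "goes_right n w ?a \<noteq> goes_right n w ?b" by (rule Cons.IH[OF w alt ne t e])
    have tr: "goes_right n (i # w) c = goes_right n w (swp n i c)"
      if c: "word_lift n w (swp n i c) (2 * t - 1) = word_lift n w (swp n i c') (2 * t - 1)"
        "res n (swp n i c) \<noteq> res n (swp n i c')" for c c'
    proof -
      consider "res n c = i" | "res n c = nxt n i" "res n c \<noteq> i" | "res n c \<noteq> i" "res n c \<noteq> nxt n i" by blast
      then show ?thesis
      proof cases
        case 1
        then have s: "swp n i c = c + 1" and r: "res n (c + 1) = nxt n i" using res_Suc[OF n(1), of c] by (auto simp: swp_def)
        have "goes_right n w (c + 1)"
        proof (rule ccontr)
          assume "\<not> goes_right n w (c + 1)"
          then have o: "i \<notin> set w" "nxt n i \<notin> set w" using altern_Cons_nxt[OF Cons.prems(2) r i] by auto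
          have o': "res n (c + 1) \<notin> set w" "prv n (res n (c + 1)) \<notin> set w" using o r prv_nxt[OF i] by auto
          have "word_lift n w (c + 1) (2 * t - 1) = of_int (c + 1)" by (rule word_lift_fixed[OF n(1) w o'])
          then have "word_lift n w (swp n i c') (2 * t - 1) = of_int (c + 1)" using c(1) s by simp
          then have "swp n i c' = c + 1"
            using word_lift_avoid[OF n(1) w o' t, of "swp n i c'"] by (cases "swp n i c'" "c + 1" rule: linorder_cases) auto
          then show False using c(2) s by simp
        qed
        then show ?thesis using gr[of c] 1 s by simp
      next
        case 2
        then have s: "swp n i c = c - 1" and r: "res n (c - 1) = i"
          using res_pred[OF n(1), of c] prv_nxt[OF i] by (auto simp: swp_def)
        then show ?thesis using gr[of c] 2 altern_Cons_same[OF Cons.prems(2) r] by simp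
      next
        case 3
        then show ?thesis using gr[of c] by (simp add: swp_def)
      qed
    qed
    show ?thesis using tr[OF e ne] tr[OF e[symmetric] ne[symmetric]] IH by simp
  qed
qed

text \<open>After a step to the right the strand goes right in the tail or is fixed by it; after a
  step to the left it does not go right in the tail. So no strand ever turns back.\<close>

lemma altern_monotone:
  assumes "n \<ge> 3"
  shows "w \<in> lists {1..n} \<Longrightarrow> altern n w \<Longrightarrow> 0 \<le> s \<Longrightarrow> s \<le> t \<Longrightarrow> t \<le> 1 \<Longrightarrow>
    (goes_right n w a \<longrightarrow> word_lift n w a s \<le> word_lift n w a t) \<and>
    (\<not> goes_right n w a \<longrightarrow> word_lift n w a t \<le> word_lift n w a s)"
proof (induction w arbitrary: a s t rule: list.induct)
  case (Cons i w)
  have n: "n \<ge> 1" "n \<ge> 2" using assms by auto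
  have i: "i \<in> {1..n}" and w: "w \<in> lists {1..n}" and alt: "altern n w" using Cons.prems by auto
  note gr = goes_right_Cons[OF n(2) i, of w a]
  let ?b = "swp n i a"
  have IH: "(goes_right n w ?b \<longrightarrow> word_lift n w ?b s \<le> word_lift n w ?b t) \<and>
    (\<not> goes_right n w ?b \<longrightarrow> word_lift n w ?b t \<le> word_lift n w ?b s)" if "0 \<le> s" "s \<le> t" "t \<le> 1" for s t
    by (rule Cons.IH[OF w alt that])
  have st: "(goes_right n (i # w) a \<longrightarrow> a \<le> ?b \<and> (\<forall>s t. 0 \<le> s \<longrightarrow> s \<le> t \<longrightarrow> t \<le> 1 \<longrightarrow> word_lift n w ?b s \<le> word_lift n w ?b t)) \<and>
    (\<not> goes_right n (i # w) a \<longrightarrow> ?b \<le> a \<and> (\<forall>s t. 0 \<le> s \<longrightarrow> s \<le> t \<longrightarrow> t \<le> 1 \<longrightarrow> word_lift n w ?b t \<le> word_lift n w ?b s))"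
  proof -
    consider "res n a = i" | "res n a = nxt n i" "res n a \<noteq> i" | "res n a \<noteq> i" "res n a \<noteq> nxt n i" by blast
    then show ?thesis
    proof cases
      case 1
      then have b: "?b = a + 1" and r: "res n ?b = nxt n i" using res_Suc[OF n(1), of a] by (auto simp: swp_def)
      have "goes_right n w ?b \<or> (\<forall>t. word_lift n w ?b t = of_int ?b)"
      proof (cases "goes_right n w ?b")
        case False
        then have o: "i \<notin> set w" "nxt n i \<notin> set w" using altern_Cons_nxt[OF Cons.prems(2) r i] by auto
        have "res n ?b \<notin> set w" "prv n (res n ?b) \<notin> set w" using o r prv_nxt[OF i] by auto
        then show ?thesis using word_lift_fixed[OF n(1) w] by blast
      qed simp
      then show ?thesis using gr 1 b IH by auto
    next
      case 2
      then have b: "?b = a - 1" and r: "res n ?b = i"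
        using res_pred[OF n(1), of a] prv_nxt[OF i] by (auto simp: swp_def)
      then show ?thesis using gr 2 altern_Cons_same[OF Cons.prems(2) r] IH by auto
    next
      case 3
      then have "?b = a" by (simp add: swp_def)
      then show ?thesis using gr 3 IH by auto
    qed
  qed
  have v0: "word_lift n w ?b 0 = of_int ?b" by (rule word_lift_0)
  consider "t \<le> 1/2" | "s \<le> 1/2" "1/2 < t" | "1/2 < s" "1/2 < t" using Cons.prems(4) by linarith
  then show ?case
  proof cases
    case 1
    then have s: "s \<le> 1/2" using Cons.prems(4) by linarith
    have "2 * s * of_int (?b - a) \<le> 2 * t * of_int (?b - a)" if "a \<le> ?b"
      using that Cons.prems(4) by (intro mult_right_mono) auto
    moreover have "2 * t * of_int (?b - a) \<le> 2 * s * of_int (?b - a)" if "?b \<le> a"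
      using that Cons.prems(4) by (intro mult_right_mono_neg) auto
    ultimately show ?thesis using st 1 s by simp
  next
    case 2
    have A: "of_int a + 2 * s * of_int (?b - a) \<le> of_int ?b" if ab: "a \<le> ?b"
    proof -
      have "2 * s * of_int (?b - a) \<le> 1 * of_int (?b - a)" using ab 2(1) by (intro mult_right_mono) auto
      then show ?thesis by simp
    qed
    have B: "of_int ?b \<le> of_int a + 2 * s * of_int (?b - a)" if ab: "?b \<le> a"
    proof -
      have "1 * of_int (?b - a) \<le> 2 * s * of_int (?b - a)" using ab 2(1) by (intro mult_right_mono_neg) auto
      then show ?thesis by simp
    qed
    have t': "0 \<le> 2 * t - 1" "2 * t - 1 \<le> 1" using 2 Cons.prems(5) by auto
    have lifts: "word_lift n (i # w) a s = of_int a + 2 * s * of_int (?b - a)" "word_lift n (i # w) a t = word_lift n w ?b (2 * t - 1)"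
      using 2 by simp_all
    have "word_lift n w ?b 0 \<le> word_lift n w ?b (2 * t - 1)" if "goes_right n (i # w) a" using st that t' by blast
    moreover have "word_lift n w ?b (2 * t - 1) \<le> word_lift n w ?b 0" if "\<not> goes_right n (i # w) a" using st that t' by blast
    ultimately show ?thesis unfolding lifts using A B st v0 by force
  next
    case 3
    have "0 \<le> 2 * s - 1" "2 * s - 1 \<le> 2 * t - 1" "2 * t - 1 \<le> 1" using 3 Cons.prems by auto
    then show ?thesis using st 3 by simp
  qed
qed simp

text \<open>Crossing strands have opposite directions, and three directions cannot be pairwise
  opposite, which excludes triangles of any kind. For bigons contractibility matters: the disk lifts
  to the cover, so the two arcs lift to two lifts that agree at both ends. One of these increases
  weakly and the other decreases weakly, so they coincide in between, against the finiteness of the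
  double points.\<close>

lemma altern_no_bad_region:
  assumes "n \<ge> 3" "w \<in> lists {1..n}" "altern n w"
  shows "\<not> has_bad_region n (word_diag n w)"
proof -
  have n: "n \<ge> 1" using assms(1) by simp
  let ?D = "word_diag n w"
  have D: "is_diag n ?D" by (rule is_diag_word[OF assms(1,2)])
  have lift: "?D k t = circ_pt n (word_lift n w (int k + int n * m) t)" if "k \<in> {1..n}" "t \<in> {0..1}" for k t m
    using word_diag_lift[OF assms(1,2) that(2), of "int k + int n * m"] res_period[of n "int k" m] res_int[OF that(1)] by simp
  have cross: "goes_right n w (int j) \<noteq> goes_right n w (int k)"
    if "j \<in> {1..n}" "k \<in> {1..n}" "j \<noteq> k" "t \<in> {0..1}" "?D j t = ?D k t" for j k t
  proof -
    have "circ_pt n (word_lift n w (int j) t) = circ_pt n (word_lift n w (int k) t)"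
      using lift[OF that(1,4), of 0] lift[OF that(2,4), of 0] that(5) by simp
    then obtain m :: int where "word_lift n w (int j) t = word_lift n w (int k) t + real n * of_int m"
      using circ_pt_eq_iff[OF n] by blast
    then have e: "word_lift n w (int j) t = word_lift n w (int k + int n * m) t" by (simp add: word_lift_period)
    have "res n (int j) \<noteq> res n (int k + int n * m)" using that(1-3) res_int by (simp add: res_period)
    from altern_crossing[OF assms this that(4) e] show ?thesis by (simp add: goes_right_period)
  qed
  have "\<not> has_contractible_triangle n ?D"
  proof
    assume "has_contractible_triangle n ?D"
    then obtain i j k r s t where b: "i \<in> {1..n}" "j \<in> {1..n}" "k \<in> {1..n}" "r \<in> {0..1}" "s \<in> {0..1}" "t \<in> {0..1}"
      "i \<noteq> j" "j \<noteq> k" "i \<noteq> k" "?D i r = ?D j r" "?D j s = ?D k s" "?D k t = ?D i t"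
      unfolding has_contractible_triangle_def by blast
    show False using cross[OF b(1,2,7,4,10)] cross[OF b(2,3,8,5,11)] cross[OF b(3,1) b(9)[symmetric] b(6,12)] by blast
  qed
  moreover have "\<not> has_contractible_bigon n ?D"
  proof
    assume "has_contractible_bigon n ?D"
    then obtain j k s t where b: "j \<in> {1..n}" "k \<in> {1..n}" "s \<in> {0..1}" "t \<in> {0..1}" "j \<noteq> k" "s < t"
      "?D j s = ?D k s" "?D j t = ?D k t" "bounds_disk (strand_arc ?D j s t \<union> strand_arc ?D k s t)"
      unfolding has_contractible_bigon_def by blast
    obtain d :: "complex \<Rightarrow> complex \<times> real" where d: "continuous_on (cball 0 1) d" "inj_on d (cball 0 1)"
      "d ` cball 0 1 \<subseteq> cylinder" "d ` sphere 0 1 = strand_arc ?D j s t \<union> strand_arc ?D k s t"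
      using b(9) unfolding bounds_disk_def by blast
    have fd: "continuous_on (cball 0 1) (\<lambda>z. fst (d z))" by (intro continuous_intros d(1))
    have fs: "(\<lambda>z. fst (d z)) ` cball 0 1 \<subseteq> sphere 0 1"
    proof (rule image_subsetI)
      fix z :: complex assume "z \<in> cball 0 1"
      then have "d z \<in> sphere 0 1 \<times> {0..1}" using d(3) unfolding cylinder_def by blast
      then show "fst (d z) \<in> sphere 0 1" unfolding mem_Times_iff by blast
    qed
    obtain l where l: "continuous_on (cball 0 1) l" "\<forall>z\<in>cball 0 1. fst (d z) = circ_pt n (l z)"
      using circ_lift_contractible[OF n convex_imp_contractible[OF convex_cball] fd fs] by blast
    \<comment> \<open>The inverse of the disk parametrisation transports the lift \<open>l\<close>,
      which lives on the disk, to the points of the two boundary arcs; a single lift for both arcs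
      is the point of using the disk.\<close>
    obtain e where e: "homeomorphism (cball 0 1) (d ` cball 0 1) d e"
      using homeomorphism_compact[OF compact_cball d(1) _ d(2)] by blast
    have ec: "continuous_on (d ` cball 0 1) e" and ei: "e ` (d ` cball 0 1) \<subseteq> cball 0 1"
      and de: "\<And>q. q \<in> d ` cball 0 1 \<Longrightarrow> d (e q) = q" using e unfolding homeomorphism_def by auto
    have sub: "(?D m u, u) \<in> d ` cball 0 1" if "m = j \<or> m = k" "u \<in> {s..t}" for m u
    proof -
      have "(?D m u, u) \<in> d ` sphere 0 1" unfolding d(4) strand_arc_le[OF less_imp_le[OF b(6)]] using that by blast
      then show ?thesis using image_mono[OF sphere_cball[of 0 1], of d] by blast
    qed
    have st: "{s..t} \<subseteq> {0..1}" using b(3,4) by auto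
    have main: "\<exists>a. res n a = m \<and> (\<forall>u\<in>{s..t}. l (e (?D m u, u)) = word_lift n w a u)"
      if m: "m = j \<or> m = k" for m
    proof -
      have mn: "m \<in> {1..n}" using m b(1,2) by blast
      define L where "L u = l (e (?D m u, u))" for u
      have Dm: "continuous_on {s..t} (\<lambda>u. (?D m u, u))"
        by (intro continuous_intros continuous_on_subset[OF is_diagD(1)[OF D mn] st])
      have im: "(\<lambda>u. (?D m u, u)) ` {s..t} \<subseteq> d ` cball 0 1" using sub[OF m] by blast
      have Ec: "continuous_on {s..t} (\<lambda>u. e (?D m u, u))" by (rule continuous_on_compose2[OF ec Dm im])
      have Ei: "(\<lambda>u. e (?D m u, u)) ` {s..t} \<subseteq> cball 0 1" using im ei by blast
      have Lc: "continuous_on {s..t} L" unfolding L_def by (rule continuous_on_compose2[OF l(1) Ec Ei])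
      have LD: "?D m u = circ_pt n (L u)" if u: "u \<in> {s..t}" for u
      proof -
        have "e (?D m u, u) \<in> cball 0 1" using Ei u by blast
        then have "fst (d (e (?D m u, u))) = circ_pt n (L u)" using l(2) unfolding L_def by blast
        then show ?thesis using de[OF sub[OF m u]] by simp
      qed
      have ss: "s \<in> {s..t}" using b(6) by simp
      have "circ_pt n (L s) = circ_pt n (word_lift n w (int m) s)" using LD[OF ss] lift[OF mn b(3), of 0] by simp
      then obtain q :: int where q: "L s = word_lift n w (int m) s + real n * of_int q" using circ_pt_eq_iff[OF n] by blast
      define a where "a = int m + int n * q"
      have "L u = word_lift n w a u" if u: "u \<in> {s..t}" for u
      proof (rule circ_lift_unique[OF n, of "{s..t}" L "word_lift n w a" s])
        show "continuous_on {s..t} (word_lift n w a)" by (rule continuous_on_subset[OF continuous_on_word_lift st])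
        show "L s = word_lift n w a s" using q by (simp add: a_def word_lift_period)
        show "circ_pt n (L x) = circ_pt n (word_lift n w a x)" if "x \<in> {s..t}" for x
          using LD[OF that] lift[OF mn, of x q] that st by (auto simp: a_def)
      qed (use u ss Lc in auto)
      moreover have "res n a = m" unfolding a_def using res_period res_int[OF mn] by simp
      ultimately show ?thesis unfolding L_def by blast
    qed
    obtain a where a: "res n a = j" "\<And>u. u \<in> {s..t} \<Longrightarrow> l (e (?D j u, u)) = word_lift n w a u" using main[of j] by blast
    obtain c where c: "res n c = k" "\<And>u. u \<in> {s..t} \<Longrightarrow> l (e (?D k u, u)) = word_lift n w c u" using main[of k] by blast
    have ends: "s \<in> {s..t}" "t \<in> {s..t}" using b(6) by auto
    have es: "word_lift n w a s = word_lift n w c s" using a(2)[OF ends(1)] c(2)[OF ends(1)] b(7) by simp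
    have et: "word_lift n w a t = word_lift n w c t" using a(2)[OF ends(2)] c(2)[OF ends(2)] b(8) by simp
    have gr: "goes_right n w a \<noteq> goes_right n w c"
      using altern_crossing[OF assms _ b(3) es] a(1) c(1) b(5) by simp
    have eq: "word_lift n w a u = word_lift n w c u" if u: "u \<in> {s..t}" for u
    proof -
      have su: "0 \<le> s" "s \<le> u" "u \<le> 1" and ut: "0 \<le> u" "u \<le> t" "t \<le> 1" using u b(3,4) by auto
      note M = altern_monotone[OF assms su, of a] altern_monotone[OF assms ut, of a]
        altern_monotone[OF assms su, of c] altern_monotone[OF assms ut, of c]
      show ?thesis using M gr es et by (cases "goes_right n w a") auto
    qed
    have same: "?D j u = ?D k u" if u: "u \<in> {s..t}" for u
      using word_diag_lift[OF assms(1,2), of u a] word_diag_lift[OF assms(1,2), of u c] eq[OF u] a(1) c(1) u st by auto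
    have "(\<lambda>u. (?D j u, u)) ` {s..t} \<subseteq> double_points n ?D"
    proof
      fix p assume "p \<in> (\<lambda>u. (?D j u, u)) ` {s..t}"
      then obtain u where u: "u \<in> {s..t}" "p = (?D j u, u)" by blast
      have "u \<in> {0..1}" using u(1) st by blast
      from double_pointsI[OF b(1,2) this b(5)[symmetric], of ?D] show "p \<in> double_points n ?D" using same[OF u(1)] u(2) by simp
    qed
    moreover have "finite (double_points n ?D)" using D unfolding is_diag_def by blast
    ultimately have "finite ((\<lambda>u. (?D j u, u)) ` {s..t})" by (rule finite_subset)
    then have "finite {s..t}" by (rule finite_imageD) (auto intro: inj_onI)
    then show False using infinite_Icc[OF b(6)] by blast
  qed
  ultimately show ?thesis unfolding has_bad_region_def by blast
qed

section \<open>The bijections\<close>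

lemma equiv_C_rel: "equiv (lists {1..n}) (C_rel n)"
proof (rule equivI)
  show "C_rel n \<subseteq> lists {1..n} \<times> lists {1..n}" unfolding C_rel_def using C_cong_lists by blast
  show "refl_on (lists {1..n}) (C_rel n)" by (intro refl_onI) (auto simp: C_rel_def intro: C_cong.refl)
  show "sym (C_rel n)" by (intro symI) (auto simp: C_rel_def intro: C_cong.sym)
  show "trans (C_rel n)" by (intro transI) (auto simp: C_rel_def intro: C_cong.trans)
qed

lemma C_rel_class_eq: "C_cong n u v \<Longrightarrow> C_rel n `` {u} = C_rel n `` {v}"
  by (rule equiv_class_eq[OF equiv_C_rel]) (simp add: C_rel_def)

lemma DC_rel_class_eq: "(D, E) \<in> DC_rel n \<Longrightarrow> DC_rel n `` {D} = DC_rel n `` {E}"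
  by (rule equiv_class_eq[OF equiv_DC_rel])

lemma ndiags_word:
  assumes "n \<ge> 3" "D \<in> ndiags n"
  shows "\<exists>w\<in>lists {1..n}. isotopic n (word_diag n w) D \<and> (word_diag n w, D) \<in> DC_rel n"
proof -
  obtain w where w: "w \<in> lists {1..n}" "isotopic n (word_diag n w) D" using assms(2) unfolding ndiags_def by blast
  then show ?thesis using DC_rel_step[OF word_ndiags[OF assms(1) w(1)] assms(2)] by blast
qed

lemma eps_class:
  assumes "n \<ge> 3" "w \<in> lists {1..n}"
  shows "eps n (C_rel n `` {w}) = DC_rel n `` {word_diag n w}"
proof -
  have "DC_rel n `` {word_diag n v} = DC_rel n `` {word_diag n w}" if "v \<in> C_rel n `` {w}" for v
  proof -
    have "C_cong n w v" using that by (simp add: C_rel_def)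
    then have "(word_diag n w, word_diag n v) \<in> DC_rel n"
      using DC_rel_words_iff[OF assms] C_cong_lists by blast
    then show ?thesis using DC_rel_class_eq by blast
  qed
  moreover have "w \<in> C_rel n `` {w}" using assms(2) by (simp add: C_rel_def C_cong.refl)
  ultimately show ?thesis unfolding eps_def by blast
qed

lemma eps_bij:
  assumes "n \<ge> 3"
  shows "bij_betw (eps n) (carrier (C_mon n)) (carrier (DC_mon n))"
proof (rule bij_betwI')
  have repr: "\<exists>w\<in>lists {1..n}. X = C_rel n `` {w}" if "X \<in> carrier (C_mon n)" for X
    using that by (auto simp: C_mon_def elim: quotientE)
  {
    fix X Y assume "X \<in> carrier (C_mon n)" "Y \<in> carrier (C_mon n)"
    then obtain u v where u: "u \<in> lists {1..n}" "X = C_rel n `` {u}" and v: "v \<in> lists {1..n}" "Y = C_rel n `` {v}"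
      using repr by metis
    show "eps n X = eps n Y \<longleftrightarrow> X = Y"
    proof
      assume "eps n X = eps n Y"
      then have "DC_rel n `` {word_diag n u} = DC_rel n `` {word_diag n v}" using eps_class[OF assms] u v by simp
      then have "(word_diag n u, word_diag n v) \<in> DC_rel n"
        by (rule eq_equiv_class[OF _ equiv_DC_rel word_ndiags[OF assms v(1)]])
      then have "C_cong n u v" using DC_rel_words_iff[OF assms u(1) v(1)] by blast
      then show "X = Y" using C_rel_class_eq u v by simp
    qed simp
  }
  {
    fix X assume "X \<in> carrier (C_mon n)"
    then obtain u where u: "u \<in> lists {1..n}" "X = C_rel n `` {u}" using repr by blast
    then show "eps n X \<in> carrier (DC_mon n)"
      using eps_class[OF assms u(1)] quotientI[OF word_ndiags[OF assms u(1)]] by (simp add: DC_mon_def)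
  }
  fix Y assume "Y \<in> carrier (DC_mon n)"
  then have "Y \<in> ndiags n // DC_rel n" by (simp add: DC_mon_def)
  then obtain D where D: "D \<in> ndiags n" "Y = DC_rel n `` {D}" by (rule quotientE)
  obtain w where w: "w \<in> lists {1..n}" "(word_diag n w, D) \<in> DC_rel n" using ndiags_word[OF assms D(1)] by blast
  have "Y = eps n (C_rel n `` {w})" using eps_class[OF assms w(1)] DC_rel_class_eq[OF w(2)] D(2) by simp
  moreover have "C_rel n `` {w} \<in> carrier (C_mon n)" using w(1) by (simp add: C_mon_def quotientI)
  ultimately show "\<exists>X\<in>carrier (C_mon n). Y = eps n X" by blast
qed

lemma C_cong_append:
  assumes "C_cong n u x" "C_cong n v y"
  shows "C_cong n (u @ v) (x @ y)"
proof -
  have 1: "C_cong n (u @ v) (x @ v)" using C_cong.ctxt[OF assms(1), of "[]" v] C_cong_lists[OF assms(2)] by simp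
  have 2: "C_cong n (x @ v) (x @ y)" using C_cong.ctxt[OF assms(2), of x "[]"] C_cong_lists[OF assms(1)] by simp
  show ?thesis by (rule C_cong.trans[OF 1 2])
qed

text \<open>\<open>A\<close> and \<open>B\<close> are arbitrary diagrams. Each is replaced by an
  isotopic diagram of a word, and the comparison with \<open>u\<close> and \<open>v\<close> is then
  made between words, where concatenation respects the congruence.\<close>

lemma DC_rel_stack:
  assumes "n \<ge> 3" "u \<in> lists {1..n}" "v \<in> lists {1..n}"
    "(word_diag n u, A) \<in> DC_rel n" "(word_diag n v, B) \<in> DC_rel n"
  shows "(word_diag n (u @ v), stack n A B) \<in> DC_rel n"
proof -
  have n: "n \<ge> 1" using assms(1) by simp
  note W = is_diag_word[OF assms(1)]
  have AB: "A \<in> ndiags n" "B \<in> ndiags n" using DC_rel_ndiags assms(4,5) by blast+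
  have dA: "is_diag n A" and dB: "is_diag n B" by (rule ndiagsD[OF AB(1)], rule ndiagsD[OF AB(2)])
  obtain x where x: "x \<in> lists {1..n}" "isotopic n (word_diag n x) A" "(word_diag n x, A) \<in> DC_rel n"
    using ndiags_word[OF assms(1) AB(1)] by blast
  obtain y where y: "y \<in> lists {1..n}" "isotopic n (word_diag n y) B" "(word_diag n y, B) \<in> DC_rel n"
    using ndiags_word[OF assms(1) AB(2)] by blast
  have "C_cong n u x" using DC_rel_trans[OF assms(4) DC_rel_sym[OF x(3)]] DC_rel_words_iff[OF assms(1,2) x(1)] by blast
  moreover have "C_cong n v y" using DC_rel_trans[OF assms(5) DC_rel_sym[OF y(3)]] DC_rel_words_iff[OF assms(1,3) y(1)] by blast
  ultimately have "C_cong n (u @ v) (x @ y)"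
    by (rule C_cong_append)
  moreover have uv: "u @ v \<in> lists {1..n}" and xy: "x @ y \<in> lists {1..n}" using assms x y by auto
  ultimately have 1: "(word_diag n (u @ v), word_diag n (x @ y)) \<in> DC_rel n" using DC_rel_words_iff[OF assms(1)] by blast
  note S = is_diag_stack[OF n W[OF x(1)] W[OF y(1)]]
  have "isotopic n (word_diag n (x @ y)) (stack n (word_diag n x) (word_diag n y))"
    by (rule isotopic_sym[OF isotopic_word_append[OF assms(1) y(1) x(1)] S])
  moreover have "isotopic n (stack n (word_diag n x) (word_diag n y)) (stack n A B)"
    by (rule isotopic_stack[OF n x(2) y(2) W[OF x(1)] W[OF y(1)] dA dB])
  ultimately have iso: "isotopic n (word_diag n (x @ y)) (stack n A B)" using isotopic_trans W[OF xy] by blast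
  have "stack n A B \<in> ndiags n" by (rule ndiags_isotopic[OF assms(1) xy iso is_diag_stack[OF n dA dB]])
  then have "(word_diag n (x @ y), stack n A B) \<in> DC_rel n" using DC_rel_step[OF word_ndiags[OF assms(1) xy]] iso by blast
  then show ?thesis by (rule DC_rel_trans[OF 1])
qed

lemma eps_hom:
  assumes "n \<ge> 3"
  shows "eps n \<in> hom (C_mon n) (DC_mon n)"
proof (rule homI)
  fix X assume "X \<in> carrier (C_mon n)"
  then show "eps n X \<in> carrier (DC_mon n)" using eps_bij[OF assms] bij_betwE by blast
next
  fix X Y assume "X \<in> carrier (C_mon n)" "Y \<in> carrier (C_mon n)"
  then obtain u v where u: "u \<in> lists {1..n}" "X = C_rel n `` {u}" and v: "v \<in> lists {1..n}" "Y = C_rel n `` {v}"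
    by (auto simp: C_mon_def elim!: quotientE)
  have uv: "u @ v \<in> lists {1..n}" using u v by simp
  have "C_rel n `` {x @ y} = C_rel n `` {u @ v}" if "x \<in> X" "y \<in> Y" for x y
  proof -
    have xy: "C_cong n u x" "C_cong n v y" using that u v by (auto simp: C_rel_def)
    then have "C_cong n (u @ v) (x @ y)" by (rule C_cong_append)
    then show ?thesis using C_rel_class_eq by blast
  qed
  moreover have "u \<in> X" "v \<in> Y" using u v by (auto simp: C_rel_def intro: C_cong.refl)
  ultimately have "X \<otimes>\<^bsub>C_mon n\<^esub> Y = C_rel n `` {u @ v}" unfolding C_mon_def monoid.simps by blast
  then have 1: "eps n (X \<otimes>\<^bsub>C_mon n\<^esub> Y) = DC_rel n `` {word_diag n (u @ v)}" using eps_class[OF assms uv] by simp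
  have "DC_rel n `` {stack n A B} = DC_rel n `` {word_diag n (u @ v)}" if "A \<in> eps n X" "B \<in> eps n Y" for A B
  proof -
    have "(word_diag n u, A) \<in> DC_rel n" "(word_diag n v, B) \<in> DC_rel n"
      using that eps_class[OF assms] u v by simp_all
    from DC_rel_class_eq[OF DC_rel_stack[OF assms u(1) v(1) this]] show ?thesis by simp
  qed
  moreover have "word_diag n u \<in> eps n X" "word_diag n v \<in> eps n Y"
    using eps_class[OF assms] u v DC_rel_refl[OF word_ndiags[OF assms]] by simp_all
  ultimately have "eps n X \<otimes>\<^bsub>DC_mon n\<^esub> eps n Y = DC_rel n `` {word_diag n (u @ v)}"
    unfolding DC_mon_def monoid.simps by blast
  then show "eps n (X \<otimes>\<^bsub>C_mon n\<^esub> Y) = eps n X \<otimes>\<^bsub>DC_mon n\<^esub> eps n Y" using 1 by simp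
qed

text \<open>The diagram of a one-letter word is the generator stacked with the identity, isotopic to
  the generator but not equal to it.\<close>

lemma eps_gen:
  assumes "n \<ge> 3" "i \<in> {1..n}"
  shows "eps n (C_gen n i) = DC_gen n i"
proof -
  have w: "[i] \<in> lists {1..n}" using assms(2) by simp
  have d: "is_diag n (gen_diag n i)" by (rule is_diag_gen[OF assms])
  have "isotopic n (gen_diag n i) (word_diag n [i])" using isotopic_gen_id(1)[OF assms] by simp
  then have iso: "isotopic n (word_diag n [i]) (gen_diag n i)" by (rule isotopic_sym[OF _ d])
  have "gen_diag n i \<in> ndiags n" by (rule ndiags_isotopic[OF assms(1) w iso d])
  then have "(word_diag n [i], gen_diag n i) \<in> DC_rel n" using DC_rel_step[OF word_ndiags[OF assms(1) w]] iso by blast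
  from DC_rel_class_eq[OF this] show ?thesis using eps_class[OF assms(1) w] by (simp add: C_gen_def DC_gen_def)
qed

section \<open>Webs as isotopy classes of diagrams of alternating words\<close>

lemma equiv_isotopy_rel: "equiv (ndiags n) (isotopy_rel n)"
proof (rule equivI)
  show "isotopy_rel n \<subseteq> ndiags n \<times> ndiags n" by (auto simp: isotopy_rel_def)
  show "refl_on (ndiags n) (isotopy_rel n)" by (intro refl_onI) (auto simp: isotopy_rel_def intro: isotopic_refl ndiagsD)
  show "sym (isotopy_rel n)" by (intro symI) (auto simp: isotopy_rel_def intro: isotopic_sym ndiagsD)
  show "trans (isotopy_rel n)" by (intro transI) (auto simp: isotopy_rel_def intro: isotopic_trans ndiagsD)
qed

lemma word_web_iff:
  assumes "n \<ge> 3" "w \<in> lists {1..n}"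
  shows "word_diag n w \<in> nwebs n \<longleftrightarrow> altern n w"
  using word_ndiags[OF assms] altern_no_bad_region[OF assms] not_altern_bad_region[OF assms]
  unfolding nwebs_def has_bad_region_def by blast

text \<open>Contractible bigons and triangles are carried along by isotopies. A web is isotopic to
  the diagram of some word, which inherits their absence and is therefore alternating.\<close>

lemma WC_words:
  assumes "n \<ge> 3"
  shows "WC n = {isotopy_rel n `` {word_diag n w} | w. w \<in> lists {1..n} \<and> altern n w}"
proof (intro equalityI subsetI)
  fix X assume "X \<in> WC n"
  then obtain D where D: "D \<in> nwebs n" "X = isotopy_rel n `` {D}" unfolding WC_def by (rule quotientE)
  then have Dn: "D \<in> ndiags n" by (simp add: nwebs_def)
  obtain w where w: "w \<in> lists {1..n}" "isotopic n (word_diag n w) D" using ndiags_word[OF assms Dn] by blast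
  note W = word_ndiags[OF assms w(1)]
  have "\<not> has_bad_region n (word_diag n w)"
    using has_bad_region_isotopic[OF w(2) ndiagsD[OF W]] D(1) unfolding nwebs_def has_bad_region_def by blast
  then have "altern n w" using not_altern_bad_region[OF assms w(1)] by blast
  moreover have "X = isotopy_rel n `` {word_diag n w}" unfolding D(2)
    by (rule equiv_class_eq[OF equiv_isotopy_rel, symmetric]) (use W Dn w(2) in \<open>simp add: isotopy_rel_def\<close>)
  ultimately show "X \<in> {isotopy_rel n `` {word_diag n w} | w. w \<in> lists {1..n} \<and> altern n w}" using w(1) by blast
next
  fix X assume "X \<in> {isotopy_rel n `` {word_diag n w} | w. w \<in> lists {1..n} \<and> altern n w}"
  then obtain w where w: "w \<in> lists {1..n}" "altern n w" "X = isotopy_rel n `` {word_diag n w}" by blast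
  have "word_diag n w \<in> nwebs n" using word_web_iff[OF assms w(1)] w(2) by simp
  then show "X \<in> WC n" unfolding WC_def w(3) by (rule quotientI)
qed

lemma WC_class_eq:
  assumes "n \<ge> 3" "comm_cong n u v"
  shows "isotopy_rel n `` {word_diag n u} = isotopy_rel n `` {word_diag n v}"
proof (rule equiv_class_eq[OF equiv_isotopy_rel])
  have "u \<in> lists {1..n}" "v \<in> lists {1..n}" using comm_cong_lists[OF assms(2)] by auto
  then show "(word_diag n u, word_diag n v) \<in> isotopy_rel n"
    using word_ndiags[OF assms(1)] comm_cong_isotopic[OF assms] by (simp add: isotopy_rel_def)
qed

lemma iota_class:
  assumes "n \<ge> 3" "w \<in> lists {1..n}"
  shows "iota n (isotopy_rel n `` {word_diag n w}) = DC_rel n `` {word_diag n w}"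
proof -
  have "DC_rel n `` {D} = DC_rel n `` {word_diag n w}" if "D \<in> isotopy_rel n `` {word_diag n w}" for D
    using that DC_rel_class_eq[OF DC_rel_step[of "word_diag n w" n D]] by (auto simp: isotopy_rel_def)
  moreover have "word_diag n w \<in> isotopy_rel n `` {word_diag n w}"
    using word_ndiags[OF assms] isotopic_refl[OF is_diag_word[OF assms]] by (simp add: isotopy_rel_def)
  ultimately show ?thesis unfolding iota_def by blast
qed

text \<open>\<open>rho\<close> reads the true ends \<open>perm\<close> of the strands, while
  \<open>right_lists\<close> reads \<open>right_end\<close>. They agree on the right strands because
  \<open>right_end\<close> is the maximum of \<open>a\<close> and \<open>perm\<close>.\<close>

lemma rho_class:
  assumes "n \<ge> 3" "w \<in> lists {1..n}" "altern n w"
  shows "rho n (isotopy_rel n `` {word_diag n w}) = right_lists n (right_end n w)"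
proof -
  have n: "n \<ge> 1" using assms(1) by simp
  have s: "set w \<subseteq> {1..n}" using assms(2) by auto
  have key: "rho_diag n D = right_lists n (right_end n w)" if D: "D \<in> isotopy_rel n `` {word_diag n w}" for D
  proof -
    have iso: "isotopic n (word_diag n w) D" "is_diag n D" using D ndiagsD by (auto simp: isotopy_rel_def)
    have le: "lift_end n D a = perm n w a" if "a \<in> {1..int n}" for a
      using lift_end_isotopic[OF n iso(1) is_diag_word[OF assms(1,2)] iso(2) that] lift_end_word[OF assms(1,2) that] by simp
    have re: "right_end n w a = max a (perm n w a)" for a by (rule right_end_perm[OF assms(1) s assms(3)])
    have f: "filter (\<lambda>a. a < lift_end n D a) [1..int n] = filter (\<lambda>a. a < right_end n w a) [1..int n]"
      by (rule filter_cong) (auto simp: le re)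
    have m: "map (lift_end n D) (filter (\<lambda>a. a < right_end n w a) [1..int n]) =
      map (right_end n w) (filter (\<lambda>a. a < right_end n w a) [1..int n])"
      by (rule map_cong) (auto simp: le re)
    show ?thesis unfolding rho_diag_def right_lists_def Let_def f m ..
  qed
  have mem: "word_diag n w \<in> isotopy_rel n `` {word_diag n w}"
    using word_ndiags[OF assms(1,2)] isotopic_refl[OF is_diag_word[OF assms(1,2)]] by (simp add: isotopy_rel_def)
  have "rho_diag n ` (isotopy_rel n `` {word_diag n w}) = (\<lambda>_. right_lists n (right_end n w)) ` (isotopy_rel n `` {word_diag n w})"
    by (rule image_cong[OF HOL.refl key])
  also have "\<dots> = {right_lists n (right_end n w)}" by (rule image_constant[OF mem])
  finally have "rho_diag n ` (isotopy_rel n `` {word_diag n w}) = {right_lists n (right_end n w)}" .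
  then show ?thesis by (simp add: rho_def)
qed

text \<open>Equivalent diagrams of alternating words come from words that differ by commutations,
  hence are isotopic. Surjectivity is the reduction to alternating words.\<close>

lemma iota_bij:
  assumes "n \<ge> 3"
  shows "bij_betw (iota n) (WC n) (carrier (DC_mon n))"
proof (rule bij_betwI')
  {
    fix X Y assume "X \<in> WC n" "Y \<in> WC n"
    then obtain u v where u: "u \<in> lists {1..n}" "altern n u" "X = isotopy_rel n `` {word_diag n u}"
      and v: "v \<in> lists {1..n}" "altern n v" "Y = isotopy_rel n `` {word_diag n v}" unfolding WC_words[OF assms] by blast
    show "iota n X = iota n Y \<longleftrightarrow> X = Y"
    proof
      assume "iota n X = iota n Y"
      then have "DC_rel n `` {word_diag n u} = DC_rel n `` {word_diag n v}" using iota_class[OF assms] u v by simp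
      then have "(word_diag n u, word_diag n v) \<in> DC_rel n"
        by (rule eq_equiv_class[OF _ equiv_DC_rel word_ndiags[OF assms v(1)]])
      then have "comm_cong n u v" by (rule DC_rel_altern[OF assms u(1) v(1) u(2) v(2)])
      then show "X = Y" using WC_class_eq[OF assms] u v by simp
    qed simp
  }
  {
    fix X assume "X \<in> WC n"
    then obtain u where u: "u \<in> lists {1..n}" "X = isotopy_rel n `` {word_diag n u}" unfolding WC_words[OF assms] by blast
    then show "iota n X \<in> carrier (DC_mon n)"
      using iota_class[OF assms u(1)] quotientI[OF word_ndiags[OF assms u(1)]] by (simp add: DC_mon_def)
  }
  fix Y assume "Y \<in> carrier (DC_mon n)"
  then have "Y \<in> ndiags n // DC_rel n" by (simp add: DC_mon_def)
  then obtain D where D: "D \<in> ndiags n" "Y = DC_rel n `` {D}" by (rule quotientE)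
  obtain w where w: "w \<in> lists {1..n}" "(word_diag n w, D) \<in> DC_rel n" using ndiags_word[OF assms D(1)] by blast
  obtain v where v: "altern n v" "C_cong n w v" using C_cong_altern[OF assms w(1)] by blast
  have vl: "v \<in> lists {1..n}" using C_cong_lists[OF v(2)] by blast
  have "(word_diag n w, word_diag n v) \<in> DC_rel n" using DC_rel_words_iff[OF assms w(1) vl] v(2) by blast
  then have "Y = iota n (isotopy_rel n `` {word_diag n v})"
    using iota_class[OF assms vl] DC_rel_class_eq[OF w(2)] DC_rel_class_eq D(2) by metis
  moreover have "isotopy_rel n `` {word_diag n v} \<in> WC n" unfolding WC_words[OF assms] using v(1) vl by blast
  ultimately show "\<exists>X\<in>WC n. Y = iota n X" by blast
qed

text \<open>The bijection factors through the periodic displacements: they are realised by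
  alternating words, unique up to commutations, and correspond to the couples through
  \<open>right_lists\<close>.\<close>

lemma rho_bij:
  assumes "n \<ge> 3"
  shows "bij_betw (rho n) (WC n) (IIC n)"
proof (rule bij_betwI')
  have n: "n \<ge> 1" using assms by simp
  have per: "periodic_right n (right_end n w)" if "w \<in> lists {1..n}" "altern n w" for w
    by (rule periodic_right_right_end[OF assms]) (use that in auto)
  {
    fix X Y assume "X \<in> WC n" "Y \<in> WC n"
    then obtain u v where u: "u \<in> lists {1..n}" "altern n u" "X = isotopy_rel n `` {word_diag n u}"
      and v: "v \<in> lists {1..n}" "altern n v" "Y = isotopy_rel n `` {word_diag n v}" unfolding WC_words[OF assms] by blast
    show "rho n X = rho n Y \<longleftrightarrow> X = Y"
    proof
      assume "rho n X = rho n Y"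
      then have "right_lists n (right_end n u) = right_lists n (right_end n v)" using rho_class[OF assms] u v by simp
      then have "right_end n u = right_end n v" by (rule right_lists_inj[OF n per[OF u(1,2)] per[OF v(1,2)]])
      then have "comm_cong n u v" by (rule altern_unique[OF assms u(1) v(1) u(2) v(2)])
      then show "X = Y" using WC_class_eq[OF assms] u v by simp
    qed simp
  }
  {
    fix X assume "X \<in> WC n"
    then obtain u where u: "u \<in> lists {1..n}" "altern n u" "X = isotopy_rel n `` {word_diag n u}" unfolding WC_words[OF assms] by blast
    then show "rho n X \<in> IIC n" using rho_class[OF assms u(1,2)] right_lists_IIC[OF n per[OF u(1,2)]] by simp
  }
  fix p assume "p \<in> IIC n"
  then obtain r where r: "periodic_right n r" "right_lists n r = p" using right_lists_surj[OF n] by blast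
  obtain w where w: "w \<in> lists {1..n}" "altern n w" "right_end n w = r" using periodic_right_word[OF assms r(1)] by blast
  have "p = rho n (isotopy_rel n `` {word_diag n w})" using rho_class[OF assms w(1,2)] w(3) r(2) by simp
  moreover have "isotopy_rel n `` {word_diag n w} \<in> WC n" unfolding WC_words[OF assms] using w(1,2) by blast
  ultimately show "\<exists>X\<in>WC n. p = rho n X" by blast
qed

theorem theorem6p3:
  fixes n :: nat
  assumes "n \<ge> 3"
  shows "bij_betw (iota n) (WC n) (carrier (DC_mon n)) \<and>
    eps n \<in> iso (C_mon n) (DC_mon n) \<and>
    (\<forall>i\<in>{1..n}. eps n (C_gen n i) = DC_gen n i) \<and>
    bij_betw (inv_into (carrier (C_mon n)) (eps n) \<circ> iota n) (WC n) (carrier (C_mon n)) \<and>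
    bij_betw (rho n) (WC n) (IIC n) \<and>
    bij_betw (rho n \<circ> inv_into (WC n) (iota n) \<circ> eps n) (carrier (C_mon n)) (IIC n)"
proof (intro conjI ballI)
  note I = iota_bij[OF assms] and E = eps_bij[OF assms] and R = rho_bij[OF assms]
  show "bij_betw (iota n) (WC n) (carrier (DC_mon n))" by (rule I)
  show "eps n \<in> iso (C_mon n) (DC_mon n)" using eps_hom[OF assms] E by (simp add: iso_def)
  show "eps n (C_gen n i) = DC_gen n i" if "i \<in> {1..n}" for i by (rule eps_gen[OF assms that])
  show "bij_betw (inv_into (carrier (C_mon n)) (eps n) \<circ> iota n) (WC n) (carrier (C_mon n))"
    by (rule bij_betw_trans[OF I bij_betw_inv_into[OF E]])
  show "bij_betw (rho n) (WC n) (IIC n)" by (rule R)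
  show "bij_betw (rho n \<circ> inv_into (WC n) (iota n) \<circ> eps n) (carrier (C_mon n)) (IIC n)"
    by (rule bij_betw_trans[OF E bij_betw_trans[OF bij_betw_inv_into[OF I] R]])
qed

end
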